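(* Let $A$ be a finite dimensional algebra over a field with $\phi\dim(A)>0$. Then there exists $M\in\operatorname{mod}A$ such that $\phi(M)=1$. If moreover $\phi\dim(A)$ is finite, then there exists $N\in\operatorname{mod}A$ such that $\phi(N)=\phi\dim(A)-1$.
   Context: $\operatorname{mod}A$ is the category of finitely generated right $A$-modules. $K_0(A)$ denotes the abelian group generated by all symbols $[M]$, $M\in\operatorname{mod}A$, modulo the relations $[M]-[M']-[M'']$ whenever $M\cong M'\oplus M''$, and $[P]$ for each projective $P$. Let $\Omega(M)$ be the syzygy of $M$ (kernel of a projective cover), and let $\bar\Omega:K_0(A)\to K_0(A)$ be the group endomorphism induced by $\Omega$, $\bar\Omega([M])=[\Omega(M)]$. For $M\in\operatorname{mod}A$, $\langle\operatorname{add}M\rangle$ is the subgroup of $K_0(A)$ generated by the classes of the indecomposable direct summands of $M$. The Igusa-Todorov function is $$\phi(M)=\min\{l\ge 0:\ \bar\Omega|_{\bar\Omega^{l+s}\langle\operatorname{add}M\rangle}\text{ is a monomorphism for all integers } s\ge 0\}.$$ The $\phi$-dimension is $\phi\dim(A)=\sup\{\phi(M):M\in\operatorname{mod}A\}\in\{0,1,2,\dots\}\cup\{\infty\}$. *)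

theory Defs
  imports "HOL-Algebra.Algebra" "HOL-Library.Extended_Nat"
begin

section \<open>Modules over a not necessarily commutative ring\<close>

text \<open>
  The locale \<^locale>\<open>module\<close> of the library requires a commutative ring of scalars, so right
  modules are introduced here, on the library's record \<open>('a, 'm) module\<close>.  The term \<open>a \<odot>\<^bsub>M\<^esub> x\<close>
  denotes the right action of \<open>a\<close> on \<open>x\<close>, usually written \<open>x a\<close>; hence the order of the factors
  in \<open>act_assoc\<close>.  The fields \<open>mult\<close> and \<open>one\<close> of the record play no role.
\<close>

locale right_module = A?: ring A + M?: abelian_group M
  for A :: "('a, 'r) ring_scheme" and M :: "('a, 'm, 's) module_scheme" (structure) +
  assumes act_closed:
      "\<lbrakk>a \<in> carrier A; x \<in> carrier M\<rbrakk> \<Longrightarrow> a \<odot>\<^bsub>M\<^esub> x \<in> carrier M"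
    and act_add_scalar:
      "\<lbrakk>a \<in> carrier A; b \<in> carrier A; x \<in> carrier M\<rbrakk> \<Longrightarrow>
        (a \<oplus>\<^bsub>A\<^esub> b) \<odot>\<^bsub>M\<^esub> x = a \<odot>\<^bsub>M\<^esub> x \<oplus>\<^bsub>M\<^esub> b \<odot>\<^bsub>M\<^esub> x"
    and act_add:
      "\<lbrakk>a \<in> carrier A; x \<in> carrier M; y \<in> carrier M\<rbrakk> \<Longrightarrow>
        a \<odot>\<^bsub>M\<^esub> (x \<oplus>\<^bsub>M\<^esub> y) = a \<odot>\<^bsub>M\<^esub> x \<oplus>\<^bsub>M\<^esub> a \<odot>\<^bsub>M\<^esub> y"
    and act_assoc:
      "\<lbrakk>a \<in> carrier A; b \<in> carrier A; x \<in> carrier M\<rbrakk> \<Longrightarrow>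
        (a \<otimes>\<^bsub>A\<^esub> b) \<odot>\<^bsub>M\<^esub> x = b \<odot>\<^bsub>M\<^esub> (a \<odot>\<^bsub>M\<^esub> x)"
    and act_one:
      "x \<in> carrier M \<Longrightarrow> \<one>\<^bsub>A\<^esub> \<odot>\<^bsub>M\<^esub> x = x"

definition finitely_generated ::
  "('a, 'r) ring_scheme \<Rightarrow> ('a, 'm, 's) module_scheme \<Rightarrow> bool" where
  "finitely_generated A M \<longleftrightarrow>
    (\<exists>G. finite G \<and> G \<subseteq> carrier M \<and>
      (\<forall>x \<in> carrier M. \<exists>c \<in> G \<rightarrow> carrier A. x = (\<Oplus>\<^bsub>M\<^esub> g \<in> G. c g \<odot>\<^bsub>M\<^esub> g)))"

definition mod_hom ::
  "('a, 'r) ring_scheme \<Rightarrow> ('a, 'm, 's) module_scheme \<Rightarrow> ('a, 'n, 't) module_scheme \<Rightarrow> ('m \<Rightarrow> 'n) set"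
  where
  "mod_hom A M N =
    {f \<in> hom (add_monoid M) (add_monoid N).
      \<forall>a \<in> carrier A. \<forall>x \<in> carrier M. f (a \<odot>\<^bsub>M\<^esub> x) = a \<odot>\<^bsub>N\<^esub> f x}"

definition mod_isomorphic ::
  "('a, 'r) ring_scheme \<Rightarrow> ('a, 'm, 's) module_scheme \<Rightarrow> ('a, 'n, 't) module_scheme \<Rightarrow> bool" where
  "mod_isomorphic A M N \<longleftrightarrow> (\<exists>f \<in> mod_hom A M N. bij_betw f (carrier M) (carrier N))"

definition direct_sum ::
  "('a, 'm, 's) module_scheme \<Rightarrow> ('a, 'n, 't) module_scheme \<Rightarrow> ('a, 'm \<times> 'n) module" where
  "direct_sum M N =
    ring.extend (RDirProd M N) \<lparr>smult = (\<lambda>a (x, y). (a \<odot>\<^bsub>M\<^esub> x, a \<odot>\<^bsub>N\<^esub> y))\<rparr>"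

section \<open>Finite dimensional algebras\<close>

locale fd_algebra = module K A + K?: field K + A?: ring A
  for K :: "('k, 'z) ring_scheme" and A :: "('k, 'a, 'y) module_scheme" +
  assumes smult_mult_left:
      "\<lbrakk>c \<in> carrier K; x \<in> carrier A; y \<in> carrier A\<rbrakk> \<Longrightarrow>
        (c \<odot>\<^bsub>A\<^esub> x) \<otimes>\<^bsub>A\<^esub> y = c \<odot>\<^bsub>A\<^esub> (x \<otimes>\<^bsub>A\<^esub> y)"
    and smult_mult_right:
      "\<lbrakk>c \<in> carrier K; x \<in> carrier A; y \<in> carrier A\<rbrakk> \<Longrightarrow>
        x \<otimes>\<^bsub>A\<^esub> (c \<odot>\<^bsub>A\<^esub> y) = c \<odot>\<^bsub>A\<^esub> (x \<otimes>\<^bsub>A\<^esub> y)"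
    and finite_dimensional: "finitely_generated K A"

section \<open>The category of finitely generated right modules\<close>

text \<open>
  All modules are taken with elements in the type \<open>nat \<Rightarrow> 'a\<close>, so that they can be quantified over.
  The lemma \<open>fg_modules_representative\<close> below shows that every finitely generated
  right \<open>A\<close>-module, on whatever type, has an isomorphic copy in \<open>fg_modules A\<close>.
\<close>

definition fg_modules :: "('a, 'r) ring_scheme \<Rightarrow> ('a, nat \<Rightarrow> 'a) module set" where
  "fg_modules A = {M. right_module A M \<and> finitely_generated A M}"

definition transport :: "('m \<Rightarrow> 'n) \<Rightarrow> ('a, 'm, 's) module_scheme \<Rightarrow> ('a, 'n) module" where
  "transport f M =
    (let g = inv_into (carrier M) f in
      \<lparr>carrier = f ` carrier M, monoid.mult = (\<lambda>x y. f (g x \<otimes>\<^bsub>M\<^esub> g y)), monoid.one = f \<one>\<^bsub>M\<^esub>,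
        ring.zero = f \<zero>\<^bsub>M\<^esub>, ring.add = (\<lambda>x y. f (g x \<oplus>\<^bsub>M\<^esub> g y)), smult = (\<lambda>a x. f (a \<odot>\<^bsub>M\<^esub> g x))\<rparr>)"

lemma transport_iso:
  assumes M: "right_module A M" and inj: "inj_on f (carrier M)"
  shows "right_module A (transport f M)"
    and "f \<in> mod_hom A M (transport f M)"
    and "bij_betw f (carrier M) (carrier (transport f M))"
proof -
  interpret right_module A M by (rule M)
  let ?N = "transport f M"
  note [simp] = inv_into_f_f[OF inj]
  have car: "carrier ?N = f ` carrier M"
    and z: "\<zero>\<^bsub>?N\<^esub> = f \<zero>\<^bsub>M\<^esub>"
    by (simp_all add: transport_def Let_def)
  have add: "f x \<oplus>\<^bsub>?N\<^esub> f y = f (x \<oplus>\<^bsub>M\<^esub> y)" if "x \<in> carrier M" "y \<in> carrier M" for x y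
    using that by (simp add: transport_def Let_def)
  have act: "a \<odot>\<^bsub>?N\<^esub> f x = f (a \<odot>\<^bsub>M\<^esub> x)" if "x \<in> carrier M" for a x
    using that by (simp add: transport_def Let_def)
  have ab: "abelian_group ?N"
  proof (rule abelian_groupI)
    fix x assume "x \<in> carrier ?N"
    then obtain u where u: "u \<in> carrier M" "x = f u" by (auto simp: car)
    then show "\<exists>y \<in> carrier ?N. y \<oplus>\<^bsub>?N\<^esub> x = \<zero>\<^bsub>?N\<^esub>"
      by (intro bexI[of _ "f (\<ominus>\<^bsub>M\<^esub> u)"]) (auto simp: car z add M.l_neg)
  qed (auto simp: car z add M.a_ac)
  show "right_module A ?N"
    by (intro right_module.intro A.ring_axioms ab right_module_axioms.intro)
      (auto simp: car add act act_closed act_add_scalar act_add act_assoc act_one)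
  show "f \<in> mod_hom A M ?N"
    by (auto simp: mod_hom_def hom_def car add act)
  show "bij_betw f (carrier M) (carrier ?N)"
    using inj by (simp add: car bij_betw_def)
qed

lemma mod_hom_finsum:
  assumes M: "right_module A M" and N: "right_module A N" and f: "f \<in> mod_hom A M N"
    and "finite G" "h \<in> G \<rightarrow> carrier M"
  shows "f (\<Oplus>\<^bsub>M\<^esub> g \<in> G. h g) = (\<Oplus>\<^bsub>N\<^esub> g \<in> G. f (h g))"
proof -
  interpret M: abelian_group M using M by (rule right_module.axioms)
  interpret N: abelian_group N using N by (rule right_module.axioms)
  have "abelian_group_hom M N f"
    using f by (intro abelian_group_hom.intro M.abelian_group_axioms N.abelian_group_axioms
        abelian_group_hom_axioms.intro group_hom.intro M.a_group N.a_group group_hom_axioms.intro)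
      (auto simp: mod_hom_def)
  then interpret abelian_group_hom M N f .
  show ?thesis using assms(4,5)
  proof (induction G)
    case empty
    then show ?case by simp
  next
    case (insert x F)
    then have h: "h x \<in> carrier M" "h \<in> F \<rightarrow> carrier M" by auto
    then have "f (h x) \<in> carrier N" "(\<lambda>g. f (h g)) \<in> F \<rightarrow> carrier N"
      using hom_closed by blast+
    with h insert show ?case by simp
  qed
qed

lemma fg_modules_representative:
  assumes M: "right_module A M" and fg: "finitely_generated A M"
  shows "\<exists>N \<in> fg_modules A. mod_isomorphic A M N"
proof -
  interpret right_module A M by (rule M)
  obtain G where G: "finite G" "G \<subseteq> carrier M"
    and gen: "\<forall>x \<in> carrier M. \<exists>c \<in> G \<rightarrow> carrier A. x = (\<Oplus>\<^bsub>M\<^esub> g \<in> G. c g \<odot>\<^bsub>M\<^esub> g)"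
    using fg by (auto simp: finitely_generated_def)
  obtain c where c: "\<And>x. x \<in> carrier M \<Longrightarrow> c x \<in> G \<rightarrow> carrier A"
    and eq: "\<And>x. x \<in> carrier M \<Longrightarrow> x = (\<Oplus>\<^bsub>M\<^esub> g \<in> G. c x g \<odot>\<^bsub>M\<^esub> g)"
    using bchoice[OF gen[unfolded Bex_def]] by blast
  obtain e :: "_ \<Rightarrow> nat" where e: "inj_on e G"
    using finite_imp_inj_to_nat_seg[OF G(1)] by blast
  define f where "f x = (\<lambda>i. c x (inv_into G e i))" for x
  have inj: "inj_on f (carrier M)"
  proof (rule inj_onI)
    fix x y assume xy: "x \<in> carrier M" "y \<in> carrier M" "f x = f y"
    have "c x g = c y g" if "g \<in> G" for g
      using fun_cong[OF xy(3), of "e g"] that e by (simp add: f_def)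
    then have "(\<Oplus>\<^bsub>M\<^esub> g \<in> G. c x g \<odot>\<^bsub>M\<^esub> g) = (\<Oplus>\<^bsub>M\<^esub> g \<in> G. c y g \<odot>\<^bsub>M\<^esub> g)"
      using c[OF xy(2)] G(2) by (intro M.finsum_cong') (auto intro!: act_closed)
    then show "x = y" using eq xy by metis
  qed
  let ?N = "transport f M"
  note N = transport_iso[OF M inj]
  have "\<exists>d \<in> f ` G \<rightarrow> carrier A. y = (\<Oplus>\<^bsub>?N\<^esub> g \<in> f ` G. d g \<odot>\<^bsub>?N\<^esub> g)"
    if y: "y \<in> carrier ?N" for y
  proof -
    obtain x where x: "x \<in> carrier M" "y = f x"
      using y N(3) by (auto simp: bij_betw_def)
    have injG: "inj_on f G" using inj G(2) by (rule inj_on_subset)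
    let ?d = "\<lambda>u. c x (inv_into G f u)"
    have d: "?d \<in> f ` G \<rightarrow> carrier A" using c[OF x(1)] injG by auto
    have hom: "f (a \<odot>\<^bsub>M\<^esub> u) = a \<odot>\<^bsub>?N\<^esub> f u" if "a \<in> carrier A" "u \<in> carrier M" for a u
      using N(2) that by (auto simp: mod_hom_def)
    interpret N: right_module A ?N by (rule N(1))
    have mem: "f u \<in> carrier ?N" if "u \<in> carrier M" for u
      using that N(3) by (auto simp: bij_betw_def)
    have "y = f (\<Oplus>\<^bsub>M\<^esub> g \<in> G. c x g \<odot>\<^bsub>M\<^esub> g)" using eq x by metis
    also have "\<dots> = (\<Oplus>\<^bsub>?N\<^esub> g \<in> G. f (c x g \<odot>\<^bsub>M\<^esub> g))"
      using c[OF x(1)] G by (intro mod_hom_finsum[OF M N(1,2)]) (auto intro!: act_closed)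
    also have "\<dots> = (\<Oplus>\<^bsub>?N\<^esub> g \<in> G. ?d (f g) \<odot>\<^bsub>?N\<^esub> f g)"
    proof (rule N.M.finsum_cong')
      show "f (c x g \<odot>\<^bsub>M\<^esub> g) = ?d (f g) \<odot>\<^bsub>?N\<^esub> f g" if "g \<in> G" for g
        using that c[OF x(1)] G(2) injG by (subst hom) auto
    qed (use c[OF x(1)] G(2) injG in \<open>auto intro!: N.act_closed mem\<close>)
    also have "\<dots> = (\<Oplus>\<^bsub>?N\<^esub> g \<in> f ` G. ?d g \<odot>\<^bsub>?N\<^esub> g)"
      using c[OF x(1)] G(2) injG
      by (intro N.M.finsum_reindex[symmetric]) (auto intro!: N.act_closed mem)
    finally show ?thesis by (rule bexI[OF _ d])
  qed
  moreover have "finite (f ` G)" "f ` G \<subseteq> carrier ?N"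
    using G N(3) by (auto simp: bij_betw_def)
  ultimately have "finitely_generated A ?N"
    unfolding finitely_generated_def by blast
  with N show ?thesis
    by (auto simp: fg_modules_def mod_isomorphic_def)
qed

section \<open>Projective covers and syzygies\<close>

definition projective :: "('a, 'r) ring_scheme \<Rightarrow> ('a, nat \<Rightarrow> 'a) module \<Rightarrow> bool" where
  "projective A P \<longleftrightarrow> P \<in> fg_modules A \<and>
    (\<forall>U \<in> fg_modules A. \<forall>V \<in> fg_modules A. \<forall>p \<in> mod_hom A U V. \<forall>f \<in> mod_hom A P V.
      p ` carrier U = carrier V \<longrightarrow>
      (\<exists>h \<in> mod_hom A P U. \<forall>x \<in> carrier P. p (h x) = f x))"

definition superfluous ::
  "('a, 'r) ring_scheme \<Rightarrow> ('a, 'm, 's) module_scheme \<Rightarrow> 'm set \<Rightarrow> bool" where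
  "superfluous A M S \<longleftrightarrow> submodule S A M \<and>
    (\<forall>L. submodule L A M \<and> L <+>\<^bsub>M\<^esub> S = carrier M \<longrightarrow> L = carrier M)"

definition projective_cover ::
  "('a, 'r) ring_scheme \<Rightarrow> ('a, nat \<Rightarrow> 'a) module \<Rightarrow> ((nat \<Rightarrow> 'a) \<Rightarrow> (nat \<Rightarrow> 'a)) \<Rightarrow>
    ('a, nat \<Rightarrow> 'a) module \<Rightarrow> bool" where
  "projective_cover A P p M \<longleftrightarrow> projective A P \<and> p \<in> mod_hom A P M \<and>
    p ` carrier P = carrier M \<and> superfluous A P (a_kernel P M p)"

text \<open>
  A projective cover is unique up to isomorphism, so the arbitrary choice made here
  affects the syzygy only up to isomorphism.
\<close>

definition syzygy ::
  "('a, 'r) ring_scheme \<Rightarrow> ('a, nat \<Rightarrow> 'a) module \<Rightarrow> ('a, nat \<Rightarrow> 'a) module" where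
  "syzygy A M =
    (let (P, p) = (SOME (P, p). projective_cover A P p M) in P\<lparr>carrier := a_kernel P M p\<rparr>)"

section \<open>The group \<open>K\<^sub>0\<close> and the Igusa-Todorov function\<close>

definition K0_relations ::
  "('a, 'r) ring_scheme \<Rightarrow> (('a, nat \<Rightarrow> 'a) module \<Rightarrow>\<^sub>0 int) set" where
  "K0_relations A =
    {frag_of M - frag_of M' - frag_of M'' | M M' M''.
       M \<in> fg_modules A \<and> M' \<in> fg_modules A \<and> M'' \<in> fg_modules A \<and>
       mod_isomorphic A M (direct_sum M' M'')} \<union>
    {frag_of P | P. projective A P}"

definition K0_subgroup ::
  "('a, 'r) ring_scheme \<Rightarrow> (('a, nat \<Rightarrow> 'a) module \<Rightarrow>\<^sub>0 int) set" where
  "K0_subgroup A = generate (free_Abelian_group (fg_modules A)) (K0_relations A)"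

definition K0 ::
  "('a, 'r) ring_scheme \<Rightarrow> (('a, nat \<Rightarrow> 'a) module \<Rightarrow>\<^sub>0 int) set monoid" where
  "K0 A = free_Abelian_group (fg_modules A) Mod K0_subgroup A"

definition K0_class ::
  "('a, 'r) ring_scheme \<Rightarrow> ('a, nat \<Rightarrow> 'a) module \<Rightarrow> (('a, nat \<Rightarrow> 'a) module \<Rightarrow>\<^sub>0 int) set" where
  "K0_class A M = K0_subgroup A #>\<^bsub>free_Abelian_group (fg_modules A)\<^esub> frag_of M"

text \<open>
  Since the classes of modules generate \<open>K0 A\<close>, the following conditions determine the
  endomorphism; \<^const>\<open>extensional\<close> fixes its values outside the carrier.
\<close>

definition Omega_bar ::
  "('a, 'r) ring_scheme \<Rightarrow>
    (('a, nat \<Rightarrow> 'a) module \<Rightarrow>\<^sub>0 int) set \<Rightarrow> (('a, nat \<Rightarrow> 'a) module \<Rightarrow>\<^sub>0 int) set" where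
  "Omega_bar A =
    (THE h. h \<in> hom (K0 A) (K0 A) \<and> h \<in> extensional (carrier (K0 A)) \<and>
      (\<forall>M \<in> fg_modules A. h (K0_class A M) = K0_class A (syzygy A M)))"

definition indecomposable :: "('a, 'r) ring_scheme \<Rightarrow> ('a, nat \<Rightarrow> 'a) module \<Rightarrow> bool" where
  "indecomposable A M \<longleftrightarrow> M \<in> fg_modules A \<and> carrier M \<noteq> {\<zero>\<^bsub>M\<^esub>} \<and>
    (\<forall>U \<in> fg_modules A. \<forall>V \<in> fg_modules A. mod_isomorphic A M (direct_sum U V) \<longrightarrow>
      carrier U = {\<zero>\<^bsub>U\<^esub>} \<or> carrier V = {\<zero>\<^bsub>V\<^esub>})"

definition direct_summand ::
  "('a, 'r) ring_scheme \<Rightarrow> ('a, nat \<Rightarrow> 'a) module \<Rightarrow> ('a, nat \<Rightarrow> 'a) module \<Rightarrow> bool" where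
  "direct_summand A N M \<longleftrightarrow> N \<in> fg_modules A \<and>
    (\<exists>N' \<in> fg_modules A. mod_isomorphic A M (direct_sum N N'))"

definition add_subgroup ::
  "('a, 'r) ring_scheme \<Rightarrow> ('a, nat \<Rightarrow> 'a) module \<Rightarrow> (('a, nat \<Rightarrow> 'a) module \<Rightarrow>\<^sub>0 int) set set" where
  "add_subgroup A M =
    generate (K0 A) {K0_class A N | N. indecomposable A N \<and> direct_summand A N M}"

definition phi :: "('a, 'r) ring_scheme \<Rightarrow> ('a, nat \<Rightarrow> 'a) module \<Rightarrow> nat" where
  "phi A M =
    (LEAST l. \<forall>s. Omega_bar A \<in>
      mon ((K0 A)\<lparr>carrier := (Omega_bar A ^^ (l + s)) ` add_subgroup A M\<rparr>) (K0 A))"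

definition phi_dim :: "('a, 'r) ring_scheme \<Rightarrow> enat" where
  "phi_dim A = (SUP M \<in> fg_modules A. enat (phi A M))"

end

theory Submission
  imports Defs
begin

text \<open>
  The indecomposable summands of \<open>\<Omega> M\<close> embed into projective modules, so they are syzygies up to
  projective summands and \<open>\<langle>add \<Omega> M\<rangle>\<close> lies in the image of \<open>\<Omega>\<close> on \<open>K\<^sub>0\<close>. If \<open>\<phi>(M)\<close> is the
  finite \<open>\<phi>\<close>-dimension \<open>d\<close>, this forces \<open>\<phi>(\<Omega> M) = d - 1\<close>.

  Suppose now that no module has \<open>\<phi>\<close>-value one. If all indecomposable summands of \<open>N\<close> are isomorphic,
  then any two modules with syzygy \<open>N\<close> have the same class in \<open>K\<^sub>0\<close>. Given an embedding \<open>N \<rightarrow> E\<close>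
  and a map \<open>N \<rightarrow> Q\<close> with \<open>E\<close> and \<open>Q\<close> projective, comparing the cokernels of \<open>N \<rightarrow> E\<close> and
  \<open>N \<rightarrow> E \<oplus> Q\<close> by dimensions of extension groups (as in Miyata's theorem) shows that the map
  extends to \<open>E\<close>. For \<open>N\<close> equal to a simple module \<open>S\<close> or to \<open>S \<oplus> S\<close> it follows that \<open>S\<close> determines
  the projective covers of simple modules into which it embeds, and occurs in their socles at most once.
  Since there are finitely many simple modules, counting shows that these socles are simple. Hence
  maps into projective modules extend from every submodule of such a cover, and, by an argument as for
  Baer's criterion, projective modules are injective. Then every module embeds into a projective one,
  cosyzygies invert \<open>\<Omega>\<close> on \<open>K\<^sub>0\<close>, and \<open>\<phi>\<close> vanishes identically.
\<close>

section \<open>Modules and homomorphisms\<close>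

text \<open>Two obstacles shape the proof. \<open>K0 A\<close> is not shown to be free, so equal
  classes do not give isomorphic modules; they are exploited only through homomorphisms to the
  integers, the dimensions of \<open>Ext(-, W)\<close>. With \<open>W\<close> a syzygy these detect
  projectivity, with \<open>W = Q\<close> they detect that a map to \<open>Q\<close> extends.
  Secondly, a value can be forced down to zero only after it is known to be at most one. This is why
  \<open>N\<close> has a single type of summand: if the value one is absent, every power of \<Omega>
  is injective on the multiples of one class, so no kernel can appear after the first application of
  \<Omega>. The case \<open>N = S\<close> gives extensions in both directions between two covers
  that contain \<open>S\<close>. The case of two copies of \<open>S\<close> allows a map that is the
  identity on one copy and zero on the other. Counting handles non-isomorphic simple submodules:
  choosing one in each cover is an injective, hence surjective, self-map of the finite set of
  isomorphism classes, so a second one would have been chosen in another cover.\<close>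

lemma (in abelian_group) diff_eq_zero_iff:
  "a \<in> carrier G \<Longrightarrow> b \<in> carrier G \<Longrightarrow> a \<ominus> b = \<zero> \<longleftrightarrow> a = b"
  by (metis a_minus_def a_inv_closed minus_equality minus_minus r_neg)

lemma (in abelian_group) uminus_zero [simp]: "\<ominus> \<zero> = \<zero>"
  by (rule minus_equality) auto

context right_module
begin

lemma zero_act: "x \<in> carrier M \<Longrightarrow> \<zero>\<^bsub>A\<^esub> \<odot> x = \<zero>"
  using act_add_scalar[of "\<zero>\<^bsub>A\<^esub>" "\<zero>\<^bsub>A\<^esub>" x] act_closed[of "\<zero>\<^bsub>A\<^esub>" x]
  by (metis A.zero_closed A.l_zero M.add.r_cancel_one')

lemma act_zero: "a \<in> carrier A \<Longrightarrow> a \<odot> \<zero> = \<zero>"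
  using act_add[of a \<zero> \<zero>] act_closed[of a \<zero>]
  by (metis M.zero_closed M.l_zero M.add.r_cancel_one')

lemma minus_act: "a \<in> carrier A \<Longrightarrow> x \<in> carrier M \<Longrightarrow> (\<ominus>\<^bsub>A\<^esub> a) \<odot> x = \<ominus> (a \<odot> x)"
  using act_add_scalar[of "\<ominus>\<^bsub>A\<^esub> a" a x] act_closed zero_act
  by (metis A.a_inv_closed A.l_neg M.minus_equality)

lemma act_minus: "a \<in> carrier A \<Longrightarrow> x \<in> carrier M \<Longrightarrow> a \<odot> (\<ominus> x) = \<ominus> (a \<odot> x)"
  using act_add[of a "\<ominus> x" x] act_closed act_zero
  by (metis M.a_inv_closed M.l_neg M.minus_equality)

text \<open>Negatives come for free from the action of minus one, which leaves a criterion without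
  the subgroup axioms.\<close>

lemma submodule_iff:
  "submodule H A M \<longleftrightarrow> H \<subseteq> carrier M \<and> \<zero> \<in> H \<and> (\<forall>x\<in>H. \<forall>y\<in>H. x \<oplus> y \<in> H) \<and>
    (\<forall>a\<in>carrier A. \<forall>x\<in>H. a \<odot> x \<in> H)" (is "?L \<longleftrightarrow> ?R")
proof
  assume ?L
  then interpret submodule H A M .
  show ?R using subset one_closed m_closed smult_closed by auto
next
  assume R: ?R
  have "\<ominus> x \<in> H" if "x \<in> H" for x
  proof -
    have "(\<ominus>\<^bsub>A\<^esub> \<one>\<^bsub>A\<^esub>) \<odot> x \<in> H" using R that by auto
    moreover have "x \<in> carrier M" using R that by auto
    ultimately show ?thesis by (simp add: minus_act act_one)
  qed
  with R show ?L
    by (intro submodule.intro subgroup.intro submodule_axioms.intro) (auto simp: a_inv_def)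
qed

lemma submodule_minus: "submodule H A M \<Longrightarrow> x \<in> H \<Longrightarrow> \<ominus> x \<in> H"
  using minus_act[of "\<one>\<^bsub>A\<^esub>" x] act_one[of x] unfolding submodule_iff
  by (metis A.add.inv_closed A.one_closed subset_iff)

lemma submodule_diff: "submodule H A M \<Longrightarrow> x \<in> H \<Longrightarrow> y \<in> H \<Longrightarrow> x \<ominus> y \<in> H"
  using submodule_minus unfolding submodule_iff by (simp add: a_minus_def)

lemma submodule_carrier: "submodule (carrier M) A M"
  by (simp add: submodule_iff act_closed)

lemma submodule_zero: "submodule {\<zero>} A M"
  by (simp add: submodule_iff act_zero)

lemma submodule_Int: "submodule U A M \<Longrightarrow> submodule V A M \<Longrightarrow> submodule (U \<inter> V) A M"
  by (auto simp: submodule_iff)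

lemma submodule_Inter:
  "\<U> \<noteq> {} \<Longrightarrow> (\<And>U. U \<in> \<U> \<Longrightarrow> submodule U A M) \<Longrightarrow> submodule (\<Inter>\<U>) A M"
  by (auto simp: submodule_iff) blast

lemma restrict_carrier:
  assumes "submodule U A M"
  shows "right_module A (M\<lparr>carrier := U\<rparr>)"
proof -
  have U: "U \<subseteq> carrier M" "\<zero> \<in> U" "\<And>x y. x \<in> U \<Longrightarrow> y \<in> U \<Longrightarrow> x \<oplus> y \<in> U"
    "\<And>a x. a \<in> carrier A \<Longrightarrow> x \<in> U \<Longrightarrow> a \<odot> x \<in> U"
    using assms by (auto simp: submodule_iff)
  have sub: "x \<in> carrier M" if "x \<in> U" for x using U that by auto
  have "abelian_group (M\<lparr>carrier := U\<rparr>)"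
  proof (rule abelian_groupI)
    fix x assume "x \<in> carrier (M\<lparr>carrier := U\<rparr>)"
    then show "\<exists>y\<in>carrier (M\<lparr>carrier := U\<rparr>). y \<oplus>\<^bsub>M\<lparr>carrier := U\<rparr>\<^esub> x = \<zero>\<^bsub>M\<lparr>carrier := U\<rparr>\<^esub>"
      using submodule_minus[OF assms, of x] sub by (auto simp: M.l_neg intro!: bexI[of _ "\<ominus> x"])
  qed (auto simp: U sub M.a_ac)
  then show ?thesis
    by (intro right_module.intro A.ring_axioms right_module_axioms.intro)
      (auto simp: U sub act_add act_add_scalar act_assoc act_one)
qed

text \<open>A submodule is the same record with a smaller carrier, so submodules of submodules stay
  in one lattice and no inclusion maps have to be composed.\<close>

lemma submodule_restrict:
  assumes U: "submodule U A M"
  shows "submodule V A (M\<lparr>carrier := U\<rparr>) \<longleftrightarrow> submodule V A M \<and> V \<subseteq> U"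
  using U right_module.submodule_iff[OF restrict_carrier[OF U], of V] submodule_iff[of V]
    submodule_iff[of U] by auto

end

lemma mod_hom_iff:
  "f \<in> mod_hom A M N \<longleftrightarrow> (\<forall>x\<in>carrier M. f x \<in> carrier N) \<and>
    (\<forall>x\<in>carrier M. \<forall>y\<in>carrier M. f (x \<oplus>\<^bsub>M\<^esub> y) = f x \<oplus>\<^bsub>N\<^esub> f y) \<and>
    (\<forall>a\<in>carrier A. \<forall>x\<in>carrier M. f (a \<odot>\<^bsub>M\<^esub> x) = a \<odot>\<^bsub>N\<^esub> f x)"
  by (auto simp: mod_hom_def hom_def)

lemma mod_hom_closed: "f \<in> mod_hom A M N \<Longrightarrow> x \<in> carrier M \<Longrightarrow> f x \<in> carrier N"
  by (simp add: mod_hom_iff)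

lemma mod_hom_add: "f \<in> mod_hom A M N \<Longrightarrow> x \<in> carrier M \<Longrightarrow> y \<in> carrier M \<Longrightarrow>
    f (x \<oplus>\<^bsub>M\<^esub> y) = f x \<oplus>\<^bsub>N\<^esub> f y"
  by (simp add: mod_hom_iff)

lemma mod_hom_act: "f \<in> mod_hom A M N \<Longrightarrow> a \<in> carrier A \<Longrightarrow> x \<in> carrier M \<Longrightarrow>
    f (a \<odot>\<^bsub>M\<^esub> x) = a \<odot>\<^bsub>N\<^esub> f x"
  by (simp add: mod_hom_iff)

lemma mod_hom_cong: "f \<in> mod_hom A M N \<Longrightarrow> right_module A M \<Longrightarrow> (\<And>x. x \<in> carrier M \<Longrightarrow> f x = g x) \<Longrightarrow>
    g \<in> mod_hom A M N"
proof -
  assume f: "f \<in> mod_hom A M N" and M: "right_module A M" and eq: "\<And>x. x \<in> carrier M \<Longrightarrow> f x = g x"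
  interpret right_module A M by (rule M)
  show ?thesis using f unfolding mod_hom_iff by (simp add: eq[symmetric] act_closed)
qed

lemma mod_hom_zero:
  assumes "right_module A M" "right_module A N" "f \<in> mod_hom A M N"
  shows "f \<zero>\<^bsub>M\<^esub> = \<zero>\<^bsub>N\<^esub>"
proof -
  interpret M: right_module A M by (rule assms)
  interpret N: right_module A N by (rule assms)
  have "f (\<zero>\<^bsub>A\<^esub> \<odot>\<^bsub>M\<^esub> \<zero>\<^bsub>M\<^esub>) = \<zero>\<^bsub>A\<^esub> \<odot>\<^bsub>N\<^esub> f \<zero>\<^bsub>M\<^esub>" using assms(3) by (simp add: mod_hom_iff)
  then show ?thesis using mod_hom_closed[OF assms(3), of "\<zero>\<^bsub>M\<^esub>"] by (simp add: M.zero_act N.zero_act)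
qed

lemma mod_hom_minus:
  assumes "right_module A M" "right_module A N" "f \<in> mod_hom A M N" "x \<in> carrier M"
  shows "f (\<ominus>\<^bsub>M\<^esub> x) = \<ominus>\<^bsub>N\<^esub> f x"
proof -
  interpret M: right_module A M by (rule assms)
  interpret N: right_module A N by (rule assms)
  have "f ((\<ominus>\<^bsub>A\<^esub> \<one>\<^bsub>A\<^esub>) \<odot>\<^bsub>M\<^esub> x) = (\<ominus>\<^bsub>A\<^esub> \<one>\<^bsub>A\<^esub>) \<odot>\<^bsub>N\<^esub> f x" using assms by (simp add: mod_hom_iff)
  then show ?thesis using mod_hom_closed[OF assms(3,4)] assms(4)
    by (simp add: M.minus_act N.minus_act M.act_one N.act_one)
qed

lemma mod_hom_diff:
  assumes "right_module A M" "right_module A N" "f \<in> mod_hom A M N" "x \<in> carrier M" "y \<in> carrier M"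
  shows "f (x \<ominus>\<^bsub>M\<^esub> y) = f x \<ominus>\<^bsub>N\<^esub> f y"
proof -
  interpret M: right_module A M by (rule assms)
  show ?thesis using assms by (simp add: a_minus_def mod_hom_add mod_hom_minus)
qed

lemma mod_hom_comp: "f \<in> mod_hom A L M \<Longrightarrow> g \<in> mod_hom A M N \<Longrightarrow> (\<lambda>x. g (f x)) \<in> mod_hom A L N"
  by (simp add: mod_hom_iff)

lemma mod_hom_id: "(\<lambda>x. x) \<in> mod_hom A M M"
  by (simp add: mod_hom_iff)

lemma mod_hom_zero_map:
  assumes "right_module A M" "right_module A N" shows "(\<lambda>x. \<zero>\<^bsub>N\<^esub>) \<in> mod_hom A M N"
proof -
  interpret N: right_module A N by (rule assms)
  show ?thesis by (simp add: mod_hom_iff N.act_zero)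
qed

lemma mod_hom_plus:
  assumes "right_module A N" "f \<in> mod_hom A M N" "g \<in> mod_hom A M N"
  shows "(\<lambda>x. f x \<oplus>\<^bsub>N\<^esub> g x) \<in> mod_hom A M N"
proof -
  interpret N: right_module A N by (rule assms)
  show ?thesis using assms(2,3) by (auto simp: mod_hom_iff N.M.a_ac N.act_add)
qed

lemma mod_hom_uminus:
  assumes "right_module A N" "f \<in> mod_hom A M N"
  shows "(\<lambda>x. \<ominus>\<^bsub>N\<^esub> f x) \<in> mod_hom A M N"
proof -
  interpret N: right_module A N by (rule assms)
  show ?thesis using assms(2) by (auto simp: mod_hom_iff N.M.minus_add N.act_minus)
qed

lemma mod_hom_minus_map:
  assumes "right_module A N" "f \<in> mod_hom A M N" "g \<in> mod_hom A M N"
  shows "(\<lambda>x. f x \<ominus>\<^bsub>N\<^esub> g x) \<in> mod_hom A M N"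
  using mod_hom_plus[OF assms(1,2) mod_hom_uminus[OF assms(1,3)]] by (simp add: a_minus_def)

lemma mod_hom_inv:
  assumes M: "right_module A M" and f: "f \<in> mod_hom A M N" and bij: "bij_betw f (carrier M) (carrier N)"
  shows "inv_into (carrier M) f \<in> mod_hom A N M"
proof -
  interpret M: right_module A M by (rule M)
  let ?g = "inv_into (carrier M) f"
  have g: "?g y \<in> carrier M" "f (?g y) = y" if "y \<in> carrier N" for y
    using bij that by (auto simp: bij_betw_def inv_into_into f_inv_into_f)
  have gf: "?g (f x) = x" if "x \<in> carrier M" for x
    using bij that by (simp add: bij_betw_def inv_into_f_f)
  have "?g (x \<oplus>\<^bsub>N\<^esub> y) = ?g x \<oplus>\<^bsub>M\<^esub> ?g y" if "x \<in> carrier N" "y \<in> carrier N" for x y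
    using gf[of "?g x \<oplus>\<^bsub>M\<^esub> ?g y"] g that mod_hom_add[OF f, of "?g x" "?g y"] by simp
  moreover have "?g (a \<odot>\<^bsub>N\<^esub> x) = a \<odot>\<^bsub>M\<^esub> ?g x" if "x \<in> carrier N" "a \<in> carrier A" for x a
    using gf[of "a \<odot>\<^bsub>M\<^esub> ?g x"] g that mod_hom_act[OF f, of a "?g x"] by (simp add: M.act_closed)
  ultimately show ?thesis using g by (simp add: mod_hom_iff)
qed

lemma submodule_kernel:
  assumes "right_module A M" "right_module A N" "f \<in> mod_hom A M N"
  shows "submodule (a_kernel M N f) A M"
proof -
  interpret M: right_module A M by (rule assms)
  interpret N: right_module A N by (rule assms)
  show ?thesis unfolding M.submodule_iff a_kernel_def'
    using assms(3) mod_hom_zero[OF assms] by (auto simp: mod_hom_iff M.act_closed N.act_zero)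
qed

lemma submodule_vimage:
  assumes "right_module A M" "right_module A N" "f \<in> mod_hom A M N" "submodule U A N"
  shows "submodule {x \<in> carrier M. f x \<in> U} A M"
proof -
  interpret M: right_module A M by (rule assms)
  interpret N: right_module A N by (rule assms)
  show ?thesis unfolding M.submodule_iff
    using assms(3,4) mod_hom_zero[OF assms(1-3)] unfolding N.submodule_iff
    by (auto simp: mod_hom_iff M.act_closed)
qed

lemma submodule_image:
  assumes "right_module A M" "right_module A N" "f \<in> mod_hom A M N" "submodule U A M"
  shows "submodule (f ` U) A N"
proof -
  interpret M: right_module A M by (rule assms)
  interpret N: right_module A N by (rule assms)
  have U: "U \<subseteq> carrier M" "\<zero>\<^bsub>M\<^esub> \<in> U" "\<And>x y. x \<in> U \<Longrightarrow> y \<in> U \<Longrightarrow> x \<oplus>\<^bsub>M\<^esub> y \<in> U"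
    "\<And>a x. a \<in> carrier A \<Longrightarrow> x \<in> U \<Longrightarrow> a \<odot>\<^bsub>M\<^esub> x \<in> U"
    using assms(4) by (auto simp: M.submodule_iff)
  have 1: "f x \<in> carrier N" if "x \<in> U" for x using U(1) that mod_hom_closed[OF assms(3)] by auto
  have 2: "f x \<oplus>\<^bsub>N\<^esub> f y \<in> f ` U" if "x \<in> U" "y \<in> U" for x y
    using U(1) U(3)[OF that] that mod_hom_add[OF assms(3), of x y] by (metis image_eqI subset_iff)
  have 3: "a \<odot>\<^bsub>N\<^esub> f x \<in> f ` U" if "a \<in> carrier A" "x \<in> U" for a x
    using U(1) U(4)[OF that] that mod_hom_act[OF assms(3), of a x] by (metis image_eqI subset_iff)
  show ?thesis unfolding N.submodule_iff
    using 1 2 3 U(2) mod_hom_zero[OF assms(1-3)] by (auto intro: rev_image_eqI)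
qed

lemma mod_hom_inj_iff:
  assumes "right_module A M" "right_module A N" "f \<in> mod_hom A M N"
  shows "inj_on f (carrier M) \<longleftrightarrow> (\<forall>x\<in>carrier M. f x = \<zero>\<^bsub>N\<^esub> \<longrightarrow> x = \<zero>\<^bsub>M\<^esub>)"
proof -
  interpret M: right_module A M by (rule assms)
  interpret N: right_module A N by (rule assms)
  show ?thesis
  proof
    assume "inj_on f (carrier M)"
    then show "\<forall>x\<in>carrier M. f x = \<zero>\<^bsub>N\<^esub> \<longrightarrow> x = \<zero>\<^bsub>M\<^esub>"
      using mod_hom_zero[OF assms] by (metis M.M.zero_closed inj_onD)
  next
    assume *: "\<forall>x\<in>carrier M. f x = \<zero>\<^bsub>N\<^esub> \<longrightarrow> x = \<zero>\<^bsub>M\<^esub>"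
    show "inj_on f (carrier M)"
    proof (rule inj_onI)
      fix x y assume xy: "x \<in> carrier M" "y \<in> carrier M" "f x = f y"
      have "f (x \<ominus>\<^bsub>M\<^esub> y) = \<zero>\<^bsub>N\<^esub>"
        using xy mod_hom_closed[OF assms(3)] by (simp add: mod_hom_diff[OF assms] N.M.diff_eq_zero_iff)
      then have "x \<ominus>\<^bsub>M\<^esub> y = \<zero>\<^bsub>M\<^esub>" using * xy by simp
      then show "x = y" using xy by (simp add: M.M.diff_eq_zero_iff)
    qed
  qed
qed

text \<open>The quotient is realised on a set of representatives, so that it lives on the same type.\<close>

lemma quotient_exists:
  fixes M :: "('a, 'm, 's) module_scheme"
  assumes M: "right_module A M" and U: "submodule U A M"
  shows "\<exists>(C :: ('a, 'm) module) q. right_module A C \<and> q \<in> mod_hom A M C \<and>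
    q ` carrier M = carrier C \<and> a_kernel M C q = U"
proof -
  interpret right_module A M by (rule M)
  have Us: "\<zero>\<^bsub>M\<^esub> \<in> U" "\<And>x y. x \<in> U \<Longrightarrow> y \<in> U \<Longrightarrow> x \<oplus>\<^bsub>M\<^esub> y \<in> U" "U \<subseteq> carrier M"
    "\<And>a x. a \<in> carrier A \<Longrightarrow> x \<in> U \<Longrightarrow> a \<odot>\<^bsub>M\<^esub> x \<in> U"
    using U by (auto simp: submodule_iff)
  define E where "E x y \<longleftrightarrow> x \<in> carrier M \<and> y \<in> carrier M \<and> x \<ominus>\<^bsub>M\<^esub> y \<in> U" for x y
  have refl: "E x x" if "x \<in> carrier M" for x
    using that Us(1) by (simp add: E_def M.r_neg a_minus_def)
  have sym: "E y x" if "E x y" for x y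
    using that submodule_minus[OF U, of "x \<ominus>\<^bsub>M\<^esub> y"]
    by (simp add: E_def M.minus_add a_minus_def M.a_comm M.minus_minus)
  have trans: "E x z" if "E x y" "E y z" for x y z
  proof -
    have "(x \<ominus>\<^bsub>M\<^esub> y) \<oplus>\<^bsub>M\<^esub> (y \<ominus>\<^bsub>M\<^esub> z) = x \<ominus>\<^bsub>M\<^esub> z"
      using that by (simp add: E_def a_minus_def M.a_assoc)
        (metis M.add.inv_closed M.add.m_closed M.l_neg M.l_zero M.a_assoc)
    then show ?thesis using that Us(2) by (metis E_def)
  qed
  \<comment> \<open>The choice depends on \<open>x\<close> only through the predicate
    \<open>E x\<close>, so equivalent elements receive the same representative.\<close>
  define q where "q x = (SOME y. E x y)" for x
  have Eq: "E x (q x)" if "x \<in> carrier M" for x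
    unfolding q_def by (rule someI[of "E x", OF refl[OF that]])
  have qeq: "q x = q y" if "E x y" for x y
  proof -
    have "E x = E y" using that sym trans by blast
    then show ?thesis by (simp add: q_def)
  qed
  have qc: "q x \<in> carrier M" if "x \<in> carrier M" for x using Eq[OF that] by (simp add: E_def)
  have Eadd: "E (x \<oplus>\<^bsub>M\<^esub> y) (x' \<oplus>\<^bsub>M\<^esub> y')" if "E x x'" "E y y'" for x x' y y'
  proof -
    have "(x \<oplus>\<^bsub>M\<^esub> y) \<ominus>\<^bsub>M\<^esub> (x' \<oplus>\<^bsub>M\<^esub> y') = (x \<ominus>\<^bsub>M\<^esub> x') \<oplus>\<^bsub>M\<^esub> (y \<ominus>\<^bsub>M\<^esub> y')"
      using that by (simp add: E_def a_minus_def M.minus_add M.a_ac)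
    then show ?thesis using that Us(2) by (simp add: E_def)
  qed
  have Eact: "E (a \<odot>\<^bsub>M\<^esub> x) (a \<odot>\<^bsub>M\<^esub> y)" if "a \<in> carrier A" "E x y" for a x y
    using that Us(4)[of a "x \<ominus>\<^bsub>M\<^esub> y"] act_add[of a x "\<ominus>\<^bsub>M\<^esub> y"]
    by (simp add: E_def a_minus_def act_closed act_minus)
  define C :: "('a, 'm) module" where "C = \<lparr>carrier = q ` carrier M, monoid.mult = (\<lambda>x y. x),
     monoid.one = q \<zero>\<^bsub>M\<^esub>, ring.zero = q \<zero>\<^bsub>M\<^esub>, ring.add = (\<lambda>x y. q (x \<oplus>\<^bsub>M\<^esub> y)),
     smult = (\<lambda>a x. q (a \<odot>\<^bsub>M\<^esub> x))\<rparr>"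
  have add: "q x \<oplus>\<^bsub>C\<^esub> q y = q (x \<oplus>\<^bsub>M\<^esub> y)" if "x \<in> carrier M" "y \<in> carrier M" for x y
    using qeq[OF Eadd[OF Eq Eq], OF that] by (simp add: C_def)
  have act: "a \<odot>\<^bsub>C\<^esub> q x = q (a \<odot>\<^bsub>M\<^esub> x)" if "a \<in> carrier A" "x \<in> carrier M" for a x
    using qeq[OF Eact[OF _ Eq], OF that] by (simp add: C_def)
  have car: "carrier C = q ` carrier M" and z: "\<zero>\<^bsub>C\<^esub> = q \<zero>\<^bsub>M\<^esub>" by (simp_all add: C_def)
  have ab: "abelian_group C"
  proof (rule abelian_groupI)
    fix x assume "x \<in> carrier C"
    then obtain u where u: "u \<in> carrier M" "x = q u" by (auto simp: car)
    then show "\<exists>y \<in> carrier C. y \<oplus>\<^bsub>C\<^esub> x = \<zero>\<^bsub>C\<^esub>"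
      by (intro bexI[of _ "q (\<ominus>\<^bsub>M\<^esub> u)"]) (auto simp: car z add M.l_neg)
  qed (auto simp: car z add M.a_ac)
  have C: "right_module A C"
    by (intro right_module.intro A.ring_axioms ab right_module_axioms.intro)
      (auto simp: car add act act_closed act_add_scalar act_add act_assoc act_one)
  have q: "q \<in> mod_hom A M C" by (auto simp: mod_hom_iff car add act)
  have "q x = q \<zero>\<^bsub>M\<^esub> \<longleftrightarrow> E x \<zero>\<^bsub>M\<^esub>" if "x \<in> carrier M" for x
    using qeq[of x "\<zero>\<^bsub>M\<^esub>"] Eq[of x] Eq[of "\<zero>\<^bsub>M\<^esub>"] that by (metis M.zero_closed sym trans)
  moreover have "E x \<zero>\<^bsub>M\<^esub> \<longleftrightarrow> x \<in> U" if "x \<in> carrier M" for x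
    using that by (simp add: E_def a_minus_def)
  ultimately have "a_kernel M C q = U"
    using Us(3) by (auto simp: a_kernel_def' z)
  with C q car show ?thesis by blast
qed

section \<open>Length\<close>

lemma (in abelian_group) add_diff_add:
  assumes "a \<in> carrier G" "b \<in> carrier G" "c \<in> carrier G"
  shows "(a \<oplus> c) \<ominus> (b \<oplus> c) = a \<ominus> b"
proof -
  have "(a \<oplus> c) \<ominus> (b \<oplus> c) = (a \<ominus> b) \<oplus> (c \<oplus> \<ominus> c)"
    using assms by (simp add: a_minus_def minus_add a_ac del: r_neg)
  then show ?thesis using assms by (simp add: r_neg a_minus_def)
qed

definition strictly_monotone ::
  "('a, 'r) ring_scheme \<Rightarrow> ('a, 'm, 's) module_scheme \<Rightarrow> ('m set \<Rightarrow> nat) \<Rightarrow> bool" where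
  "strictly_monotone R V g \<longleftrightarrow>
    (\<forall>U U'. submodule U R V \<longrightarrow> submodule U' R V \<longrightarrow> U \<subset> U' \<longrightarrow> g U < g U')"

text \<open>A strict chain of submodules has at most \<open>g (carrier V)\<close> steps. Conversely,
  in a module of finite length the length of a submodule is such a \<open>g\<close>.\<close>

definition finite_length :: "('a, 'r) ring_scheme \<Rightarrow> ('a, 'm, 's) module_scheme \<Rightarrow> bool" where
  "finite_length R V \<longleftrightarrow> (\<exists>g. strictly_monotone R V g)"

text \<open>
  The length as the least value at the top of a strictly monotone function on the lattice of
  submodules: with this definition the additivity on short exact sequences needs no chains.
\<close>

definition len :: "('a, 'r) ring_scheme \<Rightarrow> ('a, 'm, 's) module_scheme \<Rightarrow> nat" where
  "len R V = (LEAST n. \<exists>g. strictly_monotone R V g \<and> g (carrier V) = n)"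

lemma strictly_monotoneD:
  "strictly_monotone R V g \<Longrightarrow> submodule U R V \<Longrightarrow> submodule U' R V \<Longrightarrow> U \<subset> U' \<Longrightarrow> g U < g U'"
  by (auto simp: strictly_monotone_def)

lemma strictly_monotone_mono:
  "strictly_monotone R V g \<Longrightarrow> submodule U R V \<Longrightarrow> submodule U' R V \<Longrightarrow> U \<subseteq> U' \<Longrightarrow> g U \<le> g U'"
  using strictly_monotoneD[of R V g U U'] by (cases "U = U'") (auto simp: psubset_eq)

lemma len_le: "strictly_monotone R V g \<Longrightarrow> len R V \<le> g (carrier V)"
  unfolding len_def by (rule Least_le) blast

lemma len_attained:
  assumes "finite_length R V"
  obtains g where "strictly_monotone R V g" "g (carrier V) = len R V"
proof -
  obtain g where "strictly_monotone R V g" using assms by (auto simp: finite_length_def)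
  then have "\<exists>n. \<exists>g. strictly_monotone R V g \<and> g (carrier V) = n" by blast
  from LeastI_ex[OF this] that show thesis unfolding len_def by blast
qed

text \<open>If \<open>x\<close> in \<open>U'\<close> and \<open>u\<close> in \<open>U\<close> have
  the same image, their difference lies in \<open>U'\<close> and in the kernel, hence in
  \<open>U\<close>. This modular law is what makes the sum in
  \<open>strictly_monotone_extension\<close> strict.\<close>

lemma submodule_le_kernel_image:
  assumes V: "right_module R V" and W: "right_module R W" and f: "f \<in> mod_hom R V W"
    and U: "submodule U R V" and U': "submodule U' R V" and "U \<subseteq> U'"
    and ker: "U' \<inter> a_kernel V W f \<subseteq> U" and im: "f ` U' \<subseteq> f ` U"
  shows "U = U'"
proof
  interpret V: right_module R V by (rule V)
  interpret W: right_module R W by (rule W)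
  have sub: "U \<subseteq> carrier V" "U' \<subseteq> carrier V" using U U' by (auto simp: V.submodule_iff)
  show "U' \<subseteq> U"
  proof
    fix x assume x: "x \<in> U'"
    then obtain u where u: "u \<in> U" "f x = f u" using im by blast
    then have xu: "x \<in> carrier V" "u \<in> carrier V" using x sub by auto
    then have "f (x \<ominus>\<^bsub>V\<^esub> u) = \<zero>\<^bsub>W\<^esub>"
      using u(2) mod_hom_closed[OF f] by (simp add: mod_hom_diff[OF V W f] W.M.diff_eq_zero_iff)
    then have "x \<ominus>\<^bsub>V\<^esub> u \<in> U" using ker V.submodule_diff[OF U' x] u(1) \<open>U \<subseteq> U'\<close> xu
      by (auto simp: a_kernel_def')
    then have "(x \<ominus>\<^bsub>V\<^esub> u) \<oplus>\<^bsub>V\<^esub> u \<in> U" using U u(1) by (simp add: V.submodule_iff)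
    then show "x \<in> U" using xu by (simp add: a_minus_def V.M.a_assoc V.M.l_neg)
  qed
qed fact

lemma strictly_monotone_extension:
  assumes V: "right_module R V" and W: "right_module R W" and f: "f \<in> mod_hom R V W"
    and g: "strictly_monotone R (V\<lparr>carrier := a_kernel V W f\<rparr>) g" and h: "strictly_monotone R W h"
  shows "strictly_monotone R V (\<lambda>U. g (U \<inter> a_kernel V W f) + h (f ` U))"
  unfolding strictly_monotone_def
proof (intro allI impI)
  interpret V: right_module R V by (rule V)
  let ?N = "a_kernel V W f"
  have N: "submodule ?N R V" by (rule submodule_kernel[OF V W f])
  fix U U' assume U: "submodule U R V" and U': "submodule U' R V" and lt: "U \<subset> U'"
  have 1: "submodule (U \<inter> ?N) R (V\<lparr>carrier := ?N\<rparr>)" "submodule (U' \<inter> ?N) R (V\<lparr>carrier := ?N\<rparr>)"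
    using U U' N by (simp_all add: V.submodule_restrict V.submodule_Int)
  have 2: "submodule (f ` U) R W" "submodule (f ` U') R W"
    by (auto intro: submodule_image[OF V W f] U U')
  have "g (U \<inter> ?N) \<le> g (U' \<inter> ?N)" using lt by (intro strictly_monotone_mono[OF g 1]) auto
  moreover have "h (f ` U) \<le> h (f ` U')" using lt by (intro strictly_monotone_mono[OF h 2]) auto
  moreover have "g (U \<inter> ?N) < g (U' \<inter> ?N) \<or> h (f ` U) < h (f ` U')"
  proof (rule ccontr)
    assume "\<not> ?thesis"
    then have "\<not> U \<inter> ?N \<subset> U' \<inter> ?N" "\<not> f ` U \<subset> f ` U'"
      using strictly_monotoneD[OF g 1] strictly_monotoneD[OF h 2] by auto
    then have "U = U'" using lt by (intro submodule_le_kernel_image[OF V W f U U']) auto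
    then show False using lt by simp
  qed
  ultimately show "g (U \<inter> ?N) + h (f ` U) < g (U' \<inter> ?N) + h (f ` U')" by linarith
qed

lemma finite_length_extension:
  assumes "right_module R V" "right_module R W" "f \<in> mod_hom R V W"
    and "finite_length R (V\<lparr>carrier := a_kernel V W f\<rparr>)" "finite_length R W"
  shows "finite_length R V"
  using assms(4,5) strictly_monotone_extension[OF assms(1-3)] unfolding finite_length_def by blast

lemma strictly_monotone_restrict:
  assumes V: "right_module R V" and "submodule U R V" "strictly_monotone R V g"
  shows "strictly_monotone R (V\<lparr>carrier := U\<rparr>) g"
proof -
  interpret V: right_module R V by (rule V)
  show ?thesis using assms(2,3) by (simp add: strictly_monotone_def V.submodule_restrict)
qed

lemma finite_length_restrict:
  "right_module R V \<Longrightarrow> submodule U R V \<Longrightarrow> finite_length R V \<Longrightarrow> finite_length R (V\<lparr>carrier := U\<rparr>)"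
  using strictly_monotone_restrict unfolding finite_length_def by blast

text \<open>Taking preimages embeds the submodules of \<open>W\<close> into those of
  \<open>V\<close> above the kernel. Subtracting the value at the kernel makes the bounds for kernel
  and quotient add up in \<open>len_exact\<close>; the subtraction never truncates, since each
  preimage contains the kernel.\<close>

lemma strictly_monotone_quotient:
  assumes V: "right_module R V" and W: "right_module R W" and f: "f \<in> mod_hom R V W"
    and surj: "f ` carrier V = carrier W" and g: "strictly_monotone R V g"
  shows "strictly_monotone R W (\<lambda>U. g {x \<in> carrier V. f x \<in> U} - g (a_kernel V W f))"
  unfolding strictly_monotone_def
proof (intro allI impI)
  interpret V: right_module R V by (rule V)
  interpret W: right_module R W by (rule W)
  let ?N = "a_kernel V W f" and ?p = "\<lambda>U. {x \<in> carrier V. f x \<in> U}"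
  fix U U' assume U: "submodule U R W" and U': "submodule U' R W" and lt: "U \<subset> U'"
  have p: "submodule (?p U) R V" "submodule (?p U') R V"
    by (auto intro: submodule_vimage[OF V W f] U U')
  obtain y where y: "y \<in> U'" "y \<notin> U" using lt by auto
  then have "y \<in> f ` carrier V" using surj U' by (auto simp: W.submodule_iff)
  then obtain x where "x \<in> carrier V" "f x = y" by auto
  then have "?p U \<subset> ?p U'" using lt y by auto
  then have "g (?p U) < g (?p U')" by (rule strictly_monotoneD[OF g p])
  moreover have "g ?N \<le> g (?p U)"
    using U by (intro strictly_monotone_mono[OF g submodule_kernel[OF V W f] p(1)])
      (auto simp: a_kernel_def' W.submodule_iff)
  ultimately show "g (?p U) - g ?N < g (?p U') - g ?N" by linarith
qed

lemma finite_length_image: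
  assumes "right_module R V" "right_module R W" "f \<in> mod_hom R V W" "f ` carrier V = carrier W"
    and "finite_length R V"
  shows "finite_length R W"
  using assms(5) strictly_monotone_quotient[OF assms(1-4)] unfolding finite_length_def by blast

text \<open>For \<open>\<le>\<close>, optimal functions on the kernel and on the quotient are glued.
  For \<open>\<ge>\<close>, an optimal function on \<open>V\<close> is split into its restriction to
  the kernel and the function it induces on the quotient.\<close>

lemma len_exact:
  assumes V: "right_module R V" and W: "right_module R W" and f: "f \<in> mod_hom R V W"
    and surj: "f ` carrier V = carrier W" and fin: "finite_length R V"
  shows "len R V = len R (V\<lparr>carrier := a_kernel V W f\<rparr>) + len R W"
proof (rule antisym)
  interpret V: right_module R V by (rule V)
  let ?N = "a_kernel V W f"
  have N: "submodule ?N R V" by (rule submodule_kernel[OF V W f])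
  obtain g where g: "strictly_monotone R (V\<lparr>carrier := ?N\<rparr>) g" "g ?N = len R (V\<lparr>carrier := ?N\<rparr>)"
    using len_attained[OF finite_length_restrict[OF V N fin]] by auto
  obtain h where h: "strictly_monotone R W h" "h (carrier W) = len R W"
    using len_attained[OF finite_length_image[OF V W f surj fin]] by auto
  have "len R V \<le> g (carrier V \<inter> ?N) + h (f ` carrier V)"
    by (rule len_le[OF strictly_monotone_extension[OF V W f g(1) h(1)]])
  moreover have "carrier V \<inter> ?N = ?N" by (auto simp: a_kernel_def')
  ultimately show "len R V \<le> len R (V\<lparr>carrier := ?N\<rparr>) + len R W" using g h surj by simp
  obtain g where g: "strictly_monotone R V g" "g (carrier V) = len R V"
    using len_attained[OF fin] by auto
  have "len R (V\<lparr>carrier := ?N\<rparr>) \<le> g ?N"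
    using len_le[OF strictly_monotone_restrict[OF V N g(1)]] by simp
  moreover have "len R W \<le> g {x \<in> carrier V. f x \<in> carrier W} - g ?N"
    by (rule len_le[OF strictly_monotone_quotient[OF V W f surj g(1)]])
  moreover have "{x \<in> carrier V. f x \<in> carrier W} = carrier V" using mod_hom_closed[OF f] by auto
  moreover have "g ?N \<le> g (carrier V)"
    by (rule strictly_monotone_mono[OF g(1) N V.submodule_carrier]) (auto simp: a_kernel_def')
  ultimately show "len R (V\<lparr>carrier := ?N\<rparr>) + len R W \<le> len R V" using g(2) by auto
qed

lemma finite_length_trivial:
  assumes V: "right_module R V" and "carrier V = {\<zero>\<^bsub>V\<^esub>}"
  shows "finite_length R V" "len R V = 0"
proof -
  interpret V: right_module R V by (rule V)
  have "strictly_monotone R V (\<lambda>_. 0)" using assms(2)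
    by (auto simp: strictly_monotone_def V.submodule_iff)
  then show "finite_length R V" "len R V = 0" using len_le by (fastforce simp: finite_length_def)+
qed

lemma len_restrict_less:
  assumes V: "right_module R V" and fin: "finite_length R V" and U: "submodule U R V" and "U \<noteq> carrier V"
  shows "len R (V\<lparr>carrier := U\<rparr>) < len R V"
proof -
  interpret V: right_module R V by (rule V)
  obtain g where g: "strictly_monotone R V g" "g (carrier V) = len R V"
    using len_attained[OF fin] by auto
  have "len R (V\<lparr>carrier := U\<rparr>) \<le> g U"
    using len_le[OF strictly_monotone_restrict[OF V U g(1)]] by simp
  also have "\<dots> < g (carrier V)"
    using assms(4) U by (intro strictly_monotoneD[OF g(1) U V.submodule_carrier]) (auto simp: V.submodule_iff)
  finally show ?thesis using g(2) by simp
qed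

lemma len_restrict_le:
  assumes V: "right_module R V" and fin: "finite_length R V" and U: "submodule U R V"
  shows "len R (V\<lparr>carrier := U\<rparr>) \<le> len R V"
  using len_restrict_less[OF assms] by (cases "U = carrier V") (auto simp: len_def strictly_monotone_def submodule_def subgroup_def submodule_axioms_def)

lemma len_eq_0:
  assumes V: "right_module R V" and "finite_length R V" "len R V = 0"
  shows "carrier V = {\<zero>\<^bsub>V\<^esub>}"
proof -
  interpret V: right_module R V by (rule V)
  show ?thesis using len_restrict_less[OF assms(1,2) V.submodule_zero] assms(3) by auto
qed

lemma inj_kernel:
  assumes "right_module R V" "right_module R W" "f \<in> mod_hom R V W" "inj_on f (carrier V)"
  shows "a_kernel V W f = {\<zero>\<^bsub>V\<^esub>}"
proof -
  interpret V: right_module R V by (rule assms)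
  show ?thesis using assms mod_hom_inj_iff[OF assms(1-3)] mod_hom_zero[OF assms(1-3)]
    by (auto simp: a_kernel_def')
qed

lemma finite_length_inj:
  assumes "right_module R V" "right_module R W" "f \<in> mod_hom R V W" "inj_on f (carrier V)"
    and "finite_length R W"
  shows "finite_length R V"
proof (rule finite_length_extension[OF assms(1-3) _ assms(5)])
  interpret V: right_module R V by (rule assms)
  show "finite_length R (V\<lparr>carrier := a_kernel V W f\<rparr>)"
    unfolding inj_kernel[OF assms(1-4)] using V.restrict_carrier[OF V.submodule_zero]
    by (intro finite_length_trivial) auto
qed

lemma len_bij:
  assumes "right_module R V" "right_module R W" "f \<in> mod_hom R V W" "bij_betw f (carrier V) (carrier W)"
    and "finite_length R V"
  shows "len R V = len R W"
proof -
  interpret V: right_module R V by (rule assms)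
  have "inj_on f (carrier V)" "f ` carrier V = carrier W" using assms(4) by (auto simp: bij_betw_def)
  moreover have "len R (V\<lparr>carrier := {\<zero>\<^bsub>V\<^esub>}\<rparr>) = 0"
    using V.restrict_carrier[OF V.submodule_zero] by (intro finite_length_trivial) auto
  ultimately show ?thesis using len_exact[OF assms(1-3) _ assms(5)] inj_kernel[OF assms(1-3)] by simp
qed

text \<open>Generation is phrased by submodules instead of linear combinations; in this form it
  passes through homomorphisms and restriction of scalars without any sums.\<close>

definition generates :: "('a, 'r) ring_scheme \<Rightarrow> ('a, 'm, 's) module_scheme \<Rightarrow> 'm set \<Rightarrow> bool" where
  "generates R V G \<longleftrightarrow> G \<subseteq> carrier V \<and> (\<forall>U. submodule U R V \<longrightarrow> G \<subseteq> U \<longrightarrow> U = carrier V)"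

lemma (in right_module) submodule_finsum:
  assumes "submodule U A M" "finite G" "h \<in> G \<rightarrow> U"
  shows "finsum M h G \<in> U"
  using assms(2,3)
proof (induction G)
  case empty
  then show ?case using assms(1) by (simp add: submodule_iff)
next
  case (insert x F)
  have "U \<subseteq> carrier M" using assms(1) by (simp add: submodule_iff)
  then have "h \<in> F \<rightarrow> carrier M" "h x \<in> carrier M" using insert.prems by auto
  then show ?case using insert assms(1) by (auto simp: submodule_iff)
qed

lemma finitely_generated_iff:
  assumes M: "right_module A M"
  shows "finitely_generated A M \<longleftrightarrow> (\<exists>G. finite G \<and> generates A M G)"
proof
  interpret right_module A M by (rule M)
  assume "finitely_generated A M"
  then obtain G where G: "finite G" "G \<subseteq> carrier M"
    "\<And>x. x \<in> carrier M \<Longrightarrow> \<exists>c \<in> G \<rightarrow> carrier A. x = (\<Oplus>\<^bsub>M\<^esub> g \<in> G. c g \<odot>\<^bsub>M\<^esub> g)"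
    by (auto simp: finitely_generated_def)
  have "U = carrier M" if "submodule U A M" "G \<subseteq> U" for U
  proof -
    have "x \<in> U" if x: "x \<in> carrier M" for x
    proof -
      obtain c where c: "c \<in> G \<rightarrow> carrier A" "x = (\<Oplus>\<^bsub>M\<^esub> g \<in> G. c g \<odot>\<^bsub>M\<^esub> g)" using G(3)[OF x] by auto
      have "(\<lambda>g. c g \<odot>\<^bsub>M\<^esub> g) \<in> G \<rightarrow> U" using c(1) \<open>submodule U A M\<close> \<open>G \<subseteq> U\<close> by (auto simp: submodule_iff Pi_iff subset_iff)
      then show ?thesis unfolding c(2) by (rule submodule_finsum[OF \<open>submodule U A M\<close> G(1)])
    qed
    then show ?thesis using that by (auto simp: submodule_iff)
  qed
  then show "\<exists>G. finite G \<and> generates A M G" using G by (auto simp: generates_def)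
next
  interpret right_module A M by (rule M)
  assume "\<exists>G. finite G \<and> generates A M G"
  then obtain G where G: "finite G" "G \<subseteq> carrier M" "\<And>U. submodule U A M \<Longrightarrow> G \<subseteq> U \<Longrightarrow> U = carrier M"
    by (auto simp: generates_def)
  define S where "S c = (\<Oplus>\<^bsub>M\<^esub> g \<in> G. c g \<odot>\<^bsub>M\<^esub> g)" for c
  \<comment> \<open>The linear combinations of \<open>G\<close> form a submodule that contains
    \<open>G\<close>, so they exhaust \<open>M\<close>.\<close>
  define U where "U = S ` (G \<rightarrow> carrier A)"
  have gc: "g \<in> carrier M" if "g \<in> G" for g using G(2) that by auto
  have cl: "(\<lambda>g. c g \<odot>\<^bsub>M\<^esub> g) \<in> G \<rightarrow> carrier M" if "c \<in> G \<rightarrow> carrier A" for c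
    using that gc by (auto intro!: act_closed)
  have add: "S c \<oplus>\<^bsub>M\<^esub> S d = S (\<lambda>g. c g \<oplus>\<^bsub>A\<^esub> d g)" if "c \<in> G \<rightarrow> carrier A" "d \<in> G \<rightarrow> carrier A" for c d
    unfolding S_def M.finsum_addf[OF cl[OF that(1)] cl[OF that(2)], symmetric]
  proof (rule M.finsum_cong')
    show "c g \<odot>\<^bsub>M\<^esub> g \<oplus>\<^bsub>M\<^esub> d g \<odot>\<^bsub>M\<^esub> g = (c g \<oplus>\<^bsub>A\<^esub> d g) \<odot>\<^bsub>M\<^esub> g" if "g \<in> G" for g
      using that gc \<open>c \<in> _\<close> \<open>d \<in> _\<close> by (subst act_add_scalar) auto
  qed (use that gc in \<open>auto intro!: act_closed\<close>)
  \<comment> \<open>The modules are right modules, so \<open>a\<close> multiplies the coefficients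
    from the right.\<close>
  have act: "a \<odot>\<^bsub>M\<^esub> S c = S (\<lambda>g. c g \<otimes>\<^bsub>A\<^esub> a)" if a: "a \<in> carrier A" and c: "c \<in> G \<rightarrow> carrier A" for a c
  proof -
    have "(\<lambda>x. a \<odot>\<^bsub>M\<^esub> x) \<in> hom (add_monoid M) (add_monoid M)"
      using a by (auto simp: hom_def act_closed act_add)
    then have "abelian_group_hom M M (\<lambda>x. a \<odot>\<^bsub>M\<^esub> x)"
      by (intro abelian_group_hom.intro M.abelian_group_axioms abelian_group_hom_axioms.intro
        group_hom.intro M.a_group group_hom_axioms.intro)
    then interpret h: abelian_group_hom M M "\<lambda>x. a \<odot>\<^bsub>M\<^esub> x" .
    have "a \<odot>\<^bsub>M\<^esub> finsum M h F = finsum M (\<lambda>g. a \<odot>\<^bsub>M\<^esub> h g) F"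
      if "finite F" "h \<in> F \<rightarrow> carrier M" for F h
      using that
    proof (induction F)
      case (insert x F)
      then have "h x \<in> carrier M" "h \<in> F \<rightarrow> carrier M" by auto
      moreover have "(\<lambda>g. a \<odot>\<^bsub>M\<^esub> h g) \<in> F \<rightarrow> carrier M" using insert.prems a by (auto intro!: act_closed)
      ultimately show ?case using insert a by (simp add: act_add act_closed)
    qed (use a in \<open>simp add: act_zero\<close>)
    from this[OF G(1) cl[OF c]] have "a \<odot>\<^bsub>M\<^esub> S c = (\<Oplus>\<^bsub>M\<^esub> g \<in> G. a \<odot>\<^bsub>M\<^esub> (c g \<odot>\<^bsub>M\<^esub> g))" by (simp add: S_def)
    also have "\<dots> = S (\<lambda>g. c g \<otimes>\<^bsub>A\<^esub> a)" unfolding S_def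
    proof (rule M.finsum_cong')
      show "a \<odot>\<^bsub>M\<^esub> (c g \<odot>\<^bsub>M\<^esub> g) = (c g \<otimes>\<^bsub>A\<^esub> a) \<odot>\<^bsub>M\<^esub> g" if "g \<in> G" for g
        using that gc a c by (subst act_assoc) auto
    qed (use a c gc in \<open>auto intro!: act_closed\<close>)
    finally show ?thesis .
  qed
  have z: "S (\<lambda>_. \<zero>\<^bsub>A\<^esub>) = \<zero>\<^bsub>M\<^esub>"
  proof -
    have "S (\<lambda>_. \<zero>\<^bsub>A\<^esub>) = (\<Oplus>\<^bsub>M\<^esub> g \<in> G. \<zero>\<^bsub>M\<^esub>)" unfolding S_def
      using gc by (intro M.finsum_cong') (auto simp: zero_act)
    then show ?thesis by simp
  qed
  have "submodule U A M" unfolding submodule_iff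
  proof (intro conjI ballI)
    show "U \<subseteq> carrier M" unfolding U_def S_def using cl by (auto intro!: M.finsum_closed)
    show "\<zero>\<^bsub>M\<^esub> \<in> U" unfolding U_def z[symmetric] by (intro imageI) auto
    show "x \<oplus>\<^bsub>M\<^esub> y \<in> U" if xy: "x \<in> U" "y \<in> U" for x y
    proof -
      obtain c d where "c \<in> G \<rightarrow> carrier A" "d \<in> G \<rightarrow> carrier A" "x = S c" "y = S d"
        using xy by (auto simp: U_def)
      then show ?thesis unfolding U_def using add
        by (intro image_eqI[of _ _ "\<lambda>g. c g \<oplus>\<^bsub>A\<^esub> d g"]) auto
    qed
    show "a \<odot>\<^bsub>M\<^esub> x \<in> U" if ax: "a \<in> carrier A" "x \<in> U" for a x
    proof -
      obtain c where "c \<in> G \<rightarrow> carrier A" "x = S c" using ax by (auto simp: U_def)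
      then show ?thesis unfolding U_def using act ax(1)
        by (intro image_eqI[of _ _ "\<lambda>g. c g \<otimes>\<^bsub>A\<^esub> a"]) auto
    qed
  qed
  moreover have "G \<subseteq> U"
  proof
    fix x assume x: "x \<in> G"
    have "S (\<lambda>g. if g = x then \<one>\<^bsub>A\<^esub> else \<zero>\<^bsub>A\<^esub>) = (\<Oplus>\<^bsub>M\<^esub> g \<in> G. if x = g then g else \<zero>\<^bsub>M\<^esub>)"
      unfolding S_def using gc by (intro M.finsum_cong') (auto simp: zero_act act_one)
    also have "\<dots> = x" using x G(1) gc by (intro M.finsum_singleton) auto
    finally show "x \<in> U" unfolding U_def by (intro image_eqI[of _ _ "\<lambda>g. if g = x then \<one>\<^bsub>A\<^esub> else \<zero>\<^bsub>A\<^esub>"]) auto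
  qed
  ultimately have "U = carrier M" by (rule G(3))
  then have "\<forall>x\<in>carrier M. \<exists>c\<in>G \<rightarrow> carrier A. x = S c" by (auto simp: U_def)
  then show "finitely_generated A M" using G(1,2)
    unfolding finitely_generated_def S_def by (intro exI[of _ G]) simp
qed

text \<open>Among the spans of finite sets choose one with the largest value of \<open>g\<close>. If
  a proper submodule contained the set, an element outside it would give a strictly larger
  span.\<close>

lemma finite_length_imp_fg:
  assumes M: "right_module A M" and fin: "finite_length A M"
  shows "finitely_generated A M"
proof -
  interpret right_module A M by (rule M)
  obtain g where g: "strictly_monotone A M g" using fin by (auto simp: finite_length_def)
  define spn where "spn G = \<Inter>{U. submodule U A M \<and> G \<subseteq> U}" for G
  have hs: "submodule (spn G) A M" if "G \<subseteq> carrier M" for G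
    unfolding spn_def by (rule submodule_Inter) (use that submodule_carrier in auto)
  have hG: "G \<subseteq> spn G" for G by (auto simp: spn_def)
  have least: "spn G \<subseteq> U" if "submodule U A M" "G \<subseteq> U" for G U using that by (auto simp: spn_def)
  let ?P = "\<lambda>G. finite G \<and> G \<subseteq> carrier M"
  have bound: "g (spn G) \<le> g (carrier M)" if "?P G" for G
    using that hs[of G] submodule_iff by (intro strictly_monotone_mono[OF g _ submodule_carrier]) auto
  have "\<exists>G. ?P G \<and> (\<forall>F. ?P F \<longrightarrow> g (spn F) \<le> g (spn G))"
    by (rule ex_has_greatest_nat[of ?P "{}" _ "Suc (g (carrier M))"]) (use bound in \<open>auto simp: less_Suc_eq_le\<close>)
  then obtain G where G: "?P G" "\<And>F. ?P F \<Longrightarrow> g (spn F) \<le> g (spn G)"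
    by auto
  have "generates A M G" unfolding generates_def
  proof (intro conjI allI impI)
    fix U assume U: "submodule U A M" "G \<subseteq> U"
    show "U = carrier M"
    proof (rule ccontr)
      assume "U \<noteq> carrier M"
      then obtain x where x: "x \<in> carrier M" "x \<notin> U" using U by (auto simp: submodule_iff)
      then have "x \<notin> spn G" using least[OF U] by auto
      then have "spn G \<subset> spn (insert x G)"
        using hG[of "insert x G"] x G(1) least[OF hs[of "insert x G"], of G] by auto
      then have "g (spn G) < g (spn (insert x G))"
        using G(1) x by (intro strictly_monotoneD[OF g hs hs]) auto
      then show False using G(2)[of "insert x G"] G(1) x by auto
    qed
  qed (use G in auto)
  then show ?thesis using G(1) finitely_generated_iff[OF M] by blast
qed

text \<open>Generators are adjoined one at a time. Over a field a further generator raises the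
  length by at most one, which replaces any argument with bases.\<close>

lemma finite_length_field:
  assumes F: "field F" and V: "right_module F V" and fg: "finitely_generated F V"
  shows "finite_length F V"
proof -
  interpret F: field F by (rule F)
  interpret V: right_module F V by (rule V)
  have key: "\<exists>S. submodule S F V \<and> G \<subseteq> S \<and> finite_length F (V\<lparr>carrier := S\<rparr>)"
    if "finite G" "G \<subseteq> carrier V" for G
    using that
  proof (induction G)
    case empty
    show ?case using V.submodule_zero V.restrict_carrier[OF V.submodule_zero]
      by (intro exI[of _ "{\<zero>\<^bsub>V\<^esub>}"]) (auto intro: finite_length_trivial)
  next
    case (insert x G)
    then obtain S g where S: "submodule S F V" "G \<subseteq> S" and g: "strictly_monotone F (V\<lparr>carrier := S\<rparr>) g"
      by (auto simp: finite_length_def)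
    have x: "x \<in> carrier V" using insert by auto
    have Ss: "S \<subseteq> carrier V" "\<zero>\<^bsub>V\<^esub> \<in> S" "\<And>y z. y \<in> S \<Longrightarrow> z \<in> S \<Longrightarrow> y \<oplus>\<^bsub>V\<^esub> z \<in> S"
      "\<And>c y. c \<in> carrier F \<Longrightarrow> y \<in> S \<Longrightarrow> c \<odot>\<^bsub>V\<^esub> y \<in> S" using S(1) by (auto simp: V.submodule_iff)
    define T where "T = {s \<oplus>\<^bsub>V\<^esub> c \<odot>\<^bsub>V\<^esub> x | s c. s \<in> S \<and> c \<in> carrier F}"
    have T: "submodule T F V" unfolding V.submodule_iff
    proof (intro conjI ballI)
      show "T \<subseteq> carrier V" using Ss x by (auto simp: T_def V.act_closed)
      show "\<zero>\<^bsub>V\<^esub> \<in> T" using Ss x V.zero_act[OF x] by (force simp: T_def)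
      show "y \<oplus>\<^bsub>V\<^esub> z \<in> T" if yz: "y \<in> T" "z \<in> T" for y z
      proof -
        obtain s c t d where *: "s \<in> S" "c \<in> carrier F" "t \<in> S" "d \<in> carrier F"
          "y = s \<oplus>\<^bsub>V\<^esub> c \<odot>\<^bsub>V\<^esub> x" "z = t \<oplus>\<^bsub>V\<^esub> d \<odot>\<^bsub>V\<^esub> x" using yz by (auto simp: T_def)
        then have "y \<oplus>\<^bsub>V\<^esub> z = (s \<oplus>\<^bsub>V\<^esub> t) \<oplus>\<^bsub>V\<^esub> (c \<oplus>\<^bsub>F\<^esub> d) \<odot>\<^bsub>V\<^esub> x"
          using x Ss(1) by (simp add: V.act_add_scalar V.act_closed V.M.a_ac subset_iff)
        then show ?thesis using * Ss(3) by (auto simp: T_def)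
      qed
      show "d \<odot>\<^bsub>V\<^esub> y \<in> T" if dy: "d \<in> carrier F" "y \<in> T" for d y
      proof -
        obtain s c where *: "s \<in> S" "c \<in> carrier F" "y = s \<oplus>\<^bsub>V\<^esub> c \<odot>\<^bsub>V\<^esub> x" using dy by (auto simp: T_def)
        then have "d \<odot>\<^bsub>V\<^esub> y = d \<odot>\<^bsub>V\<^esub> s \<oplus>\<^bsub>V\<^esub> (c \<otimes>\<^bsub>F\<^esub> d) \<odot>\<^bsub>V\<^esub> x"
          using x Ss(1) dy(1) by (simp add: V.act_add V.act_assoc V.act_closed subset_iff)
        then show ?thesis using * dy(1) Ss(4) by (auto simp: T_def)
      qed
    qed
    have "S \<subseteq> T"
    proof
      fix s assume s: "s \<in> S"
      then have "s = s \<oplus>\<^bsub>V\<^esub> \<zero>\<^bsub>F\<^esub> \<odot>\<^bsub>V\<^esub> x" using x Ss(1) by (auto simp: V.zero_act)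
      then show "s \<in> T" using s by (auto simp: T_def)
    qed
    moreover have "x \<in> T"
    proof -
      have "x = \<zero>\<^bsub>V\<^esub> \<oplus>\<^bsub>V\<^esub> \<one>\<^bsub>F\<^esub> \<odot>\<^bsub>V\<^esub> x" using x by (auto simp: V.act_one)
      then show ?thesis unfolding T_def using Ss(2) by blast
    qed
    ultimately have GT: "insert x G \<subseteq> T" using S(2) by auto
    \<comment> \<open>The additional unit records whether \<open>U\<close> leaves \<open>S\<close>;
      since \<open>T\<close> is \<open>S\<close> plus the line of \<open>x\<close>, the quotient of
      \<open>U\<close> by its part in \<open>S\<close> has dimension at most one.\<close>
    define h where "h U = g (U \<inter> S) + (if U \<subseteq> S then 0 else 1::nat)" for U
    have "strictly_monotone F (V\<lparr>carrier := T\<rparr>) h" unfolding strictly_monotone_def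
    proof (intro allI impI)
      fix U U' assume "submodule U F (V\<lparr>carrier := T\<rparr>)" "submodule U' F (V\<lparr>carrier := T\<rparr>)" and lt: "U \<subset> U'"
      then have U: "submodule U F V" "U \<subseteq> T" and U': "submodule U' F V" "U' \<subseteq> T"
        by (auto simp: V.submodule_restrict[OF T])
      have 1: "submodule (U \<inter> S) F (V\<lparr>carrier := S\<rparr>)" "submodule (U' \<inter> S) F (V\<lparr>carrier := S\<rparr>)"
        using U U' S by (auto simp: V.submodule_restrict V.submodule_Int)
      have le: "g (U \<inter> S) \<le> g (U' \<inter> S)" using lt by (intro strictly_monotone_mono[OF g 1]) auto
      show "h U < h U'"
      proof (cases "U \<inter> S \<subset> U' \<inter> S")
        case True
        from strictly_monotoneD[OF g 1 True] lt show ?thesis by (auto simp: h_def)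
      next
        case False
        then have eq: "U \<inter> S = U' \<inter> S" using lt by auto
        have "U \<subseteq> S"
        proof (rule ccontr)
          assume "\<not> U \<subseteq> S"
          then obtain u where u: "u \<in> U" "u \<notin> S" by auto
          then obtain s c where sc: "s \<in> S" "c \<in> carrier F" "u = s \<oplus>\<^bsub>V\<^esub> c \<odot>\<^bsub>V\<^esub> x" using U by (auto simp: T_def)
          have c0: "c \<noteq> \<zero>\<^bsub>F\<^esub>" using u sc Ss(1) x by (auto simp: V.zero_act)
          then have ci: "inv\<^bsub>F\<^esub> c \<in> carrier F" "c \<otimes>\<^bsub>F\<^esub> inv\<^bsub>F\<^esub> c = \<one>\<^bsub>F\<^esub>"
            using sc F.field_Units by (auto simp: F.Units_inv_closed)
          \<comment> \<open>Dividing by the coefficient \<open>c\<close> of \<open>u\<close>, a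
            multiple of \<open>u\<close> cancels the \<open>x\<close>-part of \<open>y\<close>. The
            difference lies in \<open>S\<close> and in \<open>U'\<close>, and there \<open>U\<close>
            and \<open>U'\<close> agree.\<close>
          have "U' \<subseteq> U"
          proof
            fix y assume y: "y \<in> U'"
            then obtain t d where td: "t \<in> S" "d \<in> carrier F" "y = t \<oplus>\<^bsub>V\<^esub> d \<odot>\<^bsub>V\<^esub> x" using U' by (auto simp: T_def)
            let ?e = "inv\<^bsub>F\<^esub> c \<otimes>\<^bsub>F\<^esub> d"
            have e: "?e \<in> carrier F" "c \<otimes>\<^bsub>F\<^esub> ?e = d"
              using ci sc td by (auto simp: F.m_assoc[symmetric])
            have c1: "s \<in> carrier V" "t \<in> carrier V" using sc td Ss(1) by auto
            have eu: "?e \<odot>\<^bsub>V\<^esub> u \<in> U" using U(1) u(1) e(1) by (auto simp: V.submodule_iff)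
            have "?e \<odot>\<^bsub>V\<^esub> u = ?e \<odot>\<^bsub>V\<^esub> s \<oplus>\<^bsub>V\<^esub> d \<odot>\<^bsub>V\<^esub> x"
              using sc e c1 x by (simp add: V.act_add V.act_closed V.act_assoc[symmetric])
            then have "y \<ominus>\<^bsub>V\<^esub> ?e \<odot>\<^bsub>V\<^esub> u = t \<ominus>\<^bsub>V\<^esub> ?e \<odot>\<^bsub>V\<^esub> s"
              using td c1 x e by (simp add: V.M.add_diff_add V.act_closed)
            moreover have "t \<ominus>\<^bsub>V\<^esub> ?e \<odot>\<^bsub>V\<^esub> s \<in> S" using V.submodule_diff[OF S(1)] td sc Ss(4) e by auto
            moreover have "y \<ominus>\<^bsub>V\<^esub> ?e \<odot>\<^bsub>V\<^esub> u \<in> U'" using V.submodule_diff[OF U'(1) y] eu lt by auto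
            ultimately have "y \<ominus>\<^bsub>V\<^esub> ?e \<odot>\<^bsub>V\<^esub> u \<in> U" using eq by auto
            then have "(y \<ominus>\<^bsub>V\<^esub> ?e \<odot>\<^bsub>V\<^esub> u) \<oplus>\<^bsub>V\<^esub> ?e \<odot>\<^bsub>V\<^esub> u \<in> U" using eu U(1) by (auto simp: V.submodule_iff)
            moreover have "y \<in> carrier V" "?e \<odot>\<^bsub>V\<^esub> u \<in> carrier V" using y eu U(1) U'(1) by (auto simp: V.submodule_iff)
            ultimately show "y \<in> U" by (simp add: a_minus_def V.M.a_assoc V.M.l_neg)
          qed
          then show False using lt by auto
        qed
        then have "\<not> U' \<subseteq> S" using eq lt by auto
        then show ?thesis using \<open>U \<subseteq> S\<close> le by (auto simp: h_def)
      qed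
    qed
    then show ?case using T GT by (auto simp: finite_length_def)
  qed
  obtain G where G: "finite G" "generates F V G" using fg finitely_generated_iff[OF V] by blast
  then have "G \<subseteq> carrier V" by (simp add: generates_def)
  from key[OF G(1) this] obtain S where S: "submodule S F V" "G \<subseteq> S" "finite_length F (V\<lparr>carrier := S\<rparr>)"
    by blast
  then have "S = carrier V" using G by (auto simp: generates_def)
  moreover have "submodule U F (V\<lparr>carrier := carrier V\<rparr>) \<longleftrightarrow> submodule U F V" for U
    unfolding V.submodule_restrict[OF V.submodule_carrier] by (auto simp: V.submodule_iff)
  ultimately show ?thesis using S(3) by (simp add: finite_length_def strictly_monotone_def)
qed

section \<open>Direct sums\<close>

lemma fg_modulesD: "M \<in> fg_modules A \<Longrightarrow> right_module A M" "M \<in> fg_modules A \<Longrightarrow> finitely_generated A M"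
  by (auto simp: fg_modules_def)

text \<open>The record \<open>direct_sum\<close> lives on a type of pairs and cannot belong to
  \<open>fg_modules A\<close>; describing a sum by its two projections keeps all modules on one
  type.\<close>

definition is_dsum where
  "is_dsum A D U V p q \<longleftrightarrow> p \<in> mod_hom A D U \<and> q \<in> mod_hom A D V \<and>
    bij_betw (\<lambda>x. (p x, q x)) (carrier D) (carrier U \<times> carrier V)"

text \<open>Split monomorphisms compose without naming complements. They describe exactly the direct
  summands, by \<open>direct_summand_iff\<close>.\<close>

definition retract where
  "retract A N M \<longleftrightarrow> N \<in> fg_modules A \<and>
    (\<exists>i \<in> mod_hom A N M. \<exists>r \<in> mod_hom A M N. \<forall>x \<in> carrier N. r (i x) = x)"

lemma direct_sum_simps:
  "carrier (direct_sum M N) = carrier M \<times> carrier N"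
  "\<zero>\<^bsub>direct_sum M N\<^esub> = (\<zero>\<^bsub>M\<^esub>, \<zero>\<^bsub>N\<^esub>)"
  "(x, y) \<oplus>\<^bsub>direct_sum M N\<^esub> (x', y') = (x \<oplus>\<^bsub>M\<^esub> x', y \<oplus>\<^bsub>N\<^esub> y')"
  "a \<odot>\<^bsub>direct_sum M N\<^esub> (x, y) = (a \<odot>\<^bsub>M\<^esub> x, a \<odot>\<^bsub>N\<^esub> y)"
  by (simp_all add: direct_sum_def RDirProd_def DirProd_def monoid.defs ring.defs)

lemma right_module_direct_sum:
  assumes "right_module A M" "right_module A N"
  shows "right_module A (direct_sum M N)"
proof -
  interpret M: right_module A M by (rule assms)
  interpret N: right_module A N by (rule assms)
  have ab: "abelian_group (direct_sum M N)"
  proof (rule abelian_groupI)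
    fix x assume "x \<in> carrier (direct_sum M N)"
    then obtain u v where "x = (u, v)" "u \<in> carrier M" "v \<in> carrier N" by (auto simp: direct_sum_simps)
    then show "\<exists>y\<in>carrier (direct_sum M N). y \<oplus>\<^bsub>direct_sum M N\<^esub> x = \<zero>\<^bsub>direct_sum M N\<^esub>"
      by (intro bexI[of _ "(\<ominus>\<^bsub>M\<^esub> u, \<ominus>\<^bsub>N\<^esub> v)"]) (auto simp: direct_sum_simps M.M.l_neg N.M.l_neg)
  qed (auto simp: direct_sum_simps M.M.a_ac N.M.a_ac)
  show ?thesis
    by (intro right_module.intro M.A.ring_axioms ab right_module_axioms.intro)
      (auto simp: direct_sum_simps M.act_closed N.act_closed M.act_add N.act_add
        M.act_add_scalar N.act_add_scalar M.act_assoc N.act_assoc M.act_one N.act_one)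
qed

lemma finite_length_direct_sum:
  assumes M: "right_module A M" "finite_length A M" and N: "right_module A N" "finite_length A N"
  shows "finite_length A (direct_sum M N)"
proof -
  let ?D = "direct_sum M N"
  note D = right_module_direct_sum[OF M(1) N(1)]
  interpret M: right_module A M by (rule M)
  interpret D: right_module A ?D by (rule D)
  have f: "fst \<in> mod_hom A ?D M" and s: "snd \<in> mod_hom A ?D N"
    by (auto simp: mod_hom_iff direct_sum_simps)
  let ?k = "a_kernel ?D M fst"
  have k: "submodule ?k A ?D" by (rule submodule_kernel[OF D M(1) f])
  have "snd \<in> mod_hom A (?D\<lparr>carrier := ?k\<rparr>) N" using s by (auto simp: mod_hom_iff a_kernel_def')
  then have "finite_length A (?D\<lparr>carrier := ?k\<rparr>)"
    by (rule finite_length_inj[OF D.restrict_carrier[OF k] N(1) _ _ N(2)])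
      (auto simp: inj_on_def a_kernel_def' direct_sum_simps)
  then show ?thesis by (rule finite_length_extension[OF D M(1) f _ M(2)])
qed

lemma mod_isomorphic_direct_sum_iff:
  "mod_isomorphic A D (direct_sum U V) \<longleftrightarrow> (\<exists>p q. is_dsum A D U V p q)"
proof
  assume "mod_isomorphic A D (direct_sum U V)"
  then obtain f where f: "f \<in> mod_hom A D (direct_sum U V)" "bij_betw f (carrier D) (carrier U \<times> carrier V)"
    by (auto simp: mod_isomorphic_def direct_sum_simps)
  have "fst (f x) \<in> carrier U \<and> snd (f x) \<in> carrier V" if "x \<in> carrier D" for x
    using mod_hom_closed[OF f(1) that] by (auto simp: direct_sum_simps)
  moreover have "f (x \<oplus>\<^bsub>D\<^esub> y) = (fst (f x) \<oplus>\<^bsub>U\<^esub> fst (f y), snd (f x) \<oplus>\<^bsub>V\<^esub> snd (f y))"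
    if "x \<in> carrier D" "y \<in> carrier D" for x y
    using mod_hom_add[OF f(1) that] by (metis direct_sum_simps(3) prod.collapse)
  moreover have "f (a \<odot>\<^bsub>D\<^esub> x) = (a \<odot>\<^bsub>U\<^esub> fst (f x), a \<odot>\<^bsub>V\<^esub> snd (f x))"
    if "a \<in> carrier A" "x \<in> carrier D" for x a
    using mod_hom_act[OF f(1) that] by (metis direct_sum_simps(4) prod.collapse)
  ultimately have "is_dsum A D U V (\<lambda>x. fst (f x)) (\<lambda>x. snd (f x))"
    using f(2) by (auto simp: is_dsum_def mod_hom_iff)
  then show "\<exists>p q. is_dsum A D U V p q" by blast
next
  assume "\<exists>p q. is_dsum A D U V p q"
  then obtain p q where "is_dsum A D U V p q" by blast
  then show "mod_isomorphic A D (direct_sum U V)" unfolding mod_isomorphic_def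
    by (intro bexI[of _ "\<lambda>x. (p x, q x)"]) (auto simp: is_dsum_def mod_hom_iff direct_sum_simps)
qed

lemma is_dsumI:
  assumes D: "right_module A D" and U: "right_module A U" and V: "right_module A V"
    and p: "p \<in> mod_hom A D U" and q: "q \<in> mod_hom A D V"
    and inj: "\<And>x. x \<in> carrier D \<Longrightarrow> p x = \<zero>\<^bsub>U\<^esub> \<Longrightarrow> q x = \<zero>\<^bsub>V\<^esub> \<Longrightarrow> x = \<zero>\<^bsub>D\<^esub>"
    and surj: "\<And>u v. u \<in> carrier U \<Longrightarrow> v \<in> carrier V \<Longrightarrow> \<exists>x\<in>carrier D. p x = u \<and> q x = v"
  shows "is_dsum A D U V p q"
proof -
  have "(\<lambda>x. (p x, q x)) \<in> mod_hom A D (direct_sum U V)"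
    using p q by (auto simp: mod_hom_iff direct_sum_simps)
  from mod_hom_inj_iff[OF D right_module_direct_sum[OF U V] this]
  have "inj_on (\<lambda>x. (p x, q x)) (carrier D)" using inj by (auto simp: direct_sum_simps)
  moreover have "(\<lambda>x. (p x, q x)) ` carrier D = carrier U \<times> carrier V"
    using mod_hom_closed[OF p] mod_hom_closed[OF q] surj by (auto simp: image_iff) metis
  ultimately show ?thesis using p q by (simp add: is_dsum_def bij_betw_def)
qed

lemma is_dsumE:
  assumes "is_dsum A D U V p q"
  shows "p \<in> mod_hom A D U" "q \<in> mod_hom A D V"
    and "\<And>x y. x \<in> carrier D \<Longrightarrow> y \<in> carrier D \<Longrightarrow> p x = p y \<Longrightarrow> q x = q y \<Longrightarrow> x = y"
    and "\<And>u v. u \<in> carrier U \<Longrightarrow> v \<in> carrier V \<Longrightarrow> \<exists>x\<in>carrier D. p x = u \<and> q x = v"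
proof -
  have bij: "bij_betw (\<lambda>x. (p x, q x)) (carrier D) (carrier U \<times> carrier V)"
    and "p \<in> mod_hom A D U" "q \<in> mod_hom A D V" using assms by (auto simp: is_dsum_def)
  then show "p \<in> mod_hom A D U" "q \<in> mod_hom A D V" by auto
  show "x = y" if "x \<in> carrier D" "y \<in> carrier D" "p x = p y" "q x = q y" for x y
    using bij that unfolding bij_betw_def inj_on_def by auto
  show "\<exists>x\<in>carrier D. p x = u \<and> q x = v" if "u \<in> carrier U" "v \<in> carrier V" for u v
  proof -
    have "(u, v) \<in> (\<lambda>x. (p x, q x)) ` carrier D" using bij that by (simp add: bij_betw_def)
    then show ?thesis by auto
  qed
qed

lemma is_dsum_swap: "is_dsum A D U V p q \<Longrightarrow> is_dsum A D V U q p"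
proof -
  assume d: "is_dsum A D U V p q"
  have "bij_betw (prod.swap \<circ> (\<lambda>x. (p x, q x))) (carrier D) (carrier V \<times> carrier U)"
    by (rule bij_betw_trans[of _ _ "carrier U \<times> carrier V"])
      (use d in \<open>auto simp: is_dsum_def bij_betw_def inj_on_def\<close>)
  then show ?thesis using d by (simp add: is_dsum_def comp_def)
qed

lemma is_dsum_pair:
  assumes D: "right_module A D" and d: "is_dsum A D U V p q"
    and f: "f \<in> mod_hom A L U" and g: "g \<in> mod_hom A L V"
  obtains h where "h \<in> mod_hom A L D"
    "\<And>x. x \<in> carrier L \<Longrightarrow> p (h x) = f x" "\<And>x. x \<in> carrier L \<Longrightarrow> q (h x) = g x"
proof -
  let ?f = "\<lambda>x. (p x, q x)"
  have bij: "bij_betw ?f (carrier D) (carrier (direct_sum U V))"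
    using d by (simp add: is_dsum_def direct_sum_simps)
  have hom: "?f \<in> mod_hom A D (direct_sum U V)"
    using d by (auto simp: is_dsum_def mod_hom_iff direct_sum_simps)
  have fg: "(\<lambda>x. (f x, g x)) \<in> mod_hom A L (direct_sum U V)"
    using f g by (auto simp: mod_hom_iff direct_sum_simps)
  let ?h = "\<lambda>x. inv_into (carrier D) ?f (f x, g x)"
  have "?f (?h x) = (f x, g x)" if "x \<in> carrier L" for x
    using bij mod_hom_closed[OF fg that] by (intro f_inv_into_f) (simp add: bij_betw_def)
  then show thesis
    using that[of ?h, OF mod_hom_comp[OF fg mod_hom_inv[OF D hom bij]]] by auto
qed

lemma is_dsum_injections:
  assumes D: "right_module A D" and U: "right_module A U" and V: "right_module A V"
    and d: "is_dsum A D U V p q"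
  obtains i j where "i \<in> mod_hom A U D" "j \<in> mod_hom A V D"
    "\<And>x. x \<in> carrier U \<Longrightarrow> p (i x) = x" "\<And>x. x \<in> carrier U \<Longrightarrow> q (i x) = \<zero>\<^bsub>V\<^esub>"
    "\<And>x. x \<in> carrier V \<Longrightarrow> q (j x) = x" "\<And>x. x \<in> carrier V \<Longrightarrow> p (j x) = \<zero>\<^bsub>U\<^esub>"
    "\<And>x. x \<in> carrier D \<Longrightarrow> i (p x) \<oplus>\<^bsub>D\<^esub> j (q x) = x"
proof -
  interpret D: right_module A D by (rule D)
  interpret U: right_module A U by (rule U)
  interpret V: right_module A V by (rule V)
  note E = is_dsumE[OF d]
  obtain i where i: "i \<in> mod_hom A U D" "\<And>x. x \<in> carrier U \<Longrightarrow> p (i x) = x"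
    "\<And>x. x \<in> carrier U \<Longrightarrow> q (i x) = \<zero>\<^bsub>V\<^esub>"
    using is_dsum_pair[OF D d mod_hom_id mod_hom_zero_map[OF U V]] by auto
  obtain j where j: "j \<in> mod_hom A V D" "\<And>x. x \<in> carrier V \<Longrightarrow> p (j x) = \<zero>\<^bsub>U\<^esub>"
    "\<And>x. x \<in> carrier V \<Longrightarrow> q (j x) = x"
    using is_dsum_pair[OF D d mod_hom_zero_map[OF V U] mod_hom_id] by auto
  have "i (p x) \<oplus>\<^bsub>D\<^esub> j (q x) = x" if x: "x \<in> carrier D" for x
  proof (rule E(3))
    have c: "p x \<in> carrier U" "q x \<in> carrier V" using x E(1,2) by (auto simp: mod_hom_iff)
    then have c': "i (p x) \<in> carrier D" "j (q x) \<in> carrier D" using i j by (auto simp: mod_hom_iff)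
    then show "i (p x) \<oplus>\<^bsub>D\<^esub> j (q x) \<in> carrier D" by simp
    show "p (i (p x) \<oplus>\<^bsub>D\<^esub> j (q x)) = p x" "q (i (p x) \<oplus>\<^bsub>D\<^esub> j (q x)) = q x"
      using c c' i j by (simp_all add: mod_hom_add[OF E(1)] mod_hom_add[OF E(2)])
  qed (rule x)
  then show thesis using that i j by blast
qed

text \<open>Splitting lemma: a preimage of \<open>v\<close> under \<open>q\<close> is corrected by
  an element of the image of \<open>i\<close>, which \<open>q\<close> kills, until \<open>r\<close>
  takes the prescribed value.\<close>

lemma split_is_dsum:
  assumes D: "right_module A D" and U: "right_module A U" and C: "right_module A C"
    and i: "i \<in> mod_hom A U D" and r: "r \<in> mod_hom A D U" and ri: "\<And>x. x \<in> carrier U \<Longrightarrow> r (i x) = x"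
    and q: "q \<in> mod_hom A D C" and surj: "q ` carrier D = carrier C"
    and ker: "a_kernel D C q = i ` carrier U"
  shows "is_dsum A D U C r q"
proof (rule is_dsumI[OF D U C r q])
  interpret D: right_module A D by (rule D)
  interpret U: right_module A U by (rule U)
  interpret C: right_module A C by (rule C)
  fix x assume "x \<in> carrier D" "r x = \<zero>\<^bsub>U\<^esub>" "q x = \<zero>\<^bsub>C\<^esub>"
  then have "x \<in> i ` carrier U" unfolding ker[symmetric] by (simp add: a_kernel_def')
  then obtain u where "u \<in> carrier U" "x = i u" by auto
  then show "x = \<zero>\<^bsub>D\<^esub>" using ri \<open>r x = _\<close> mod_hom_zero[OF U D i] by auto
next
  interpret D: right_module A D by (rule D)
  interpret U: right_module A U by (rule U)
  interpret C: right_module A C by (rule C)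
  fix u v assume u: "u \<in> carrier U" and v: "v \<in> carrier C"
  then have "v \<in> q ` carrier D" using surj by simp
  then obtain y where y: "y \<in> carrier D" "q y = v" by auto
  have ry: "r y \<in> carrier U" using y mod_hom_closed[OF r] by auto
  let ?w = "i (u \<ominus>\<^bsub>U\<^esub> r y)"
  have w: "?w \<in> carrier D" "r ?w = u \<ominus>\<^bsub>U\<^esub> r y" using u ry ri mod_hom_closed[OF i] by auto
  have "?w \<in> a_kernel D C q" unfolding ker using u ry by auto
  then have qw: "q ?w = \<zero>\<^bsub>C\<^esub>" by (simp add: a_kernel_def')
  have "r (?w \<oplus>\<^bsub>D\<^esub> y) = u"
    using w y u ry by (simp add: mod_hom_add[OF r] a_minus_def U.M.a_assoc U.M.l_neg)
  moreover have "q (?w \<oplus>\<^bsub>D\<^esub> y) = v"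
    using w y qw v by (simp add: mod_hom_add[OF q])
  ultimately show "\<exists>x\<in>carrier D. r x = u \<and> q x = v" using w y by auto
qed

text \<open>The complement is the kernel of \<open>r\<close>, and the second projection is the
  idempotent complementary to \<open>i\<close> after \<open>r\<close>.\<close>

lemma is_dsum_of_retraction:
  assumes D: "right_module A D" and U: "right_module A U"
    and i: "i \<in> mod_hom A U D" and r: "r \<in> mod_hom A D U" and ri: "\<And>x. x \<in> carrier U \<Longrightarrow> r (i x) = x"
  shows "is_dsum A D U (D\<lparr>carrier := a_kernel D U r\<rparr>) r (\<lambda>x. x \<ominus>\<^bsub>D\<^esub> i (r x))"
proof -
  interpret D: right_module A D by (rule D)
  interpret U: right_module A U by (rule U)
  let ?k = "a_kernel D U r" and ?q = "\<lambda>x. x \<ominus>\<^bsub>D\<^esub> i (r x)"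
  have k: "submodule ?k A D" by (rule submodule_kernel[OF D U r])
  have rc: "r x \<in> carrier U" "i (r x) \<in> carrier D" if "x \<in> carrier D" for x
    using that mod_hom_closed[OF r] mod_hom_closed[OF i] by auto
  have qk: "r (?q x) = \<zero>\<^bsub>U\<^esub>" if "x \<in> carrier D" for x
    using rc[OF that] that ri by (simp add: mod_hom_diff[OF D U r] U.M.diff_eq_zero_iff)
  have "?q \<in> mod_hom A D D" by (rule mod_hom_minus_map[OF D mod_hom_id mod_hom_comp[OF r i]])
  then have q: "?q \<in> mod_hom A D (D\<lparr>carrier := ?k\<rparr>)"
    using qk by (auto simp: mod_hom_iff a_kernel_def')
  have fix_k: "?q x = x" if "x \<in> ?k" for x
    using that mod_hom_zero[OF U D i] by (simp add: a_kernel_def' a_minus_def)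
  show ?thesis
  proof (rule split_is_dsum[OF D U D.restrict_carrier[OF k] i r ri q])
    show "?q ` carrier D = carrier (D\<lparr>carrier := ?k\<rparr>)"
    proof (intro equalityI subsetI)
      fix y assume "y \<in> carrier (D\<lparr>carrier := ?k\<rparr>)"
      then show "y \<in> ?q ` carrier D" using fix_k[of y] by (intro image_eqI[of _ _ y]) (auto simp: a_kernel_def')
    qed (use q in \<open>auto simp: mod_hom_iff\<close>)
    show "a_kernel D (D\<lparr>carrier := ?k\<rparr>) ?q = i ` carrier U"
    proof (intro equalityI subsetI)
      fix x assume "x \<in> a_kernel D (D\<lparr>carrier := ?k\<rparr>) ?q"
      then have "x \<in> carrier D" "?q x = \<zero>\<^bsub>D\<^esub>" by (auto simp: a_kernel_def')
      then show "x \<in> i ` carrier U" using rc[of x] by (auto simp: D.M.diff_eq_zero_iff intro!: image_eqI[of _ _ "r x"])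
    next
      fix x assume "x \<in> i ` carrier U"
      then show "x \<in> a_kernel D (D\<lparr>carrier := ?k\<rparr>) ?q"
        using mod_hom_closed[OF i] ri by (auto simp: a_kernel_def' D.M.diff_eq_zero_iff)
    qed
  qed
qed

section \<open>Finitely generated modules over a finite dimensional algebra\<close>

context fd_algebra
begin

abbreviation Mods :: "('a, nat \<Rightarrow> 'a) module set" where "Mods \<equiv> fg_modules A"

section \<open>Restriction of scalars from the algebra to the field\<close>

definition scal :: "'k \<Rightarrow> 'a" where "scal c = c \<odot>\<^bsub>A\<^esub> \<one>\<^bsub>A\<^esub>"

lemma scal_closed [simp]: "c \<in> carrier K \<Longrightarrow> scal c \<in> carrier A"
  by (simp add: scal_def)

lemma scal_mult: "c \<in> carrier K \<Longrightarrow> a \<in> carrier A \<Longrightarrow> scal c \<otimes>\<^bsub>A\<^esub> a = c \<odot>\<^bsub>A\<^esub> a"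
  by (simp add: scal_def smult_mult_left)

lemma mult_scal: "c \<in> carrier K \<Longrightarrow> a \<in> carrier A \<Longrightarrow> a \<otimes>\<^bsub>A\<^esub> scal c = c \<odot>\<^bsub>A\<^esub> a"
  by (simp add: scal_def smult_mult_right)

text \<open>The elements \<open>scal c\<close> are central in \<open>A\<close> by
  \<open>scal_mult\<close> and \<open>mult_scal\<close>; acting through them turns an
  \<open>A\<close>-module into a vector space.\<close>

definition kmod :: "('a, 'm, 's) module_scheme \<Rightarrow> ('k, 'm) module" where
  "kmod M = \<lparr>carrier = carrier M, monoid.mult = (\<lambda>x y. x), monoid.one = \<zero>\<^bsub>M\<^esub>,
     ring.zero = \<zero>\<^bsub>M\<^esub>, ring.add = ring.add M, smult = (\<lambda>c x. scal c \<odot>\<^bsub>M\<^esub> x)\<rparr>"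

lemma kmod_simps [simp]:
  "carrier (kmod M) = carrier M" "\<zero>\<^bsub>kmod M\<^esub> = \<zero>\<^bsub>M\<^esub>" "x \<oplus>\<^bsub>kmod M\<^esub> y = x \<oplus>\<^bsub>M\<^esub> y"
  "c \<odot>\<^bsub>kmod M\<^esub> x = scal c \<odot>\<^bsub>M\<^esub> x"
  by (simp_all add: kmod_def)

lemma right_module_kmod:
  assumes "right_module A M" shows "right_module K (kmod M)"
proof -
  interpret M: right_module A M by (rule assms)
  have ab: "abelian_group (kmod M)"
  proof (rule abelian_groupI)
    fix x assume "x \<in> carrier (kmod M)"
    then show "\<exists>y\<in>carrier (kmod M). y \<oplus>\<^bsub>kmod M\<^esub> x = \<zero>\<^bsub>kmod M\<^esub>"
      by (intro bexI[of _ "\<ominus>\<^bsub>M\<^esub> x"]) (auto simp: M.M.l_neg)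
  qed (auto simp: M.M.a_ac)
  have "scal (c \<oplus>\<^bsub>K\<^esub> d) = scal c \<oplus>\<^bsub>A\<^esub> scal d" if "c \<in> carrier K" "d \<in> carrier K" for c d
    using that by (simp add: scal_def smult_l_distr)
  moreover have "scal (c \<otimes>\<^bsub>K\<^esub> d) = scal c \<otimes>\<^bsub>A\<^esub> scal d" if "c \<in> carrier K" "d \<in> carrier K" for c d
    using that by (simp add: scal_mult) (simp add: scal_def smult_assoc1)
  moreover have "scal \<one>\<^bsub>K\<^esub> = \<one>\<^bsub>A\<^esub>" by (simp add: scal_def)
  ultimately show ?thesis
    by (intro right_module.intro R.ring_axioms ab right_module_axioms.intro)
      (auto simp: M.act_closed M.act_add M.act_add_scalar M.act_assoc M.act_one)
qed

lemma submodule_kmod: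
  assumes "right_module A M" "submodule U A M" shows "submodule U K (kmod M)"
  using assms right_module.submodule_iff[OF assms(1), of U]
    right_module.submodule_iff[OF right_module_kmod[OF assms(1)], of U] by auto

lemma right_module_K_A: "right_module K A"
  by (intro right_module.intro R.ring_axioms M.abelian_group_axioms right_module_axioms.intro)
    (simp_all add: smult_l_distr smult_r_distr smult_assoc1[symmetric] R.m_comm)

text \<open>The products of \<open>K\<close>-generators of \<open>A\<close> with
  \<open>A\<close>-generators of \<open>M\<close> suffice. For a subspace \<open>U\<close>
  containing them and a fixed \<open>g\<close>, the \<open>a\<close> that move \<open>g\<close> into
  \<open>U\<close> form a subspace of \<open>A\<close>, hence all of \<open>A\<close>; then the
  largest \<open>A\<close>-submodule inside \<open>U\<close> contains \<open>G\<close>, hence is all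
  of \<open>M\<close>.\<close>

lemma finitely_generated_kmod:
  assumes M: "right_module A M" and fg: "finitely_generated A M"
  shows "finitely_generated K (kmod M)"
proof -
  interpret M: right_module A M by (rule M)
  interpret KM: right_module K "kmod M" by (rule right_module_kmod[OF M])
  interpret KA: right_module K A by (rule right_module_K_A)
  obtain G where G: "finite G" "generates A M G" using fg finitely_generated_iff[OF M] by blast
  obtain B where B: "finite B" "generates K A B"
    using finite_dimensional finitely_generated_iff[OF right_module_K_A] by blast
  have GB: "G \<subseteq> carrier M" "B \<subseteq> carrier A" using G B by (auto simp: generates_def)
  let ?H = "(\<lambda>(b, g). b \<odot>\<^bsub>M\<^esub> g) ` (B \<times> G)"
  have "generates K (kmod M) ?H" unfolding generates_def
  proof (intro conjI allI impI)
    show "?H \<subseteq> carrier (kmod M)" using GB by (auto intro!: M.act_closed)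
    fix U assume U: "submodule U K (kmod M)" "?H \<subseteq> U"
    have Us: "U \<subseteq> carrier M" "\<zero>\<^bsub>M\<^esub> \<in> U" "\<And>x y. x \<in> U \<Longrightarrow> y \<in> U \<Longrightarrow> x \<oplus>\<^bsub>M\<^esub> y \<in> U"
      "\<And>c x. c \<in> carrier K \<Longrightarrow> x \<in> U \<Longrightarrow> scal c \<odot>\<^bsub>M\<^esub> x \<in> U" using U(1) by (auto simp: KM.submodule_iff)
    have 1: "a \<odot>\<^bsub>M\<^esub> g \<in> U" if g: "g \<in> G" and a: "a \<in> carrier A" for a g
    proof -
      have gM: "g \<in> carrier M" using g GB by auto
      have "submodule {a \<in> carrier A. a \<odot>\<^bsub>M\<^esub> g \<in> U} K A" unfolding KA.submodule_iff
        using Us gM by (auto simp: M.zero_act M.act_add_scalar mult_scal[symmetric] M.act_assoc)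
      then have "{a \<in> carrier A. a \<odot>\<^bsub>M\<^esub> g \<in> U} = carrier A"
        using B(2) U(2) g GB unfolding generates_def by blast
      then show ?thesis using a by blast
    qed
    let ?U = "{x \<in> carrier M. \<forall>a \<in> carrier A. a \<odot>\<^bsub>M\<^esub> x \<in> U}"
    have "submodule ?U A M" unfolding M.submodule_iff
      using Us by (auto simp: M.act_zero M.act_add M.act_closed M.act_assoc[symmetric])
    moreover have "G \<subseteq> ?U" using 1 GB by auto
    ultimately have "?U = carrier M" using G(2) unfolding generates_def by blast
    then have "x \<in> U" if "x \<in> carrier M" for x
      using that M.act_one[OF that] A.one_closed by (metis (no_types, lifting) mem_Collect_eq)
    then show "U = carrier (kmod M)" using Us by auto
  qed
  moreover have "finite ?H" using G(1) B(1) by simp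
  ultimately show ?thesis unfolding finitely_generated_iff[OF right_module_kmod[OF M]] by (intro exI conjI)
qed

lemma finite_length_kmod:
  "right_module A M \<Longrightarrow> finitely_generated A M \<Longrightarrow> finite_length K (kmod M)"
  by (rule finite_length_field[OF K.field_axioms right_module_kmod finitely_generated_kmod])

section \<open>Closure properties of the category of finitely generated modules\<close>

lemma fg_imp_finite_length:
  assumes M: "right_module A M" and fg: "finitely_generated A M"
  shows "finite_length A M"
proof -
  obtain g where "strictly_monotone K (kmod M) g"
    using finite_length_kmod[OF assms] by (auto simp: finite_length_def)
  then have "strictly_monotone A M g" by (simp add: strictly_monotone_def submodule_kmod[OF M])
  then show ?thesis by (auto simp: finite_length_def)
qed

text \<open>Finite length passes to submodules, quotients and extensions, whereas finite generation
  of a submodule is not evident. The finite dimension of \<open>A\<close> enters through this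
  equivalence.\<close>

lemma Mods_iff: "M \<in> Mods \<longleftrightarrow> right_module A M \<and> finite_length A M"
  using fg_imp_finite_length finite_length_imp_fg by (auto simp: fg_modules_def)

lemma restrict_Mods: "M \<in> Mods \<Longrightarrow> submodule U A M \<Longrightarrow> M\<lparr>carrier := U\<rparr> \<in> Mods"
  by (simp add: Mods_iff finite_length_restrict right_module.restrict_carrier)

lemma quotient_Mods:
  assumes "M \<in> Mods" "submodule U A M"
  obtains C q where "C \<in> Mods" "q \<in> mod_hom A M C" "q ` carrier M = carrier C" "a_kernel M C q = U"
proof -
  have M: "right_module A M" "finite_length A M" using assms(1) by (auto simp: Mods_iff)
  obtain C :: "('a, nat \<Rightarrow> 'a) module" and q where C: "right_module A C" "q \<in> mod_hom A M C"
    "q ` carrier M = carrier C" "a_kernel M C q = U"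
    using quotient_exists[OF M(1) assms(2)] by blast
  moreover have "finite_length A C" by (rule finite_length_image[OF M(1) C(1-3) M(2)])
  ultimately show thesis using that by (simp add: Mods_iff)
qed

lemma kernel_Mods:
  "M \<in> Mods \<Longrightarrow> N \<in> Mods \<Longrightarrow> f \<in> mod_hom A M N \<Longrightarrow> M\<lparr>carrier := a_kernel M N f\<rparr> \<in> Mods"
  by (intro restrict_Mods submodule_kernel) (auto simp: Mods_iff)

text \<open>The external sum lives on pairs; \<open>fg_modules_representative\<close> supplies an
  isomorphic copy on the common type.\<close>

lemma dsum_Mods:
  assumes "U \<in> Mods" "V \<in> Mods"
  obtains D p q where "D \<in> Mods" "is_dsum A D U V p q"
proof -
  let ?S = "direct_sum U V"
  have S: "right_module A ?S" "finite_length A ?S"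
    using assms by (auto simp: Mods_iff right_module_direct_sum finite_length_direct_sum)
  then obtain D where D: "D \<in> Mods" "mod_isomorphic A ?S D"
    using fg_modules_representative[OF S(1) finite_length_imp_fg[OF S]] by blast
  then obtain f where f: "f \<in> mod_hom A ?S D" "bij_betw f (carrier ?S) (carrier D)"
    by (auto simp: mod_isomorphic_def)
  have "mod_isomorphic A D ?S" unfolding mod_isomorphic_def
    using mod_hom_inv[OF S(1) f] bij_betw_inv_into[OF f(2)] by blast
  then obtain p q where "is_dsum A D U V p q" unfolding mod_isomorphic_direct_sum_iff by blast
  with D(1) show thesis by (rule that)
qed

lemma direct_summand_iff:
  assumes M: "M \<in> Mods"
  shows "direct_summand A N M \<longleftrightarrow> retract A N M"
proof
  assume "direct_summand A N M"
  then obtain N' p q where N: "N \<in> Mods" "N' \<in> Mods" "is_dsum A M N N' p q"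
    unfolding direct_summand_def mod_isomorphic_direct_sum_iff by blast
  then have "p \<in> mod_hom A M N" by (simp add: is_dsum_def)
  moreover obtain i where "i \<in> mod_hom A N M" "\<And>x. x \<in> carrier N \<Longrightarrow> p (i x) = x"
    by (rule is_dsum_injections[OF fg_modulesD(1)[OF M] fg_modulesD(1)[OF N(1)] fg_modulesD(1)[OF N(2)] N(3)]) blast
  ultimately show "retract A N M" using N(1) unfolding retract_def by blast
next
  assume "retract A N M"
  then obtain i r where N: "N \<in> Mods" "i \<in> mod_hom A N M" "r \<in> mod_hom A M N"
    "\<And>x. x \<in> carrier N \<Longrightarrow> r (i x) = x" unfolding retract_def by blast
  have "is_dsum A M N (M\<lparr>carrier := a_kernel M N r\<rparr>) r (\<lambda>x. x \<ominus>\<^bsub>M\<^esub> i (r x))"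
    using N M by (intro is_dsum_of_retraction) (auto simp: Mods_iff)
  then show "direct_summand A N M"
    unfolding direct_summand_def mod_isomorphic_direct_sum_iff
    using N kernel_Mods[OF M N(1,3)] by blast
qed

text \<open>The free module of rank one, moved to the type of \<open>Mods\<close>. After this
  transport only the generator \<open>e\<close> and the universal property are remembered.\<close>

lemma regular_module_exists:
  obtains R e where "R \<in> Mods" "e \<in> carrier R"
    "carrier R = (\<lambda>a. a \<odot>\<^bsub>R\<^esub> e) ` carrier A"
    "\<And>M :: ('a, nat \<Rightarrow> 'a) module. \<And>m. M \<in> Mods \<Longrightarrow> m \<in> carrier M \<Longrightarrow> \<exists>h \<in> mod_hom A R M. h e = m"
proof -
  define S :: "('a, 'a) module" where "S = \<lparr>carrier = carrier A, monoid.mult = (\<lambda>x y. x),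
    monoid.one = \<zero>\<^bsub>A\<^esub>, ring.zero = \<zero>\<^bsub>A\<^esub>, ring.add = ring.add A, smult = (\<lambda>a x. x \<otimes>\<^bsub>A\<^esub> a)\<rparr>"
  have s: "carrier S = carrier A" "\<zero>\<^bsub>S\<^esub> = \<zero>\<^bsub>A\<^esub>" "\<And>x y. x \<oplus>\<^bsub>S\<^esub> y = x \<oplus>\<^bsub>A\<^esub> y"
    "\<And>a x. a \<odot>\<^bsub>S\<^esub> x = x \<otimes>\<^bsub>A\<^esub> a" by (simp_all add: S_def)
  have ab: "abelian_group S"
  proof (rule abelian_groupI)
    fix x assume "x \<in> carrier S"
    then show "\<exists>y\<in>carrier S. y \<oplus>\<^bsub>S\<^esub> x = \<zero>\<^bsub>S\<^esub>"
      by (intro bexI[of _ "\<ominus>\<^bsub>A\<^esub> x"]) (auto simp: s M.l_neg)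
  qed (auto simp: s M.a_ac)
  have S: "right_module A S"
    by (intro right_module.intro A.ring_axioms ab right_module_axioms.intro)
      (auto simp: s A.l_distr A.r_distr A.m_assoc)
  have "generates A S {\<one>\<^bsub>A\<^esub>}" unfolding generates_def right_module.submodule_iff[OF S]
    by (auto simp: s) (metis A.l_one)
  then have "finitely_generated A S" using finitely_generated_iff[OF S] by blast
  from fg_modules_representative[OF S this] obtain R f where R: "R \<in> Mods"
    and f: "f \<in> mod_hom A S R" "bij_betw f (carrier S) (carrier R)"
    by (auto simp: mod_isomorphic_def)
  let ?e = "f \<one>\<^bsub>A\<^esub>" and ?g = "inv_into (carrier S) f"
  have e: "?e \<in> carrier R" using mod_hom_closed[OF f(1)] by (simp add: s)
  have fa: "f a = a \<odot>\<^bsub>R\<^esub> ?e" if "a \<in> carrier A" for a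
    using mod_hom_act[OF f(1) that, of "\<one>\<^bsub>A\<^esub>"] that by (simp add: s)
  have "carrier R = f ` carrier A" using f(2) by (simp add: bij_betw_def s)
  then have 1: "carrier R = (\<lambda>a. a \<odot>\<^bsub>R\<^esub> ?e) ` carrier A" using image_cong[OF refl fa] by simp
  have g: "?g \<in> mod_hom A R S" by (rule mod_hom_inv[OF S f])
  have ge: "?g ?e = \<one>\<^bsub>A\<^esub>" using f(2) by (intro inv_into_f_f) (auto simp: bij_betw_def s)
  have "\<exists>h \<in> mod_hom A R M. h ?e = m" if M: "M \<in> Mods" and m: "m \<in> carrier M"
    for M :: "('a, nat \<Rightarrow> 'a) module" and m
  proof -
    interpret M: right_module A M using M by (simp add: Mods_iff)
    have "(\<lambda>a. a \<odot>\<^bsub>M\<^esub> m) \<in> mod_hom A S M"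
      using m by (auto simp: mod_hom_iff s M.act_closed M.act_add_scalar M.act_assoc)
    from mod_hom_comp[OF g this] show ?thesis using ge m by (intro bexI) (auto simp: M.act_one)
  qed
  with R e 1 show thesis by (rule that)
qed

section \<open>Projective modules\<close>

lemma projective_Mods: "projective A P \<Longrightarrow> P \<in> Mods"
  by (simp add: projective_def)

lemma projectiveI:
  assumes "P \<in> Mods"
    and "\<And>U V p f. U \<in> Mods \<Longrightarrow> V \<in> Mods \<Longrightarrow> p \<in> mod_hom A U V \<Longrightarrow> f \<in> mod_hom A P V \<Longrightarrow>
      p ` carrier U = carrier V \<Longrightarrow> \<exists>h\<in>mod_hom A P U. \<forall>x\<in>carrier P. p (h x) = f x"
  shows "projective A P"
  unfolding projective_def by (intro conjI ballI impI assms)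

lemma projective_lift:
  assumes "projective A P" "U \<in> Mods" "V \<in> Mods" "p \<in> mod_hom A U V" "f \<in> mod_hom A P V"
    "p ` carrier U = carrier V"
  shows "\<exists>h\<in>mod_hom A P U. \<forall>x\<in>carrier P. p (h x) = f x"
  using assms unfolding projective_def by blast

lemma projective_retract:
  assumes P: "projective A P" and N: "retract A N P"
  shows "projective A N"
proof -
  obtain i r where ir: "i \<in> mod_hom A N P" "r \<in> mod_hom A P N" "\<And>x. x \<in> carrier N \<Longrightarrow> r (i x) = x"
    using N by (auto simp: retract_def)
  have "\<exists>h\<in>mod_hom A N U. \<forall>x\<in>carrier N. p (h x) = f x"
    if *: "U \<in> Mods" "V \<in> Mods" "p \<in> mod_hom A U V" "f \<in> mod_hom A N V" "p ` carrier U = carrier V" for U V p f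
  proof -
    obtain h where h: "h \<in> mod_hom A P U" "\<And>x. x \<in> carrier P \<Longrightarrow> p (h x) = f (r x)"
      using projective_lift[OF P *(1-3) mod_hom_comp[OF ir(2) *(4)] *(5)] by blast
    have "p (h (i x)) = f x" if "x \<in> carrier N" for x
      using that by (simp add: h(2) mod_hom_closed[OF ir(1)] ir(3))
    then show ?thesis by (intro bexI[OF _ mod_hom_comp[OF ir(1) h(1)]] ballI)
  qed
  moreover have "N \<in> Mods" using N by (simp add: retract_def)
  ultimately show ?thesis by (intro projectiveI)
qed

lemma projective_trivial:
  assumes M: "M \<in> Mods" and z: "carrier M = {\<zero>\<^bsub>M\<^esub>}"
  shows "projective A M"
proof -
  have "\<exists>h\<in>mod_hom A M U. \<forall>x\<in>carrier M. p (h x) = f x"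
    if *: "U \<in> Mods" "V \<in> Mods" "p \<in> mod_hom A U V" "f \<in> mod_hom A M V" for U V p f
  proof -
    note rm = fg_modulesD(1)[OF M] fg_modulesD(1)[OF *(1)] fg_modulesD(1)[OF *(2)]
    have "p \<zero>\<^bsub>U\<^esub> = f \<zero>\<^bsub>M\<^esub>"
      by (simp add: mod_hom_zero[OF rm(2,3) *(3)] mod_hom_zero[OF rm(1,3) *(4)])
    then have "\<forall>x\<in>carrier M. p \<zero>\<^bsub>U\<^esub> = f x" unfolding z by simp
    then show ?thesis using mod_hom_zero_map[OF rm(1,2)] by (intro bexI[of _ "\<lambda>_. \<zero>\<^bsub>U\<^esub>"])
  qed
  then show ?thesis using M by (intro projectiveI)
qed

lemma zero_module_exists:
  obtains Z where "Z \<in> Mods" "carrier Z = {\<zero>\<^bsub>Z\<^esub>}" "projective A Z"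
proof -
  obtain R e where R: "R \<in> Mods" and "e \<in> carrier R" by (rule regular_module_exists)
  then interpret R: right_module A R by (simp add: Mods_iff)
  have "R\<lparr>carrier := {\<zero>\<^bsub>R\<^esub>}\<rparr> \<in> Mods" by (rule restrict_Mods[OF R R.submodule_zero])
  then show thesis using that projective_trivial by force
qed

lemma projective_dsum:
  assumes U: "projective A U" and V: "projective A V" and D: "D \<in> Mods" and d: "is_dsum A D U V p q"
  shows "projective A D"
proof -
  have UV: "U \<in> Mods" "V \<in> Mods" using U V by (auto simp: projective_def)
  note rm = D[THEN fg_modulesD(1)] UV[THEN fg_modulesD(1)]
  obtain i j where ij: "i \<in> mod_hom A U D" "j \<in> mod_hom A V D"
    "\<And>x. x \<in> carrier D \<Longrightarrow> i (p x) \<oplus>\<^bsub>D\<^esub> j (q x) = x"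
    by (rule is_dsum_injections[OF rm d]) blast
  have pq: "p \<in> mod_hom A D U" "q \<in> mod_hom A D V" using d by (auto simp: is_dsum_def)
  have "\<exists>h\<in>mod_hom A D M. \<forall>x\<in>carrier D. s (h x) = f x"
    if *: "M \<in> Mods" "N \<in> Mods" "s \<in> mod_hom A M N" "f \<in> mod_hom A D N" "s ` carrier M = carrier N" for M N s f
  proof -
    obtain h where h: "h \<in> mod_hom A U M" "\<And>x. x \<in> carrier U \<Longrightarrow> s (h x) = f (i x)"
      using projective_lift[OF U *(1-3) mod_hom_comp[OF ij(1) *(4)] *(5)] by blast
    obtain k where k: "k \<in> mod_hom A V M" "\<And>x. x \<in> carrier V \<Longrightarrow> s (k x) = f (j x)"
      using projective_lift[OF V *(1-3) mod_hom_comp[OF ij(2) *(4)] *(5)] by blast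
    have "(\<lambda>x. h (p x) \<oplus>\<^bsub>M\<^esub> k (q x)) \<in> mod_hom A D M"
      using * by (intro mod_hom_plus mod_hom_comp[OF pq(1) h(1)] mod_hom_comp[OF pq(2) k(1)]) (auto simp: Mods_iff)
    moreover have "s (h (p x) \<oplus>\<^bsub>M\<^esub> k (q x)) = f x" if x: "x \<in> carrier D" for x
    proof -
      have c: "p x \<in> carrier U" "q x \<in> carrier V" using x pq by (auto simp: mod_hom_iff)
      then have "s (h (p x) \<oplus>\<^bsub>M\<^esub> k (q x)) = f (i (p x)) \<oplus>\<^bsub>N\<^esub> f (j (q x))"
        using h k by (simp add: mod_hom_add[OF *(3)] mod_hom_closed)
      also have "\<dots> = f (i (p x) \<oplus>\<^bsub>D\<^esub> j (q x))"
        using c ij by (intro mod_hom_add[OF *(4), symmetric]) (auto simp: mod_hom_closed)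
      finally show ?thesis using ij(3)[OF x] by simp
    qed
    ultimately show ?thesis by (intro bexI[of _ "\<lambda>x. h (p x) \<oplus>\<^bsub>M\<^esub> k (q x)"] ballI)
  qed
  then show ?thesis using D by (intro projectiveI)
qed

lemma image_iff_generates:
  assumes "M \<in> Mods" "P \<in> Mods" "p \<in> mod_hom A P M" "generates A M G" "G \<subseteq> p ` carrier P"
  shows "p ` carrier P = carrier M"
proof -
  note rm = fg_modulesD(1)[OF assms(2)] fg_modulesD(1)[OF assms(1)]
  have "submodule (p ` carrier P) A M"
    by (rule submodule_image[OF rm assms(3) right_module.submodule_carrier[OF rm(1)]])
  then show ?thesis using assms(4,5) by (simp add: generates_def)
qed

text \<open>One copy of the regular module is added for each generator of \<open>M\<close>; a sum of
  two projectives at a time is enough, by induction on the generating set.\<close>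

lemma enough_projectives:
  assumes M: "M \<in> Mods"
  obtains P p where "projective A P" "p \<in> mod_hom A P M" "p ` carrier P = carrier M"
proof -
  interpret M: right_module A M using M by (simp add: Mods_iff)
  obtain R e where R: "R \<in> Mods" "e \<in> carrier R" "carrier R = (\<lambda>a. a \<odot>\<^bsub>R\<^esub> e) ` carrier A"
    "\<And>M :: ('a, nat \<Rightarrow> 'a) module. \<And>m. M \<in> Mods \<Longrightarrow> m \<in> carrier M \<Longrightarrow> \<exists>h \<in> mod_hom A R M. h e = m"
    by (rule regular_module_exists) blast
  have projR: "projective A R"
  proof -
    have "\<exists>h\<in>mod_hom A R U. \<forall>x\<in>carrier R. p (h x) = f x"
      if *: "U \<in> Mods" "V \<in> Mods" "p \<in> mod_hom A U V" "f \<in> mod_hom A R V" "p ` carrier U = carrier V" for U V p f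
    proof -
      have "f e \<in> p ` carrier U" using * R(2) by (simp add: mod_hom_closed)
      then obtain u where u: "u \<in> carrier U" "p u = f e" by auto
      obtain h where h: "h \<in> mod_hom A R U" "h e = u" using R(4)[OF *(1) u(1)] by blast
      have "p (h x) = f x" if x: "x \<in> carrier R" for x
      proof -
        obtain a where a: "a \<in> carrier A" "x = a \<odot>\<^bsub>R\<^esub> e" using x unfolding R(3) by auto
        have "h x = a \<odot>\<^bsub>U\<^esub> u" using mod_hom_act[OF h(1) a(1) R(2)] a(2) h(2) by simp
        then have "p (h x) = a \<odot>\<^bsub>V\<^esub> f e" using mod_hom_act[OF *(3) a(1) u(1)] u(2) by simp
        then show ?thesis using mod_hom_act[OF *(4) a(1) R(2)] a(2) by simp
      qed
      then show ?thesis using h(1) by (intro bexI[of _ h] ballI)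
    qed
    then show ?thesis using R(1) by (intro projectiveI)
  qed
  have key: "\<exists>P p. projective A P \<and> p \<in> mod_hom A P M \<and> G \<subseteq> p ` carrier P"
    if "finite G" "G \<subseteq> carrier M" for G
    using that
  proof (induction G)
    case empty
    obtain Z where Z: "Z \<in> Mods" "projective A Z" by (rule zero_module_exists)
    have "(\<lambda>_. \<zero>\<^bsub>M\<^esub>) \<in> mod_hom A Z M"
      by (rule mod_hom_zero_map[OF fg_modulesD(1)[OF Z(1)] M.right_module_axioms])
    with Z(2) show ?case by (intro exI[of _ Z] exI[of _ "\<lambda>_. \<zero>\<^bsub>M\<^esub>"] conjI) auto
  next
    case (insert m G)
    then obtain P p where P: "projective A P" "p \<in> mod_hom A P M" "G \<subseteq> p ` carrier P" by auto
    have PM: "P \<in> Mods" using P by (simp add: projective_def)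
    have "m \<in> carrier M" using insert.prems by simp
    from R(4)[OF M this] obtain h where h: "h \<in> mod_hom A R M" "h e = m" by blast
    obtain D s t where D: "D \<in> Mods" "is_dsum A D P R s t" by (rule dsum_Mods[OF PM R(1)])
    note E = is_dsumE[OF D(2)]
    let ?f = "\<lambda>x. p (s x) \<oplus>\<^bsub>M\<^esub> h (t x)"
    have f: "?f \<in> mod_hom A D M"
      by (intro mod_hom_plus mod_hom_comp[OF E(1) P(2)] mod_hom_comp[OF E(2) h(1)] M.right_module_axioms)
    have rm: "right_module A P" "right_module A R" "right_module A D" using PM R D by (auto simp: Mods_iff)
    interpret P: right_module A P by (rule rm)
    interpret R: right_module A R by (rule rm)
    have "G \<subseteq> ?f ` carrier D"
    proof
      fix g assume "g \<in> G"
      then obtain x where x: "x \<in> carrier P" "g = p x" using P(3) by auto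
      then obtain y where "y \<in> carrier D" "s y = x" "t y = \<zero>\<^bsub>R\<^esub>" using E(4)[of x "\<zero>\<^bsub>R\<^esub>"] by auto
      then show "g \<in> ?f ` carrier D" using x mod_hom_closed[OF P(2)] mod_hom_zero[OF rm(2) M.right_module_axioms h(1)]
        by (intro image_eqI[of _ _ y]) auto
    qed
    moreover have "m \<in> ?f ` carrier D"
    proof -
      obtain y where "y \<in> carrier D" "s y = \<zero>\<^bsub>P\<^esub>" "t y = e" using E(4)[of "\<zero>\<^bsub>P\<^esub>" e] R(2) by auto
      then show ?thesis using h insert.prems mod_hom_zero[OF rm(1) M.right_module_axioms P(2)]
        by (intro image_eqI[of _ _ y]) auto
    qed
    ultimately show ?case using f projective_dsum[OF P(1) projR D]
      by (intro exI[of _ D] exI[of _ ?f] conjI insert_subsetI)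
  qed
  obtain G where G: "finite G" "generates A M G"
    using finitely_generated_iff[OF M.right_module_axioms] fg_modulesD(2)[OF M] by blast
  then have "G \<subseteq> carrier M" by (simp add: generates_def)
  from key[OF G(1) this] obtain P p where P: "projective A P" "p \<in> mod_hom A P M" "G \<subseteq> p ` carrier P"
    by blast
  show thesis
    by (rule that[OF P(1,2) image_iff_generates[OF M projective_Mods[OF P(1)] P(2) G(2) P(3)]])
qed

end

section \<open>Short exact sequences and projective covers\<close>

definition ses where
  "ses A L i P p M \<longleftrightarrow> L \<in> fg_modules A \<and> P \<in> fg_modules A \<and> M \<in> fg_modules A \<and>
    i \<in> mod_hom A L P \<and> p \<in> mod_hom A P M \<and> inj_on i (carrier L) \<and>
    p ` carrier P = carrier M \<and> a_kernel P M p = i ` carrier L"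

lemma sesD:
  assumes "ses A L i P p M"
  shows "L \<in> fg_modules A" "P \<in> fg_modules A" "M \<in> fg_modules A" "i \<in> mod_hom A L P" "p \<in> mod_hom A P M"
    "inj_on i (carrier L)" "p ` carrier P = carrier M" "a_kernel P M p = i ` carrier L"
    "right_module A L" "right_module A P" "right_module A M"
  using assms by (auto simp: ses_def fg_modules_def)

lemma ses_comp: "ses A L i P p M \<Longrightarrow> x \<in> carrier L \<Longrightarrow> p (i x) = \<zero>\<^bsub>M\<^esub>"
  using sesD(8)[of A L i P p M] by (auto simp: a_kernel_def')

lemma ses_surj: "ses A L i P p M \<Longrightarrow> y \<in> carrier M \<Longrightarrow> \<exists>x\<in>carrier P. p x = y"
proof -
  assume "ses A L i P p M" "y \<in> carrier M"
  then have "y \<in> p ` carrier P" by (simp add: sesD(7))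
  then show ?thesis by auto
qed

lemma ses_exact: "ses A L i P p M \<Longrightarrow> x \<in> carrier P \<Longrightarrow> p x = \<zero>\<^bsub>M\<^esub> \<Longrightarrow> \<exists>y\<in>carrier L. x = i y"
proof -
  assume s: "ses A L i P p M" and "x \<in> carrier P" "p x = \<zero>\<^bsub>M\<^esub>"
  then have "x \<in> i ` carrier L" unfolding sesD(8)[OF s, symmetric] by (simp add: a_kernel_def')
  then show ?thesis by auto
qed

lemma sesI:
  assumes L: "L \<in> fg_modules A" and P: "P \<in> fg_modules A" and M: "M \<in> fg_modules A"
    and i: "i \<in> mod_hom A L P" and p: "p \<in> mod_hom A P M"
    and inj: "\<And>x. x \<in> carrier L \<Longrightarrow> i x = \<zero>\<^bsub>P\<^esub> \<Longrightarrow> x = \<zero>\<^bsub>L\<^esub>"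
    and surj: "\<And>y. y \<in> carrier M \<Longrightarrow> \<exists>x\<in>carrier P. p x = y"
    and comp: "\<And>x. x \<in> carrier L \<Longrightarrow> p (i x) = \<zero>\<^bsub>M\<^esub>"
    and exact: "\<And>x. x \<in> carrier P \<Longrightarrow> p x = \<zero>\<^bsub>M\<^esub> \<Longrightarrow> \<exists>y\<in>carrier L. x = i y"
  shows "ses A L i P p M"
  unfolding ses_def
proof (intro conjI)
  show "inj_on i (carrier L)"
    using mod_hom_inj_iff[OF fg_modulesD(1)[OF L] fg_modulesD(1)[OF P] i] inj by blast
  show "p ` carrier P = carrier M" using mod_hom_closed[OF p] surj by (auto simp: image_iff)
  show "a_kernel P M p = i ` carrier L"
    using comp exact mod_hom_closed[OF i] by (auto simp: a_kernel_def' image_iff)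
qed fact+

lemma ses_inj:
  assumes "ses A L i P p M" "x \<in> carrier L" "i x = \<zero>\<^bsub>P\<^esub>" shows "x = \<zero>\<^bsub>L\<^esub>"
  using mod_hom_inj_iff[OF sesD(9,10,4)[OF assms(1)]] sesD(6)[OF assms(1)] assms(2,3) by blast

lemma mod_hom_factor_inj:
  assumes L: "right_module A L" and i: "i \<in> mod_hom A L P" and inj: "inj_on i (carrier L)"
    and f: "f \<in> mod_hom A T P" and im: "f ` carrier T \<subseteq> i ` carrier L"
  obtains g where "g \<in> mod_hom A T L" "\<And>x. x \<in> carrier T \<Longrightarrow> i (g x) = f x"
proof -
  let ?L' = "P\<lparr>carrier := i ` carrier L\<rparr>"
  have i': "i \<in> mod_hom A L ?L'" using i by (auto simp: mod_hom_iff)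
  have bij: "bij_betw i (carrier L) (carrier ?L')" using inj by (simp add: bij_betw_def)
  have f': "f \<in> mod_hom A T ?L'" using f im by (auto simp: mod_hom_iff)
  have "i (inv_into (carrier L) i (f x)) = f x" if "x \<in> carrier T" for x
    using that im by (intro f_inv_into_f) auto
  with mod_hom_comp[OF f' mod_hom_inv[OF L i' bij]] show thesis by (rule that)
qed

lemma ses_lift:
  assumes s: "ses A L i P p M" and f: "f \<in> mod_hom A T P" and z: "\<And>x. x \<in> carrier T \<Longrightarrow> p (f x) = \<zero>\<^bsub>M\<^esub>"
  obtains g where "g \<in> mod_hom A T L" "\<And>x. x \<in> carrier T \<Longrightarrow> i (g x) = f x"
proof (rule mod_hom_factor_inj[OF sesD(9,4,6)[OF s] f])
  show "f ` carrier T \<subseteq> i ` carrier L"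
    using mod_hom_closed[OF f] z ses_exact[OF s] by (auto simp: image_iff)
qed (rule that)

lemma ses_colift:
  assumes s: "ses A L i P p M" and T: "right_module A T" and f: "f \<in> mod_hom A P T"
    and z: "\<And>x. x \<in> carrier L \<Longrightarrow> f (i x) = \<zero>\<^bsub>T\<^esub>"
  obtains g where "g \<in> mod_hom A M T" "\<And>x. x \<in> carrier P \<Longrightarrow> g (p x) = f x"
proof -
  note D = sesD[OF s]
  interpret P: right_module A P by (rule D)
  interpret T: right_module A T by (rule T)
  interpret M: right_module A M by (rule D)
  \<comment> \<open>A section of sets only. It becomes linear after \<open>f\<close> is applied,
    because \<open>f\<close> does not distinguish elements with the same image under
    \<open>p\<close>.\<close>
  obtain t where t: "\<And>y. y \<in> carrier M \<Longrightarrow> t y \<in> carrier P \<and> p (t y) = y"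
    using bchoice[of "carrier M" "\<lambda>y x. x \<in> carrier P \<and> p x = y"] ses_surj[OF s] by blast
  have eq: "f x = f y" if xy: "x \<in> carrier P" "y \<in> carrier P" "p x = p y" for x y
  proof -
    have "p (x \<ominus>\<^bsub>P\<^esub> y) = \<zero>\<^bsub>M\<^esub>"
      using that mod_hom_closed[OF D(5)] by (simp add: mod_hom_diff[OF D(10,11,5)] M.M.diff_eq_zero_iff)
    then obtain l where "l \<in> carrier L" "x \<ominus>\<^bsub>P\<^esub> y = i l" using ses_exact[OF s, of "x \<ominus>\<^bsub>P\<^esub> y"] xy by auto
    then have "f (x \<ominus>\<^bsub>P\<^esub> y) = \<zero>\<^bsub>T\<^esub>" using z by simp
    then show ?thesis using that mod_hom_closed[OF f]
      by (simp add: mod_hom_diff[OF D(10) T f] T.M.diff_eq_zero_iff)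
  qed
  have fact: "f (t (p x)) = f x" if "x \<in> carrier P" for x
    using that t mod_hom_closed[OF D(5) that] by (intro eq) auto
  have tc: "t y \<in> carrier P" "p (t y) = y" if "y \<in> carrier M" for y using t[OF that] by auto
  have "(\<lambda>y. f (t y)) \<in> mod_hom A M T" unfolding mod_hom_iff
  proof (intro conjI ballI)
    fix x y assume xy: "x \<in> carrier M" "y \<in> carrier M"
    show "f (t x) \<in> carrier T" using tc xy mod_hom_closed[OF f] by simp
    have "f (t (x \<oplus>\<^bsub>M\<^esub> y)) = f (t x \<oplus>\<^bsub>P\<^esub> t y)"
      using tc xy by (intro eq) (auto simp: mod_hom_add[OF D(5)])
    then show "f (t (x \<oplus>\<^bsub>M\<^esub> y)) = f (t x) \<oplus>\<^bsub>T\<^esub> f (t y)" using tc xy by (simp add: mod_hom_add[OF f])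
  next
    fix a x assume ax: "a \<in> carrier A" "x \<in> carrier M"
    have "f (t (a \<odot>\<^bsub>M\<^esub> x)) = f (a \<odot>\<^bsub>P\<^esub> t x)"
      using tc ax by (intro eq) (auto simp: mod_hom_act[OF D(5)] P.act_closed M.act_closed)
    then show "f (t (a \<odot>\<^bsub>M\<^esub> x)) = a \<odot>\<^bsub>T\<^esub> f (t x)" using tc ax by (simp add: mod_hom_act[OF f])
  qed
  then show thesis using fact by (rule that)
qed

lemma ses_retraction:
  assumes s: "ses A L i P p M" and r: "r \<in> mod_hom A P L" "\<And>x. x \<in> carrier L \<Longrightarrow> r (i x) = x"
  shows "is_dsum A P L M r p"
  by (rule split_is_dsum[OF sesD(10,9,11,4)[OF s] r sesD(5,7,8)[OF s]])

text \<open>The identity of \<open>P\<close> minus \<open>t\<close> after \<open>p\<close> takes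
  values in the kernel of \<open>p\<close>, so it factors through \<open>i\<close> and yields a
  retraction.\<close>

lemma ses_section:
  assumes s: "ses A L i P p M" and t: "t \<in> mod_hom A M P" "\<And>x. x \<in> carrier M \<Longrightarrow> p (t x) = x"
  obtains r where "is_dsum A P L M r p"
proof -
  note D = sesD[OF s]
  interpret P: right_module A P by (rule D)
  interpret M: right_module A M by (rule D)
  let ?f = "\<lambda>x. x \<ominus>\<^bsub>P\<^esub> t (p x)"
  have f: "?f \<in> mod_hom A P P" by (rule mod_hom_minus_map[OF D(10) mod_hom_id mod_hom_comp[OF D(5) t(1)]])
  have "p (?f x) = \<zero>\<^bsub>M\<^esub>" if "x \<in> carrier P" for x
    using that mod_hom_closed[OF t(1)] mod_hom_closed[OF D(5)]
    by (simp add: mod_hom_diff[OF D(10,11,5)] t(2) M.M.diff_eq_zero_iff)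
  then obtain r where r: "r \<in> mod_hom A P L" "\<And>x. x \<in> carrier P \<Longrightarrow> i (r x) = ?f x"
    by (rule ses_lift[OF s f]) blast+
  have "r (i x) = x" if x: "x \<in> carrier L" for x
  proof (rule inj_onD[OF D(6)])
    show "i (r (i x)) = i x"
      using r(2)[OF mod_hom_closed[OF D(4) x]] ses_comp[OF s x] mod_hom_zero[OF D(11,10) t(1)]
        mod_hom_closed[OF D(4) x] by (simp add: a_minus_def)
    show "r (i x) \<in> carrier L" using mod_hom_closed[OF r(1)] mod_hom_closed[OF D(4) x] by blast
  qed (rule x)
  then show thesis by (rule that[OF ses_retraction[OF s r(1)]])
qed

lemma len_ses:
  assumes s: "ses A L i P p M" and fin: "finite_length A P"
  shows "len A P = len A L + len A M"
proof -
  note D = sesD[OF s]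
  interpret P: right_module A P by (rule D)
  have k: "submodule (a_kernel P M p) A P" by (rule submodule_kernel[OF D(10,11,5)])
  let ?K = "P\<lparr>carrier := a_kernel P M p\<rparr>"
  have "bij_betw i (carrier L) (carrier ?K)" using D(6,8) by (simp add: bij_betw_def)
  moreover have "i \<in> mod_hom A L ?K" using D(4,8) by (auto simp: mod_hom_iff)
  moreover have "finite_length A L" by (rule finite_length_inj[OF D(9,10,4,6) fin])
  ultimately have "len A L = len A ?K" using len_bij[OF D(9) P.restrict_carrier[OF k]] by blast
  then show ?thesis using len_exact[OF D(10,11,5,7) fin] by simp
qed

lemma mod_hom_funpow: "h \<in> mod_hom A M M \<Longrightarrow> (h ^^ n) \<in> mod_hom A M M"
proof (induction n)
  case 0
  then show ?case by (simp add: mod_hom_iff)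
next
  case (Suc n)
  then show ?case using mod_hom_comp[of "h ^^ n" A M M h M] by (simp add: comp_def)
qed

context fd_algebra
begin

lemma finite_length_Mods: "M \<in> Mods \<Longrightarrow> finite_length A M"
  by (simp add: Mods_iff)

lemma right_module_Mods: "M \<in> Mods \<Longrightarrow> right_module A M"
  by (simp add: Mods_iff)

lemma ses_kernel:
  assumes "P \<in> Mods" "M \<in> Mods" "p \<in> mod_hom A P M" "p ` carrier P = carrier M"
  shows "ses A (P\<lparr>carrier := a_kernel P M p\<rparr>) (\<lambda>x. x) P p M"
  using assms kernel_Mods[OF assms(1-3)]
  by (auto simp: ses_def mod_hom_iff a_kernel_def')

lemma ses_cokernel:
  assumes "L \<in> Mods" "P \<in> Mods" "i \<in> mod_hom A L P" "inj_on i (carrier L)"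
  obtains C q where "ses A L i P q C"
proof -
  note rm = assms(1,2)[THEN right_module_Mods]
  have "submodule (i ` carrier L) A P"
    by (rule submodule_image[OF rm assms(3) right_module.submodule_carrier[OF rm(1)]])
  from quotient_Mods[OF assms(2) this] show thesis
    using that assms unfolding ses_def by metis
qed

lemma ses_dsum:
  assumes U: "U \<in> Mods" and V: "V \<in> Mods" and D: "D \<in> Mods" and d: "is_dsum A D U V p q"
  obtains i where "ses A U i D q V"
proof -
  note rm = U[THEN right_module_Mods] V[THEN right_module_Mods] D[THEN right_module_Mods]
  interpret U: right_module A U by (rule rm)
  interpret V: right_module A V by (rule rm)
  interpret D: right_module A D by (rule rm)
  note E = is_dsumE[OF d]
  obtain i j where ij: "i \<in> mod_hom A U D" "j \<in> mod_hom A V D"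
    "\<And>x. x \<in> carrier U \<Longrightarrow> p (i x) = x" "\<And>x. x \<in> carrier U \<Longrightarrow> q (i x) = \<zero>\<^bsub>V\<^esub>"
    "\<And>x. x \<in> carrier V \<Longrightarrow> q (j x) = x" "\<And>x. x \<in> carrier D \<Longrightarrow> i (p x) \<oplus>\<^bsub>D\<^esub> j (q x) = x"
    by (rule is_dsum_injections[OF rm(3,1,2) d]) blast
  have "ses A U i D q V"
  proof (rule sesI[OF U D V ij(1) E(2) _ _ ij(4)])
    fix x assume "x \<in> carrier U" "i x = \<zero>\<^bsub>D\<^esub>"
    then show "x = \<zero>\<^bsub>U\<^esub>" using ij(3)[of x] mod_hom_zero[OF rm(3,1) E(1)] by simp
  next
    fix y assume "y \<in> carrier V"
    then show "\<exists>x\<in>carrier D. q x = y" using ij(5) mod_hom_closed[OF ij(2)] by blast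
  next
    fix x assume x: "x \<in> carrier D" "q x = \<zero>\<^bsub>V\<^esub>"
    have px: "p x \<in> carrier U" using mod_hom_closed[OF E(1)] x by blast
    then have "x = i (p x)" using ij(6)[OF x(1)] x(2) mod_hom_zero[OF rm(2,3) ij(2)] mod_hom_closed[OF ij(1)] by simp
    then show "\<exists>y\<in>carrier U. x = i y" using px by blast
  qed
  then show thesis by (rule that)
qed

lemma len_dsum:
  assumes "U \<in> Mods" "V \<in> Mods" "D \<in> Mods" "is_dsum A D U V p q"
  shows "len A D = len A U + len A V"
proof -
  obtain i where "ses A U i D q V" by (rule ses_dsum[OF assms])
  then show ?thesis by (rule len_ses[OF _ finite_length_Mods[OF assms(3)]])
qed

section \<open>Fitting's lemma and the existence of projective covers\<close>

lemma inj_imp_surj: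
  assumes M: "M \<in> Mods" and h: "h \<in> mod_hom A M M" and inj: "inj_on h (carrier M)"
  shows "h ` carrier M = carrier M"
proof (rule ccontr)
  note rm = right_module_Mods[OF M]
  interpret N: right_module A M by (rule rm)
  assume ne: "h ` carrier M \<noteq> carrier M"
  have s: "submodule (h ` carrier M) A M" by (rule submodule_image[OF rm rm h N.submodule_carrier])
  let ?I = "M\<lparr>carrier := h ` carrier M\<rparr>"
  have "h \<in> mod_hom A M ?I" using h by (auto simp: mod_hom_iff)
  then have "len A M = len A ?I"
    by (rule len_bij[OF rm N.restrict_carrier[OF s] _ _ finite_length_Mods[OF M]]) (simp add: inj bij_betw_def)
  then show False using len_restrict_less[OF rm finite_length_Mods[OF M] s ne] by simp
qed

lemma surj_imp_inj:
  assumes M: "M \<in> Mods" and h: "h \<in> mod_hom A M M" and surj: "h ` carrier M = carrier M"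
  shows "inj_on h (carrier M)"
proof -
  note rm = right_module_Mods[OF M]
  interpret N: right_module A M by (rule rm)
  have k: "submodule (a_kernel M M h) A M" by (rule submodule_kernel[OF rm rm h])
  have "len A (M\<lparr>carrier := a_kernel M M h\<rparr>) = 0"
    using len_exact[OF rm rm h surj finite_length_Mods[OF M]] by simp
  then have "a_kernel M M h = {\<zero>\<^bsub>M\<^esub>}"
    using len_eq_0[OF N.restrict_carrier[OF k]] finite_length_Mods[OF restrict_Mods[OF M k]] by simp
  then show ?thesis unfolding mod_hom_inj_iff[OF rm rm h] by (auto simp: a_kernel_def')
qed

text \<open>Fitting's lemma. Some positive \<open>n\<close> minimises the length of the image of
  \<open>h ^^ n\<close>; then \<open>h ^^ n\<close> is bijective on this image, and \<open>r\<close>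
  is \<open>h ^^ n\<close> followed by the inverse of that bijection. Positivity of \<open>n\<close>
  lets later proofs split off one factor \<open>h\<close>.\<close>

lemma fitting:
  assumes M: "M \<in> Mods" and h: "h \<in> mod_hom A M M"
  obtains n r where "n > 0" "submodule ((h ^^ n) ` carrier M) A M"
    "r \<in> mod_hom A M (M\<lparr>carrier := (h ^^ n) ` carrier M\<rparr>)"
    "\<And>x. x \<in> (h ^^ n) ` carrier M \<Longrightarrow> r x = x"
    "\<And>x. x \<in> carrier M \<Longrightarrow> r x = \<zero>\<^bsub>M\<^esub> \<Longrightarrow> (h ^^ n) x = \<zero>\<^bsub>M\<^esub>"
proof -
  note rm = right_module_Mods[OF M]
  interpret N: right_module A M by (rule rm)
  let ?I = "\<lambda>n. M\<lparr>carrier := (h ^^ n) ` carrier M\<rparr>"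
  note hn = mod_hom_funpow[OF h]
  have s: "submodule ((h ^^ n) ` carrier M) A M" for n
    by (rule submodule_image[OF rm rm hn N.submodule_carrier])
  obtain n where n: "n > 0" "\<And>m. m > 0 \<Longrightarrow> len A (?I n) \<le> len A (?I m)"
    using ex_has_least_nat[of "\<lambda>n. n > 0" 1 "\<lambda>n. len A (?I n)"] by auto
  let ?g = "h ^^ n"
  have gg: "(h ^^ (n + n)) x = ?g (?g x)" for x by (simp add: funpow_add)
  have IM: "?I n \<in> Mods" by (rule restrict_Mods[OF M s])
  have gI: "?g \<in> mod_hom A (?I n) (?I n)"
    using hn[of n] mod_hom_closed[OF hn[of n]] by (auto simp: mod_hom_iff)
  have "?g ` (?g ` carrier M) = ?g ` carrier M"
  proof (rule ccontr)
    have eq: "?g ` (?g ` carrier M) = (h ^^ (n + n)) ` carrier M" by (auto simp: gg image_iff)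
    assume "?g ` (?g ` carrier M) \<noteq> ?g ` carrier M"
    moreover have "submodule ((h ^^ (n + n)) ` carrier M) A (?I n)"
      unfolding N.submodule_restrict[OF s] using s[of "n + n"] mod_hom_closed[OF hn[of n]] by (auto simp: gg)
    ultimately have "len A (?I (n + n)) < len A (?I n)"
      using len_restrict_less[OF N.restrict_carrier[OF s] finite_length_Mods[OF IM], of "(h ^^ (n + n)) ` carrier M"] eq
      by simp
    then show False using n(2)[of "n + n"] n(1) by simp
  qed
  then have surj: "?g ` carrier (?I n) = carrier (?I n)" by simp
  from surj_imp_inj[OF IM gI surj] have inj: "inj_on ?g (carrier (?I n))" .
  have "?g \<in> mod_hom A M (?I n)" using hn[of n] by (auto simp: mod_hom_iff)
  then obtain r where r: "r \<in> mod_hom A M (?I n)" "\<And>x. x \<in> carrier M \<Longrightarrow> ?g (r x) = ?g x"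
    by (rule mod_hom_factor_inj[OF N.restrict_carrier[OF s] gI inj]) (use surj in auto)
  have "r x = x" if "x \<in> ?g ` carrier M" for x
  proof (rule inj_onD[OF inj])
    have "x \<in> carrier M" using that mod_hom_closed[OF hn[of n]] by (auto simp del: funpow.simps)
    then show "?g (r x) = ?g x" "r x \<in> carrier (?I n)" by (fact r(2), fact mod_hom_closed[OF r(1)])
  qed (use that in simp)
  moreover have "?g x = \<zero>\<^bsub>M\<^esub>" if "x \<in> carrier M" "r x = \<zero>\<^bsub>M\<^esub>" for x
    using r(2)[OF that(1)] that(2) mod_hom_zero[OF rm rm hn[of n]] by simp
  ultimately show thesis using that[OF n(1) s r(1)] by blast
qed

lemma retract_inclusion:
  assumes M: "M \<in> Mods" and s: "submodule I A M" and r: "r \<in> mod_hom A M (M\<lparr>carrier := I\<rparr>)"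
    and eq: "\<And>x. x \<in> I \<Longrightarrow> r x = x"
  shows "retract A (M\<lparr>carrier := I\<rparr>) M"
proof -
  interpret N: right_module A M by (rule right_module_Mods[OF M])
  have "(\<lambda>x. x) \<in> mod_hom A (M\<lparr>carrier := I\<rparr>) M"
    using s by (auto simp: mod_hom_iff N.submodule_iff)
  then show ?thesis unfolding retract_def using r eq restrict_Mods[OF M s]
    by (intro conjI bexI[of _ "\<lambda>x. x"] bexI[of _ r]) auto
qed

text \<open>Take a projective \<open>P\<close> of least length that maps onto \<open>M\<close>. If
  \<open>L\<close> and the kernel span \<open>P\<close>, then \<open>p\<close> lifts through
  \<open>L\<close> to an endomorphism \<open>h\<close> with values in \<open>L\<close>. By Fitting's
  lemma the image of a power of \<open>h\<close> is a summand of \<open>P\<close>; it still maps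
  onto \<open>M\<close>, so it is \<open>P\<close> by minimality, and \<open>L\<close> is
  everything.\<close>

lemma projective_cover_exists:
  assumes M: "M \<in> Mods"
  obtains P p where "projective_cover A P p M"
proof -
  let ?S = "\<lambda>P. projective A P \<and> (\<exists>p \<in> mod_hom A P M. p ` carrier P = carrier M)"
  have "\<exists>P. ?S P" by (rule enough_projectives[OF M]) auto
  then obtain P where P: "?S P" "\<And>P'. ?S P' \<Longrightarrow> len A P \<le> len A P'"
    using ex_has_least_nat[of ?S _ "len A"] by metis
  then obtain p where Pp: "projective A P" "p \<in> mod_hom A P M" "p ` carrier P = carrier M" by auto
  have min: "len A P \<le> len A P'" if "projective A P'" "p' \<in> mod_hom A P' M" "p' ` carrier P' = carrier M" for P' p'
    using that by (intro P(2)) auto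
  note PM = projective_Mods[OF Pp(1)]
  note rm = right_module_Mods[OF PM] right_module_Mods[OF M]
  interpret P: right_module A P by (rule rm)
  interpret MM: right_module A M by (rule rm)
  have "superfluous A P (a_kernel P M p)" unfolding superfluous_def
  proof (intro conjI allI impI)
    show "submodule (a_kernel P M p) A P" by (rule submodule_kernel[OF rm Pp(2)])
    fix L assume "submodule L A P \<and> L <+>\<^bsub>P\<^esub> a_kernel P M p = carrier P"
    then have L: "submodule L A P" and sum: "L <+>\<^bsub>P\<^esub> a_kernel P M p = carrier P" by auto
    have Ls: "L \<subseteq> carrier P" using L by (simp add: P.submodule_iff)
    let ?L = "P\<lparr>carrier := L\<rparr>"
    have pL: "p \<in> mod_hom A ?L M" using Pp(2) subsetD[OF Ls] by (simp add: mod_hom_iff)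
    have surjL: "p ` carrier ?L = carrier M"
    proof (intro equalityI subsetI)
      fix y assume "y \<in> carrier M"
      then have "y \<in> p ` carrier P" by (simp add: Pp(3))
      then obtain x where x: "x \<in> carrier P" "p x = y" by auto
      then have "x \<in> L <+>\<^bsub>P\<^esub> a_kernel P M p" by (simp add: sum)
      then obtain l k where "l \<in> L" "k \<in> carrier P" "p k = \<zero>\<^bsub>M\<^esub>" "x = l \<oplus>\<^bsub>P\<^esub> k"
        by (auto simp: set_add_def' a_kernel_def')
      then have "p l = y" using x(2) Ls mod_hom_closed[OF Pp(2)] by (auto simp: mod_hom_add[OF Pp(2)] subset_iff)
      then show "y \<in> p ` carrier ?L" using \<open>l \<in> L\<close> by auto
    qed (use mod_hom_closed[OF pL] in auto)
    from projective_lift[OF Pp(1) restrict_Mods[OF PM L] M pL Pp(2) surjL]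
    obtain h where h: "h \<in> mod_hom A P ?L" "\<forall>x\<in>carrier P. p (h x) = p x" by auto
    have hP: "h \<in> mod_hom A P P" using h(1) subsetD[OF Ls] by (simp add: mod_hom_iff)
    obtain n r where n: "n > 0" and I: "submodule ((h ^^ n) ` carrier P) A P"
      and r: "r \<in> mod_hom A P (P\<lparr>carrier := (h ^^ n) ` carrier P\<rparr>)" "\<And>x. x \<in> (h ^^ n) ` carrier P \<Longrightarrow> r x = x"
      by (rule fitting[OF PM hP]) blast
    let ?I = "P\<lparr>carrier := (h ^^ n) ` carrier P\<rparr>"
    have php: "p ((h ^^ k) x) = p x" if "x \<in> carrier P" for k x
    proof (induction k)
      case (Suc k)
      then show ?case using h(2) mod_hom_closed[OF mod_hom_funpow[OF hP] that, of k] by simp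
    qed simp
    have "projective A ?I" by (rule projective_retract[OF Pp(1) retract_inclusion[OF PM I r]])
    moreover have "p \<in> mod_hom A ?I M"
      using Pp(2) mod_hom_closed[OF mod_hom_funpow[OF hP]] by (auto simp: mod_hom_iff)
    moreover have "p ` carrier ?I = carrier M" using php Pp(3) by (auto simp: image_image)
    ultimately have "len A P \<le> len A ?I" by (rule min)
    then have I_eq: "(h ^^ n) ` carrier P = carrier P"
      using len_restrict_less[OF rm(1) finite_length_Mods[OF PM] I] by linarith
    obtain m where m: "n = Suc m" using n by (cases n) auto
    have "(h ^^ n) x \<in> L" if "x \<in> carrier P" for x
      using mod_hom_closed[OF h(1) mod_hom_closed[OF mod_hom_funpow[OF hP] that, of m]] by (simp add: m)
    then have "(h ^^ n) ` carrier P \<subseteq> L" by (rule image_subsetI)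
    then have "carrier P \<subseteq> L" by (simp only: I_eq)
    with Ls show "L = carrier P" by (rule equalityI)
  qed
  then show thesis using that[of P p] Pp by (simp add: projective_cover_def)
qed

text \<open>Later arguments see the chosen cover only as such a presentation;
  \<open>cls_syzygy_unique\<close> shows that the class of the syzygy depends on nothing
  more.\<close>

lemma syzygy_ses:
  assumes M: "M \<in> Mods"
  obtains P i p where "projective A P" "ses A (syzygy A M) i P p M"
proof -
  obtain P p where "projective_cover A P p M" by (rule projective_cover_exists[OF M])
  then have "case (P, p) of (P, p) \<Rightarrow> projective_cover A P p M" by simp
  then have "case (SOME (P, p). projective_cover A P p M) of (P, p) \<Rightarrow> projective_cover A P p M"
    by (rule someI)
  then obtain Q q where Q: "projective_cover A Q q M" "(SOME (P, p). projective_cover A P p M) = (Q, q)"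
    by (cases "SOME (P, p). projective_cover A P p M") simp
  then have "syzygy A M = Q\<lparr>carrier := a_kernel Q M q\<rparr>" by (simp add: syzygy_def)
  moreover have "ses A (Q\<lparr>carrier := a_kernel Q M q\<rparr>) (\<lambda>x. x) Q q M"
    using Q(1) M by (intro ses_kernel) (auto simp: projective_cover_def projective_Mods)
  ultimately show thesis using that[of Q] Q(1) by (simp add: projective_cover_def)
qed

lemma syzygy_Mods: "M \<in> Mods \<Longrightarrow> syzygy A M \<in> Mods"
  by (rule syzygy_ses) (auto dest: sesD)

end

section \<open>Schanuel's lemma and indecomposable modules\<close>

context fd_algebra
begin

text \<open>One half of Schanuel's lemma: the pullback of a presentation along \<open>p'\<close> splits.\<close>

lemma pullback_split:
  assumes s: "ses A L i P p M" and P': "projective A P'" and p': "p' \<in> mod_hom A P' M"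
    and S: "S \<in> Mods" "is_dsum A S P P' u v"
    and D: "D = S\<lparr>carrier := {x \<in> carrier S. p (u x) = p' (v x)}\<rparr>"
  shows "D \<in> Mods \<and> (\<exists>r. is_dsum A D L P' r v)"
proof
  note sD = sesD[OF s]
  have PM: "P' \<in> Mods" by (rule projective_Mods[OF P'])
  note rS = right_module_Mods[OF S(1)] and rP' = right_module_Mods[OF PM]
  interpret S: right_module A S by (rule rS)
  interpret N: right_module A M by (rule sD)
  interpret P: right_module A P by (rule sD)
  interpret P': right_module A P' by (rule rP')
  note E = is_dsumE[OF S(2)]
  have pu: "(\<lambda>x. p (u x)) \<in> mod_hom A S M" by (rule mod_hom_comp[OF E(1) sD(5)])
  have pv: "(\<lambda>x. p' (v x)) \<in> mod_hom A S M" by (rule mod_hom_comp[OF E(2) p'])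
  have d: "(\<lambda>x. p (u x) \<ominus>\<^bsub>M\<^esub> p' (v x)) \<in> mod_hom A S M" by (rule mod_hom_minus_map[OF sD(11) pu pv])
  have k: "a_kernel S M (\<lambda>x. p (u x) \<ominus>\<^bsub>M\<^esub> p' (v x)) = {x \<in> carrier S. p (u x) = p' (v x)}"
    using mod_hom_closed[OF pu] mod_hom_closed[OF pv] by (auto simp: a_kernel_def' N.M.diff_eq_zero_iff)
  show DM: "D \<in> Mods" using kernel_Mods[OF S(1) sD(3) d] unfolding k D .
  have cD: "x \<in> carrier D \<longleftrightarrow> x \<in> carrier S \<and> p (u x) = p' (v x)" for x by (simp add: D)
  have vD: "v \<in> mod_hom A D P'" using E(2) by (auto simp: mod_hom_iff D)
  obtain j where j: "j \<in> mod_hom A L S" "\<And>x. x \<in> carrier L \<Longrightarrow> u (j x) = i x"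
    "\<And>x. x \<in> carrier L \<Longrightarrow> v (j x) = \<zero>\<^bsub>P'\<^esub>"
    by (rule is_dsum_pair[OF rS S(2) sD(4) mod_hom_zero_map[OF sD(9) rP']]) blast
  have jD: "j \<in> mod_hom A L D" using j mod_hom_zero[OF rP' sD(11) p'] ses_comp[OF s]
    by (auto simp: mod_hom_iff D)
  have "ses A L j D v P'"
  proof (rule sesI[OF sD(1) DM PM jD vD])
    fix x assume "x \<in> carrier L" "j x = \<zero>\<^bsub>D\<^esub>"
    then show "x = \<zero>\<^bsub>L\<^esub>" using ses_inj[OF s, of x] j(2)[of x] mod_hom_zero[OF rS sD(10) E(1)] by (simp add: D)
  next
    fix y assume y: "y \<in> carrier P'"
    obtain z where z: "z \<in> carrier P" "p z = p' y" using ses_surj[OF s mod_hom_closed[OF p' y]] by blast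
    then obtain x where "x \<in> carrier S" "u x = z" "v x = y" using E(4)[of z y] y by blast
    then show "\<exists>x\<in>carrier D. v x = y" using z by (auto simp: D)
  next
    fix x assume x: "x \<in> carrier D" "v x = \<zero>\<^bsub>P'\<^esub>"
    then have "u x \<in> carrier P" "p (u x) = \<zero>\<^bsub>M\<^esub>"
      using mod_hom_closed[OF E(1)] mod_hom_zero[OF rP' sD(11) p'] by (auto simp: D)
    then obtain l where l: "l \<in> carrier L" "u x = i l" using ses_exact[OF s] by blast
    have "x \<in> carrier S" using x(1) by (simp add: D)
    then have "x = j l"
      by (rule E(3)[OF _ mod_hom_closed[OF j(1) l(1)]])
        (simp_all only: j(2,3)[OF l(1)] l(2) x(2))
    then show "\<exists>y\<in>carrier L. x = j y" using l by blast
  qed (rule j(3))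
  note sv = this
  from projective_lift[OF P' DM PM vD mod_hom_id sesD(7)[OF sv]]
  obtain t where t: "t \<in> mod_hom A P' D" "\<forall>x\<in>carrier P'. v (t x) = x" by (rule bexE)
  show "\<exists>r. is_dsum A D L P' r v"
  proof (rule ses_section[OF sv t(1)])
    show "v (t x) = x" if "x \<in> carrier P'" for x using t(2) that by (rule bspec)
  qed (rule exI)
qed

text \<open>\<open>D\<close> is the pullback of \<open>p\<close> and \<open>p'\<close>. Both of its
  projections onto a projective split, so \<open>pullback_split\<close> is applied twice to the same
  module.\<close>

lemma schanuel:
  assumes s: "ses A L i P p M" "projective A P" and s': "ses A L' i' P' p' M" "projective A P'"
  obtains D r v r' v' where "D \<in> Mods" "is_dsum A D L P' r v" "is_dsum A D L' P r' v'"
proof -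
  obtain S u v where S: "S \<in> Mods" "is_dsum A S P P' u v"
    by (rule dsum_Mods[OF sesD(2)[OF s(1)] sesD(2)[OF s'(1)]])
  let ?D = "S\<lparr>carrier := {x \<in> carrier S. p (u x) = p' (v x)}\<rparr>"
  have "?D \<in> Mods \<and> (\<exists>r. is_dsum A ?D L P' r v)"
    by (rule pullback_split[OF s(1) s'(2) sesD(5)[OF s'(1)] S refl])
  moreover have "?D = S\<lparr>carrier := {x \<in> carrier S. p' (v x) = p (u x)}\<rparr>" by (simp add: eq_commute)
  then have "\<exists>r. is_dsum A ?D L' P r u"
    using pullback_split[OF s'(1) s(2) sesD(5)[OF s(1)] S(1) is_dsum_swap[OF S(2)]] by blast
  ultimately show thesis using that by blast
qed

text \<open>Up to a sign, \<open>D\<close> is the pushout of \<open>i\<close> and \<open>i'\<close>,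
  presented as the cokernel of \<open>k\<close>. The module \<open>E\<close> embeds in it with
  cokernel \<open>C'\<close>. That such an embedding splits is the hypothesis \<open>inj\<close>,
  because projectives are shown to be injective only under the assumption of the final
  argument.\<close>

lemma pushout_split:
  assumes s: "ses A M i E q C" and s': "ses A M i' E' q' C'"
    and S: "S \<in> Mods" "is_dsum A S E E' u v"
    and kk: "ses A M k S w D" "\<And>x. x \<in> carrier M \<Longrightarrow> u (k x) = i x" "\<And>x. x \<in> carrier M \<Longrightarrow> v (k x) = i' x"
    and inj: "\<And>N j f. N \<in> Mods \<Longrightarrow> j \<in> mod_hom A E N \<Longrightarrow> inj_on j (carrier E) \<Longrightarrow>
      \<exists>r \<in> mod_hom A N E. \<forall>x\<in>carrier E. r (j x) = x"
  shows "\<exists>r t. is_dsum A D E C' r t"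
proof -
  note sD = sesD[OF s] and sD' = sesD[OF s'] and kD = sesD[OF kk(1)]
  note rS = right_module_Mods[OF S(1)]
  interpret S: right_module A S by (rule rS)
  note E = is_dsumE[OF S(2)]
  obtain a b where ab: "a \<in> mod_hom A E S" "b \<in> mod_hom A E' S"
    "\<And>x. x \<in> carrier E \<Longrightarrow> u (a x) = x" "\<And>x. x \<in> carrier E \<Longrightarrow> v (a x) = \<zero>\<^bsub>E'\<^esub>"
    "\<And>x. x \<in> carrier E' \<Longrightarrow> v (b x) = x" "\<And>x. x \<in> carrier E' \<Longrightarrow> u (b x) = \<zero>\<^bsub>E\<^esub>"
    by (rule is_dsum_injections[OF rS sD(10) sD'(10) S(2)]) blast
  let ?j = "\<lambda>x. w (a x)"
  have j: "?j \<in> mod_hom A E D" by (rule mod_hom_comp[OF ab(1) kD(5)])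
  have qv: "(\<lambda>x. q' (v x)) \<in> mod_hom A S C'" by (rule mod_hom_comp[OF E(2) sD'(5)])
  have "q' (v (k x)) = \<zero>\<^bsub>C'\<^esub>" if "x \<in> carrier M" for x using that kk(3) ses_comp[OF s'] by simp
  then obtain t where t: "t \<in> mod_hom A D C'" "\<And>x. x \<in> carrier S \<Longrightarrow> t (w x) = q' (v x)"
    by (rule ses_colift[OF kk(1) sD'(11) qv]) blast+
  have "ses A E ?j D t C'"
  proof (rule sesI[OF sD(2) kD(3) sD'(3) j t(1)])
    fix x assume x: "x \<in> carrier E" "w (a x) = \<zero>\<^bsub>D\<^esub>"
    then obtain m where m: "m \<in> carrier M" "a x = k m" using ses_exact[OF kk(1) mod_hom_closed[OF ab(1) x(1)]] by blast
    then have "i' m = \<zero>\<^bsub>E'\<^esub>" using kk(3)[of m] ab(4)[OF x(1)] by simp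
    then have "m = \<zero>\<^bsub>M\<^esub>" by (rule ses_inj[OF s' m(1)])
    then show "x = \<zero>\<^bsub>E\<^esub>" using m kk(2)[OF m(1)] ab(3)[OF x(1)] mod_hom_zero[OF sD(9,10,4)] by simp
  next
    fix y assume "y \<in> carrier C'"
    then obtain z where "z \<in> carrier E'" "q' z = y" using ses_surj[OF s'] by blast
    then show "\<exists>x\<in>carrier D. t x = y"
      using t(2) ab(5) mod_hom_closed[OF ab(2)] mod_hom_closed[OF kD(5)] by (intro bexI[of _ "w (b z)"]) auto
  next
    fix x assume "x \<in> carrier E"
    then show "t (w (a x)) = \<zero>\<^bsub>C'\<^esub>"
      using t(2) ab(4) mod_hom_closed[OF ab(1)] mod_hom_zero[OF sD'(10,11,5)] by simp
  next
    fix y assume y: "y \<in> carrier D" "t y = \<zero>\<^bsub>C'\<^esub>"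
    then obtain x where x: "x \<in> carrier S" "w x = y" using ses_surj[OF kk(1)] by blast
    then have "q' (v x) = \<zero>\<^bsub>C'\<^esub>" using t(2)[of x] y(2) by simp
    then obtain m where m: "m \<in> carrier M" "v x = i' m"
      using ses_exact[OF s' mod_hom_closed[OF E(2) x(1)]] by blast
    have c: "k m \<in> carrier S" "x \<ominus>\<^bsub>S\<^esub> k m \<in> carrier S" using x mod_hom_closed[OF kD(4) m(1)] by auto
    let ?e = "u (x \<ominus>\<^bsub>S\<^esub> k m)"
    have e: "?e \<in> carrier E" by (rule mod_hom_closed[OF E(1) c(2)])
    interpret D: right_module A D by (rule kD)
    interpret E': right_module A E' by (rule sD')
    have "x \<ominus>\<^bsub>S\<^esub> k m = a ?e"
    proof (rule E(3)[OF c(2) mod_hom_closed[OF ab(1) e]])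
      show "v (x \<ominus>\<^bsub>S\<^esub> k m) = v (a ?e)"
        using ab(4)[OF e] kk(3)[OF m(1)] m x c mod_hom_closed[OF sD'(4) m(1)]
        by (simp add: mod_hom_diff[OF rS sD'(10) E(2)] E'.M.diff_eq_zero_iff)
    qed (simp add: ab(3)[OF e])
    then have "w (a ?e) = w x \<ominus>\<^bsub>D\<^esub> w (k m)" using x c by (metis mod_hom_diff[OF rS kD(11,5)])
    also have "\<dots> = y" using x y(1) ses_comp[OF kk(1) m(1)] by (simp add: a_minus_def)
    finally show "\<exists>x\<in>carrier E. y = w (a x)" using e by blast
  qed
  note st = this
  from inj[OF kD(3) j sesD(6)[OF st]]
  obtain r where r: "r \<in> mod_hom A D E" "\<forall>x\<in>carrier E. r (?j x) = x" by (rule bexE)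
  have "is_dsum A D E C' r t" by (rule ses_retraction[OF st r(1) bspec[OF r(2)]])
  then show ?thesis by (intro exI)
qed

text \<open>The sums at all three places are prescribed by their projections, so the maps between
  them are built by components and every condition is checked by components.\<close>

lemma dsum_ses:
  assumes s: "ses A L i P p M" and s': "ses A L' i' P' p' M'"
    and N: "N \<in> Mods" "is_dsum A N M M' c d"
    and D: "D \<in> Mods" "is_dsum A D P P' u v"
    and F: "F \<in> Mods" "is_dsum A F L L' a b"
  obtains j q where "ses A F j D q N"
proof -
  note sD = sesD[OF s] and sD' = sesD[OF s']
  note rm = right_module_Mods[OF N(1)] right_module_Mods[OF D(1)] right_module_Mods[OF F(1)]
  note EN = is_dsumE[OF N(2)] and ED = is_dsumE[OF D(2)] and EF = is_dsumE[OF F(2)]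
  interpret N: right_module A N by (rule rm)
  interpret D: right_module A D by (rule rm)
  interpret F: right_module A F by (rule rm)
  obtain q where q: "q \<in> mod_hom A D N" "\<And>x. x \<in> carrier D \<Longrightarrow> c (q x) = p (u x)"
    "\<And>x. x \<in> carrier D \<Longrightarrow> d (q x) = p' (v x)"
    by (rule is_dsum_pair[OF rm(1) N(2) mod_hom_comp[OF ED(1) sD(5)] mod_hom_comp[OF ED(2) sD'(5)]]) blast
  obtain j where j: "j \<in> mod_hom A F D" "\<And>x. x \<in> carrier F \<Longrightarrow> u (j x) = i (a x)"
    "\<And>x. x \<in> carrier F \<Longrightarrow> v (j x) = i' (b x)"
    by (rule is_dsum_pair[OF rm(2) D(2) mod_hom_comp[OF EF(1) sD(4)] mod_hom_comp[OF EF(2) sD'(4)]]) blast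
  have zc: "c \<zero>\<^bsub>N\<^esub> = \<zero>\<^bsub>M\<^esub>" "d \<zero>\<^bsub>N\<^esub> = \<zero>\<^bsub>M'\<^esub>"
    by (rule mod_hom_zero[OF rm(1) sD(11) EN(1)], rule mod_hom_zero[OF rm(1) sD'(11) EN(2)])
  have zu: "u \<zero>\<^bsub>D\<^esub> = \<zero>\<^bsub>P\<^esub>" "v \<zero>\<^bsub>D\<^esub> = \<zero>\<^bsub>P'\<^esub>"
    by (rule mod_hom_zero[OF rm(2) sD(10) ED(1)], rule mod_hom_zero[OF rm(2) sD'(10) ED(2)])
  have za: "a \<zero>\<^bsub>F\<^esub> = \<zero>\<^bsub>L\<^esub>" "b \<zero>\<^bsub>F\<^esub> = \<zero>\<^bsub>L'\<^esub>"
    by (rule mod_hom_zero[OF rm(3) sD(9) EF(1)], rule mod_hom_zero[OF rm(3) sD'(9) EF(2)])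
  have "ses A F j D q N"
  proof (rule sesI[OF F(1) D(1) N(1) j(1) q(1)])
    fix x assume x: "x \<in> carrier F" "j x = \<zero>\<^bsub>D\<^esub>"
    have "i (a x) = \<zero>\<^bsub>P\<^esub>" "i' (b x) = \<zero>\<^bsub>P'\<^esub>" using j(2,3)[OF x(1)] x(2) zu by auto
    then have "a x = \<zero>\<^bsub>L\<^esub>" "b x = \<zero>\<^bsub>L'\<^esub>"
      using ses_inj[OF s mod_hom_closed[OF EF(1) x(1)]] ses_inj[OF s' mod_hom_closed[OF EF(2) x(1)]] by blast+
    then show "x = \<zero>\<^bsub>F\<^esub>" by (intro EF(3)[OF x(1) F.M.zero_closed]) (simp_all only: za)
  next
    fix y assume y: "y \<in> carrier N"
    obtain z where z: "z \<in> carrier P" "p z = c y" using ses_surj[OF s mod_hom_closed[OF EN(1) y]] by blast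
    obtain z' where z': "z' \<in> carrier P'" "p' z' = d y" using ses_surj[OF s' mod_hom_closed[OF EN(2) y]] by blast
    obtain x where x: "x \<in> carrier D" "u x = z" "v x = z'" using ED(4)[OF z(1) z'(1)] by blast
    have "q x = y"
      by (rule EN(3)[OF mod_hom_closed[OF q(1) x(1)] y])
        (simp_all only: q(2,3)[OF x(1)] x(2,3) z(2) z'(2))
    then show "\<exists>x\<in>carrier D. q x = y" using x by blast
  next
    fix x assume x: "x \<in> carrier F"
    note jx = mod_hom_closed[OF j(1) x]
    show "q (j x) = \<zero>\<^bsub>N\<^esub>"
      by (rule EN(3)[OF mod_hom_closed[OF q(1) jx] N.M.zero_closed])
        (simp_all only: q(2,3)[OF jx] j(2,3)[OF x] zc ses_comp[OF s mod_hom_closed[OF EF(1) x]]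
          ses_comp[OF s' mod_hom_closed[OF EF(2) x]])
  next
    fix x assume x: "x \<in> carrier D" "q x = \<zero>\<^bsub>N\<^esub>"
    obtain l where l: "l \<in> carrier L" "u x = i l"
      using ses_exact[OF s mod_hom_closed[OF ED(1) x(1)]] q(2)[OF x(1)] x(2) zc by auto
    obtain l' where l': "l' \<in> carrier L'" "v x = i' l'"
      using ses_exact[OF s' mod_hom_closed[OF ED(2) x(1)]] q(3)[OF x(1)] x(2) zc by auto
    obtain y where y: "y \<in> carrier F" "a y = l" "b y = l'" using EF(4)[OF l(1) l'(1)] by blast
    have "x = j y"
      by (rule ED(3)[OF x(1) mod_hom_closed[OF j(1) y(1)]])
        (simp_all only: j(2,3)[OF y(1)] y(2,3) l(2) l'(2))
    then show "\<exists>y\<in>carrier F. x = j y" using y by blast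
  qed
  then show thesis by (rule that)
qed

section \<open>Retracts, local endomorphism rings and decompositions\<close>

lemma retract_intro:
  assumes "N \<in> Mods" "i \<in> mod_hom A N M" "r \<in> mod_hom A M N"
    and "\<And>x. x \<in> carrier N \<Longrightarrow> r (i x) = x"
  shows "retract A N M"
  unfolding retract_def by (intro conjI bexI[OF _ assms(2)] bexI[OF _ assms(3)] ballI assms(1,4))

text \<open>Composing \<open>r\<close> with the inverse of the automorphism \<open>r\<close> after
  \<open>i\<close> gives an honest retraction.\<close>

lemma retractI:
  assumes "N \<in> Mods" "M \<in> Mods" "i \<in> mod_hom A N M" "r \<in> mod_hom A M N"
    and bij: "bij_betw (\<lambda>x. r (i x)) (carrier N) (carrier N)"
  shows "retract A N M"
proof -
  let ?g = "\<lambda>x. r (i x)"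
  have g: "?g \<in> mod_hom A N N" by (rule mod_hom_comp[OF assms(3,4)])
  have "inv_into (carrier N) ?g \<in> mod_hom A N N"
    by (rule mod_hom_inv[OF right_module_Mods[OF assms(1)] g bij])
  from mod_hom_comp[OF assms(4) this] have "(\<lambda>x. inv_into (carrier N) ?g (r x)) \<in> mod_hom A M N" .
  moreover have "inv_into (carrier N) ?g (r (i x)) = x" if "x \<in> carrier N" for x
    using that bij inv_into_f_f[of ?g "carrier N" x] by (simp add: bij_betw_def)
  ultimately show ?thesis by (rule retract_intro[OF assms(1,3)])
qed

lemma retract_trans:
  assumes "retract A N M" "retract A M L" shows "retract A N L"
proof -
  obtain i r where ir: "i \<in> mod_hom A N M" "r \<in> mod_hom A M N" "\<And>x. x \<in> carrier N \<Longrightarrow> r (i x) = x"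
    using assms(1) unfolding retract_def by blast
  obtain j s where js: "j \<in> mod_hom A M L" "s \<in> mod_hom A L M" "\<And>x. x \<in> carrier M \<Longrightarrow> s (j x) = x"
    using assms(2) unfolding retract_def by blast
  have "r (s (j (i x))) = x" if "x \<in> carrier N" for x
    using that ir js mod_hom_closed[OF ir(1) that] by simp
  moreover have "N \<in> Mods" using assms(1) by (simp add: retract_def)
  ultimately show ?thesis
    by (intro retract_intro[OF _ mod_hom_comp[OF ir(1) js(1)] mod_hom_comp[OF js(2) ir(2)]])
qed

lemma retract_dsum:
  assumes "U \<in> Mods" "V \<in> Mods" "D \<in> Mods" "is_dsum A D U V p q"
  shows "retract A U D" "retract A V D"
proof -
  note rm = assms(1-3)[THEN right_module_Mods]
  obtain i j where ij: "i \<in> mod_hom A U D" "j \<in> mod_hom A V D"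
    "\<And>x. x \<in> carrier U \<Longrightarrow> p (i x) = x" "\<And>x. x \<in> carrier V \<Longrightarrow> q (j x) = x"
    by (rule is_dsum_injections[OF rm(3,1,2) assms(4)]) blast
  show "retract A U D" by (rule retract_intro[OF assms(1) ij(1) is_dsumE(1)[OF assms(4)]]) (rule ij(3))
  show "retract A V D" by (rule retract_intro[OF assms(2) ij(2) is_dsumE(2)[OF assms(4)]]) (rule ij(4))
qed

lemma retract_complement:
  assumes M: "M \<in> Mods" and "retract A N M"
  obtains N' r s where "N' \<in> Mods" "is_dsum A M N N' r s"
proof -
  obtain i r where ir: "N \<in> Mods" "i \<in> mod_hom A N M" "r \<in> mod_hom A M N" "\<And>x. x \<in> carrier N \<Longrightarrow> r (i x) = x"
    using assms(2) unfolding retract_def by blast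
  show thesis
    by (rule that[OF kernel_Mods[OF M ir(1,3)]
      is_dsum_of_retraction[OF right_module_Mods[OF M] right_module_Mods[OF ir(1)] ir(2,3)]]) (rule ir(4))
qed

lemma indecomposableD:
  assumes "indecomposable A N"
  shows "N \<in> Mods" "carrier N \<noteq> {\<zero>\<^bsub>N\<^esub>}"
    "\<And>U V p q. U \<in> Mods \<Longrightarrow> V \<in> Mods \<Longrightarrow> is_dsum A N U V p q \<Longrightarrow> carrier U = {\<zero>\<^bsub>U\<^esub>} \<or> carrier V = {\<zero>\<^bsub>V\<^esub>}"
  using assms unfolding indecomposable_def mod_isomorphic_direct_sum_iff by blast+

text \<open>Fitting's lemma splits \<open>N\<close> into the image of a power of \<open>h\<close>
  and a submodule killed by that power; one of the two vanishes.\<close>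

lemma indecomposable_endo:
  assumes N: "indecomposable A N" and h: "h \<in> mod_hom A N N"
  shows "bij_betw h (carrier N) (carrier N) \<or> (\<exists>n. \<forall>x\<in>carrier N. (h ^^ n) x = \<zero>\<^bsub>N\<^esub>)"
proof -
  note NM = indecomposableD(1)[OF N]
  note rm = right_module_Mods[OF NM]
  interpret N: right_module A N by (rule rm)
  obtain n r where n: "n > 0" and I: "submodule ((h ^^ n) ` carrier N) A N"
    and r: "r \<in> mod_hom A N (N\<lparr>carrier := (h ^^ n) ` carrier N\<rparr>)" "\<And>x. x \<in> (h ^^ n) ` carrier N \<Longrightarrow> r x = x"
      "\<And>x. x \<in> carrier N \<Longrightarrow> r x = \<zero>\<^bsub>N\<^esub> \<Longrightarrow> (h ^^ n) x = \<zero>\<^bsub>N\<^esub>"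
    by (rule fitting[OF NM h]) blast
  let ?I = "N\<lparr>carrier := (h ^^ n) ` carrier N\<rparr>"
  have IM: "?I \<in> Mods" by (rule restrict_Mods[OF NM I])
  have incl: "(\<lambda>x. x) \<in> mod_hom A ?I N" using I by (auto simp: mod_hom_iff N.submodule_iff)
  have ds: "is_dsum A N ?I (N\<lparr>carrier := a_kernel N ?I r\<rparr>) r (\<lambda>x. x \<ominus>\<^bsub>N\<^esub> r x)"
    by (rule is_dsum_of_retraction[OF rm right_module_Mods[OF IM] incl r(1)]) (use r(2) in simp)
  have "(h ^^ n) ` carrier N = {\<zero>\<^bsub>N\<^esub>} \<or> a_kernel N ?I r = {\<zero>\<^bsub>N\<^esub>}"
    using indecomposableD(3)[OF N IM kernel_Mods[OF NM IM r(1)] ds] by simp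
  then show ?thesis
  proof
    assume "(h ^^ n) ` carrier N = {\<zero>\<^bsub>N\<^esub>}"
    then show ?thesis by (intro disjI2 exI[of _ n]) auto
  next
    assume k: "a_kernel N ?I r = {\<zero>\<^bsub>N\<^esub>}"
    have "inj_on r (carrier N)"
      unfolding mod_hom_inj_iff[OF rm right_module_Mods[OF IM] r(1)] using k by (auto simp: a_kernel_def')
    moreover have "r ((h ^^ n) x) = (h ^^ n) x" if "x \<in> carrier N" for x using r(2) that by auto
    ultimately have surj: "(h ^^ n) ` carrier N = carrier N"
    proof (intro equalityI subsetI)
      fix x assume inj: "inj_on r (carrier N)" and fx: "\<And>x. x \<in> carrier N \<Longrightarrow> r ((h ^^ n) x) = (h ^^ n) x"
        and x: "x \<in> carrier N"
      have rx: "r x \<in> (h ^^ n) ` carrier N" using mod_hom_closed[OF r(1) x] by simp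
      have "r (r x) = r x" by (rule r(2)[OF rx])
      moreover have "r x \<in> carrier N" using rx mod_hom_closed[OF mod_hom_funpow[OF h]] by auto
      ultimately have "r x = x" using inj x by (auto dest: inj_onD)
      then show "x \<in> (h ^^ n) ` carrier N" using rx by simp
    qed (use mod_hom_closed[OF mod_hom_funpow[OF h]] in auto)
    obtain m where m: "n = Suc m" using n by (cases n) auto
    have "carrier N \<subseteq> h ` carrier N"
    proof
      fix x assume "x \<in> carrier N"
      then have "x \<in> (h ^^ n) ` carrier N" using surj by simp
      then show "x \<in> h ` carrier N" using mod_hom_closed[OF mod_hom_funpow[OF h, of m]] by (auto simp: m)
    qed
    then have "h ` carrier N = carrier N" using mod_hom_closed[OF h] by auto
    with surj_imp_inj[OF NM h this] show ?thesis by (simp add: bij_betw_def)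
  qed
qed

text \<open>If \<open>b\<close> is not bijective it is nilpotent. An element killed by
  \<open>a\<close> is then fixed by \<open>b\<close>, hence by all powers of \<open>b\<close>, hence
  zero; so \<open>a\<close> is injective and, by length, bijective.\<close>

lemma indecomposable_local:
  assumes N: "indecomposable A N" and a: "a \<in> mod_hom A N N" and b: "b \<in> mod_hom A N N"
    and one: "\<And>x. x \<in> carrier N \<Longrightarrow> a x \<oplus>\<^bsub>N\<^esub> b x = x"
  shows "bij_betw a (carrier N) (carrier N) \<or> bij_betw b (carrier N) (carrier N)"
proof (rule disjCI)
  note NM = indecomposableD(1)[OF N]
  note rm = right_module_Mods[OF NM]
  interpret N: right_module A N by (rule rm)
  assume "\<not> bij_betw b (carrier N) (carrier N)"
  then obtain n where n: "\<And>x. x \<in> carrier N \<Longrightarrow> (b ^^ n) x = \<zero>\<^bsub>N\<^esub>"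
    using indecomposable_endo[OF N b] by blast
  have "inj_on a (carrier N)" unfolding mod_hom_inj_iff[OF rm rm a]
  proof (intro ballI impI)
    fix x assume x: "x \<in> carrier N" "a x = \<zero>\<^bsub>N\<^esub>"
    then have "b x = x" using one[OF x(1)] mod_hom_closed[OF b x(1)] by simp
    then have "(b ^^ n) x = x" by (induction n) auto
    then show "x = \<zero>\<^bsub>N\<^esub>" using n[OF x(1)] by simp
  qed
  with inj_imp_surj[OF NM a this] show "bij_betw a (carrier N) (carrier N)" by (simp add: bij_betw_def)
qed

text \<open>This exchange property does the work of the Krull-Schmidt theorem. The identity of
  \<open>N\<close> is the sum of two endomorphisms, one through \<open>U\<close> and one through
  \<open>V\<close>, and locality makes one of them bijective.\<close>

lemma indecomposable_retract_dsum:
  assumes N: "indecomposable A N" and ND: "retract A N D"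
    and D: "D \<in> Mods" and U: "U \<in> Mods" and V: "V \<in> Mods" and d: "is_dsum A D U V p q"
  shows "retract A N U \<or> retract A N V"
proof -
  note NM = indecomposableD(1)[OF N]
  note rm = right_module_Mods[OF D] right_module_Mods[OF U] right_module_Mods[OF V]
  obtain i r where ir: "i \<in> mod_hom A N D" "r \<in> mod_hom A D N" "\<And>x. x \<in> carrier N \<Longrightarrow> r (i x) = x"
    using ND unfolding retract_def by blast
  obtain e f where ef: "e \<in> mod_hom A U D" "f \<in> mod_hom A V D"
    "\<And>x. x \<in> carrier D \<Longrightarrow> e (p x) \<oplus>\<^bsub>D\<^esub> f (q x) = x"
    by (rule is_dsum_injections[OF rm d]) blast
  note E = is_dsumE(1,2)[OF d]
  have pi: "(\<lambda>x. p (i x)) \<in> mod_hom A N U" by (rule mod_hom_comp[OF ir(1) E(1)])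
  have qi: "(\<lambda>x. q (i x)) \<in> mod_hom A N V" by (rule mod_hom_comp[OF ir(1) E(2)])
  have re: "(\<lambda>x. r (e x)) \<in> mod_hom A U N" by (rule mod_hom_comp[OF ef(1) ir(2)])
  have rf: "(\<lambda>x. r (f x)) \<in> mod_hom A V N" by (rule mod_hom_comp[OF ef(2) ir(2)])
  have "r (e (p (i x))) \<oplus>\<^bsub>N\<^esub> r (f (q (i x))) = x" if x: "x \<in> carrier N" for x
  proof -
    have ix: "i x \<in> carrier D" by (rule mod_hom_closed[OF ir(1) x])
    have "r (e (p (i x)) \<oplus>\<^bsub>D\<^esub> f (q (i x))) = r (e (p (i x))) \<oplus>\<^bsub>N\<^esub> r (f (q (i x)))"
      by (rule mod_hom_add[OF ir(2) mod_hom_closed[OF ef(1) mod_hom_closed[OF E(1) ix]]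
        mod_hom_closed[OF ef(2) mod_hom_closed[OF E(2) ix]]])
    then show ?thesis using ef(3)[OF ix] ir(3)[OF x] by simp
  qed
  from indecomposable_local[OF N mod_hom_comp[OF pi re] mod_hom_comp[OF qi rf] this]
  show ?thesis using retractI[OF NM U pi re] retractI[OF NM V qi rf] by blast
qed

lemma retract_indecomposable:
  assumes M: "indecomposable A M" and N: "retract A N M" "carrier N \<noteq> {\<zero>\<^bsub>N\<^esub>}"
  shows "mod_isomorphic A N M"
proof -
  note MM = indecomposableD(1)[OF M]
  note rm = right_module_Mods[OF MM]
  obtain i r where ir: "N \<in> Mods" "i \<in> mod_hom A N M" "r \<in> mod_hom A M N" "\<And>x. x \<in> carrier N \<Longrightarrow> r (i x) = x"
    using N(1) unfolding retract_def by blast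
  note rN = right_module_Mods[OF ir(1)]
  have "is_dsum A M N (M\<lparr>carrier := a_kernel M N r\<rparr>) r (\<lambda>x. x \<ominus>\<^bsub>M\<^esub> i (r x))"
    by (rule is_dsum_of_retraction[OF rm rN ir(2,3)]) (rule ir(4))
  from indecomposableD(3)[OF M ir(1) kernel_Mods[OF MM ir(1,3)] this]
  have "a_kernel M N r = {\<zero>\<^bsub>M\<^esub>}" using N(2) by simp
  then have inj: "inj_on r (carrier M)"
    unfolding mod_hom_inj_iff[OF rm rN ir(3)] by (auto simp: a_kernel_def')
  have "bij_betw i (carrier N) (carrier M)"
  proof (rule bij_betw_byWitness[of _ r])
    show "\<forall>y\<in>carrier M. i (r y) = y"
    proof
      fix y assume y: "y \<in> carrier M"
      have ry: "r y \<in> carrier N" by (rule mod_hom_closed[OF ir(3) y])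
      show "i (r y) = y" by (rule inj_onD[OF inj ir(4)[OF ry] mod_hom_closed[OF ir(2) ry] y])
    qed
    show "\<forall>x\<in>carrier N. r (i x) = x" by (intro ballI ir(4))
    show "i ` carrier N \<subseteq> carrier M" "r ` carrier M \<subseteq> carrier N"
      by (intro image_subsetI mod_hom_closed[OF ir(2)], assumption)
        (intro image_subsetI mod_hom_closed[OF ir(3)], assumption)
  qed
  then show ?thesis using ir(2) by (auto simp: mod_isomorphic_def)
qed

text \<open>Both terms of a nontrivial decomposition are shorter. This induction is used in place of
  decompositions into finite families of indecomposables.\<close>

lemma decomposition_induct [consumes 1, case_names trivial indecomposable dsum]:
  assumes "M \<in> Mods"
    and triv: "\<And>M. M \<in> Mods \<Longrightarrow> carrier M = {\<zero>\<^bsub>M\<^esub>} \<Longrightarrow> Q M"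
    and indec: "\<And>M. indecomposable A M \<Longrightarrow> Q M"
    and dsum: "\<And>M U V p q. M \<in> Mods \<Longrightarrow> U \<in> Mods \<Longrightarrow> V \<in> Mods \<Longrightarrow> is_dsum A M U V p q \<Longrightarrow> Q U \<Longrightarrow> Q V \<Longrightarrow> Q M"
  shows "Q M"
  using assms(1)
proof (induction "len A M" arbitrary: M rule: less_induct)
  case less
  show ?case
  proof (cases "carrier M = {\<zero>\<^bsub>M\<^esub>} \<or> indecomposable A M")
    case True
    then show ?thesis using triv indec less.prems by blast
  next
    case False
    then obtain U V p q where U: "U \<in> Mods" "carrier U \<noteq> {\<zero>\<^bsub>U\<^esub>}" and V: "V \<in> Mods" "carrier V \<noteq> {\<zero>\<^bsub>V\<^esub>}"
      and d: "is_dsum A M U V p q"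
      using less.prems unfolding indecomposable_def mod_isomorphic_direct_sum_iff by blast
    have "len A U \<noteq> 0" "len A V \<noteq> 0"
      using len_eq_0[OF right_module_Mods finite_length_Mods] U V by blast+
    then have "len A U < len A M" "len A V < len A M"
      using len_dsum[OF U(1) V(1) less.prems d] by linarith+
    then show ?thesis using less.hyps U V d less.prems by (intro dsum[of M U V p q]) auto
  qed
qed

text \<open>By the exchange property an indecomposable summand of a sum is a summand of one of the
  terms, so the lists for the two terms can be joined. It makes \<open>add_subgroup\<close> finitely
  generated and the number of simple modules finite.\<close>

lemma finite_indecomposable_retracts:
  assumes "M \<in> Mods"
  shows "\<exists>F. finite F \<and> F \<subseteq> Mods \<and> (\<forall>N. indecomposable A N \<longrightarrow> retract A N M \<longrightarrow> (\<exists>Y\<in>F. mod_isomorphic A N Y))"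
  using assms
proof (induction rule: decomposition_induct)
  case (trivial M)
  have "\<not> retract A N M" if "indecomposable A N" for N
  proof
    assume "retract A N M"
    then obtain i r where ir: "i \<in> mod_hom A N M" "r \<in> mod_hom A M N" "\<And>x. x \<in> carrier N \<Longrightarrow> r (i x) = x"
      unfolding retract_def by blast
    note NM = indecomposableD(1)[OF that]
    interpret N: right_module A N by (rule right_module_Mods[OF NM])
    have "x = \<zero>\<^bsub>N\<^esub>" if "x \<in> carrier N" for x
      using ir(3)[OF that] mod_hom_closed[OF ir(1) that] trivial(2)
        mod_hom_zero[OF right_module_Mods[OF trivial(1)] right_module_Mods[OF NM] ir(2)] by simp
    then show False using indecomposableD(2)[OF that] N.M.zero_closed by blast
  qed
  then show ?case by (intro exI[of _ "{}"]) auto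
next
  case (indecomposable M)
  show ?case
  proof (intro exI[of _ "{M}"] conjI allI impI)
    fix N assume "indecomposable A N" "retract A N M"
    then show "\<exists>Y\<in>{M}. mod_isomorphic A N Y"
      using retract_indecomposable[OF indecomposable] indecomposableD(2) by blast
  qed (use indecomposableD(1)[OF indecomposable] in auto)
next
  case (dsum M U V p q)
  then obtain F G where F: "finite F" "F \<subseteq> Mods" "\<forall>N. indecomposable A N \<longrightarrow> retract A N U \<longrightarrow> (\<exists>Y\<in>F. mod_isomorphic A N Y)"
    and G: "finite G" "G \<subseteq> Mods" "\<forall>N. indecomposable A N \<longrightarrow> retract A N V \<longrightarrow> (\<exists>Y\<in>G. mod_isomorphic A N Y)"
    by metis
  show ?case
  proof (intro exI[of _ "F \<union> G"] conjI allI impI)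
    fix N assume "indecomposable A N" "retract A N M"
    then show "\<exists>Y\<in>F \<union> G. mod_isomorphic A N Y"
      using indecomposable_retract_dsum[OF _ _ dsum(1-4)] F(3) G(3) by blast
  qed (use F G in auto)
qed

end

section \<open>The group \<open>K\<^sub>0\<close>\<close>

lemma hom_eq_on_generate:
  assumes G: "group G" and H: "group H" and "f \<in> hom G H" "g \<in> hom G H" and S: "S \<subseteq> carrier G"
    and eq: "\<And>x. x \<in> S \<Longrightarrow> f x = g x" and x: "x \<in> generate G S"
  shows "f x = g x"
proof -
  interpret f: group_hom G H f by (intro group_hom.intro group_hom_axioms.intro assms)
  interpret g: group_hom G H g by (intro group_hom.intro group_hom_axioms.intro assms)
  show ?thesis using x
  proof (induction rule: generate.induct)
    case (inv h)
    then show ?case using S eq by (metis f.hom_inv g.hom_inv subsetD)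
  next
    case (eng h1 h2)
    then show ?case using f.G.generate_in_carrier[OF S] by simp
  qed (use eq in auto)
qed

context fd_algebra
begin

abbreviation FG :: "(('a, nat \<Rightarrow> 'a) module \<Rightarrow>\<^sub>0 int) monoid" where "FG \<equiv> free_Abelian_group Mods"

abbreviation cls :: "('a, nat \<Rightarrow> 'a) module \<Rightarrow> (('a, nat \<Rightarrow> 'a) module \<Rightarrow>\<^sub>0 int) set" where
  "cls M \<equiv> K0_class A M"

lemma K0_relations_subset: "K0_relations A \<subseteq> carrier FG"
proof
  fix x assume "x \<in> K0_relations A"
  then consider M M' M'' where "M \<in> Mods" "M' \<in> Mods" "M'' \<in> Mods" "x = frag_of M - frag_of M' - frag_of M''"
    | P where "P \<in> Mods" "x = frag_of P"
    unfolding K0_relations_def using projective_Mods by blast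
  then show "x \<in> carrier FG"
  proof cases
    case 1
    have "Poly_Mapping.keys x \<subseteq> Poly_Mapping.keys (frag_of M) \<union> Poly_Mapping.keys (frag_of M') \<union> Poly_Mapping.keys (frag_of M'')"
      unfolding 1(4) using keys_diff[of "frag_of M - frag_of M'" "frag_of M''"] keys_diff[of "frag_of M" "frag_of M'"] by blast
    then show ?thesis using 1 by auto
  qed auto
qed

lemma subgroup_K0_subgroup: "subgroup (K0_subgroup A) FG"
  unfolding K0_subgroup_def
  by (rule group.generate_is_subgroup[OF group_free_Abelian_group K0_relations_subset])

lemma K0_subgroup_normal: "K0_subgroup A \<lhd> FG"
  by (rule comm_group.subgroup_imp_normal[OF abelian_free_Abelian_group subgroup_K0_subgroup])

lemma comm_group_K0: "comm_group (K0 A)"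
  unfolding K0_def
  by (rule comm_group.abelian_FactGroup[OF abelian_free_Abelian_group subgroup_K0_subgroup])

lemma group_K0: "group (K0 A)"
  using comm_group_K0 by (simp add: comm_group_def)

lemma K0_proj_hom: "(\<lambda>x. K0_subgroup A #>\<^bsub>FG\<^esub> x) \<in> hom FG (K0 A)"
  unfolding K0_def by (rule normal.r_coset_hom_Mod[OF K0_subgroup_normal])

lemma K0_proj_relation:
  assumes "x \<in> K0_relations A" shows "K0_subgroup A #>\<^bsub>FG\<^esub> x = \<one>\<^bsub>K0 A\<^esub>"
proof -
  have "x \<in> K0_subgroup A" unfolding K0_subgroup_def by (rule generate.incl[OF assms])
  then show ?thesis unfolding K0_def one_FactGroup
    by (rule subgroup.rcos_const[OF subgroup_K0_subgroup group_free_Abelian_group])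
qed

lemma cls_closed [simp]: "M \<in> Mods \<Longrightarrow> cls M \<in> carrier (K0 A)"
  unfolding K0_class_def by (rule hom_in_carrier[OF K0_proj_hom]) simp

lemma cls_dsum:
  assumes "U \<in> Mods" "V \<in> Mods" "D \<in> Mods" "is_dsum A D U V p q"
  shows "cls D = cls U \<otimes>\<^bsub>K0 A\<^esub> cls V"
proof -
  interpret G: comm_group "K0 A" by (rule comm_group_K0)
  interpret h: group_hom FG "K0 A" "\<lambda>x. K0_subgroup A #>\<^bsub>FG\<^esub> x"
    by (intro group_hom.intro group_hom_axioms.intro group_free_Abelian_group group_K0 K0_proj_hom)
  let ?x = "frag_of D - frag_of U - frag_of V"
  have "?x \<in> K0_relations A" unfolding K0_relations_def mod_isomorphic_direct_sum_iff using assms by blast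
  then have c: "?x \<in> carrier FG" and 1: "K0_subgroup A #>\<^bsub>FG\<^esub> ?x = \<one>\<^bsub>K0 A\<^esub>"
    by (rule subsetD[OF K0_relations_subset], rule K0_proj_relation)
  have f: "frag_of U \<in> carrier FG" "frag_of V \<in> carrier FG" using assms by simp_all
  have "frag_of D = ?x \<otimes>\<^bsub>FG\<^esub> (frag_of U \<otimes>\<^bsub>FG\<^esub> frag_of V)" by simp
  then have "cls D = (K0_subgroup A #>\<^bsub>FG\<^esub> ?x) \<otimes>\<^bsub>K0 A\<^esub> (cls U \<otimes>\<^bsub>K0 A\<^esub> cls V)"
    unfolding K0_class_def using h.hom_mult[OF c h.G.m_closed[OF f]] h.hom_mult[OF f] by metis
  then show ?thesis using assms by (simp add: 1)
qed

lemma cls_projective: "projective A P \<Longrightarrow> cls P = \<one>\<^bsub>K0 A\<^esub>"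
  unfolding K0_class_def by (rule K0_proj_relation) (auto simp: K0_relations_def)

text \<open>The three homomorphisms out of \<open>K0 A\<close> that the proof constructs all come
  from here: the syzygy map, the dimension of \<open>Ext(-, W)\<close>, and the cosyzygy
  map.\<close>

lemma K0_universal:
  assumes H: "comm_group H" and F: "\<And>M. M \<in> Mods \<Longrightarrow> F M \<in> carrier H"
    and ds: "\<And>D U V p q. D \<in> Mods \<Longrightarrow> U \<in> Mods \<Longrightarrow> V \<in> Mods \<Longrightarrow> is_dsum A D U V p q \<Longrightarrow> F D = F U \<otimes>\<^bsub>H\<^esub> F V"
    and pr: "\<And>P. projective A P \<Longrightarrow> F P = \<one>\<^bsub>H\<^esub>"
  obtains h where "h \<in> hom (K0 A) H" "\<And>M. M \<in> Mods \<Longrightarrow> h (cls M) = F M"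
proof -
  interpret H: comm_group H by (rule H)
  have "F ` Mods \<subseteq> carrier H" using F by blast
  then obtain g where g: "g \<in> hom FG H" "\<And>M. M \<in> Mods \<Longrightarrow> g (frag_of M) = F M"
    by (rule H.free_Abelian_group_universal[of F Mods]) blast
  interpret g: group_hom FG H g
    by (intro group_hom.intro group_hom_axioms.intro group_free_Abelian_group H.is_group g)
  have rel: "g x = \<one>\<^bsub>H\<^esub>" if x: "x \<in> K0_relations A" for x
  proof -
    from x consider M M' M'' where "M \<in> Mods" "M' \<in> Mods" "M'' \<in> Mods" "x = frag_of M - frag_of M' - frag_of M''"
        "mod_isomorphic A M (direct_sum M' M'')"
      | P where "projective A P" "x = frag_of P"
      unfolding K0_relations_def by blast
    then show ?thesis
    proof cases
      case 1
      then obtain p q where "is_dsum A M M' M'' p q" by (auto simp: mod_isomorphic_direct_sum_iff)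
      then have "F M = F M' \<otimes>\<^bsub>H\<^esub> F M''" by (rule ds[OF 1(1-3)])
      moreover have "x \<in> carrier FG" using x K0_relations_subset by blast
      moreover have "frag_of M = x \<otimes>\<^bsub>FG\<^esub> (frag_of M' \<otimes>\<^bsub>FG\<^esub> frag_of M'')" using 1(4) by simp
      moreover have c: "frag_of M' \<in> carrier FG" "frag_of M'' \<in> carrier FG" using 1 by simp_all
      ultimately have "F M' \<otimes>\<^bsub>H\<^esub> F M'' = g x \<otimes>\<^bsub>H\<^esub> (F M' \<otimes>\<^bsub>H\<^esub> F M'')"
        using g(2) 1(1-3) g.hom_mult[OF _ g.G.m_closed[OF c]] g.hom_mult[OF c] by metis
      moreover have "g x \<in> carrier H" by (rule g.hom_closed) fact
      ultimately show ?thesis using F[OF 1(2)] F[OF 1(3)] by (metis H.m_closed H.r_cancel_one')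
    next
      case 2
      then show ?thesis using g(2)[OF projective_Mods] pr by simp
    qed
  qed
  have sub: "g x = \<one>\<^bsub>H\<^esub>" if "x \<in> K0_subgroup A" for x
    by (rule hom_eq_on_generate[where g = "\<lambda>_. \<one>\<^bsub>H\<^esub>",
        OF g.G.is_group H.is_group g(1) _ K0_relations_subset rel that[unfolded K0_subgroup_def]])
      (auto simp: hom_def)
  have "g x = g y" if xy: "x \<in> carrier FG" "y \<in> carrier FG" "K0_subgroup A #>\<^bsub>FG\<^esub> x = K0_subgroup A #>\<^bsub>FG\<^esub> y" for x y
  proof -
    have "x \<in> K0_subgroup A #>\<^bsub>FG\<^esub> y"
      using g.G.rcos_self[OF xy(1) subgroup_K0_subgroup] xy(3) by simp
    then obtain z where z: "z \<in> K0_subgroup A" "x = z \<otimes>\<^bsub>FG\<^esub> y" by (auto simp: r_coset_def)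
    then have "g x = g z \<otimes>\<^bsub>H\<^esub> g y"
      using g.hom_mult[OF subgroup.mem_carrier[OF subgroup_K0_subgroup z(1)] xy(2)] by simp
    then show ?thesis using sub[OF z(1)] g.hom_closed[OF xy(2)] by simp
  qed
  then obtain h where h: "h \<in> hom (FG Mod K0_subgroup A) H" "\<And>x. x \<in> carrier FG \<Longrightarrow> h (K0_subgroup A #>\<^bsub>FG\<^esub> x) = g x"
    by (rule FactGroup_universal[OF g(1) K0_subgroup_normal]) blast+
  have "h (cls M) = F M" if "M \<in> Mods" for M
    unfolding K0_class_def using h(2)[of "frag_of M"] g(2) that by simp
  then show thesis using that h(1) by (simp add: K0_def)
qed

lemma K0_induct [consumes 1, case_names one cls diff]:
  assumes x: "x \<in> carrier (K0 A)" and 1: "Q \<one>\<^bsub>K0 A\<^esub>" and "\<And>M. M \<in> Mods \<Longrightarrow> Q (cls M)"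
    and "\<And>x y. x \<in> carrier (K0 A) \<Longrightarrow> y \<in> carrier (K0 A) \<Longrightarrow> Q x \<Longrightarrow> Q y \<Longrightarrow> Q (x \<otimes>\<^bsub>K0 A\<^esub> inv\<^bsub>K0 A\<^esub> y)"
  shows "Q x"
proof -
  interpret h: group_hom FG "K0 A" "\<lambda>x. K0_subgroup A #>\<^bsub>FG\<^esub> x"
    by (intro group_hom.intro group_hom_axioms.intro group_free_Abelian_group group_K0 K0_proj_hom)
  obtain c where c: "Poly_Mapping.keys c \<subseteq> Mods" "x = K0_subgroup A #>\<^bsub>FG\<^esub> c"
    using x unfolding K0_def carrier_FactGroup by auto
  have "Q (K0_subgroup A #>\<^bsub>FG\<^esub> c)" using c(1)
  proof (rule free_Abelian_group_induct)
    show "Q (K0_subgroup A #>\<^bsub>FG\<^esub> 0)" using 1 h.hom_one by simp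
  next
    fix a b assume ab: "Poly_Mapping.keys a \<subseteq> Mods" "Poly_Mapping.keys b \<subseteq> Mods"
      "Q (K0_subgroup A #>\<^bsub>FG\<^esub> a)" "Q (K0_subgroup A #>\<^bsub>FG\<^esub> b)"
    have "a - b = a \<otimes>\<^bsub>FG\<^esub> inv\<^bsub>FG\<^esub> b" using ab by simp
    then have "K0_subgroup A #>\<^bsub>FG\<^esub> (a - b) = (K0_subgroup A #>\<^bsub>FG\<^esub> a) \<otimes>\<^bsub>K0 A\<^esub> inv\<^bsub>K0 A\<^esub> (K0_subgroup A #>\<^bsub>FG\<^esub> b)"
      using h.hom_mult[of a "inv\<^bsub>FG\<^esub> b"] h.hom_inv[of b] ab by simp
    then show "Q (K0_subgroup A #>\<^bsub>FG\<^esub> (a - b))"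
      using assms(4)[OF h.hom_closed[of a] h.hom_closed[of b]] ab by simp
  next
    fix M assume "M \<in> Mods"
    then show "Q (K0_subgroup A #>\<^bsub>FG\<^esub> frag_of M)" using assms(3) by (simp add: K0_class_def)
  qed
  then show ?thesis by (simp add: c(2))
qed

lemma hom_K0_eqI:
  assumes H: "group H" and "f \<in> hom (K0 A) H" "g \<in> hom (K0 A) H"
    and eq: "\<And>M. M \<in> Mods \<Longrightarrow> f (cls M) = g (cls M)" and x: "x \<in> carrier (K0 A)"
  shows "f x = g x"
proof -
  interpret f: group_hom "K0 A" H f by (intro group_hom.intro group_hom_axioms.intro assms group_K0)
  interpret g: group_hom "K0 A" H g by (intro group_hom.intro group_hom_axioms.intro assms group_K0)
  show ?thesis using x by (induction rule: K0_induct) (auto simp: eq)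
qed

text \<open>Isomorphism enters the defining relations only through direct sums, so \<open>M\<close>
  is regarded as a sum of \<open>N\<close> and a zero module, which is projective.\<close>

lemma cls_iso:
  assumes M: "M \<in> Mods" and N: "N \<in> Mods" and "mod_isomorphic A M N"
  shows "cls M = cls N"
proof -
  interpret G: comm_group "K0 A" by (rule comm_group_K0)
  obtain f where f: "f \<in> mod_hom A M N" "bij_betw f (carrier M) (carrier N)"
    using assms(3) unfolding mod_isomorphic_def by (rule bexE)
  obtain Z where Z: "Z \<in> Mods" "carrier Z = {\<zero>\<^bsub>Z\<^esub>}" "projective A Z" by (rule zero_module_exists)
  note rm = right_module_Mods[OF M] right_module_Mods[OF N] right_module_Mods[OF Z(1)]
  have inj: "inj_on f (carrier M)" and im: "f ` carrier M = carrier N" using f(2) by (auto simp: bij_betw_def)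
  have "is_dsum A M N Z f (\<lambda>_. \<zero>\<^bsub>Z\<^esub>)"
  proof (rule is_dsumI[OF rm f(1) mod_hom_zero_map[OF rm(1,3)]])
    fix x assume "x \<in> carrier M" "f x = \<zero>\<^bsub>N\<^esub>"
    then show "x = \<zero>\<^bsub>M\<^esub>" using inj unfolding mod_hom_inj_iff[OF rm(1,2) f(1)] by blast
  next
    fix u v assume u: "u \<in> carrier N" and v: "v \<in> carrier Z"
    then have "u \<in> f ` carrier M" "v = \<zero>\<^bsub>Z\<^esub>" using im Z(2) by auto
    then show "\<exists>x\<in>carrier M. f x = u \<and> \<zero>\<^bsub>Z\<^esub> = v" by auto
  qed
  from cls_dsum[OF N Z(1) M this] show ?thesis using N by (simp add: cls_projective[OF Z(3)])
qed

lemma cls_syzygy_unique: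
  assumes s: "ses A L i P p M" "projective A P" and s': "ses A L' i' P' p' M" "projective A P'"
  shows "cls L = cls L'"
proof -
  interpret G: comm_group "K0 A" by (rule comm_group_K0)
  obtain D r v r' v' where D: "D \<in> Mods" "is_dsum A D L P' r v" "is_dsum A D L' P r' v'"
    by (rule schanuel[OF s s'])
  note sD = sesD[OF s(1)] and sD' = sesD[OF s'(1)]
  show ?thesis
    using cls_dsum[OF sD(1) sD'(2) D(1,2)] cls_dsum[OF sD'(1) sD(2) D(1,3)] sD(1) sD'(1)
    by (simp add: cls_projective[OF s(2)] cls_projective[OF s'(2)])
qed

text \<open>Presentations of two modules add up to a presentation of their sum, and a presentation
  of a projective splits; \<open>cls_syzygy_unique\<close> compares the former with the chosen
  covers.\<close>

lemma Omega_bar_exists: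
  obtains h where "h \<in> hom (K0 A) (K0 A)" "\<And>M. M \<in> Mods \<Longrightarrow> h (cls M) = cls (syzygy A M)"
proof (rule K0_universal[OF comm_group_K0, of "\<lambda>M. cls (syzygy A M)"])
  show "cls (syzygy A M) \<in> carrier (K0 A)" if "M \<in> Mods" for M using that by (simp add: syzygy_Mods)
next
  fix D U V p q assume D: "D \<in> Mods" and U: "U \<in> Mods" and V: "V \<in> Mods" and d: "is_dsum A D U V p q"
  obtain P i1 p1 where s1: "projective A P" "ses A (syzygy A U) i1 P p1 U" by (rule syzygy_ses[OF U])
  obtain Q i2 p2 where s2: "projective A Q" "ses A (syzygy A V) i2 Q p2 V" by (rule syzygy_ses[OF V])
  obtain R i3 p3 where s3: "projective A R" "ses A (syzygy A D) i3 R p3 D" by (rule syzygy_ses[OF D])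
  obtain E a b where E: "E \<in> Mods" "is_dsum A E P Q a b"
    by (rule dsum_Mods[OF projective_Mods[OF s1(1)] projective_Mods[OF s2(1)]])
  obtain F a' b' where F: "F \<in> Mods" "is_dsum A F (syzygy A U) (syzygy A V) a' b'"
    by (rule dsum_Mods[OF syzygy_Mods[OF U] syzygy_Mods[OF V]])
  obtain j t where t: "ses A F j E t D" by (rule dsum_ses[OF s1(2) s2(2) D d E F])
  have "cls (syzygy A D) = cls F"
    by (rule cls_syzygy_unique[OF s3(2,1) t projective_dsum[OF s1(1) s2(1) E]])
  then show "cls (syzygy A D) = cls (syzygy A U) \<otimes>\<^bsub>K0 A\<^esub> cls (syzygy A V)"
    using cls_dsum[OF syzygy_Mods[OF U] syzygy_Mods[OF V] F] by simp
next
  fix P assume P: "projective A P"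
  note PM = projective_Mods[OF P]
  obtain Q i p where s: "projective A Q" "ses A (syzygy A P) i Q p P" by (rule syzygy_ses[OF PM])
  interpret G: comm_group "K0 A" by (rule comm_group_K0)
  from projective_lift[OF P sesD(2,3,5)[OF s(2)] mod_hom_id sesD(7)[OF s(2)]]
  obtain t where t: "t \<in> mod_hom A P Q" "\<forall>x\<in>carrier P. p (t x) = x" by (rule bexE)
  obtain r where "is_dsum A Q (syzygy A P) P r p"
    by (rule ses_section[OF s(2) t(1)]) (use t(2) in blast)+
  from cls_dsum[OF syzygy_Mods[OF PM] PM sesD(2)[OF s(2)] this]
  show "cls (syzygy A P) = \<one>\<^bsub>K0 A\<^esub>" using syzygy_Mods[OF PM] by (simp add: cls_projective[OF s(1)] cls_projective[OF P])
qed (use that in blast)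

text \<open>The definite description needs a unique candidate: restricting to the carrier makes the
  homomorphism extensional, and two candidates agree because classes of modules generate
  \<open>K0 A\<close>.\<close>

lemma Omega_bar_props:
  "Omega_bar A \<in> hom (K0 A) (K0 A)" (is ?A)
  "M \<in> Mods \<Longrightarrow> Omega_bar A (cls M) = cls (syzygy A M)" (is "_ \<Longrightarrow> ?B")
proof -
  interpret G: comm_group "K0 A" by (rule comm_group_K0)
  obtain h where h: "h \<in> hom (K0 A) (K0 A)" "\<And>M. M \<in> Mods \<Longrightarrow> h (cls M) = cls (syzygy A M)"
    by (rule Omega_bar_exists) blast
  let ?h = "restrict h (carrier (K0 A))"
  let ?Q = "\<lambda>h. h \<in> hom (K0 A) (K0 A) \<and> h \<in> extensional (carrier (K0 A)) \<and>
      (\<forall>M \<in> fg_modules A. h (K0_class A M) = K0_class A (syzygy A M))"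
  have "?Q ?h" using h by (auto simp: hom_def)
  moreover have "g = ?h" if g: "?Q g" for g
  proof (rule extensionalityI[of _ "carrier (K0 A)"])
    show "g x = ?h x" if "x \<in> carrier (K0 A)" for x
      using g h that hom_K0_eqI[OF group_K0, of g h x] by simp
  qed (use g in auto)
  ultimately have "Omega_bar A = ?h" unfolding Omega_bar_def by (rule the_equality)
  with \<open>?Q ?h\<close> show ?A "M \<in> Mods \<Longrightarrow> ?B" by auto
qed

lemma Omega_bar_ses:
  assumes s: "ses A L i P p M" and P: "projective A P"
  shows "Omega_bar A (cls M) = cls L"
proof -
  note M = sesD(3)[OF s]
  obtain Q j q where t: "projective A Q" "ses A (syzygy A M) j Q q M" by (rule syzygy_ses[OF M])
  show ?thesis unfolding Omega_bar_props(2)[OF M] by (rule cls_syzygy_unique[OF t(2,1) s P])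
qed

end

section \<open>The Igusa-Todorov function of a syzygy\<close>

lemma int_subgroup_cyclic:
  fixes J :: "int set"
  assumes "0 \<in> J" and diff: "\<And>x y. x \<in> J \<Longrightarrow> y \<in> J \<Longrightarrow> x - y \<in> J"
  obtains d where "d \<in> J" "\<And>x. x \<in> J \<Longrightarrow> \<exists>z. x = z * d"
proof (cases "J = {0}")
  case True
  then show thesis using that[of 0] by simp
next
  case False
  then obtain a where a: "a \<in> J" "a \<noteq> 0" using assms(1) by blast
  have neg: "- x \<in> J" if "x \<in> J" for x using diff[OF assms(1) that] by simp
  have add: "x + y \<in> J" if "x \<in> J" "y \<in> J" for x y using diff[OF that(1) neg[OF that(2)]] by simp
  have "\<bar>a\<bar> \<in> J" using a neg by (cases "a < 0") auto
  then have "int (nat \<bar>a\<bar>) \<in> J" "nat \<bar>a\<bar> > 0" using a by auto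
  then obtain n where n: "n > 0" "int n \<in> J" "\<And>m. m > 0 \<Longrightarrow> int m \<in> J \<Longrightarrow> n \<le> m"
    using exists_least_iff[of "\<lambda>n. n > 0 \<and> int n \<in> J"] by (metis not_less)
  have mul: "int k * int n \<in> J" for k by (induction k) (use n add assms(1) in \<open>auto simp: algebra_simps\<close>)
  then have mulz: "z * int n \<in> J" for z :: int
    using neg[OF mul[of "nat (- z)"]] mul[of "nat z"] by (cases "z \<ge> 0") auto
  have "\<exists>z. x = z * int n" if x: "x \<in> J" for x
  proof -
    have "x mod int n = x - (x div int n) * int n" by (simp add: minus_div_mult_eq_mod)
    then have "x mod int n \<in> J" using diff[OF x mulz] by simp
    moreover have "x mod int n \<ge> 0" "x mod int n < int n" using n(1) by simp_all
    ultimately have "x mod int n = 0"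
      using n(3)[of "nat (x mod int n)"] by (metis int_nat_eq nat_less_iff not_less zero_less_nat_eq order_le_less)
    then show ?thesis by (metis add.right_neutral div_mult_mod_eq)
  qed
  then show thesis using that n(2) by blast
qed

lemma (in comm_group) generate_insert:
  assumes a: "a \<in> carrier G" and S: "S \<subseteq> carrier G" and x: "x \<in> generate G (insert a S)"
  obtains z :: int and s where "s \<in> generate G S" "x = a [^] z \<otimes> s"
proof -
  note sc = generate_in_carrier[OF S]
  have "\<exists>(z :: int) s. s \<in> generate G S \<and> x = a [^] z \<otimes> s" using x
  proof (induction rule: generate.induct)
    case one
    show ?case by (intro exI[of _ 0] exI[of _ \<one>]) (auto intro: generate.one)
  next
    case (incl h)
    then consider "h = a" | "h \<in> S" by blast
    then show ?case
    proof cases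
      case 1
      then show ?thesis using a by (intro exI[of _ 1] exI[of _ \<one>]) (auto intro: generate.one)
    next
      case 2
      then show ?thesis using S by (intro exI[of _ 0] exI[of _ h]) (auto intro: generate.incl)
    qed
  next
    case (inv h)
    then consider "h = a" | "h \<in> S" by blast
    then show ?case
    proof cases
      case 1
      then show ?thesis using a by (intro exI[of _ "-1"] exI[of _ \<one>]) (auto intro: generate.one simp: int_pow_neg)
    next
      case 2
      then show ?thesis using S by (intro exI[of _ 0] exI[of _ "inv h"]) (auto intro: generate.inv)
    qed
  next
    case (eng h k)
    then obtain z s w t where st: "s \<in> generate G S" "h = a [^] (z::int) \<otimes> s" "t \<in> generate G S" "k = a [^] (w::int) \<otimes> t"
      by blast
    then have "h \<otimes> k = a [^] (z + w) \<otimes> (s \<otimes> t)"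
      using a sc by (simp add: int_pow_mult m_ac)
    then show ?case using st by (intro exI[of _ "z + w"] exI[of _ "s \<otimes> t"]) (auto intro: generate.eng)
  qed
  then show thesis using that by blast
qed

lemma (in comm_group) noetherian_fg:
  assumes "finite S" "S \<subseteq> carrier G" and N: "\<And>n::nat. subgroup (N n) G" and mono: "\<And>m n. m \<le> n \<Longrightarrow> N m \<subseteq> N n"
  shows "\<exists>k. \<forall>n\<ge>k. N n \<inter> generate G S \<subseteq> N k"
  using assms(1,2)
proof (induction S)
  case empty
  have "generate G {} = {\<one>}" by (rule generate_empty)
  then show ?case using subgroup.one_closed[OF N] by auto
next
  case (insert a S)
  then obtain k0 where k0: "\<And>n. n \<ge> k0 \<Longrightarrow> N n \<inter> generate G S \<subseteq> N k0" by auto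
  have a: "a \<in> carrier G" and S: "S \<subseteq> carrier G" using insert by auto
  note sc = generate_in_carrier[OF S]
  note gs = generate_is_subgroup[OF S]
  \<comment> \<open>The exponents with which \<open>a\<close> occurs in \<open>N n\<close>, the
    analogue of an ideal of leading coefficients.\<close>
  define I where "I n = {z::int. \<exists>s \<in> generate G S. a [^] z \<otimes> s \<in> N n}" for n
  have I_mono: "I m \<subseteq> I n" if "m \<le> n" for m n using mono[OF that] by (auto simp: I_def)
  have I_diff: "z - w \<in> I n" if zw: "z \<in> I n" "w \<in> I n" for z w n
  proof -
    obtain s t where st: "s \<in> generate G S" "a [^] z \<otimes> s \<in> N n" "t \<in> generate G S" "a [^] w \<otimes> t \<in> N n"
      using zw by (auto simp: I_def)
    have "(a [^] z \<otimes> s) \<otimes> inv (a [^] w \<otimes> t) \<in> N n"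
      by (intro subgroup.m_closed[OF N] subgroup.m_inv_closed[OF N] st)
    also have "(a [^] z \<otimes> s) \<otimes> inv (a [^] w \<otimes> t) = a [^] (z - w) \<otimes> (s \<otimes> inv t)"
      using st(1,3)[THEN sc] a by (simp add: int_pow_diff inv_mult m_ac)
    finally show ?thesis unfolding I_def
      using subgroup.m_closed[OF gs st(1) subgroup.m_inv_closed[OF gs st(3)]] by blast
  qed
  have I0: "0 \<in> I n" for n unfolding I_def
    using subgroup.one_closed[OF N] by (auto intro!: bexI[of _ \<one>] generate.one)
  have "(0::int) \<in> (\<Union>n. I n)" using I0 by blast
  moreover have "x - y \<in> (\<Union>n. I n)" if xy: "x \<in> (\<Union>n. I n)" "y \<in> (\<Union>n. I n)" for x y
  proof -
    obtain m n where mn: "x \<in> I m" "y \<in> I n" using xy by blast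
    have "x \<in> I (max m n)" "y \<in> I (max m n)"
      by (rule subsetD[OF I_mono[OF max.cobounded1] mn(1)], rule subsetD[OF I_mono[OF max.cobounded2] mn(2)])
    then show ?thesis using I_diff by blast
  qed
  ultimately obtain d where d: "d \<in> (\<Union>n. I n)" "\<And>x. x \<in> (\<Union>n. I n) \<Longrightarrow> \<exists>z. x = z * d"
    by (rule int_subgroup_cyclic) blast+
  then obtain k1 where k1: "d \<in> I k1" by blast
  have mult_nat: "int m * d \<in> I k1" for m
  proof (induction m)
    case (Suc m)
    have "int (Suc m) * d = int m * d - (0 - d)" by (simp add: algebra_simps)
    then show ?case using I_diff[OF Suc I_diff[OF I0 k1]] by simp
  qed (simp add: I0)
  have mult: "z * d \<in> I k1" for z
    using mult_nat[of "nat z"] I_diff[OF I0 mult_nat[of "nat (- z)"]] by (cases "z \<ge> 0") auto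
  \<comment> \<open>From \<open>k0\<close> on the traces on the old group are stationary; from
    \<open>k1\<close> on every exponent that ever occurs is already present.\<close>
  let ?k = "max k0 k1"
  have "N n \<inter> generate G (insert a S) \<subseteq> N ?k" if n: "n \<ge> ?k" for n
  proof
    fix x assume x: "x \<in> N n \<inter> generate G (insert a S)"
    then obtain z s where zs: "s \<in> generate G S" "x = a [^] (z::int) \<otimes> s" using generate_insert[OF a S] by blast
    then have "z \<in> I n" using x by (auto simp: I_def)
    then have "z \<in> I k1" using d(2)[of z] mult by auto
    then have "z \<in> I ?k" using I_mono[of k1 ?k] by auto
    then obtain t where t: "t \<in> generate G S" "a [^] z \<otimes> t \<in> N ?k" by (auto simp: I_def)
    have c: "s \<in> carrier G" "t \<in> carrier G" using zs t sc by auto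
    have "x \<otimes> inv (a [^] z \<otimes> t) \<in> N n"
      by (rule subgroup.m_closed[OF N _ subgroup.m_inv_closed[OF N]]) (use x t(2) mono[OF n] in auto)
    moreover have eq: "x \<otimes> inv (a [^] z \<otimes> t) = s \<otimes> inv t"
    proof -
      have "x \<otimes> inv (a [^] z \<otimes> t) = (a [^] z \<otimes> inv (a [^] z)) \<otimes> (s \<otimes> inv t)"
        using c a unfolding zs(2) by (simp add: inv_mult m_ac del: r_inv)
      then show ?thesis using c a by simp
    qed
    moreover have "s \<otimes> inv t \<in> generate G S"
      by (intro subgroup.m_closed[OF gs] subgroup.m_inv_closed[OF gs] zs t)
    ultimately have "s \<otimes> inv t \<in> N ?k" using k0[of n] mono[of k0 ?k] n by auto
    then have "(s \<otimes> inv t) \<otimes> (a [^] z \<otimes> t) \<in> N ?k" using t(2) by (rule subgroup.m_closed[OF N])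
    also have "(s \<otimes> inv t) \<otimes> (a [^] z \<otimes> t) = x"
    proof -
      have "(s \<otimes> inv t) \<otimes> (a [^] z \<otimes> t) = (a [^] z \<otimes> s) \<otimes> (inv t \<otimes> t)"
        using c a by (simp only: m_ac m_closed inv_closed int_pow_closed)
      then show ?thesis using c a zs(2) by simp
    qed
    finally show "x \<in> N ?k" .
  qed
  then show ?case by blast
qed

context fd_algebra
begin

abbreviation \<Omega> :: "(('a, nat \<Rightarrow> 'a) module \<Rightarrow>\<^sub>0 int) set \<Rightarrow> (('a, nat \<Rightarrow> 'a) module \<Rightarrow>\<^sub>0 int) set" where
  "\<Omega> \<equiv> Omega_bar A"

section \<open>Powers of the syzygy map, the subgroups \<open>add_subgroup\<close>, and the values
  of \<phi>\<close>

lemma Omega_group_hom: "group_hom (K0 A) (K0 A) \<Omega>"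
  by (intro group_hom.intro group_hom_axioms.intro group_K0 Omega_bar_props(1))

lemma Omega_funpow_hom: "group_hom (K0 A) (K0 A) (\<Omega> ^^ n)"
proof -
  interpret \<Omega>: group_hom "K0 A" "K0 A" \<Omega> by (rule Omega_group_hom)
  have "(\<Omega> ^^ n) \<in> hom (K0 A) (K0 A)"
  proof (induction n)
    case (Suc n)
    then show ?case using hom_compose[OF Suc Omega_bar_props(1)] by (simp add: comp_def)
  qed (simp add: hom_def)
  then show ?thesis by (intro group_hom.intro group_hom_axioms.intro group_K0)
qed

lemma add_subgroup_eq:
  "M \<in> Mods \<Longrightarrow> add_subgroup A M = generate (K0 A) {cls N | N. indecomposable A N \<and> retract A N M}"
  unfolding add_subgroup_def by (simp add: direct_summand_iff)

lemma indec_cls_subset: "{cls N | N. indecomposable A N \<and> P N} \<subseteq> carrier (K0 A)"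
  using indecomposableD(1) by auto

lemma subgroup_add_subgroup: "M \<in> Mods \<Longrightarrow> subgroup (add_subgroup A M) (K0 A)"
  unfolding add_subgroup_eq by (rule group.generate_is_subgroup[OF group_K0 indec_cls_subset])

lemma add_subgroup_carrier: "M \<in> Mods \<Longrightarrow> x \<in> add_subgroup A M \<Longrightarrow> x \<in> carrier (K0 A)"
  using subgroup.mem_carrier[OF subgroup_add_subgroup] by blast

lemma indec_in_add_subgroup:
  "M \<in> Mods \<Longrightarrow> indecomposable A N \<Longrightarrow> retract A N M \<Longrightarrow> cls N \<in> add_subgroup A M"
  unfolding add_subgroup_eq by (rule generate.incl) blast

lemma add_subgroup_least:
  assumes "M \<in> Mods" "subgroup S (K0 A)" "\<And>N. indecomposable A N \<Longrightarrow> retract A N M \<Longrightarrow> cls N \<in> S"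
  shows "add_subgroup A M \<subseteq> S"
  unfolding add_subgroup_eq[OF assms(1)]
  by (rule group.generate_subgroup_incl[OF group_K0 _ assms(2)]) (use assms(3) in blast)

lemma add_subgroup_retract:
  assumes "M \<in> Mods" "N \<in> Mods" "retract A N M"
  shows "add_subgroup A N \<subseteq> add_subgroup A M"
  by (rule add_subgroup_least[OF assms(2) subgroup_add_subgroup[OF assms(1)]])
    (use indec_in_add_subgroup[OF assms(1)] retract_trans assms(3) in blast)

lemma cls_in_add_subgroup:
  assumes "M \<in> Mods" shows "cls M \<in> add_subgroup A M"
  using assms
proof (induction rule: decomposition_induct)
  case (trivial M)
  then show ?case using subgroup.one_closed[OF subgroup_add_subgroup[OF trivial(1)]]
    by (simp add: cls_projective[OF projective_trivial])
next
  case (indecomposable M)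
  then have M: "M \<in> Mods" by (rule indecomposableD)
  have "retract A M M" by (rule retract_intro[OF M mod_hom_id mod_hom_id]) simp
  then show ?case by (rule indec_in_add_subgroup[OF M indecomposable])
next
  case (dsum M U V p q)
  have "cls U \<in> add_subgroup A M" "cls V \<in> add_subgroup A M"
    using add_subgroup_retract[OF dsum(1,2) retract_dsum(1)[OF dsum(2,3,1,4)]]
      add_subgroup_retract[OF dsum(1,3) retract_dsum(2)[OF dsum(2,3,1,4)]] dsum by auto
  then show ?case unfolding cls_dsum[OF dsum(2,3,1,4)]
    by (rule subgroup.m_closed[OF subgroup_add_subgroup[OF dsum(1)]])
qed

lemma cls_retract_in_add_subgroup:
  "M \<in> Mods \<Longrightarrow> N \<in> Mods \<Longrightarrow> retract A N M \<Longrightarrow> cls N \<in> add_subgroup A M"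
  using add_subgroup_retract[of M N] cls_in_add_subgroup[of N] by blast

text \<open>By the exchange property the only additional indecomposable summands lie in
  \<open>P\<close>; they are projective, so their classes are trivial.\<close>

lemma add_subgroup_projective_summand:
  assumes D: "D \<in> Mods" "U \<in> Mods" "is_dsum A D U P p q" and P: "projective A P"
  shows "add_subgroup A D \<subseteq> add_subgroup A U"
proof (rule add_subgroup_least[OF D(1) subgroup_add_subgroup[OF D(2)]])
  fix N assume N: "indecomposable A N" "retract A N D"
  then consider "retract A N U" | "retract A N P"
    using indecomposable_retract_dsum[OF N D(1,2) projective_Mods[OF P] D(3)] by blast
  then show "cls N \<in> add_subgroup A U"
  proof cases
    case 1
    then show ?thesis by (rule indec_in_add_subgroup[OF D(2) N(1)])
  next
    case 2
    then show ?thesis using subgroup.one_closed[OF subgroup_add_subgroup[OF D(2)]]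
      by (simp add: cls_projective[OF projective_retract[OF P]])
  qed
qed

text \<open>A summand \<open>N\<close> of \<open>M\<close> and its complement have presentations
  whose sum presents \<open>M\<close>. Schanuel's lemma compares this sum with the given
  presentation: the syzygy of \<open>N\<close> is a summand of \<open>L\<close> plus a projective,
  and the projective contributes nothing.\<close>

lemma Omega_add_subgroup:
  assumes s: "ses A L i P p M" and P: "projective A P"
  shows "\<Omega> ` add_subgroup A M \<subseteq> add_subgroup A L"
proof -
  interpret \<Omega>: group_hom "K0 A" "K0 A" \<Omega> by (rule Omega_group_hom)
  note sD = sesD[OF s]
  let ?S = "{x \<in> carrier (K0 A). \<Omega> x \<in> add_subgroup A L}"
  note sL = subgroup_add_subgroup[OF sD(1)]
  have "subgroup ?S (K0 A)"
    using sL by (intro \<Omega>.G.subgroupI) (auto simp: subgroup.m_closed subgroup.m_inv_closed intro!: exI[of _ "\<one>\<^bsub>K0 A\<^esub>"] subgroup.one_closed \<Omega>.G.subgroup_self)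
  then have "add_subgroup A M \<subseteq> ?S"
  proof (rule add_subgroup_least[OF sD(3)])
    fix N assume N: "indecomposable A N" "retract A N M"
    note NM = indecomposableD(1)[OF N(1)]
    obtain N' r' q' where N': "N' \<in> Mods" "is_dsum A M N N' r' q'" by (rule retract_complement[OF sD(3) N(2)])
    obtain Q1 i1 p1 where s1: "projective A Q1" "ses A (syzygy A N) i1 Q1 p1 N" by (rule syzygy_ses[OF NM])
    obtain Q2 i2 p2 where s2: "projective A Q2" "ses A (syzygy A N') i2 Q2 p2 N'" by (rule syzygy_ses[OF N'(1)])
    obtain E a b where E: "E \<in> Mods" "is_dsum A E Q1 Q2 a b"
      by (rule dsum_Mods[OF sesD(2)[OF s1(2)] sesD(2)[OF s2(2)]])
    obtain F a' b' where F: "F \<in> Mods" "is_dsum A F (syzygy A N) (syzygy A N') a' b'"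
      by (rule dsum_Mods[OF sesD(1)[OF s1(2)] sesD(1)[OF s2(2)]])
    obtain j t where t: "ses A F j E t M" by (rule dsum_ses[OF s1(2) s2(2) sD(3) N'(2) E F])
    obtain D r v r' v' where D: "D \<in> Mods" "is_dsum A D F P r v" "is_dsum A D L E r' v'"
      by (rule schanuel[OF t projective_dsum[OF s1(1) s2(1) E] s P])
    have "retract A (syzygy A N) D"
      by (rule retract_trans[OF retract_dsum(1)[OF sesD(1)[OF s1(2)] sesD(1)[OF s2(2)] F]
        retract_dsum(1)[OF F(1) sD(2) D(1,2)]])
    then have "cls (syzygy A N) \<in> add_subgroup A D"
      by (rule cls_retract_in_add_subgroup[OF D(1) sesD(1)[OF s1(2)]])
    also have "\<dots> \<subseteq> add_subgroup A L"
      by (rule add_subgroup_projective_summand[OF D(1) sD(1) D(3) projective_dsum[OF s1(1) s2(1) E]])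
    finally show "cls N \<in> ?S" using NM by (simp add: Omega_bar_props(2))
  qed
  then show ?thesis by blast
qed

text \<open>Injectivity of \<Omega> on \<open>\<Omega>\<^sup>j\<langle>add M\<rangle>\<close> is
  rewritten on the group \<open>\<langle>add M\<rangle>\<close> itself: from \<open>l\<close> on the
  kernels of the powers of \<Omega> stop growing there. By \<open>phi_le_iff\<close> this is the
  inequality \<open>phi A M \<le> l\<close>.\<close>

definition kernel_stable where
  "kernel_stable M l \<longleftrightarrow> (\<forall>j\<ge>l. \<forall>x\<in>add_subgroup A M.
    (\<Omega> ^^ Suc j) x = \<one>\<^bsub>K0 A\<^esub> \<longrightarrow> (\<Omega> ^^ j) x = \<one>\<^bsub>K0 A\<^esub>)"

lemma kernel_stable_mono: "kernel_stable M l \<Longrightarrow> l \<le> l' \<Longrightarrow> kernel_stable M l'"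
  by (auto simp: kernel_stable_def)

lemma phi_condition:
  assumes M: "M \<in> Mods"
  shows "\<Omega> \<in> mon ((K0 A)\<lparr>carrier := (\<Omega> ^^ j) ` add_subgroup A M\<rparr>) (K0 A) \<longleftrightarrow>
    (\<forall>x\<in>add_subgroup A M. (\<Omega> ^^ Suc j) x = \<one>\<^bsub>K0 A\<^esub> \<longrightarrow> (\<Omega> ^^ j) x = \<one>\<^bsub>K0 A\<^esub>)"
proof -
  interpret \<Omega>: group_hom "K0 A" "K0 A" \<Omega> by (rule Omega_group_hom)
  interpret j: group_hom "K0 A" "K0 A" "\<Omega> ^^ j" by (rule Omega_funpow_hom)
  note s = subgroup_add_subgroup[OF M]
  let ?T = "(\<Omega> ^^ j) ` add_subgroup A M"
  have T: "subgroup ?T (K0 A)" by (rule j.subgroup_img_is_subgroup[OF s])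
  have Tc: "?T \<subseteq> carrier (K0 A)" by (rule subgroup.subset[OF T])
  have "\<Omega> \<in> hom ((K0 A)\<lparr>carrier := ?T\<rparr>) (K0 A)"
    using Tc Omega_bar_props(1) by (auto simp: hom_def Pi_iff subset_iff)
  moreover have "inj_on \<Omega> ?T \<longleftrightarrow> (\<forall>y\<in>?T. \<Omega> y = \<one>\<^bsub>K0 A\<^esub> \<longrightarrow> y = \<one>\<^bsub>K0 A\<^esub>)"
  proof
    assume "inj_on \<Omega> ?T"
    then show "\<forall>y\<in>?T. \<Omega> y = \<one>\<^bsub>K0 A\<^esub> \<longrightarrow> y = \<one>\<^bsub>K0 A\<^esub>"
      using \<Omega>.hom_one subgroup.one_closed[OF T] by (metis inj_onD)
  next
    assume *: "\<forall>y\<in>?T. \<Omega> y = \<one>\<^bsub>K0 A\<^esub> \<longrightarrow> y = \<one>\<^bsub>K0 A\<^esub>"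
    show "inj_on \<Omega> ?T"
    proof (rule inj_onI)
      fix x y assume xy: "x \<in> ?T" "y \<in> ?T" "\<Omega> x = \<Omega> y"
      have c: "x \<in> carrier (K0 A)" "y \<in> carrier (K0 A)" using xy Tc by auto
      then have "\<Omega> (x \<otimes>\<^bsub>K0 A\<^esub> inv\<^bsub>K0 A\<^esub> y) = \<one>\<^bsub>K0 A\<^esub>" using xy(3) by simp
      moreover have "x \<otimes>\<^bsub>K0 A\<^esub> inv\<^bsub>K0 A\<^esub> y \<in> ?T"
        by (intro subgroup.m_closed[OF T] subgroup.m_inv_closed[OF T] xy)
      ultimately have "x \<otimes>\<^bsub>K0 A\<^esub> inv\<^bsub>K0 A\<^esub> y = \<one>\<^bsub>K0 A\<^esub>" using * by blast
      then show "x = y" using c by (simp add: \<Omega>.G.inv_solve_right')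
    qed
  qed
  ultimately show ?thesis by (simp add: mon_def)
qed

lemma kernel_stable_iff:
  assumes "M \<in> Mods"
  shows "kernel_stable M l \<longleftrightarrow>
    (\<forall>s. \<Omega> \<in> mon ((K0 A)\<lparr>carrier := (\<Omega> ^^ (l + s)) ` add_subgroup A M\<rparr>) (K0 A))"
  unfolding phi_condition[OF assms] kernel_stable_def by (metis le_add1 le_Suc_ex)

text \<open>The kernels of the powers of \<Omega> increase, and they become stationary on the
  finitely generated group \<open>add_subgroup A M\<close>. This guarantees that the least element
  in the definition of \<open>phi\<close> exists.\<close>

lemma kernel_stable_exists:
  assumes M: "M \<in> Mods" shows "\<exists>l. kernel_stable M l"
proof -
  interpret G: comm_group "K0 A" by (rule comm_group_K0)
  obtain F where F: "finite F" "F \<subseteq> Mods"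
    "\<And>N. indecomposable A N \<Longrightarrow> retract A N M \<Longrightarrow> \<exists>Y\<in>F. mod_isomorphic A N Y"
    using finite_indecomposable_retracts[OF M] by blast
  have "{cls N | N. indecomposable A N \<and> retract A N M} \<subseteq> cls ` F"
    using F cls_iso indecomposableD(1) by (auto simp: image_iff subset_iff) metis
  then have fin: "finite {cls N | N. indecomposable A N \<and> retract A N M}"
    using F(1) by (meson finite_imageI finite_subset)
  let ?N = "\<lambda>n. {x \<in> carrier (K0 A). (\<Omega> ^^ n) x = \<one>\<^bsub>K0 A\<^esub>}"
  have sub: "subgroup (?N n) (K0 A)" for n
  proof -
    interpret n: group_hom "K0 A" "K0 A" "\<Omega> ^^ n" by (rule Omega_funpow_hom)
    show ?thesis using n.subgroup_kernel by (simp add: kernel_def)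
  qed
  interpret \<Omega>: group_hom "K0 A" "K0 A" \<Omega> by (rule Omega_group_hom)
  have step: "?N n \<subseteq> ?N (Suc n)" for n
  proof
    fix x assume "x \<in> ?N n"
    then show "x \<in> ?N (Suc n)" using \<Omega>.hom_one by simp
  qed
  have "?N m \<subseteq> ?N n" if "m \<le> n" for m n by (rule lift_Suc_mono_le[of ?N, OF step that])
  from G.noetherian_fg[of _ ?N, OF fin indec_cls_subset sub this]
  obtain k where "\<forall>n\<ge>k. ?N n \<inter> add_subgroup A M \<subseteq> ?N k"
    unfolding add_subgroup_eq[OF M, symmetric] by (rule exE)
  then have k: "?N n \<inter> add_subgroup A M \<subseteq> ?N k" if "n \<ge> k" for n using that by simp
  have mono: "?N m \<subseteq> ?N n" if "m \<le> n" for m n by (rule lift_Suc_mono_le[of ?N, OF step that])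
  have "kernel_stable M k" unfolding kernel_stable_def
  proof (intro allI impI ballI)
    fix j x assume j: "j \<ge> k" and x: "x \<in> add_subgroup A M" "(\<Omega> ^^ Suc j) x = \<one>\<^bsub>K0 A\<^esub>"
    then have "x \<in> ?N (Suc j) \<inter> add_subgroup A M" using add_subgroup_carrier[OF M] by blast
    then have "x \<in> ?N k" using k[of "Suc j"] j by auto
    then show "(\<Omega> ^^ j) x = \<one>\<^bsub>K0 A\<^esub>" using mono[OF j] by blast
  qed
  then show ?thesis by blast
qed

lemma phi_le_iff:
  assumes M: "M \<in> Mods" shows "phi A M \<le> l \<longleftrightarrow> kernel_stable M l"
proof -
  have eq: "phi A M = (LEAST l. kernel_stable M l)"
    unfolding phi_def by (simp add: kernel_stable_iff[OF M])
  have "kernel_stable M (phi A M)" unfolding eq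
    using kernel_stable_exists[OF M] by (rule LeastI_ex)
  then show ?thesis using kernel_stable_mono[of M "phi A M" l] Least_le[of "kernel_stable M" l] eq by auto
qed

text \<open>A difference of elements attached to \<open>M\<close> and to \<open>N\<close> is
  attached to their direct sum. A bound on all values of \<phi> therefore controls the kernels of
  the powers of \<Omega> on the whole of \<open>K0 A\<close>.\<close>

lemma K0_add_subgroup:
  assumes "x \<in> carrier (K0 A)"
  shows "\<exists>M\<in>Mods. x \<in> add_subgroup A M"
  using assms
proof (induction rule: K0_induct)
  case one
  obtain Z where "Z \<in> Mods" by (rule zero_module_exists)
  then show ?case using subgroup.one_closed[OF subgroup_add_subgroup] by blast
next
  case (cls M)
  then show ?case using cls_in_add_subgroup by blast
next
  case (diff x y)
  then obtain M N where MN: "M \<in> Mods" "x \<in> add_subgroup A M" "N \<in> Mods" "y \<in> add_subgroup A N" by blast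
  obtain D p q where D: "D \<in> Mods" "is_dsum A D M N p q" by (rule dsum_Mods[OF MN(1,3)])
  have "x \<in> add_subgroup A D" "y \<in> add_subgroup A D"
    using add_subgroup_retract[OF D(1) MN(1) retract_dsum(1)[OF MN(1,3) D]] MN(2)
      add_subgroup_retract[OF D(1) MN(3) retract_dsum(2)[OF MN(1,3) D]] MN(4) by auto
  then have "x \<otimes>\<^bsub>K0 A\<^esub> inv\<^bsub>K0 A\<^esub> y \<in> add_subgroup A D"
    by (intro subgroup.m_closed[OF subgroup_add_subgroup[OF D(1)]] subgroup.m_inv_closed[OF subgroup_add_subgroup[OF D(1)]])
  then show ?case using D(1) by blast
qed

lemma phi_dim_bound:
  assumes d: "phi_dim A \<le> enat d" and j: "j \<ge> d" and x: "x \<in> carrier (K0 A)"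
    and "(\<Omega> ^^ Suc j) x = \<one>\<^bsub>K0 A\<^esub>"
  shows "(\<Omega> ^^ j) x = \<one>\<^bsub>K0 A\<^esub>"
proof -
  obtain M where M: "M \<in> Mods" "x \<in> add_subgroup A M" using K0_add_subgroup[OF x] by blast
  have "enat (phi A M) \<le> phi_dim A" unfolding phi_dim_def by (rule SUP_upper[OF M(1)])
  then have "enat (phi A M) \<le> enat d" using d by (rule order_trans)
  then have "kernel_stable M d" using phi_le_iff[OF M(1)] by simp
  then show ?thesis using j M(2) assms(4) unfolding kernel_stable_def by blast
qed

text \<open>
  Every indecomposable summand of a syzygy embeds into a projective module, so it is again a syzygy;
  hence the subgroup generated by the summands of \<open>\<Omega> M\<close> lies in the image of the endomorphism
  \<open>\<Omega>\<close> of \<open>K\<^sub>0\<close>.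
\<close>

lemma add_subgroup_syzygy_image:
  assumes M: "M \<in> Mods"
  shows "add_subgroup A (syzygy A M) \<subseteq> \<Omega> ` carrier (K0 A)"
proof (rule add_subgroup_least[OF syzygy_Mods[OF M]])
  interpret \<Omega>: group_hom "K0 A" "K0 A" \<Omega> by (rule Omega_group_hom)
  show "subgroup (\<Omega> ` carrier (K0 A)) (K0 A)" by (rule \<Omega>.img_is_subgroup)
  fix N assume N: "indecomposable A N" "retract A N (syzygy A M)"
  note NM = indecomposableD(1)[OF N(1)]
  obtain P i p where s: "projective A P" "ses A (syzygy A M) i P p M" by (rule syzygy_ses[OF M])
  note sD = sesD[OF s(2)]
  obtain e r where er: "e \<in> mod_hom A N (syzygy A M)" "\<And>x. x \<in> carrier N \<Longrightarrow> r (e x) = x"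
    using N(2) unfolding retract_def by blast
  have "inj_on e (carrier N)" by (rule inj_on_inverseI[of _ r]) (rule er(2))
  moreover have "e ` carrier N \<subseteq> carrier (syzygy A M)" by (intro image_subsetI mod_hom_closed[OF er(1)])
  ultimately have "inj_on (i \<circ> e) (carrier N)" by (intro comp_inj_on inj_on_subset[OF sD(6)])
  then have "inj_on (\<lambda>x. i (e x)) (carrier N)" by (simp add: comp_def)
  then obtain C q where C: "ses A N (\<lambda>x. i (e x)) P q C"
    by (rule ses_cokernel[OF NM sD(2) mod_hom_comp[OF er(1) sD(4)]])
  have "cls N = \<Omega> (cls C)" using Omega_bar_ses[OF C s(1)] by simp
  then show "cls N \<in> \<Omega> ` carrier (K0 A)" using cls_closed[OF sesD(3)[OF C]] by blast
qed

text \<open>Upper bound: an element of the subgroup of the syzygy is \<open>\<Omega> v\<close> with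
  \<open>v\<close> somewhere in \<open>K0 A\<close>, and the global bound \<open>Suc d\<close> for
  \<open>v\<close> becomes \<open>d\<close> for its image. Lower bound: since \<Omega> maps the
  subgroup of \<open>M\<close> into that of the syzygy, the value at \<open>M\<close> exceeds the
  value at the syzygy by at most one.\<close>

lemma phi_syzygy:
  assumes M: "M \<in> Mods" and d: "phi_dim A = enat (Suc d)" and phi: "phi A M = Suc d"
  shows "phi A (syzygy A M) = d"
proof (rule antisym)
  note SM = syzygy_Mods[OF M]
  show "phi A (syzygy A M) \<le> d" unfolding phi_le_iff[OF SM] kernel_stable_def
  proof (intro allI impI ballI)
    fix j x assume j: "j \<ge> d" and x: "x \<in> add_subgroup A (syzygy A M)" "(\<Omega> ^^ Suc j) x = \<one>\<^bsub>K0 A\<^esub>"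
    obtain v where v: "v \<in> carrier (K0 A)" "x = \<Omega> v" using add_subgroup_syzygy_image[OF M] x(1) by blast
    have "(\<Omega> ^^ Suc (Suc j)) v = \<one>\<^bsub>K0 A\<^esub>" using x(2) unfolding v(2) by (simp only: funpow_Suc_right o_apply)
    then have "(\<Omega> ^^ Suc j) v = \<one>\<^bsub>K0 A\<^esub>" using d j v(1) by (intro phi_dim_bound[of "Suc d" "Suc j"]) auto
    then show "(\<Omega> ^^ j) x = \<one>\<^bsub>K0 A\<^esub>" unfolding v(2) by (simp only: funpow_Suc_right o_apply)
  qed
  show "d \<le> phi A (syzygy A M)"
  proof (rule ccontr)
    assume "\<not> d \<le> phi A (syzygy A M)"
    then obtain e where e: "d = Suc e" "phi A (syzygy A M) \<le> e" by (cases d) auto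
    then have ks: "kernel_stable (syzygy A M) e" using phi_le_iff[OF SM] by simp
    obtain P i p where s: "projective A P" "ses A (syzygy A M) i P p M" by (rule syzygy_ses[OF M])
    have "kernel_stable M d" unfolding kernel_stable_def
    proof (intro allI impI ballI)
      fix j x assume j: "j \<ge> d" and x: "x \<in> add_subgroup A M" "(\<Omega> ^^ Suc j) x = \<one>\<^bsub>K0 A\<^esub>"
      obtain k where k: "j = Suc k" "k \<ge> e" using j e(1) by (cases j) auto
      have "\<Omega> x \<in> add_subgroup A (syzygy A M)" using Omega_add_subgroup[OF s(2,1)] x(1) by blast
      moreover have "(\<Omega> ^^ Suc k) (\<Omega> x) = \<one>\<^bsub>K0 A\<^esub>"
        using x(2) unfolding k(1) by (simp only: funpow_Suc_right o_apply)
      ultimately have "(\<Omega> ^^ k) (\<Omega> x) = \<one>\<^bsub>K0 A\<^esub>" using ks k(2) unfolding kernel_stable_def by blast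
      then show "(\<Omega> ^^ j) x = \<one>\<^bsub>K0 A\<^esub>" unfolding k(1) by (simp only: funpow_Suc_right o_apply)
    qed
    then show False using phi phi_le_iff[OF M, of d] by simp
  qed
qed

lemma phi_dim_attained:
  assumes "phi_dim A = enat d"
  obtains M where "M \<in> Mods" "phi A M = d"
proof -
  obtain Z where Z: "Z \<in> Mods" by (rule zero_module_exists)
  have le: "phi A M \<le> d" if "M \<in> Mods" for M
    using SUP_upper[OF that, of "\<lambda>M. enat (phi A M)"] assms by (simp add: phi_dim_def)
  have "\<exists>M\<in>Mods. phi A M = d"
  proof (rule ccontr)
    assume "\<not> ?thesis"
    then have lt: "phi A M < d" if "M \<in> Mods" for M using le[OF that] that by force
    then have "d > 0" using Z by force
    have "phi_dim A \<le> enat (d - 1)" unfolding phi_dim_def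
      using lt by (intro SUP_least) force
    then show False using assms \<open>d > 0\<close> by simp
  qed
  then show thesis using that by blast
qed

lemma phi_pred_attained:
  assumes "phi_dim A > 0" "phi_dim A < \<infinity>"
  shows "\<exists>N\<in>Mods. enat (phi A N) = phi_dim A - 1"
proof -
  obtain d where d: "phi_dim A = enat (Suc d)"
    using assms by (cases "phi_dim A") (auto simp: zero_enat_def gr0_conv_Suc)
  obtain M where "M \<in> Mods" "phi A M = Suc d" by (rule phi_dim_attained[OF d])
  from phi_syzygy[OF this(1) d this(2)] syzygy_Mods[OF this(1)] show ?thesis
    using d by (intro bexI[of _ "syzygy A M"]) (auto simp: one_enat_def)
qed

end

section \<open>Dimensions of extension groups\<close>

context fd_algebra
begin

text \<open>Members of \<open>mod_hom\<close> are arbitrary outside the carrier. Taking the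
  extensional ones makes maps that agree on \<open>L\<close> equal, so that the length over
  \<open>K\<close> is the dimension of \<open>Hom(L, W)\<close>.\<close>

definition hom_space ::
  "('a, nat \<Rightarrow> 'a) module \<Rightarrow> ('a, nat \<Rightarrow> 'a) module \<Rightarrow> ('k, (nat \<Rightarrow> 'a) \<Rightarrow> (nat \<Rightarrow> 'a)) module" where
  "hom_space L W = \<lparr>carrier = mod_hom A L W \<inter> extensional (carrier L),
     monoid.mult = (\<lambda>f g. f), monoid.one = (\<lambda>x\<in>carrier L. \<zero>\<^bsub>W\<^esub>),
     ring.zero = (\<lambda>x\<in>carrier L. \<zero>\<^bsub>W\<^esub>), ring.add = (\<lambda>f g. \<lambda>x\<in>carrier L. f x \<oplus>\<^bsub>W\<^esub> g x),
     smult = (\<lambda>c f. \<lambda>x\<in>carrier L. scal c \<odot>\<^bsub>W\<^esub> f x)\<rparr>"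

lemma hom_space_simps:
  "carrier (hom_space L W) = mod_hom A L W \<inter> extensional (carrier L)"
  "\<zero>\<^bsub>hom_space L W\<^esub> = (\<lambda>x\<in>carrier L. \<zero>\<^bsub>W\<^esub>)"
  "f \<oplus>\<^bsub>hom_space L W\<^esub> g = (\<lambda>x\<in>carrier L. f x \<oplus>\<^bsub>W\<^esub> g x)"
  "c \<odot>\<^bsub>hom_space L W\<^esub> f = (\<lambda>x\<in>carrier L. scal c \<odot>\<^bsub>W\<^esub> f x)"
  by (simp_all add: hom_space_def)

lemma restrict_hom_space:
  assumes "right_module A L" "f \<in> mod_hom A L W"
  shows "restrict f (carrier L) \<in> carrier (hom_space L W)"
  unfolding hom_space_simps
  using mod_hom_cong[OF assms(2,1), of "restrict f (carrier L)"] by simp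

lemma hom_spaceD: "f \<in> carrier (hom_space L W) \<Longrightarrow> f \<in> mod_hom A L W"
  by (simp add: hom_space_simps)

lemma hom_space_eqI:
  "f \<in> carrier (hom_space L W) \<Longrightarrow> g \<in> carrier (hom_space L W) \<Longrightarrow>
    (\<And>x. x \<in> carrier L \<Longrightarrow> f x = g x) \<Longrightarrow> f = g"
  unfolding hom_space_simps by (auto intro: extensionalityI)

text \<open>Scalar multiples of linear maps are linear because \<open>scal c\<close> is
  central.\<close>

lemma mod_hom_scal:
  assumes "right_module A W" "f \<in> mod_hom A L W" "c \<in> carrier K"
  shows "(\<lambda>x. scal c \<odot>\<^bsub>W\<^esub> f x) \<in> mod_hom A L W"
proof -
  interpret W: right_module A W by (rule assms)
  have "scal c \<odot>\<^bsub>W\<^esub> (a \<odot>\<^bsub>W\<^esub> w) = a \<odot>\<^bsub>W\<^esub> (scal c \<odot>\<^bsub>W\<^esub> w)" if "a \<in> carrier A" "w \<in> carrier W" for a w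
    using that assms(3) by (simp add: W.act_assoc[symmetric] scal_mult mult_scal)
  then show ?thesis using assms(2,3) by (auto simp: mod_hom_iff W.act_closed W.act_add)
qed

lemma right_module_hom_space:
  assumes L: "right_module A L" and W: "right_module A W"
  shows "right_module K (hom_space L W)"
proof -
  interpret W: right_module A W by (rule W)
  interpret KW: right_module K "kmod W" by (rule right_module_kmod[OF W])
  let ?H = "hom_space L W"
  note cl = mod_hom_closed[OF hom_spaceD]
  have z: "\<zero>\<^bsub>?H\<^esub> \<in> carrier ?H" unfolding hom_space_simps(2)
    by (rule restrict_hom_space[OF L mod_hom_zero_map[OF L W]])
  have a: "f \<oplus>\<^bsub>?H\<^esub> g \<in> carrier ?H" if "f \<in> carrier ?H" "g \<in> carrier ?H" for f g
    unfolding hom_space_simps(3)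
    by (rule restrict_hom_space[OF L mod_hom_plus[OF W that[THEN hom_spaceD]]])
  have s: "c \<odot>\<^bsub>?H\<^esub> f \<in> carrier ?H" if "c \<in> carrier K" "f \<in> carrier ?H" for c f
    unfolding hom_space_simps(4)
    by (rule restrict_hom_space[OF L mod_hom_scal[OF W hom_spaceD[OF that(2)] that(1)]])
  have ab: "abelian_group ?H"
  proof (rule abelian_groupI)
    fix f assume f: "f \<in> carrier ?H"
    let ?g = "\<lambda>x\<in>carrier L. \<ominus>\<^bsub>W\<^esub> f x"
    have "?g \<in> carrier ?H" by (rule restrict_hom_space[OF L mod_hom_uminus[OF W hom_spaceD[OF f]]])
    moreover from this have "?g \<oplus>\<^bsub>?H\<^esub> f = \<zero>\<^bsub>?H\<^esub>"
      by (intro hom_space_eqI[OF a[OF _ f] z]) (auto simp: hom_space_simps(2,3) W.M.l_neg cl[OF f])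
    ultimately show "\<exists>g\<in>carrier ?H. g \<oplus>\<^bsub>?H\<^esub> f = \<zero>\<^bsub>?H\<^esub>" by blast
  next
    fix f g h assume f: "f \<in> carrier ?H" "g \<in> carrier ?H" "h \<in> carrier ?H"
    show "f \<oplus>\<^bsub>?H\<^esub> g \<oplus>\<^bsub>?H\<^esub> h = f \<oplus>\<^bsub>?H\<^esub> (g \<oplus>\<^bsub>?H\<^esub> h)"
      by (intro hom_space_eqI[of _ L W] a f) (auto simp: hom_space_simps(3) W.M.a_assoc cl[OF f(1)] cl[OF f(2)] cl[OF f(3)])
  next
    fix f g assume f: "f \<in> carrier ?H" "g \<in> carrier ?H"
    show "f \<oplus>\<^bsub>?H\<^esub> g = g \<oplus>\<^bsub>?H\<^esub> f"
      by (intro hom_space_eqI[of _ L W] a f) (auto simp: hom_space_simps(3) W.M.a_comm cl[OF f(1)] cl[OF f(2)])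
  next
    fix f assume f: "f \<in> carrier ?H"
    show "\<zero>\<^bsub>?H\<^esub> \<oplus>\<^bsub>?H\<^esub> f = f"
      by (intro hom_space_eqI[of _ L W] a f z) (auto simp: hom_space_simps(2,3) cl[OF f])
  qed (use z a in auto)
  show ?thesis
  proof (intro right_module.intro R.ring_axioms ab right_module_axioms.intro)
    fix c d f assume c: "c \<in> carrier K" "d \<in> carrier K" and f: "f \<in> carrier ?H"
    show "(c \<oplus>\<^bsub>K\<^esub> d) \<odot>\<^bsub>?H\<^esub> f = c \<odot>\<^bsub>?H\<^esub> f \<oplus>\<^bsub>?H\<^esub> d \<odot>\<^bsub>?H\<^esub> f"
      using KW.act_add_scalar[OF c] by (intro hom_space_eqI[of _ L W] a s f c) (auto simp: c hom_space_simps(3,4) cl[OF f])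
    show "(c \<otimes>\<^bsub>K\<^esub> d) \<odot>\<^bsub>?H\<^esub> f = d \<odot>\<^bsub>?H\<^esub> (c \<odot>\<^bsub>?H\<^esub> f)"
      using KW.act_assoc[OF c] by (intro hom_space_eqI[of _ L W] a s f c) (auto simp: c hom_space_simps(3,4) cl[OF f])
  next
    fix c f g assume c: "c \<in> carrier K" and f: "f \<in> carrier ?H" "g \<in> carrier ?H"
    show "c \<odot>\<^bsub>?H\<^esub> (f \<oplus>\<^bsub>?H\<^esub> g) = c \<odot>\<^bsub>?H\<^esub> f \<oplus>\<^bsub>?H\<^esub> c \<odot>\<^bsub>?H\<^esub> g"
      using KW.act_add[OF c] by (intro hom_space_eqI[of _ L W] a s f c) (auto simp: c hom_space_simps(3,4) cl[OF f(1)] cl[OF f(2)])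
  next
    fix f assume f: "f \<in> carrier ?H"
    show "\<one>\<^bsub>K\<^esub> \<odot>\<^bsub>?H\<^esub> f = f"
      using KW.act_one by (intro hom_space_eqI[of _ L W] a s f R.one_closed) (auto simp: hom_space_simps(3,4) cl[OF f])
  qed (use s in auto)
qed

text \<open>Maps are evaluated at one generator at a time. Evaluation at \<open>d\<close> takes
  values in the finite dimensional \<open>W\<close>, and its kernel on \<open>V F\<close> is
  \<open>V (insert d F)\<close>; a map that vanishes on a generating set is zero.\<close>

lemma finite_length_hom_space:
  assumes L: "L \<in> Mods" and W: "W \<in> Mods"
  shows "finite_length K (hom_space L W)"
proof -
  note rm = right_module_Mods[OF L] right_module_Mods[OF W]
  let ?H = "hom_space L W"
  interpret L: right_module A L by (rule rm)
  interpret W: right_module A W by (rule rm)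
  interpret H: right_module K ?H by (rule right_module_hom_space[OF rm])
  define V where "V F = {f \<in> carrier ?H. \<forall>x\<in>F. f x = \<zero>\<^bsub>W\<^esub>}" for F
  note KW = right_module_kmod[OF rm(2)]
  interpret KW: right_module K "kmod W" by (rule KW)
  have V: "submodule (V F) K ?H" if "F \<subseteq> carrier L" for F
  proof -
    have "x \<in> carrier L" if "x \<in> F" for x using that \<open>F \<subseteq> carrier L\<close> by blast
    then show ?thesis unfolding H.submodule_iff V_def using KW.act_zero H.act_closed H.M.zero_closed H.M.a_closed
      by (auto simp: hom_space_simps(2-4))
  qed
  have "finite_length K (?H\<lparr>carrier := V F\<rparr>)"
    if "finite D" "D \<subseteq> carrier L" "F \<subseteq> carrier L" "generates A L (D \<union> F)" for D F
    using that
  proof (induction D arbitrary: F)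
    case empty
    have "V F = {\<zero>\<^bsub>?H\<^esub>}"
    proof (intro equalityI subsetI)
      fix f assume f: "f \<in> V F"
      then have fH: "f \<in> carrier ?H" by (simp add: V_def)
      have "F \<subseteq> a_kernel L W f" using f empty by (auto simp: V_def a_kernel_def')
      then have "a_kernel L W f = carrier L"
        using empty submodule_kernel[OF rm hom_spaceD[OF fH]] by (simp add: generates_def)
      then have "f x = \<zero>\<^bsub>W\<^esub>" if "x \<in> carrier L" for x using that by (auto simp: a_kernel_def')
      then have "f = \<zero>\<^bsub>?H\<^esub>" by (intro hom_space_eqI[OF fH H.M.zero_closed]) (simp add: hom_space_simps(2))
      then show "f \<in> {\<zero>\<^bsub>?H\<^esub>}" by simp
    next
      fix f assume "f \<in> {\<zero>\<^bsub>?H\<^esub>}"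
      then show "f \<in> V F" using V[OF empty(2)] by (simp add: H.submodule_iff)
    qed
    then show ?case using H.restrict_carrier[OF V[OF empty(2)]] by (intro finite_length_trivial) auto
  next
    case (insert d D)
    have d: "d \<in> carrier L" using insert.prems by simp
    let ?V = "?H\<lparr>carrier := V F\<rparr>"
    note rV = H.restrict_carrier[OF V[OF insert.prems(2)]]
    have ev: "(\<lambda>f. f d) \<in> mod_hom K ?V (kmod W)"
      using d mod_hom_closed[OF hom_spaceD] by (auto simp: mod_hom_iff V_def hom_space_simps(3,4))
    have k: "a_kernel ?V (kmod W) (\<lambda>f. f d) = V (insert d F)" by (auto simp: a_kernel_def' V_def)
    have "finite_length K (?H\<lparr>carrier := V (insert d F)\<rparr>)" using insert.prems by (intro insert.IH) auto
    then have "finite_length K (?V\<lparr>carrier := a_kernel ?V (kmod W) (\<lambda>f. f d)\<rparr>)" unfolding k by simp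
    then show ?case by (rule finite_length_extension[OF rV KW ev _ finite_length_kmod[OF fg_modulesD[OF W]]])
  qed
  note key = this
  obtain G where G: "finite G" "generates A L G"
    using finitely_generated_iff[OF rm(1)] fg_modulesD(2)[OF L] by blast
  then have "finite_length K (?H\<lparr>carrier := V {}\<rparr>)" by (intro key[of G]) (auto simp: generates_def)
  moreover have "V {} = carrier ?H" by (simp add: V_def)
  moreover have "submodule U K (?H\<lparr>carrier := carrier ?H\<rparr>) \<longleftrightarrow> submodule U K ?H" for U
    unfolding H.submodule_restrict[OF H.submodule_carrier] by (auto simp: H.submodule_iff)
  ultimately show ?thesis by (simp add: finite_length_def strictly_monotone_def)
qed

definition precomp where
  "precomp L i f = (\<lambda>x\<in>carrier L. f (i x))"

definition hdim :: "('a, nat \<Rightarrow> 'a) module \<Rightarrow> ('a, nat \<Rightarrow> 'a) module \<Rightarrow> nat" where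
  "hdim L W = len K (hom_space L W)"

lemma precomp_hom:
  assumes L: "right_module A L" and W: "right_module A W" and i: "i \<in> mod_hom A L P"
  shows "precomp L i \<in> mod_hom K (hom_space P W) (hom_space L W)"
  unfolding mod_hom_iff
proof (intro conjI ballI)
  interpret KW: right_module K "kmod W" by (rule right_module_kmod[OF W])
  note ic = mod_hom_closed[OF i]
  show c: "precomp L i f \<in> carrier (hom_space L W)" if "f \<in> carrier (hom_space P W)" for f
    unfolding precomp_def by (rule restrict_hom_space[OF L mod_hom_comp[OF i hom_spaceD[OF that]]])
  show "precomp L i (f \<oplus>\<^bsub>hom_space P W\<^esub> g) = precomp L i f \<oplus>\<^bsub>hom_space L W\<^esub> precomp L i g" for f g
    using ic by (auto simp: precomp_def hom_space_simps fun_eq_iff restrict_def)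
  show "precomp L i (c \<odot>\<^bsub>hom_space P W\<^esub> f) = c \<odot>\<^bsub>hom_space L W\<^esub> precomp L i f" for c f
    using ic by (auto simp: precomp_def hom_space_simps fun_eq_iff restrict_def)
qed

text \<open>Left exactness of \<open>Hom(-, W)\<close>: the maps that vanish on \<open>L\<close> are
  those that factor through \<open>p\<close>, in a unique way.\<close>

lemma kernel_precomp_len:
  assumes s: "ses A L i P p M" and W: "W \<in> Mods"
  shows "len K ((hom_space P W)\<lparr>carrier := a_kernel (hom_space P W) (hom_space L W) (precomp L i)\<rparr>) = hdim M W"
proof -
  note D = sesD[OF s] and rW = right_module_Mods[OF W]
  let ?k = "a_kernel (hom_space P W) (hom_space L W) (precomp L i)"
  note HP = right_module_hom_space[OF D(10) rW] and HL = right_module_hom_space[OF D(9) rW]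
    and HM = right_module_hom_space[OF D(11) rW]
  interpret HP: right_module K "hom_space P W" by (rule HP)
  have kk: "submodule ?k K (hom_space P W)" by (rule submodule_kernel[OF HP HL precomp_hom[OF D(9) rW D(4)]])
  have mem: "f \<in> ?k \<longleftrightarrow> f \<in> carrier (hom_space P W) \<and> (\<forall>x\<in>carrier L. f (i x) = \<zero>\<^bsub>W\<^esub>)" for f
    by (auto simp: a_kernel_def' hom_space_simps(2) precomp_def fun_eq_iff restrict_def)
  have im: "precomp P p f \<in> ?k" if f: "f \<in> carrier (hom_space M W)" for f
  proof -
    have "precomp P p f \<in> carrier (hom_space P W)"
      by (rule mod_hom_closed[OF precomp_hom[OF D(10) rW D(5)] f])
    moreover have "precomp P p f (i x) = \<zero>\<^bsub>W\<^esub>" if "x \<in> carrier L" for x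
      using that mod_hom_closed[OF D(4) that] mod_hom_zero[OF D(11) rW hom_spaceD[OF f]]
      by (simp add: precomp_def ses_comp[OF s])
    ultimately show ?thesis by (simp add: mem)
  qed
  then have h: "precomp P p \<in> mod_hom K (hom_space M W) ((hom_space P W)\<lparr>carrier := ?k\<rparr>)"
    using precomp_hom[OF D(10) rW D(5)] by (simp add: mod_hom_iff)
  have "bij_betw (precomp P p) (carrier (hom_space M W)) (carrier ((hom_space P W)\<lparr>carrier := ?k\<rparr>))"
    unfolding bij_betw_def
  proof (intro conjI equalityI subsetI inj_onI)
    fix f g assume f: "f \<in> carrier (hom_space M W)" "g \<in> carrier (hom_space M W)" "precomp P p f = precomp P p g"
    show "f = g"
    proof (rule hom_space_eqI[OF f(1,2)])
      fix y assume "y \<in> carrier M"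
      then obtain x where "x \<in> carrier P" "p x = y" using ses_surj[OF s] by blast
      then show "f y = g y" using fun_cong[OF f(3), of x] by (simp add: precomp_def)
    qed
  next
    fix f assume "f \<in> carrier ((hom_space P W)\<lparr>carrier := ?k\<rparr>)"
    then have f: "f \<in> carrier (hom_space P W)" "\<And>x. x \<in> carrier L \<Longrightarrow> f (i x) = \<zero>\<^bsub>W\<^esub>" using mem[of f] by auto
    obtain g where g: "g \<in> mod_hom A M W" "\<And>x. x \<in> carrier P \<Longrightarrow> g (p x) = f x"
      by (rule ses_colift[OF s rW hom_spaceD[OF f(1)]]) (use f(2) in blast)+
    let ?g = "restrict g (carrier M)"
    have gM: "?g \<in> carrier (hom_space M W)" by (rule restrict_hom_space[OF D(11) g(1)])
    have "f = precomp P p ?g"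
      using g(2) mod_hom_closed[OF D(5)]
      by (intro hom_space_eqI[OF f(1) mod_hom_closed[OF precomp_hom[OF D(10) rW D(5)] gM]]) (simp add: precomp_def)
    then show "f \<in> precomp P p ` carrier (hom_space M W)" using gM by blast
  qed (use im in auto)
  from len_bij[OF HM HP.restrict_carrier[OF kk] h this finite_length_hom_space[OF D(3) W]]
  show ?thesis by (simp add: hdim_def)
qed

text \<open>The maps from \<open>L\<close> to \<open>W\<close> that extend along \<open>i\<close>.
  When \<open>P\<close> is projective, \<open>Hom(L, W)\<close> modulo this subspace is
  \<open>Ext\<^sup>1(M, W)\<close>.\<close>

definition ext_image where
  "ext_image L i P W = precomp L i ` carrier (hom_space P W)"

lemma submodule_ext_image:
  assumes "right_module A L" "right_module A P" "right_module A W" "i \<in> mod_hom A L P"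
  shows "submodule (ext_image L i P W) K (hom_space L W)"
  unfolding ext_image_def
  by (rule submodule_image[OF right_module_hom_space right_module_hom_space precomp_hom
    right_module.submodule_carrier[OF right_module_hom_space]]; rule assms)

lemma hdim_ses:
  assumes s: "ses A L i P p M" and W: "W \<in> Mods"
  shows "hdim P W = hdim M W + len K ((hom_space L W)\<lparr>carrier := ext_image L i P W\<rparr>)"
proof -
  note D = sesD[OF s] and rW = right_module_Mods[OF W]
  note HP = right_module_hom_space[OF D(10) rW] and HL = right_module_hom_space[OF D(9) rW]
  interpret HL: right_module K "hom_space L W" by (rule HL)
  let ?I = "(hom_space L W)\<lparr>carrier := ext_image L i P W\<rparr>"
  note I = HL.restrict_carrier[OF submodule_ext_image[OF D(9,10) rW D(4)]]
  have h: "precomp L i \<in> mod_hom K (hom_space P W) ?I"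
    using precomp_hom[OF D(9) rW D(4)] by (auto simp: mod_hom_iff ext_image_def)
  have k: "a_kernel (hom_space P W) ?I (precomp L i) = a_kernel (hom_space P W) (hom_space L W) (precomp L i)"
    by (simp add: a_kernel_def')
  have surj: "precomp L i ` carrier (hom_space P W) = carrier ?I" by (simp add: ext_image_def)
  show ?thesis
    using len_exact[OF HP I h surj finite_length_hom_space[OF D(2) W]] kernel_precomp_len[OF s W]
    unfolding k by (simp add: hdim_def)
qed

text \<open>The exact sequence is rebuilt with the inclusion \<open>e\<close> that \<open>p\<close>
  retracts; then every map on \<open>U\<close> extends to \<open>D\<close> by composition with
  \<open>p\<close>, and restriction is onto.\<close>

lemma hdim_dsum:
  assumes U: "U \<in> Mods" and V: "V \<in> Mods" and D: "D \<in> Mods" and d: "is_dsum A D U V p q" and W: "W \<in> Mods"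
  shows "hdim D W = hdim U W + hdim V W"
proof -
  note rm = right_module_Mods[OF U] right_module_Mods[OF V] right_module_Mods[OF D] right_module_Mods[OF W]
  obtain i where s: "ses A U i D q V" by (rule ses_dsum[OF U V D d])
  note E = is_dsumE[OF d] and sD = sesD[OF s]
  obtain e where e: "e \<in> mod_hom A U D" "\<And>x. x \<in> carrier U \<Longrightarrow> p (e x) = x" "\<And>x. x \<in> carrier U \<Longrightarrow> q (e x) = \<zero>\<^bsub>V\<^esub>"
    by (rule is_dsum_injections[OF rm(3,1,2) d]) blast
  have s': "ses A U e D q V"
  proof (rule sesI[OF U D V e(1) E(2) _ ses_surj[OF s]])
    show "x = \<zero>\<^bsub>U\<^esub>" if "x \<in> carrier U" "e x = \<zero>\<^bsub>D\<^esub>" for x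
      using e(2)[OF that(1)] that(2) mod_hom_zero[OF rm(3,1) E(1)] by simp
    show "\<exists>y\<in>carrier U. x = e y" if x: "x \<in> carrier D" "q x = \<zero>\<^bsub>V\<^esub>" for x
    proof -
      have px: "p x \<in> carrier U" by (rule mod_hom_closed[OF E(1) x(1)])
      have "x = e (p x)"
        by (rule E(3)[OF x(1) mod_hom_closed[OF e(1) px]]) (simp_all only: e(2,3)[OF px] x(2))
      then show ?thesis using px by blast
    qed
  qed (use e(3) in auto)
  have "precomp U e ` carrier (hom_space D W) = carrier (hom_space U W)"
  proof (intro equalityI subsetI)
    fix f assume f: "f \<in> carrier (hom_space U W)"
    let ?g = "restrict (\<lambda>x. f (p x)) (carrier D)"
    have g: "?g \<in> carrier (hom_space D W)"
      by (rule restrict_hom_space[OF rm(3) mod_hom_comp[OF E(1) hom_spaceD[OF f]]])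
    have "f = precomp U e ?g"
      using e(2) mod_hom_closed[OF e(1)]
      by (intro hom_space_eqI[OF f mod_hom_closed[OF precomp_hom[OF rm(1,4) e(1)] g]]) (simp add: precomp_def)
    then show "f \<in> precomp U e ` carrier (hom_space D W)" using g by blast
  qed (use mod_hom_closed[OF precomp_hom[OF rm(1,4) e(1)]] in blast)
  from len_exact[OF right_module_hom_space[OF rm(3,4)] right_module_hom_space[OF rm(1,4)]
    precomp_hom[OF rm(1,4) e(1)] this finite_length_hom_space[OF D W]]
  show ?thesis using kernel_precomp_len[OF s' W] by (simp add: hdim_def)
qed

text \<open>
  The dimension of \<open>Ext\<^sup>1(M, W)\<close>, computed as an Euler characteristic: in this form its independence
  of the presentation and its additivity in \<open>M\<close> only involve dimensions of spaces of homomorphisms.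
\<close>

definition ext_dim :: "('a, nat \<Rightarrow> 'a) module \<Rightarrow> ('a, nat \<Rightarrow> 'a) module \<Rightarrow> int" where
  "ext_dim W M = (SOME e. \<exists>L i P p. projective A P \<and> ses A L i P p M \<and>
     e = int (hdim L W) - int (hdim P W) + int (hdim M W))"

text \<open>By Schanuel's lemma \<open>L\<close> plus \<open>P'\<close> and \<open>L'\<close> plus
  \<open>P\<close> have a common model \<open>D\<close>, so the two Euler characteristics
  agree.\<close>

lemma ext_dim_ses:
  assumes W: "W \<in> Mods" and s: "ses A L i P p M" "projective A P"
  shows "ext_dim W M = int (hdim L W) - int (hdim P W) + int (hdim M W)"
proof -
  have "\<exists>L i P p. projective A P \<and> ses A L i P p M \<and>
     ext_dim W M = int (hdim L W) - int (hdim P W) + int (hdim M W)"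
    unfolding ext_dim_def by (rule someI_ex) (use s in blast)
  then obtain L' i' P' p' where s': "projective A P'" "ses A L' i' P' p' M"
    and e: "ext_dim W M = int (hdim L' W) - int (hdim P' W) + int (hdim M W)" by blast
  note sD = sesD[OF s(1)] and sD' = sesD[OF s'(2)]
  obtain D r v r' v' where D: "D \<in> Mods" "is_dsum A D L P' r v" "is_dsum A D L' P r' v'"
    by (rule schanuel[OF s s'(2,1)])
  show ?thesis using hdim_dsum[OF sD(1) sD'(2) D(1,2) W] hdim_dsum[OF sD'(1) sD(2) D(1,3) W] e by simp
qed

text \<open>This identifies the Euler characteristic with the codimension of the extendable maps,
  which is the form from which extensions of maps are extracted.\<close>

lemma ext_dim_image:
  assumes W: "W \<in> Mods" and s: "ses A L i P p M" "projective A P"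
  shows "ext_dim W M = int (hdim L W) - int (len K ((hom_space L W)\<lparr>carrier := ext_image L i P W\<rparr>))"
  using ext_dim_ses[OF assms] hdim_ses[OF s(1) W] by simp

lemma ext_dim_dsum:
  assumes W: "W \<in> Mods" and D: "D \<in> Mods" and U: "U \<in> Mods" and V: "V \<in> Mods" and d: "is_dsum A D U V p q"
  shows "ext_dim W D = ext_dim W U + ext_dim W V"
proof -
  obtain P i1 p1 where s1: "projective A P" "ses A (syzygy A U) i1 P p1 U" by (rule syzygy_ses[OF U])
  obtain Q i2 p2 where s2: "projective A Q" "ses A (syzygy A V) i2 Q p2 V" by (rule syzygy_ses[OF V])
  obtain E a b where E: "E \<in> Mods" "is_dsum A E P Q a b"
    by (rule dsum_Mods[OF projective_Mods[OF s1(1)] projective_Mods[OF s2(1)]])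
  obtain F a' b' where F: "F \<in> Mods" "is_dsum A F (syzygy A U) (syzygy A V) a' b'"
    by (rule dsum_Mods[OF syzygy_Mods[OF U] syzygy_Mods[OF V]])
  obtain j t where t: "ses A F j E t D" by (rule dsum_ses[OF s1(2) s2(2) D d E F])
  show ?thesis
    using ext_dim_ses[OF W s1(2,1)] ext_dim_ses[OF W s2(2,1)] ext_dim_ses[OF W t projective_dsum[OF s1(1) s2(1) E]]
      hdim_dsum[OF U V D d W] hdim_dsum[OF sesD(2)[OF s1(2)] sesD(2)[OF s2(2)] E W]
      hdim_dsum[OF sesD(1)[OF s1(2)] sesD(1)[OF s2(2)] F W] by simp
qed

lemma ses_projective_dsum:
  assumes s: "ses A L i Q p P" and P: "projective A P"
  obtains r where "is_dsum A Q L P r p"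
proof -
  from projective_lift[OF P sesD(2,3,5)[OF s] mod_hom_id sesD(7)[OF s]]
  obtain t where t: "t \<in> mod_hom A P Q" "\<forall>x\<in>carrier P. p (t x) = x" by (rule bexE)
  obtain r where "is_dsum A Q L P r p"
    by (rule ses_section[OF s t(1)]) (use t(2) in blast)+
  then show thesis by (rule that)
qed

lemma ext_dim_projective:
  assumes W: "W \<in> Mods" and P: "projective A P" shows "ext_dim W P = 0"
proof -
  note PM = projective_Mods[OF P]
  obtain Q i p where s: "projective A Q" "ses A (syzygy A P) i Q p P" by (rule syzygy_ses[OF PM])
  obtain r where d: "is_dsum A Q (syzygy A P) P r p" by (rule ses_projective_dsum[OF s(2) P])
  from hdim_dsum[OF syzygy_Mods[OF PM] PM projective_Mods[OF s(1)] d W]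
  show ?thesis using ext_dim_ses[OF W s(2,1)] by simp
qed

text \<open>Additivity and vanishing on projectives make the dimension of \<open>Ext(-, W)\<close> a
  function of the class. This is the bridge from equalities in \<open>K0 A\<close> back to
  modules.\<close>

lemma ext_dim_hom:
  assumes W: "W \<in> Mods"
  obtains h where "h \<in> hom (K0 A) integer_group" "\<And>M. M \<in> Mods \<Longrightarrow> h (cls M) = ext_dim W M"
proof (rule K0_universal[OF abelian_integer_group, of "ext_dim W"])
  show "ext_dim W D = ext_dim W U \<otimes>\<^bsub>integer_group\<^esub> ext_dim W V"
    if "D \<in> Mods" "U \<in> Mods" "V \<in> Mods" "is_dsum A D U V p q" for D U V p q
    using ext_dim_dsum[OF W that] by (simp add: integer_group_def)
  show "ext_dim W P = \<one>\<^bsub>integer_group\<^esub>" if "projective A P" for P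
    using ext_dim_projective[OF W that] by (simp add: integer_group_def)
qed (use that in auto)

lemma ext_dim_cls: "W \<in> Mods \<Longrightarrow> M \<in> Mods \<Longrightarrow> N \<in> Mods \<Longrightarrow> cls M = cls N \<Longrightarrow> ext_dim W M = ext_dim W N"
  by (rule ext_dim_hom[of W], assumption) metis

text \<open>Apply the dimension of \<open>Ext(-, W)\<close> with \<open>W\<close> the syzygy of
  \<open>M\<close>: it is zero, so every endomorphism of the syzygy extends to \<open>P\<close>.
  Extending the identity splits the presentation. Integer multiples are allowed, so torsion in
  \<open>K0 A\<close> needs no separate treatment.\<close>

lemma cls_pow_one_imp_projective:
  assumes M: "M \<in> Mods" and n: "n \<noteq> 0" and one: "cls M [^]\<^bsub>K0 A\<^esub> (n::int) = \<one>\<^bsub>K0 A\<^esub>"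
  shows "projective A M"
proof -
  obtain P i p where s: "projective A P" "ses A (syzygy A M) i P p M" by (rule syzygy_ses[OF M])
  let ?L = "syzygy A M"
  note sD = sesD[OF s(2)]
  obtain h where h: "h \<in> hom (K0 A) integer_group" "\<And>M. M \<in> Mods \<Longrightarrow> h (cls M) = ext_dim ?L M"
    by (rule ext_dim_hom[OF sD(1)]) blast
  interpret h: group_hom "K0 A" integer_group h
    by (intro group_hom.intro group_hom_axioms.intro group_K0 group_integer_group h(1))
  have "n * ext_dim ?L M = 0"
    using h.hom_int_pow[OF cls_closed[OF M], of n] one h.hom_one h(2)[OF M]
    by simp
  then have "ext_dim ?L M = 0" using n by simp
  then have len: "len K ((hom_space ?L ?L)\<lparr>carrier := ext_image ?L i P ?L\<rparr>) = len K (hom_space ?L ?L)"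
    using ext_dim_image[OF sD(1) s(2,1)] by (simp add: hdim_def)
  have "ext_image ?L i P ?L = carrier (hom_space ?L ?L)"
    using len_restrict_less[OF right_module_hom_space[OF sD(9,9)] finite_length_hom_space[OF sD(1,1)]
      submodule_ext_image[OF sD(9,10,9,4)]] len by auto
  then have "restrict (\<lambda>x. x) (carrier ?L) \<in> ext_image ?L i P ?L"
    using restrict_hom_space[OF sD(9) mod_hom_id] by simp
  then obtain r where r: "r \<in> mod_hom A P ?L" "restrict (\<lambda>x. x) (carrier ?L) = precomp ?L i r"
    unfolding ext_image_def using hom_spaceD by blast
  have ri: "r (i x) = x" if "x \<in> carrier ?L" for x
    using fun_cong[OF r(2), of x] that by (simp add: precomp_def)
  have "is_dsum A P ?L M r p" by (rule ses_retraction[OF s(2) r(1)]) (rule ri)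
  from retract_dsum(2)[OF sD(1,3,2) this] show ?thesis by (rule projective_retract[OF s(1)])
qed

text \<open>
  A version of Miyata's theorem: the second extension is the pushout of the first one along \<open>g\<close>, and
  it cannot have the same class unless \<open>g\<close> factors through \<open>a\<close>.
\<close>

lemma cls_eq_imp_extends:
  assumes a: "ses A N a E q C" and E: "projective A E" and Q: "projective A Q"
    and g: "g \<in> mod_hom A N Q"
    and S: "S \<in> Mods" "is_dsum A S E Q u v" and k: "ses A N k S w Y"
    and uk: "\<And>x. x \<in> carrier N \<Longrightarrow> u (k x) = a x" and vk: "\<And>x. x \<in> carrier N \<Longrightarrow> v (k x) = g x"
    and eq: "cls C = cls Y"
  shows "\<exists>h\<in>mod_hom A E Q. \<forall>x\<in>carrier N. h (a x) = g x"
proof -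
  note aD = sesD[OF a] and kD = sesD[OF k] and QM = projective_Mods[OF Q]
  note rQ = right_module_Mods[OF QM]
  note Es = is_dsumE[OF S(2)]
  have PS: "projective A S" by (rule projective_dsum[OF E Q S])
  let ?H = "hom_space N Q" and ?I = "ext_image N a E Q" and ?J = "ext_image N k S Q"
  note rH = right_module_hom_space[OF aD(9) rQ]
  interpret H: right_module K ?H by (rule rH)
  have I: "submodule ?I K ?H" by (rule submodule_ext_image[OF aD(9,10) rQ aD(4)])
  have J: "submodule ?J K ?H" by (rule submodule_ext_image[OF kD(9,10) rQ kD(4)])
  \<comment> \<open>Both cokernels have \<open>N\<close> as syzygy, so equal classes mean that the
    extendable maps along \<open>a\<close> and along \<open>k\<close> have the same
    dimension.\<close>
  have len: "len K (?H\<lparr>carrier := ?I\<rparr>) = len K (?H\<lparr>carrier := ?J\<rparr>)"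
    using ext_dim_image[OF QM a E] ext_dim_image[OF QM k PS] ext_dim_cls[OF QM aD(3) kD(3) eq] by simp
  have "?I \<subseteq> ?J"
  proof
    fix f assume "f \<in> ?I"
    then obtain f' where f': "f' \<in> carrier (hom_space E Q)" "f = precomp N a f'" by (auto simp: ext_image_def)
    let ?g = "restrict (\<lambda>x. f' (u x)) (carrier S)"
    have "?g \<in> carrier (hom_space S Q)"
      by (rule restrict_hom_space[OF kD(10) mod_hom_comp[OF Es(1) hom_spaceD[OF f'(1)]]])
    moreover have "f = precomp N k ?g"
      unfolding f'(2) precomp_def by (rule restrict_ext) (simp add: uk mod_hom_closed[OF kD(4)])
    ultimately show "f \<in> ?J" by (auto simp: ext_image_def)
  qed
  then have "submodule ?I K (?H\<lparr>carrier := ?J\<rparr>)" using I by (simp add: H.submodule_restrict[OF J])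
  from len_restrict_less[OF H.restrict_carrier[OF J]
    finite_length_restrict[OF rH J finite_length_hom_space[OF aD(1) QM]] this]
  have "?I = ?J" using len by auto
  \<comment> \<open>The projection \<open>v\<close> extends \<open>g\<close> along \<open>k\<close>;
    as the two spaces coincide, \<open>g\<close> also extends along \<open>a\<close>.\<close>
  moreover have "restrict g (carrier N) = precomp N k (restrict v (carrier S))"
    unfolding precomp_def by (rule restrict_ext) (simp add: vk mod_hom_closed[OF kD(4)])
  then have "restrict g (carrier N) \<in> ?J"
    using restrict_hom_space[OF kD(10) Es(2)] by (auto simp: ext_image_def)
  ultimately obtain h where h: "h \<in> mod_hom A E Q" "restrict g (carrier N) = precomp N a h"
    unfolding ext_image_def using hom_spaceD by blast
  have "h (a x) = g x" if "x \<in> carrier N" for x using fun_cong[OF h(2), of x] that by (simp add: precomp_def)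
  then show ?thesis by (intro bexI[OF _ h(1)] ballI)
qed

end

section \<open>Simple modules and their projective covers\<close>

context fd_algebra
begin

definition simple where
  "simple T \<longleftrightarrow> T \<in> Mods \<and> carrier T \<noteq> {\<zero>\<^bsub>T\<^esub>} \<and>
    (\<forall>U. submodule U A T \<longrightarrow> U = {\<zero>\<^bsub>T\<^esub>} \<or> U = carrier T)"

lemma simpleD:
  assumes "simple T"
  shows "T \<in> Mods" "carrier T \<noteq> {\<zero>\<^bsub>T\<^esub>}" "submodule U A T \<Longrightarrow> U = {\<zero>\<^bsub>T\<^esub>} \<or> U = carrier T"
  using assms by (auto simp: simple_def)

lemma simple_submodule_exists:
  assumes M: "M \<in> Mods" and ne: "carrier M \<noteq> {\<zero>\<^bsub>M\<^esub>}"
  obtains U where "submodule U A M" "simple (M\<lparr>carrier := U\<rparr>)"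
proof -
  note rm = right_module_Mods[OF M]
  interpret N: right_module A M by (rule rm)
  let ?S = "\<lambda>U. submodule U A M \<and> U \<noteq> {\<zero>\<^bsub>M\<^esub>}"
  have "?S (carrier M)" using ne N.submodule_carrier by simp
  then obtain U where U: "?S U" and min: "\<And>V. ?S V \<Longrightarrow> len A (M\<lparr>carrier := U\<rparr>) \<le> len A (M\<lparr>carrier := V\<rparr>)"
    using ex_has_least_nat[of ?S "carrier M" "\<lambda>U. len A (M\<lparr>carrier := U\<rparr>)"] by blast
  then have Us: "submodule U A M" by simp
  have UM: "M\<lparr>carrier := U\<rparr> \<in> Mods" by (rule restrict_Mods[OF M Us])
  have "V = {\<zero>\<^bsub>M\<^esub>} \<or> V = U" if V: "submodule V A (M\<lparr>carrier := U\<rparr>)" for V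
  proof (rule disjCI)
    assume "V \<noteq> U"
    from len_restrict_less[OF right_module_Mods[OF UM] finite_length_Mods[OF UM] V] this
    have "len A (M\<lparr>carrier := V\<rparr>) < len A (M\<lparr>carrier := U\<rparr>)" by simp
    then show "V = {\<zero>\<^bsub>M\<^esub>}" using min[of V] V unfolding N.submodule_restrict[OF Us] by fastforce
  qed
  then have "simple (M\<lparr>carrier := U\<rparr>)" unfolding simple_def using UM U by simp
  with Us show thesis by (rule that)
qed

lemma simple_quotient_exists:
  assumes M: "M \<in> Mods" and ne: "carrier M \<noteq> {\<zero>\<^bsub>M\<^esub>}"
  obtains T q where "simple T" "q \<in> mod_hom A M T" "q ` carrier M = carrier T"
proof -
  note rm = right_module_Mods[OF M]
  interpret N: right_module A M by (rule rm)
  let ?S = "\<lambda>U. submodule U A M \<and> U \<noteq> carrier M"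
  have "?S {\<zero>\<^bsub>M\<^esub>}" using ne N.submodule_zero by auto
  moreover have "\<forall>U. ?S U \<longrightarrow> len A (M\<lparr>carrier := U\<rparr>) < Suc (len A M)"
    using len_restrict_le[OF rm finite_length_Mods[OF M]] by (auto simp: less_Suc_eq_le)
  ultimately obtain U where U: "?S U" and max: "\<And>V. ?S V \<Longrightarrow> len A (M\<lparr>carrier := V\<rparr>) \<le> len A (M\<lparr>carrier := U\<rparr>)"
    using Lattices_Big.ex_has_greatest_nat[of ?S "{\<zero>\<^bsub>M\<^esub>}" "\<lambda>U. len A (M\<lparr>carrier := U\<rparr>)"] by blast
  then have Us: "submodule U A M" by simp
  obtain T q where T: "T \<in> Mods" "q \<in> mod_hom A M T" "q ` carrier M = carrier T" "a_kernel M T q = U"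
    by (rule quotient_Mods[OF M Us])
  note rT = right_module_Mods[OF T(1)]
  interpret T: right_module A T by (rule rT)
  have "V = {\<zero>\<^bsub>T\<^esub>} \<or> V = carrier T" if V: "submodule V A T" for V
  proof (rule disjCI)
    assume neq: "V \<noteq> carrier T"
    let ?W = "{x \<in> carrier M. q x \<in> V}"
    have W: "submodule ?W A M" by (rule submodule_vimage[OF rm rT T(2) V])
    have qW: "q ` ?W = V"
    proof (intro equalityI subsetI)
      fix y assume y: "y \<in> V"
      then have "y \<in> q ` carrier M" using V T(3) by (auto simp: T.submodule_iff)
      then show "y \<in> q ` ?W" using y by auto
    qed auto
    have "?W \<noteq> carrier M" using qW neq T(3) by auto
    then have le: "len A (M\<lparr>carrier := ?W\<rparr>) \<le> len A (M\<lparr>carrier := U\<rparr>)" using W by (intro max) simp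
    have UW: "U \<subseteq> ?W" unfolding T(4)[symmetric] using V by (auto simp: a_kernel_def' T.submodule_iff)
    have WM: "M\<lparr>carrier := ?W\<rparr> \<in> Mods" by (rule restrict_Mods[OF M W])
    have "submodule U A (M\<lparr>carrier := ?W\<rparr>)" using Us UW by (simp add: N.submodule_restrict[OF W])
    from len_restrict_less[OF right_module_Mods[OF WM] finite_length_Mods[OF WM] this]
    have "U = ?W" using le by auto
    then have "q ` ?W \<subseteq> {\<zero>\<^bsub>T\<^esub>}" using T(4) by (auto simp: a_kernel_def')
    then have "V \<subseteq> {\<zero>\<^bsub>T\<^esub>}" by (simp only: qW)
    then show "V = {\<zero>\<^bsub>T\<^esub>}" using V by (auto simp: T.submodule_iff)
  qed
  moreover have "carrier T \<noteq> {\<zero>\<^bsub>T\<^esub>}"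
  proof
    assume "carrier T = {\<zero>\<^bsub>T\<^esub>}"
    then have "a_kernel M T q = carrier M" using mod_hom_closed[OF T(2)] by (auto simp: a_kernel_def')
    then show False using U T(4) by simp
  qed
  ultimately have "simple T" using T(1) by (simp add: simple_def)
  then show thesis using T(2,3) by (rule that)
qed

lemma hom_from_simple:
  assumes T: "simple T" and M: "M \<in> Mods" and f: "f \<in> mod_hom A T M" and x: "x \<in> carrier T" "f x \<noteq> \<zero>\<^bsub>M\<^esub>"
  shows "inj_on f (carrier T)"
proof -
  note TM = simpleD(1)[OF T]
  note rm = right_module_Mods[OF TM] right_module_Mods[OF M]
  have "a_kernel T M f \<noteq> carrier T" using x by (auto simp: a_kernel_def')
  then have k: "a_kernel T M f = {\<zero>\<^bsub>T\<^esub>}" using simpleD(3)[OF T submodule_kernel[OF rm f]] by blast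
  have "y = \<zero>\<^bsub>T\<^esub>" if "y \<in> carrier T" "f y = \<zero>\<^bsub>M\<^esub>" for y
    using that k by (auto simp: a_kernel_def')
  then show ?thesis unfolding mod_hom_inj_iff[OF rm f] by blast
qed

lemma hom_to_simple:
  assumes T: "simple T" and M: "M \<in> Mods" and f: "f \<in> mod_hom A M T"
    and U: "submodule U A M" and x: "x \<in> U" "f x \<noteq> \<zero>\<^bsub>T\<^esub>"
  shows "f ` U = carrier T"
  using simpleD(3)[OF T submodule_image[OF right_module_Mods[OF M] right_module_Mods[OF simpleD(1)[OF T]] f U]] x
  by blast

lemma simple_nonzero:
  assumes "simple T" obtains x where "x \<in> carrier T" "x \<noteq> \<zero>\<^bsub>T\<^esub>"
proof -
  interpret T: right_module A T by (rule right_module_Mods[OF simpleD(1)[OF assms]])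
  have "\<zero>\<^bsub>T\<^esub> \<in> carrier T" by simp
  then show thesis using simpleD(2)[OF assms] that by blast
qed

lemma simple_indecomposable: assumes T: "simple T" shows "indecomposable A T"
  unfolding indecomposable_def mod_isomorphic_direct_sum_iff
proof (intro conjI ballI impI)
  note TM = simpleD(1)[OF T]
  show "T \<in> Mods" "carrier T \<noteq> {\<zero>\<^bsub>T\<^esub>}" by (rule simpleD[OF T])+
  fix U V assume U: "U \<in> Mods" and V: "V \<in> Mods" and "\<exists>p q. is_dsum A T U V p q"
  then obtain p q where d: "is_dsum A T U V p q" by blast
  have "len A (T\<lparr>carrier := W\<rparr>) = 0 \<or> len A (T\<lparr>carrier := W\<rparr>) = len A T" if W: "submodule W A T" for W
  proof -
    interpret T: right_module A T by (rule right_module_Mods[OF TM])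
    from simpleD(3)[OF T W] show ?thesis
    proof
      assume "W = {\<zero>\<^bsub>T\<^esub>}"
      then show ?thesis using finite_length_trivial(2)[OF T.restrict_carrier[OF W]] by simp
    next
      assume "W = carrier T"
      then show ?thesis by (cases T) simp
    qed
  qed
  show "carrier U = {\<zero>\<^bsub>U\<^esub>} \<or> carrier V = {\<zero>\<^bsub>V\<^esub>}"
  proof (rule disjCI)
    assume "carrier V \<noteq> {\<zero>\<^bsub>V\<^esub>}"
    obtain i where s: "ses A U i T q V" by (rule ses_dsum[OF U V TM d])
    note sD = sesD[OF s]
    interpret U: right_module A U by (rule sD)
    interpret V: right_module A V by (rule sD)
    have im: "submodule (i ` carrier U) A T" by (rule submodule_image[OF sD(9,10,4) U.submodule_carrier])
    have "i ` carrier U \<noteq> carrier T"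
    proof
      assume "i ` carrier U = carrier T"
      then have "q ` carrier T = {\<zero>\<^bsub>V\<^esub>}" using ses_comp[OF s] U.M.zero_closed by (metis (no_types, lifting) image_cong image_constant image_image)
      then show False using sD(7) \<open>carrier V \<noteq> _\<close> by simp
    qed
    then have "i ` carrier U = {\<zero>\<^bsub>T\<^esub>}" using simpleD(3)[OF T im] by blast
    then have "x = \<zero>\<^bsub>U\<^esub>" if "x \<in> carrier U" for x using ses_inj[OF s that] that by blast
    then show "carrier U = {\<zero>\<^bsub>U\<^esub>}" using U.M.zero_closed by blast
  qed
qed

lemma cover_local:
  assumes T: "simple T" and c: "projective_cover A P p T" and U: "submodule U A P" "U \<noteq> carrier P" and x: "x \<in> U"
  shows "p x = \<zero>\<^bsub>T\<^esub>"
proof (rule ccontr)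
  assume px: "p x \<noteq> \<zero>\<^bsub>T\<^esub>"
  have PM: "P \<in> Mods" and p: "p \<in> mod_hom A P T" and sf: "superfluous A P (a_kernel P T p)"
    using c by (auto simp: projective_cover_def projective_Mods)
  note rm = right_module_Mods[OF PM] right_module_Mods[OF simpleD(1)[OF T]]
  interpret P: right_module A P by (rule rm)
  interpret T: right_module A T by (rule rm)
  have im: "p ` U = carrier T" by (rule hom_to_simple[OF T PM p U(1) x px])
  have Us: "U \<subseteq> carrier P" using U by (simp add: P.submodule_iff)
  have "U <+>\<^bsub>P\<^esub> a_kernel P T p = carrier P"
  proof (intro equalityI subsetI)
    fix y assume y: "y \<in> carrier P"
    then have "p y \<in> p ` U" unfolding im by (rule mod_hom_closed[OF p])
    then obtain u where u: "u \<in> U" "p u = p y" by auto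
    then have uP: "u \<in> carrier P" using Us by blast
    have "y \<ominus>\<^bsub>P\<^esub> u \<in> a_kernel P T p"
      using y uP u mod_hom_closed[OF p] by (simp add: a_kernel_def' mod_hom_diff[OF rm p] T.M.diff_eq_zero_iff)
    moreover have "y = u \<oplus>\<^bsub>P\<^esub> (y \<ominus>\<^bsub>P\<^esub> u)"
      using y uP by (simp add: a_minus_def P.M.a_comm[of u] P.M.a_assoc P.M.l_neg)
    ultimately show "y \<in> U <+>\<^bsub>P\<^esub> a_kernel P T p" using u(1) by (auto simp: set_add_def')
  qed (use Us in \<open>auto simp: set_add_def' a_kernel_def'\<close>)
  then show False using sf U unfolding superfluous_def by blast
qed

text \<open>Two proper summands would both lie in the kernel of \<open>p\<close> by
  \<open>cover_local\<close>, and so would their sum.\<close>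

lemma cover_indecomposable:
  assumes T: "simple T" and c: "projective_cover A P p T"
  shows "indecomposable A P"
  unfolding indecomposable_def mod_isomorphic_direct_sum_iff
proof (intro conjI ballI impI)
  have PM: "P \<in> Mods" and p: "p \<in> mod_hom A P T" and surj: "p ` carrier P = carrier T"
    using c by (auto simp: projective_cover_def projective_Mods)
  note rm = right_module_Mods[OF PM] right_module_Mods[OF simpleD(1)[OF T]]
  interpret P: right_module A P by (rule rm)
  interpret T: right_module A T by (rule rm)
  show "P \<in> Mods" by (rule PM)
  show "carrier P \<noteq> {\<zero>\<^bsub>P\<^esub>}"
  proof
    assume "carrier P = {\<zero>\<^bsub>P\<^esub>}"
    then have "carrier T = {\<zero>\<^bsub>T\<^esub>}" using surj mod_hom_zero[OF rm p] by auto
    then show False using simpleD(2)[OF T] by blast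
  qed
  fix U V assume U: "U \<in> Mods" and V: "V \<in> Mods" and "\<exists>a b. is_dsum A P U V a b"
  then obtain a b where d: "is_dsum A P U V a b" by blast
  note rU = right_module_Mods[OF U] and rV = right_module_Mods[OF V]
  interpret U: right_module A U by (rule rU)
  interpret V: right_module A V by (rule rV)
  obtain i j where ij: "i \<in> mod_hom A U P" "j \<in> mod_hom A V P"
    "\<And>x. x \<in> carrier U \<Longrightarrow> a (i x) = x" "\<And>x. x \<in> carrier U \<Longrightarrow> b (i x) = \<zero>\<^bsub>V\<^esub>"
    "\<And>x. x \<in> carrier V \<Longrightarrow> b (j x) = x" "\<And>x. x \<in> carrier V \<Longrightarrow> a (j x) = \<zero>\<^bsub>U\<^esub>"
    "\<And>x. x \<in> carrier P \<Longrightarrow> i (a x) \<oplus>\<^bsub>P\<^esub> j (b x) = x"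
    by (rule is_dsum_injections[OF rm(1) rU rV d]) blast
  note E = is_dsumE(1,2)[OF d]
  show "carrier U = {\<zero>\<^bsub>U\<^esub>} \<or> carrier V = {\<zero>\<^bsub>V\<^esub>}"
  proof (rule ccontr)
    assume "\<not> ?thesis"
    then obtain u v where u: "u \<in> carrier U" "u \<noteq> \<zero>\<^bsub>U\<^esub>" and v: "v \<in> carrier V" "v \<noteq> \<zero>\<^bsub>V\<^esub>"
      using U.M.zero_closed V.M.zero_closed by blast
    have "j v \<notin> i ` carrier U" using ij(4) ij(5)[OF v(1)] v(2) by auto
    then have 1: "i ` carrier U \<noteq> carrier P" using mod_hom_closed[OF ij(2) v(1)] by blast
    have "i u \<notin> j ` carrier V" using ij(6) ij(3)[OF u(1)] u(2) by auto
    then have 2: "j ` carrier V \<noteq> carrier P" using mod_hom_closed[OF ij(1) u(1)] by blast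
    have "p x = \<zero>\<^bsub>T\<^esub>" if x: "x \<in> carrier P" for x
    proof -
      have c': "a x \<in> carrier U" "b x \<in> carrier V" using x mod_hom_closed[OF E(1)] mod_hom_closed[OF E(2)] by auto
      have "p (i (a x)) = \<zero>\<^bsub>T\<^esub>"
        by (rule cover_local[OF T c submodule_image[OF rU rm(1) ij(1) U.submodule_carrier] 1]) (use c' in blast)
      moreover have "p (j (b x)) = \<zero>\<^bsub>T\<^esub>"
        by (rule cover_local[OF T c submodule_image[OF rV rm(1) ij(2) V.submodule_carrier] 2]) (use c' in blast)
      moreover have "p (i (a x) \<oplus>\<^bsub>P\<^esub> j (b x)) = p (i (a x)) \<oplus>\<^bsub>T\<^esub> p (j (b x))"
        by (rule mod_hom_add[OF p mod_hom_closed[OF ij(1) c'(1)] mod_hom_closed[OF ij(2) c'(2)]])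
      ultimately show ?thesis using ij(7)[OF x] by simp
    qed
    then have "p ` carrier P \<subseteq> {\<zero>\<^bsub>T\<^esub>}" by blast
    then show False using surj simpleD(2)[OF T] T.M.zero_closed by blast
  qed
qed

lemma mod_isomorphic_sym:
  assumes M: "M \<in> Mods" and "mod_isomorphic A M N" shows "mod_isomorphic A N M"
proof -
  obtain f where f: "f \<in> mod_hom A M N" "bij_betw f (carrier M) (carrier N)"
    using assms(2) unfolding mod_isomorphic_def by (rule bexE)
  show ?thesis unfolding mod_isomorphic_def
    by (rule bexI[of _ "inv_into (carrier M) f"])
      (rule bij_betw_inv_into[OF f(2)], rule mod_hom_inv[OF right_module_Mods[OF M] f])
qed

lemma mod_isomorphic_trans:
  assumes "mod_isomorphic A L M" "mod_isomorphic A M N" shows "mod_isomorphic A L N"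
proof -
  obtain f where f: "f \<in> mod_hom A L M" "bij_betw f (carrier L) (carrier M)"
    using assms(1) unfolding mod_isomorphic_def by (rule bexE)
  obtain g where g: "g \<in> mod_hom A M N" "bij_betw g (carrier M) (carrier N)"
    using assms(2) unfolding mod_isomorphic_def by (rule bexE)
  show ?thesis unfolding mod_isomorphic_def
    using bij_betw_trans[OF f(2) g(2)] by (intro bexI[OF _ mod_hom_comp[OF f(1) g(1)]]) (simp add: comp_def)
qed

lemma mod_isomorphic_refl: "mod_isomorphic A M M"
  unfolding mod_isomorphic_def by (rule bexI[OF _ mod_hom_id]) (simp add: bij_betw_def)

text \<open>The isomorphism carries the kernel of \<open>p\<close> to a proper submodule, which lies
  in the kernel of \<open>p'\<close>. It therefore induces a nonzero map between the simple
  quotients.\<close>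

lemma cover_iso_imp_iso:
  assumes T: "simple T" "projective_cover A P p T" and T': "simple T'" "projective_cover A P' p' T'"
    and iso: "mod_isomorphic A P P'"
  shows "mod_isomorphic A T T'"
proof -
  have P: "P \<in> Mods" "p \<in> mod_hom A P T" "p ` carrier P = carrier T"
    and P': "P' \<in> Mods" "p' \<in> mod_hom A P' T'" "p' ` carrier P' = carrier T'"
    using T T' by (auto simp: projective_cover_def projective_Mods)
  obtain f where f: "f \<in> mod_hom A P P'" "bij_betw f (carrier P) (carrier P')"
    using iso unfolding mod_isomorphic_def by (rule bexE)
  note TM = simpleD(1)[OF T(1)] and TM' = simpleD(1)[OF T'(1)]
  note rm = right_module_Mods[OF P(1)] right_module_Mods[OF TM] right_module_Mods[OF P'(1)] right_module_Mods[OF TM']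
  let ?k = "a_kernel P T p"
  have k: "submodule ?k A P" by (rule submodule_kernel[OF rm(1,2) P(2)])
  obtain t where t: "t \<in> carrier T" "t \<noteq> \<zero>\<^bsub>T\<^esub>" by (rule simple_nonzero[OF T(1)])
  have "t \<in> p ` carrier P" using t P(3) by simp
  then obtain y where y: "y \<in> carrier P" "p y = t" by auto
  have ne: "f ` ?k \<noteq> carrier P'"
  proof
    assume "f ` ?k = carrier P'"
    then have "f y \<in> f ` ?k" using mod_hom_closed[OF f(1) y(1)] by simp
    then obtain z where "z \<in> ?k" "f y = f z" by auto
    then have "y = z" using f(2) y(1) by (auto simp: bij_betw_def a_kernel_def' dest: inj_onD)
    then show False using \<open>z \<in> ?k\<close> y t by (auto simp: a_kernel_def')
  qed
  have s: "ses A (P\<lparr>carrier := ?k\<rparr>) (\<lambda>x. x) P p T" by (rule ses_kernel[OF P(1) TM P(2,3)])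
  have pf: "(\<lambda>x. p' (f x)) \<in> mod_hom A P T'" by (rule mod_hom_comp[OF f(1) P'(2)])
  have "p' (f x) = \<zero>\<^bsub>T'\<^esub>" if "x \<in> carrier (P\<lparr>carrier := ?k\<rparr>)" for x
    by (rule cover_local[OF T' submodule_image[OF rm(1,3) f(1) k] ne]) (use that in simp)
  then obtain g where g: "g \<in> mod_hom A T T'" "\<And>x. x \<in> carrier P \<Longrightarrow> g (p x) = p' (f x)"
    by (rule ses_colift[OF s rm(4) pf]) blast+
  obtain t' where t': "t' \<in> carrier T'" "t' \<noteq> \<zero>\<^bsub>T'\<^esub>" by (rule simple_nonzero[OF T'(1)])
  have "t' \<in> p' ` carrier P'" using t' P'(3) by simp
  then obtain z' where z': "z' \<in> carrier P'" "p' z' = t'" by auto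
  then have "z' \<in> f ` carrier P" using f(2) by (simp add: bij_betw_def)
  then obtain z where z: "z \<in> carrier P" "z' = f z" by auto
  have pz: "p z \<in> carrier T" by (rule mod_hom_closed[OF P(2) z(1)])
  have gz: "g (p z) \<noteq> \<zero>\<^bsub>T'\<^esub>" using g(2)[OF z(1)] z z' t' by simp
  interpret T: right_module A T by (rule rm)
  have "bij_betw g (carrier T) (carrier T')" unfolding bij_betw_def
    using hom_from_simple[OF T(1) TM' g(1) pz gz] hom_to_simple[OF T'(1) TM g(1) T.submodule_carrier pz gz] by blast
  then show ?thesis using g(1) by (auto simp: mod_isomorphic_def)
qed

lemma cyclic_add_subgroup:
  assumes M: "M \<in> Mods" and S: "S \<in> Mods"
    and iso: "\<And>N. indecomposable A N \<Longrightarrow> retract A N M \<Longrightarrow> mod_isomorphic A N S"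
    and x: "x \<in> add_subgroup A M"
  shows "\<exists>n::int. x = cls S [^]\<^bsub>K0 A\<^esub> n"
proof -
  interpret G: comm_group "K0 A" by (rule comm_group_K0)
  have c: "{cls S} \<subseteq> carrier (K0 A)" using S by simp
  have "add_subgroup A M \<subseteq> generate (K0 A) {cls S}"
  proof (rule add_subgroup_least[OF M G.generate_is_subgroup[OF c]])
    fix N assume N: "indecomposable A N" "retract A N M"
    have "cls N = cls S" by (rule cls_iso[OF indecomposableD(1)[OF N(1)] S iso[OF N]])
    then show "cls N \<in> generate (K0 A) {cls S}" by (auto intro: generate.incl)
  qed
  then show ?thesis using x G.generate_pow[of "cls S"] S by auto
qed

lemma cyclic_add_subgroup_indecomposable:
  assumes N: "indecomposable A N" and x: "x \<in> add_subgroup A N"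
  shows "\<exists>n::int. x = cls N [^]\<^bsub>K0 A\<^esub> n"
  by (rule cyclic_add_subgroup[OF indecomposableD(1)[OF N] indecomposableD(1)[OF N] _ x])
    (rule retract_indecomposable[OF N _ indecomposableD(2)])

lemma cyclic_add_subgroup_double:
  assumes N: "indecomposable A N" and D: "D \<in> Mods" "is_dsum A D N N p q" and x: "x \<in> add_subgroup A D"
  shows "\<exists>n::int. x = cls N [^]\<^bsub>K0 A\<^esub> n"
proof (rule cyclic_add_subgroup[OF D(1) indecomposableD(1)[OF N] _ x])
  note NM = indecomposableD(1)[OF N]
  fix L assume L: "indecomposable A L" "retract A L D"
  then have "retract A L N" using indecomposable_retract_dsum[OF L D(1) NM NM D(2)] by blast
  then show "mod_isomorphic A L N" by (rule retract_indecomposable[OF N _ indecomposableD(2)[OF L(1)]])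
qed

end

section \<open>Algebras without modules of \<open>\<phi>\<close>-value one\<close>

context fd_algebra
begin

lemma coverD:
  assumes "projective_cover A P p T"
  shows "projective A P" "P \<in> Mods" "p \<in> mod_hom A P T" "p ` carrier P = carrier T"
  using assms by (auto simp: projective_cover_def projective_Mods)

text \<open>A nilpotent endomorphism has no nonzero fixed point. All isomorphisms between covers are
  obtained from this.\<close>

lemma fix_point_imp_bij:
  assumes P: "indecomposable A P" and f: "f \<in> mod_hom A P P" and x: "x \<in> carrier P" "f x = x" "x \<noteq> \<zero>\<^bsub>P\<^esub>"
  shows "bij_betw f (carrier P) (carrier P)"
proof (rule ccontr)
  assume "\<not> ?thesis"
  then obtain n where "(f ^^ n) x = \<zero>\<^bsub>P\<^esub>" using indecomposable_endo[OF P f] x(1) by blast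
  moreover have "(f ^^ n) x = x" by (induction n) (use x(2) in auto)
  ultimately show False using x(3) by simp
qed

definition iso_class where
  "iso_class M = {N \<in> Mods. mod_isomorphic A M N}"

lemma iso_class_eq:
  assumes MN: "M \<in> Mods" "N \<in> Mods"
  shows "iso_class M = iso_class N \<longleftrightarrow> mod_isomorphic A M N"
proof
  assume "iso_class M = iso_class N"
  moreover have "N \<in> iso_class N" using MN(2) mod_isomorphic_refl by (simp add: iso_class_def)
  ultimately have "N \<in> iso_class M" by simp
  then show "mod_isomorphic A M N" by (simp add: iso_class_def)
next
  assume iso: "mod_isomorphic A M N"
  have "mod_isomorphic A M L \<longleftrightarrow> mod_isomorphic A N L" for L :: "('a, nat \<Rightarrow> 'a) module"
    using mod_isomorphic_trans iso mod_isomorphic_sym[OF MN(1) iso] by metis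
  then show "iso_class M = iso_class N" by (simp add: iso_class_def)
qed

text \<open>The cover of a simple module is an indecomposable summand of the regular module, of
  which there are finitely many up to isomorphism, and the cover determines the simple module. This
  finiteness is what the counting argument rests on.\<close>

lemma finite_simples:
  "finite {iso_class T | T. simple T}" (is "finite ?C")
proof -
  let ?cl = iso_class
  note cl_eq = iso_class_eq
  obtain R e where R: "R \<in> Mods" "e \<in> carrier R"
    and Rh: "\<And>M :: ('a, nat \<Rightarrow> 'a) module. \<And>m. M \<in> Mods \<Longrightarrow> m \<in> carrier M \<Longrightarrow> \<exists>h \<in> mod_hom A R M. h e = m"
    by (rule regular_module_exists) blast
  obtain F where F: "finite F" "F \<subseteq> Mods"
    "\<forall>N. indecomposable A N \<longrightarrow> retract A N R \<longrightarrow> (\<exists>Y\<in>F. mod_isomorphic A N Y)"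
    using finite_indecomposable_retracts[OF R(1)] by blast
  have cover: "\<exists>P p. projective_cover A P p T" if "simple T" for T
    by (rule projective_cover_exists[OF simpleD(1)[OF that]]) blast
  define pc where "pc T = (SOME P. \<exists>p. projective_cover A P p T)" for T
  have pc: "\<exists>p. projective_cover A (pc T) p T" if "simple T" for T
    unfolding pc_def by (rule someI_ex[OF cover[OF that]])
  have mem: "?cl (pc T) \<in> ?cl ` F" if T: "simple T" for T
  proof -
    obtain p where p: "projective_cover A (pc T) p T" using pc[OF T] by blast
    then have P: "projective A (pc T)" "p \<in> mod_hom A (pc T) T" "p ` carrier (pc T) = carrier T"
      "superfluous A (pc T) (a_kernel (pc T) T p)" by (auto simp: projective_cover_def)
    note PM = projective_Mods[OF P(1)] and TM = simpleD(1)[OF T]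
    note rm = right_module_Mods[OF PM] right_module_Mods[OF TM] right_module_Mods[OF R(1)]
    interpret PP: right_module A "pc T" by (rule rm)
    interpret RR: right_module A R by (rule rm)
    obtain t where t: "t \<in> carrier T" "t \<noteq> \<zero>\<^bsub>T\<^esub>" by (rule simple_nonzero[OF T])
    then have "t \<in> p ` carrier (pc T)" using P(3) by simp
    then obtain y where y: "y \<in> carrier (pc T)" "p y = t" by auto
    from Rh[OF PM y(1)] obtain h where h: "h \<in> mod_hom A R (pc T)" "h e = y" by (rule bexE)
    have im: "submodule (h ` carrier R) A (pc T)" by (rule submodule_image[OF rm(3,1) h(1) RR.submodule_carrier])
    \<comment> \<open>The image contains \<open>y\<close>, which is not in the kernel of the cover,
      whereas every proper submodule is.\<close>
    have surj: "h ` carrier R = carrier (pc T)"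
    proof (rule ccontr)
      assume "h ` carrier R \<noteq> carrier (pc T)"
      from cover_local[OF T p im this, of y] h R(2) y t show False by auto
    qed
    have s: "ses A (R\<lparr>carrier := a_kernel R (pc T) h\<rparr>) (\<lambda>x. x) R h (pc T)" by (rule ses_kernel[OF R(1) PM h(1) surj])
    obtain r where "is_dsum A R (R\<lparr>carrier := a_kernel R (pc T) h\<rparr>) (pc T) r h" by (rule ses_projective_dsum[OF s P(1)])
    from retract_dsum(2)[OF sesD(1)[OF s] PM R(1) this]
    obtain Y where Y: "Y \<in> F" "mod_isomorphic A (pc T) Y" using F(3) cover_indecomposable[OF T p] by blast
    then have "?cl (pc T) = ?cl Y" using cl_eq[OF PM] F(2) by blast
    then show ?thesis using Y(1) by blast
  qed
  define rep where "rep Z = (SOME T. simple T \<and> ?cl T = Z)" for Z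
  have rep: "simple (rep Z) \<and> ?cl (rep Z) = Z" if "Z \<in> ?C" for Z
    unfolding rep_def by (rule someI_ex) (use that in blast)
  have "inj_on (\<lambda>Z. ?cl (pc (rep Z))) ?C"
  proof (rule inj_onI)
    fix Z Y assume ZY: "Z \<in> ?C" "Y \<in> ?C" "?cl (pc (rep Z)) = ?cl (pc (rep Y))"
    have sZ: "simple (rep Z)" "?cl (rep Z) = Z" and sY: "simple (rep Y)" "?cl (rep Y) = Y"
      using rep[OF ZY(1)] rep[OF ZY(2)] by auto
    obtain p where p: "projective_cover A (pc (rep Z)) p (rep Z)" using pc[OF sZ(1)] by blast
    obtain q where q: "projective_cover A (pc (rep Y)) q (rep Y)" using pc[OF sY(1)] by blast
    have "mod_isomorphic A (pc (rep Z)) (pc (rep Y))"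
      using ZY(3) p q by (subst cl_eq[symmetric]) (auto simp: projective_cover_def projective_Mods)
    from cover_iso_imp_iso[OF sZ(1) p sY(1) q this]
    have "?cl (rep Z) = ?cl (rep Y)" using cl_eq simpleD(1) sZ(1) sY(1) by blast
    then show "Z = Y" using sZ(2) sY(2) by simp
  qed
  moreover have "(\<lambda>Z. ?cl (pc (rep Z))) ` ?C \<subseteq> ?cl ` F"
    using mem rep by blast
  moreover have "finite (?cl ` F)" using F(1) by simp
  ultimately show ?thesis by (rule inj_on_finite)
qed

section \<open>Consequences of the absence of the value one\<close>

context
  assumes no_phi_one: "\<And>M. M \<in> Mods \<Longrightarrow> phi A M \<noteq> 1"
begin

text \<open>The hypothesis \<open>stable\<close> states that the value at \<open>M\<close> is at
  most one. As one is excluded, the value is zero, and \<Omega> is injective already on the subgroup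
  of \<open>M\<close>.\<close>

lemma Omega_injective_if_phi_le_1:
  assumes M: "M \<in> Mods"
    and stable: "\<And>j x. x \<in> add_subgroup A M \<Longrightarrow> (\<Omega> ^^ Suc j) (\<Omega> x) = \<one>\<^bsub>K0 A\<^esub> \<Longrightarrow> (\<Omega> ^^ j) (\<Omega> x) = \<one>\<^bsub>K0 A\<^esub>"
    and x: "x \<in> add_subgroup A M" "\<Omega> x = \<one>\<^bsub>K0 A\<^esub>"
  shows "x = \<one>\<^bsub>K0 A\<^esub>"
proof -
  have "kernel_stable M 1" unfolding kernel_stable_def
  proof (intro allI impI ballI)
    fix j y assume j: "1 \<le> j" and y: "y \<in> add_subgroup A M" "(\<Omega> ^^ Suc j) y = \<one>\<^bsub>K0 A\<^esub>"
    obtain k where k: "j = Suc k" using j by (cases j) auto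
    have "(\<Omega> ^^ Suc k) (\<Omega> y) = \<one>\<^bsub>K0 A\<^esub>" using y(2) unfolding k by (simp only: funpow_Suc_right o_apply)
    from stable[OF y(1) this] show "(\<Omega> ^^ j) y = \<one>\<^bsub>K0 A\<^esub>" unfolding k by (simp only: funpow_Suc_right o_apply)
  qed
  then have "phi A M \<le> 1" by (simp only: phi_le_iff[OF M])
  then have "phi A M \<le> 0" using no_phi_one[OF M] by linarith
  then have "kernel_stable M 0" by (simp only: phi_le_iff[OF M])
  moreover have "(\<Omega> ^^ Suc 0) x = \<one>\<^bsub>K0 A\<^esub>" using x(2) by simp
  ultimately have "(\<Omega> ^^ 0) x = \<one>\<^bsub>K0 A\<^esub>" using x(1) unfolding kernel_stable_def by blast
  then show ?thesis by simp
qed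

text \<open>No module has projective dimension one: here \<Omega> annihilates the subgroup of
  \<open>M\<close>, so the value at \<open>M\<close> is at most one, hence zero, and the class of
  \<open>M\<close> is trivial.\<close>

lemma projective_if_syzygy_projective:
  assumes s: "ses A L i P p M" and P: "projective A P" and L: "projective A L"
  shows "projective A M"
proof -
  interpret G: comm_group "K0 A" by (rule comm_group_K0)
  note sD = sesD[OF s]
  have one: "subgroup {\<one>\<^bsub>K0 A\<^esub>} (K0 A)" by (rule G.triv_subgroup)
  have "add_subgroup A L \<subseteq> {\<one>\<^bsub>K0 A\<^esub>}"
    by (rule add_subgroup_least[OF sD(1) one]) (simp add: cls_projective[OF projective_retract[OF L]])
  then have triv: "\<Omega> x = \<one>\<^bsub>K0 A\<^esub>" if "x \<in> add_subgroup A M" for x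
    using Omega_add_subgroup[OF s P] that by blast
  have pow: "(\<Omega> ^^ j) \<one>\<^bsub>K0 A\<^esub> = \<one>\<^bsub>K0 A\<^esub>" for j by (rule group_hom.hom_one[OF Omega_funpow_hom])
  have "cls M = \<one>\<^bsub>K0 A\<^esub>"
  proof (rule Omega_injective_if_phi_le_1[OF sD(3) _ cls_in_add_subgroup[OF sD(3)]])
    show "(\<Omega> ^^ j) (\<Omega> x) = \<one>\<^bsub>K0 A\<^esub>" if "x \<in> add_subgroup A M" for j x
      using triv[OF that] pow by (simp only:)
  qed (rule triv[OF cls_in_add_subgroup[OF sD(3)]])
  then have "cls M [^]\<^bsub>K0 A\<^esub> (1::int) = \<one>\<^bsub>K0 A\<^esub>" by simp
  then show ?thesis by (rule cls_pow_one_imp_projective[OF sD(3), rotated]) simp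
qed

text \<open>Each power of \<Omega> is absorbed by passing to a syzygy; projectivity then climbs back
  along the presentations. Consequently multiples of the class of a non-projective module are never
  killed by a power of \<Omega>.\<close>

lemma projective_if_Omega_pow_one:
  assumes "M \<in> Mods" "n \<noteq> 0" "(\<Omega> ^^ j) (cls M [^]\<^bsub>K0 A\<^esub> (n::int)) = \<one>\<^bsub>K0 A\<^esub>"
  shows "projective A M"
  using assms(1,3)
proof (induction j arbitrary: M)
  case 0
  then show ?case using cls_pow_one_imp_projective[OF 0(1) assms(2)] by simp
next
  case (Suc j)
  note M = Suc.prems(1)
  obtain P i p where s: "projective A P" "ses A (syzygy A M) i P p M" by (rule syzygy_ses[OF M])
  interpret \<Omega>: group_hom "K0 A" "K0 A" \<Omega> by (rule Omega_group_hom)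
  have "\<Omega> (cls M [^]\<^bsub>K0 A\<^esub> n) = cls (syzygy A M) [^]\<^bsub>K0 A\<^esub> n"
    using \<Omega>.hom_int_pow[OF cls_closed[OF M], of n] Omega_bar_props(2)[OF M] by simp
  then have "(\<Omega> ^^ j) (cls (syzygy A M) [^]\<^bsub>K0 A\<^esub> n) = \<one>\<^bsub>K0 A\<^esub>"
    using Suc.prems(2) by (simp only: funpow_Suc_right o_apply)
  from Suc.IH[OF syzygy_Mods[OF M] this] show ?case
    by (rule projective_if_syzygy_projective[OF s(2,1)])
qed

text \<open>
  If all indecomposable summands of \<open>N\<close> are isomorphic to \<open>S\<close>, then \<open>\<Omega>\<close> is injective on all
  \<open>\<Omega>\<^sup>j\<langle>add N\<rangle>\<close>; so two modules with syzygy \<open>N\<close> have a direct sum with \<open>\<phi> \<le> 1\<close>,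
  hence the same class. Applied to the cokernels of \<open>a\<close> and of \<open>(a, g)\<close> this gives the extension of \<open>g\<close>.
\<close>

lemma extends_if_cyclic:
  assumes cyc: "\<And>x. x \<in> add_subgroup A N \<Longrightarrow> \<exists>n::int. x = cls S [^]\<^bsub>K0 A\<^esub> n" and SM: "S \<in> Mods"
    and N: "N \<in> Mods" and a: "a \<in> mod_hom A N E" "inj_on a (carrier N)"
    and E: "projective A E" and Q: "projective A Q" and g: "g \<in> mod_hom A N Q"
  shows "\<exists>h\<in>mod_hom A E Q. \<forall>x\<in>carrier N. h (a x) = g x"
proof -
  interpret G: comm_group "K0 A" by (rule comm_group_K0)
  interpret \<Omega>: group_hom "K0 A" "K0 A" \<Omega> by (rule Omega_group_hom)
  note EM = projective_Mods[OF E] and QM = projective_Mods[OF Q]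
  note rm = right_module_Mods[OF N] right_module_Mods[OF EM] right_module_Mods[OF QM]
  \<comment> \<open>If a nonzero multiple of the class of \<open>S\<close> is killed, then
    \<open>S\<close> is projective and its class, hence \<open>x\<close>, is trivial anyway.\<close>
  have inj: "x = \<one>\<^bsub>K0 A\<^esub>" if x: "x \<in> add_subgroup A N" "(\<Omega> ^^ j) x = \<one>\<^bsub>K0 A\<^esub>" for x j
  proof -
    obtain n where n: "x = cls S [^]\<^bsub>K0 A\<^esub> (n::int)" using cyc[OF x(1)] by blast
    show ?thesis
    proof (cases "n = 0")
      case False
      then have "projective A S" using projective_if_Omega_pow_one[OF SM False] x(2) n by blast
      then show ?thesis using n by (simp add: cls_projective)
    qed (simp add: n)
  qed
  obtain C q where C: "ses A N a E q C" by (rule ses_cokernel[OF N EM a])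
  obtain B u v where B: "B \<in> Mods" "is_dsum A B E Q u v" by (rule dsum_Mods[OF EM QM])
  obtain k where k: "k \<in> mod_hom A N B" "\<And>x. x \<in> carrier N \<Longrightarrow> u (k x) = a x" "\<And>x. x \<in> carrier N \<Longrightarrow> v (k x) = g x"
    by (rule is_dsum_pair[OF right_module_Mods[OF B(1)] B(2) a(1) g]) blast
  have "inj_on k (carrier N)" using a(2) k(2) by (auto simp: inj_on_def) metis
  then obtain Y w where Y: "ses A N k B w Y" by (rule ses_cokernel[OF N B(1) k(1)])
  note CM = sesD(3)[OF C] and YM = sesD(3)[OF Y]
  have PB: "projective A B" by (rule projective_dsum[OF E Q B])
  \<comment> \<open>The sum of both cokernels contains the difference of their classes in its
    subgroup, and its syzygy, two copies of \<open>N\<close>, has no new indecomposable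
    summands.\<close>
  obtain M c d where M: "M \<in> Mods" "is_dsum A M C Y c d" by (rule dsum_Mods[OF CM YM])
  obtain F e f where F: "F \<in> Mods" "is_dsum A F N N e f" by (rule dsum_Mods[OF N N])
  obtain D e' f' where D: "D \<in> Mods" "is_dsum A D E B e' f'" by (rule dsum_Mods[OF EM B(1)])
  obtain j t where s: "ses A F j D t M" by (rule dsum_ses[OF C Y M D F])
  have PD: "projective A D" by (rule projective_dsum[OF E PB D])
  have "add_subgroup A F \<subseteq> add_subgroup A N"
  proof (rule add_subgroup_least[OF F(1) subgroup_add_subgroup[OF N]])
    fix L assume L: "indecomposable A L" "retract A L F"
    then have "retract A L N" using indecomposable_retract_dsum[OF L F(1) N N F(2)] by blast
    then show "cls L \<in> add_subgroup A N" by (rule indec_in_add_subgroup[OF N L(1)])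
  qed
  then have im: "\<Omega> x \<in> add_subgroup A N" if "x \<in> add_subgroup A M" for x
    using Omega_add_subgroup[OF s PD] that by blast
  have stable: "(\<Omega> ^^ j) (\<Omega> x) = \<one>\<^bsub>K0 A\<^esub>"
    if x: "x \<in> add_subgroup A M" "(\<Omega> ^^ Suc j) (\<Omega> x) = \<one>\<^bsub>K0 A\<^esub>" for j x
    using inj[OF im[OF x(1)] x(2)] group_hom.hom_one[OF Omega_funpow_hom] by simp
  have "cls C \<in> add_subgroup A M" "cls Y \<in> add_subgroup A M"
    by (rule cls_retract_in_add_subgroup[OF M(1) CM retract_dsum(1)[OF CM YM M]],
      rule cls_retract_in_add_subgroup[OF M(1) YM retract_dsum(2)[OF CM YM M]])
  then have mem: "cls C \<otimes>\<^bsub>K0 A\<^esub> inv\<^bsub>K0 A\<^esub> cls Y \<in> add_subgroup A M"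
    by (intro subgroup.m_closed[OF subgroup_add_subgroup[OF M(1)]] subgroup.m_inv_closed[OF subgroup_add_subgroup[OF M(1)]])
  have "\<Omega> (cls C \<otimes>\<^bsub>K0 A\<^esub> inv\<^bsub>K0 A\<^esub> cls Y) = \<one>\<^bsub>K0 A\<^esub>"
    using CM YM N Omega_bar_ses[OF C E] Omega_bar_ses[OF Y PB] by simp
  then have "cls C \<otimes>\<^bsub>K0 A\<^esub> inv\<^bsub>K0 A\<^esub> cls Y = \<one>\<^bsub>K0 A\<^esub>"
    using stable by (intro Omega_injective_if_phi_le_1[OF M(1) _ mem])
  then have eq: "cls C = cls Y" using CM YM by (simp add: G.inv_solve_right')
  show ?thesis by (rule cls_eq_imp_extends[OF C E Q g B Y _ _ eq]) (use k(2,3) in auto)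
qed

section \<open>Socles of the projective covers of simple modules\<close>

lemma extends_if_indecomposable:
  assumes "indecomposable A N" "a \<in> mod_hom A N E" "inj_on a (carrier N)"
    "projective A E" "projective A Q" "g \<in> mod_hom A N Q"
  shows "\<exists>h\<in>mod_hom A E Q. \<forall>x\<in>carrier N. h (a x) = g x"
  using cyclic_add_subgroup_indecomposable[OF assms(1)] indecomposableD(1)[OF assms(1)]
  by (intro extends_if_cyclic[of N N] assms(2-6)) auto

text \<open>Extending \<open>b\<close> along \<open>a\<close> and \<open>a\<close> along
  \<open>b\<close> gives maps between the covers whose composite on \<open>P\<close> fixes a nonzero
  element. It is bijective, so \<open>P\<close> is a nonzero summand of the indecomposable
  \<open>P'\<close>.\<close>

lemma socle_determines_top:
  assumes S: "simple S" and T: "simple T" "projective_cover A P p T" and T': "simple T'" "projective_cover A P' p' T'"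
    and a: "a \<in> mod_hom A S P" "inj_on a (carrier S)" and b: "b \<in> mod_hom A S P'" "inj_on b (carrier S)"
  shows "mod_isomorphic A T T'"
proof -
  note P = coverD[OF T(2)] and P' = coverD[OF T'(2)]
  note iS = simple_indecomposable[OF S]
  from extends_if_indecomposable[OF iS a P(1) P'(1) b(1)]
  obtain h where h: "h \<in> mod_hom A P P'" "\<forall>x\<in>carrier S. h (a x) = b x" by (rule bexE)
  from extends_if_indecomposable[OF iS b P'(1) P(1) a(1)]
  obtain h' where h': "h' \<in> mod_hom A P' P" "\<forall>x\<in>carrier S. h' (b x) = a x" by (rule bexE)
  obtain x where x: "x \<in> carrier S" "x \<noteq> \<zero>\<^bsub>S\<^esub>" by (rule simple_nonzero[OF S])
  have ax: "a x \<noteq> \<zero>\<^bsub>P\<^esub>"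
    using mod_hom_inj_iff[OF right_module_Mods[OF simpleD(1)[OF S]] right_module_Mods[OF P(2)] a(1)] a(2) x by blast
  note iP = cover_indecomposable[OF T] and iP' = cover_indecomposable[OF T']
  have "h' (h (a x)) = a x" using h(2) h'(2) x(1) by simp
  from fix_point_imp_bij[OF iP mod_hom_comp[OF h(1) h'(1)] mod_hom_closed[OF a(1) x(1)] this ax]
  have "retract A P P'" by (rule retractI[OF P(2) P'(2) h(1) h'(1)])
  from retract_indecomposable[OF iP' this indecomposableD(2)[OF iP]]
  show ?thesis by (rule cover_iso_imp_iso[OF T T'])
qed

text \<open>Images are compared, since embeddings with the same image may differ by an automorphism
  of \<open>S\<close>. Distinct images would embed two copies of \<open>S\<close> into
  \<open>P\<close>. The map that is \<open>a\<close> on the first copy and zero on the second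
  extends to an endomorphism of \<open>P\<close>; it fixes a nonzero element, so it is bijective,
  yet it kills the image of \<open>b\<close>.\<close>

lemma socle_multiplicity_one:
  assumes S: "simple S" and T: "simple T" "projective_cover A P p T"
    and a: "a \<in> mod_hom A S P" "inj_on a (carrier S)" and b: "b \<in> mod_hom A S P" "inj_on b (carrier S)"
  shows "a ` carrier S = b ` carrier S"
proof (rule ccontr)
  assume neq: "a ` carrier S \<noteq> b ` carrier S"
  note P = coverD[OF T(2)]
  note SM = simpleD(1)[OF S]
  note rm = right_module_Mods[OF SM] right_module_Mods[OF P(2)]
  interpret S: right_module A S by (rule rm)
  interpret P: right_module A P by (rule rm)
  note a0 = mod_hom_zero[OF rm a(1)] and b0 = mod_hom_zero[OF rm b(1)]
  have sub: "submodule (a ` carrier S) A P" "submodule (b ` carrier S) A P"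
    by (rule submodule_image[OF rm a(1) S.submodule_carrier], rule submodule_image[OF rm b(1) S.submodule_carrier])
  have disj: "x = \<zero>\<^bsub>S\<^esub>" if x: "x \<in> carrier S" "a x \<in> b ` carrier S" for x
  proof (rule ccontr)
    assume ne: "x \<noteq> \<zero>\<^bsub>S\<^esub>"
    obtain y where y: "y \<in> carrier S" "a x = b y" using x by blast
    have y0: "y \<noteq> \<zero>\<^bsub>S\<^esub>" using y a0 b0 ne x(1) a(2) by (metis S.M.zero_closed inj_onD)
    let ?A = "{z \<in> carrier S. a z \<in> b ` carrier S}" and ?B = "{z \<in> carrier S. b z \<in> a ` carrier S}"
    have "x \<in> ?A" using x by simp
    then have "?A \<noteq> {\<zero>\<^bsub>S\<^esub>}" using ne by auto
    then have A: "?A = carrier S" using simpleD(3)[OF S submodule_vimage[OF rm a(1) sub(2)]] by simp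
    have "b y \<in> a ` carrier S" unfolding y(2)[symmetric] using x(1) by (rule imageI)
    then have "y \<in> ?B" using y(1) by simp
    then have "?B \<noteq> {\<zero>\<^bsub>S\<^esub>}" using y0 by auto
    then have B: "?B = carrier S" using simpleD(3)[OF S submodule_vimage[OF rm b(1) sub(1)]] by simp
    have "a z \<in> b ` carrier S" "b z \<in> a ` carrier S" if "z \<in> carrier S" for z
      using that A B by (metis (lifting) mem_Collect_eq)+
    then have "a ` carrier S = b ` carrier S" by (intro equalityI image_subsetI)
    with neq show False ..
  qed
  obtain D u v where D: "D \<in> Mods" "is_dsum A D S S u v" by (rule dsum_Mods[OF SM SM])
  note rD = right_module_Mods[OF D(1)] and E = is_dsumE[OF D(2)]
  interpret D: right_module A D by (rule rD)
  let ?k = "\<lambda>x. a (u x) \<oplus>\<^bsub>P\<^esub> b (v x)"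
  have k: "?k \<in> mod_hom A D P"
    by (rule mod_hom_plus[OF rm(2) mod_hom_comp[OF E(1) a(1)] mod_hom_comp[OF E(2) b(1)]])
  have "inj_on ?k (carrier D)" unfolding mod_hom_inj_iff[OF rD rm(2) k]
  proof (intro ballI impI)
    fix x assume x: "x \<in> carrier D" "?k x = \<zero>\<^bsub>P\<^esub>"
    have c: "u x \<in> carrier S" "v x \<in> carrier S" using x mod_hom_closed[OF E(1)] mod_hom_closed[OF E(2)] by auto
    then have c': "a (u x) \<in> carrier P" "b (v x) \<in> carrier P" using mod_hom_closed[OF a(1)] mod_hom_closed[OF b(1)] by auto
    have "a (u x) = \<ominus>\<^bsub>P\<^esub> b (v x)" using x(2) c' by (metis P.M.minus_equality)
    also have "\<dots> \<in> b ` carrier S" using P.submodule_minus[OF sub(2)] c(2) by blast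
    finally have u0: "u x = \<zero>\<^bsub>S\<^esub>" by (rule disj[OF c(1)])
    then have "b (v x) = \<zero>\<^bsub>P\<^esub>" using x(2) c' a0 by simp
    then have v0: "v x = \<zero>\<^bsub>S\<^esub>" using b(2) c(2) unfolding mod_hom_inj_iff[OF rm b(1)] by blast
    show "x = \<zero>\<^bsub>D\<^esub>"
      by (rule E(3)[OF x(1) D.M.zero_closed])
        (simp_all only: u0 v0 mod_hom_zero[OF rD rm(1) E(1)] mod_hom_zero[OF rD rm(1) E(2)])
  qed
  then have "\<exists>h\<in>mod_hom A P P. \<forall>x\<in>carrier D. h (?k x) = a (u x)"
    using cyclic_add_subgroup_double[OF simple_indecomposable[OF S] D]
    by (intro extends_if_cyclic[of D S, OF _ SM D(1) k _ P(1,1) mod_hom_comp[OF E(1) a(1)]])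
  then obtain h where h: "h \<in> mod_hom A P P" "\<forall>x\<in>carrier D. h (?k x) = a (u x)" by (rule bexE)
  obtain x where x: "x \<in> carrier S" "x \<noteq> \<zero>\<^bsub>S\<^esub>" by (rule simple_nonzero[OF S])
  have nz: "a x \<noteq> \<zero>\<^bsub>P\<^esub>" "b x \<noteq> \<zero>\<^bsub>P\<^esub>"
    using a(2) b(2) x unfolding mod_hom_inj_iff[OF rm a(1)] mod_hom_inj_iff[OF rm b(1)] by blast+
  have cx: "a x \<in> carrier P" "b x \<in> carrier P" using x(1) mod_hom_closed[OF a(1)] mod_hom_closed[OF b(1)] by auto
  obtain d where d: "d \<in> carrier D" "u d = x" "v d = \<zero>\<^bsub>S\<^esub>" using E(4)[OF x(1) S.M.zero_closed] by blast
  obtain d' where d': "d' \<in> carrier D" "u d' = \<zero>\<^bsub>S\<^esub>" "v d' = x" using E(4)[OF S.M.zero_closed x(1)] by blast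
  have "h (a x) = a x" using bspec[OF h(2) d(1)] d cx b0 by simp
  moreover have "h (b x) = \<zero>\<^bsub>P\<^esub>" using bspec[OF h(2) d'(1)] d' cx a0 by simp
  ultimately have "bij_betw h (carrier P) (carrier P)" "h (b x) = h \<zero>\<^bsub>P\<^esub>"
    using fix_point_imp_bij[OF cover_indecomposable[OF T] h(1) cx(1) _ nz(1)] mod_hom_zero[OF rm(2,2) h(1)] by auto
  then show False using nz(2) cx(2) by (auto simp: bij_betw_def dest: inj_onD)
qed

text \<open>For each isomorphism class of simple modules, \<sigma> picks a simple submodule of a
  cover. By \<open>socle_determines_top\<close> this choice is injective on the finite set of
  classes, hence surjective, so every simple module embeds into the cover of a simple
  module.\<close>

lemma socle_correspondence:
  obtains \<sigma> where "\<And>S. simple S \<Longrightarrow> \<exists>T P p e. simple T \<and> projective_cover A P p T \<and> simple (\<sigma> (iso_class T)) \<and>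
      e \<in> mod_hom A (\<sigma> (iso_class T)) P \<and> inj_on e (carrier (\<sigma> (iso_class T))) \<and>
      mod_isomorphic A S (\<sigma> (iso_class T))"
proof -
  let ?C = "{iso_class T | T. simple T}"
  let ?R = "\<lambda>Z S. \<exists>T P p e. simple T \<and> iso_class T = Z \<and> projective_cover A P p T \<and> simple S \<and>
    e \<in> mod_hom A S P \<and> inj_on e (carrier S)"
  have "\<forall>Z\<in>?C. \<exists>S. ?R Z S"
  proof
    fix Z assume "Z \<in> ?C"
    then obtain T where T: "simple T" "iso_class T = Z" by blast
    obtain P p where P: "projective_cover A P p T" by (rule projective_cover_exists[OF simpleD(1)[OF T(1)]])
    note PM = coverD(2)[OF P]
    interpret P: right_module A P by (rule right_module_Mods[OF PM])
    obtain U where U: "submodule U A P" "simple (P\<lparr>carrier := U\<rparr>)"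
      by (rule simple_submodule_exists[OF PM indecomposableD(2)[OF cover_indecomposable[OF T(1) P]]])
    have "(\<lambda>x. x) \<in> mod_hom A (P\<lparr>carrier := U\<rparr>) P"
      using U(1) by (auto simp: mod_hom_iff P.submodule_iff)
    then show "\<exists>S. ?R Z S" using T P U(2)
      by (intro exI[of _ "P\<lparr>carrier := U\<rparr>"] exI[of _ T] exI[of _ P] exI[of _ p] exI[of _ "\<lambda>x. x"]) simp
  qed
  then obtain \<sigma> where \<sigma>: "\<forall>Z\<in>?C. ?R Z (\<sigma> Z)" by (rule bchoice[THEN exE])
  let ?t = "\<lambda>Z. iso_class (\<sigma> Z)"
  have "inj_on ?t ?C"
  proof (rule inj_onI)
    fix Y Z assume YZ: "Y \<in> ?C" "Z \<in> ?C" "?t Y = ?t Z"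
    obtain T P p e where Y: "simple T" "iso_class T = Y" "projective_cover A P p T" "simple (\<sigma> Y)"
      "e \<in> mod_hom A (\<sigma> Y) P" "inj_on e (carrier (\<sigma> Y))" using bspec[OF \<sigma> YZ(1)] by (elim exE conjE)
    obtain T' P' p' e' where Z: "simple T'" "iso_class T' = Z" "projective_cover A P' p' T'" "simple (\<sigma> Z)"
      "e' \<in> mod_hom A (\<sigma> Z) P'" "inj_on e' (carrier (\<sigma> Z))" using bspec[OF \<sigma> YZ(2)] by (elim exE conjE)
    have "mod_isomorphic A (\<sigma> Y) (\<sigma> Z)" using YZ(3) iso_class_eq simpleD(1) Y(4) Z(4) by blast
    then obtain f where f: "f \<in> mod_hom A (\<sigma> Y) (\<sigma> Z)" "bij_betw f (carrier (\<sigma> Y)) (carrier (\<sigma> Z))"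
      unfolding mod_isomorphic_def by (rule bexE)
    have "inj_on (e' \<circ> f) (carrier (\<sigma> Y))"
      using f(2) Z(6) by (intro comp_inj_on) (auto simp: bij_betw_def)
    then have inj: "inj_on (\<lambda>x. e' (f x)) (carrier (\<sigma> Y))" by (simp add: comp_def)
    have "mod_isomorphic A T T'"
      by (rule socle_determines_top[OF Y(4) Y(1,3) Z(1,3) Y(5,6) mod_hom_comp[OF f(1) Z(5)] inj])
    then have "iso_class T = iso_class T'" using iso_class_eq simpleD(1) Y(1) Z(1) by blast
    then show "Y = Z" using Y(2) Z(2) by simp
  qed
  moreover have "?t ` ?C \<subseteq> ?C"
  proof
    fix Y assume "Y \<in> ?t ` ?C"
    then obtain Z where Z: "Z \<in> ?C" "Y = ?t Z" by blast
    have "simple (\<sigma> Z)" using bspec[OF \<sigma> Z(1)] by (elim exE conjE)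
    then show "Y \<in> ?C" using Z(2) by blast
  qed
  ultimately have surj: "?t ` ?C = ?C" by (intro endo_inj_surj[OF finite_simples])
  show thesis
  proof (rule that)
    fix S assume S: "simple S"
    then have "iso_class S \<in> ?t ` ?C" unfolding surj by blast
    then obtain Z where Z: "Z \<in> ?C" "iso_class S = ?t Z" by blast
    obtain T P p e where Y: "simple T" "iso_class T = Z" "projective_cover A P p T" "simple (\<sigma> Z)"
      "e \<in> mod_hom A (\<sigma> Z) P" "inj_on e (carrier (\<sigma> Z))" using bspec[OF \<sigma> Z(1)] by (elim exE conjE)
    have "mod_isomorphic A S (\<sigma> Z)" using Z(2) iso_class_eq simpleD(1) S Y(4) by blast
    with Y show "\<exists>T P p e. simple T \<and> projective_cover A P p T \<and> simple (\<sigma> (iso_class T)) \<and>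
      e \<in> mod_hom A (\<sigma> (iso_class T)) P \<and> inj_on e (carrier (\<sigma> (iso_class T))) \<and>
      mod_isomorphic A S (\<sigma> (iso_class T))"
      by (intro exI[of _ T] exI[of _ P] exI[of _ p] exI[of _ e]) simp
  qed
qed

text \<open>A simple submodule of \<open>P\<close> is isomorphic to the one chosen in some cover.
  The two covers share it, so their tops are isomorphic by \<open>socle_determines_top\<close>;
  hence it is the one chosen for \<open>T\<close>.\<close>

lemma socle_unique:
  assumes T: "simple T" "projective_cover A P p T"
    and S: "simple S" "a \<in> mod_hom A S P" "inj_on a (carrier S)"
    and S': "simple S'" "b \<in> mod_hom A S' P" "inj_on b (carrier S')"
  shows "mod_isomorphic A S S'"
proof -
  obtain \<sigma> where \<sigma>: "\<And>S. simple S \<Longrightarrow> \<exists>T P p e. simple T \<and> projective_cover A P p T \<and> simple (\<sigma> (iso_class T)) \<and>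
      e \<in> mod_hom A (\<sigma> (iso_class T)) P \<and> inj_on e (carrier (\<sigma> (iso_class T))) \<and>
      mod_isomorphic A S (\<sigma> (iso_class T))" by (rule socle_correspondence) blast
  have key: "mod_isomorphic A S (\<sigma> (iso_class T)) \<and> simple (\<sigma> (iso_class T))"
    if S: "simple S" "a \<in> mod_hom A S P" "inj_on a (carrier S)" for S a
  proof -
    obtain T1 P1 p1 e where 1: "simple T1" "projective_cover A P1 p1 T1" "simple (\<sigma> (iso_class T1))"
      "e \<in> mod_hom A (\<sigma> (iso_class T1)) P1" "inj_on e (carrier (\<sigma> (iso_class T1)))"
      "mod_isomorphic A S (\<sigma> (iso_class T1))" using \<sigma>[OF S(1)] by (elim exE conjE)
    obtain f where f: "f \<in> mod_hom A S (\<sigma> (iso_class T1))" "bij_betw f (carrier S) (carrier (\<sigma> (iso_class T1)))"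
      using 1(6) unfolding mod_isomorphic_def by (rule bexE)
    have "inj_on (e \<circ> f) (carrier S)" using f(2) 1(5) by (intro comp_inj_on) (auto simp: bij_betw_def)
    then have inj: "inj_on (\<lambda>x. e (f x)) (carrier S)" by (simp add: comp_def)
    have "mod_isomorphic A T T1"
      by (rule socle_determines_top[OF S(1) T 1(1,2) S(2,3) mod_hom_comp[OF f(1) 1(4)] inj])
    then have "iso_class T = iso_class T1" using iso_class_eq simpleD(1) T(1) 1(1) by blast
    then show ?thesis using 1(3,6) by simp
  qed
  show ?thesis
    using mod_isomorphic_trans mod_isomorphic_sym[OF simpleD(1)[OF S'(1)]] key[OF S] key[OF S'] by blast
qed

text \<open>The two preceding facts say that any two simple submodules of \<open>P\<close> are
  isomorphic and, being isomorphic, equal; every nonzero submodule contains one.\<close>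

lemma cover_uniform:
  assumes T: "simple T" "projective_cover A P p T"
    and U: "submodule U A P" "U \<noteq> {\<zero>\<^bsub>P\<^esub>}" and V: "submodule V A P" "V \<noteq> {\<zero>\<^bsub>P\<^esub>}"
  shows "\<exists>x\<in>U \<inter> V. x \<noteq> \<zero>\<^bsub>P\<^esub>"
proof -
  note PM = coverD(2)[OF T(2)]
  interpret P: right_module A P by (rule right_module_Mods[OF PM])
  have sub: "\<exists>W. submodule W A P \<and> W \<subseteq> U \<and> simple (P\<lparr>carrier := W\<rparr>)"
    if U: "submodule U A P" "U \<noteq> {\<zero>\<^bsub>P\<^esub>}" for U
  proof -
    obtain W where W: "submodule W A (P\<lparr>carrier := U\<rparr>)" "simple ((P\<lparr>carrier := U\<rparr>)\<lparr>carrier := W\<rparr>)"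
      by (rule simple_submodule_exists[OF restrict_Mods[OF PM U(1)]]) (use U(2) in simp)
    then show ?thesis by (intro exI[of _ W]) (simp add: P.submodule_restrict[OF U(1)])
  qed
  obtain W where W: "submodule W A P" "W \<subseteq> U" "simple (P\<lparr>carrier := W\<rparr>)" using sub[OF U] by blast
  obtain W' where W': "submodule W' A P" "W' \<subseteq> V" "simple (P\<lparr>carrier := W'\<rparr>)" using sub[OF V] by blast
  have incl: "(\<lambda>x. x) \<in> mod_hom A (P\<lparr>carrier := W\<rparr>) P" if "submodule W A P" for W
    using that by (auto simp: mod_hom_iff P.submodule_iff)
  have "mod_isomorphic A (P\<lparr>carrier := W\<rparr>) (P\<lparr>carrier := W'\<rparr>)"
    by (rule socle_unique[OF T W(3) incl[OF W(1)] _ W'(3) incl[OF W'(1)]]) simp_all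
  then obtain f where f: "f \<in> mod_hom A (P\<lparr>carrier := W\<rparr>) (P\<lparr>carrier := W'\<rparr>)" "bij_betw f W W'"
    unfolding mod_isomorphic_def by auto
  have "(\<lambda>x. x) ` carrier (P\<lparr>carrier := W\<rparr>) = f ` carrier (P\<lparr>carrier := W\<rparr>)"
    using f(2) mod_hom_comp[OF f(1) incl[OF W'(1)]]
    by (intro socle_multiplicity_one[OF W(3) T incl[OF W(1)]]) (auto simp: bij_betw_def)
  then have "W = W'" using f(2) by (simp add: bij_betw_def)
  obtain x where "x \<in> W" "x \<noteq> \<zero>\<^bsub>P\<^esub>" using simple_nonzero[OF W(3)] by auto
  then show ?thesis using W(2) W'(2) \<open>W = W'\<close> by blast
qed

section \<open>Projective modules are injective\<close>

lemma extends_from_cover_submodule: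
  assumes T: "simple T" "projective_cover A P p T" and U: "submodule U A P"
    and Q: "projective A Q" and g: "g \<in> mod_hom A (P\<lparr>carrier := U\<rparr>) Q"
  shows "\<exists>h\<in>mod_hom A P Q. \<forall>x\<in>U. h x = g x"
proof -
  note P = coverD[OF T(2)] and QM = projective_Mods[OF Q]
  let ?U = "P\<lparr>carrier := U\<rparr>"
  have UM: "?U \<in> Mods" by (rule restrict_Mods[OF P(2) U])
  note rm = right_module_Mods[OF P(2)] right_module_Mods[OF QM] right_module_Mods[OF UM]
  interpret P: right_module A P by (rule rm)
  have incl: "(\<lambda>x. x) \<in> mod_hom A ?U P" using U by (auto simp: mod_hom_iff P.submodule_iff)
  show ?thesis
  proof (cases "U = {\<zero>\<^bsub>P\<^esub>}")
    case True
    then have "g \<zero>\<^bsub>P\<^esub> = \<zero>\<^bsub>Q\<^esub>" using mod_hom_zero[OF rm(3,2) g] by simp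
    then show ?thesis using mod_hom_zero_map[OF rm(1,2)] True by (intro bexI[of _ "\<lambda>_. \<zero>\<^bsub>Q\<^esub>"]) auto
  next
    case False
    \<comment> \<open>Two nonzero summands of \<open>U\<close> would intersect by
      \<open>cover_uniform\<close>. Thus \<open>extends_if_indecomposable\<close> applies to the
      inclusion of \<open>U\<close> itself.\<close>
    have "indecomposable A ?U" unfolding indecomposable_def mod_isomorphic_direct_sum_iff
    proof (intro conjI ballI impI)
      fix B C assume B: "B \<in> Mods" and C: "C \<in> Mods" and "\<exists>b c. is_dsum A ?U B C b c"
      then obtain b c where d: "is_dsum A ?U B C b c" by blast
      note rB = right_module_Mods[OF B] and rC = right_module_Mods[OF C]
      interpret B: right_module A B by (rule rB)
      interpret C: right_module A C by (rule rC)
      obtain i j where ij: "i \<in> mod_hom A B ?U" "j \<in> mod_hom A C ?U"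
        "\<And>x. x \<in> carrier B \<Longrightarrow> b (i x) = x" "\<And>x. x \<in> carrier C \<Longrightarrow> c (j x) = x"
        "\<And>x. x \<in> carrier C \<Longrightarrow> b (j x) = \<zero>\<^bsub>B\<^esub>"
        by (rule is_dsum_injections[OF rm(3) rB rC d]) blast
      note E = is_dsumE(1,2)[OF d]
      have sub: "submodule (i ` carrier B) A P" "submodule (j ` carrier C) A P"
        by (rule submodule_image[OF rB rm(1) mod_hom_comp[OF ij(1) incl] B.submodule_carrier],
          rule submodule_image[OF rC rm(1) mod_hom_comp[OF ij(2) incl] C.submodule_carrier])
      have z: "b \<zero>\<^bsub>P\<^esub> = \<zero>\<^bsub>B\<^esub>" "c \<zero>\<^bsub>P\<^esub> = \<zero>\<^bsub>C\<^esub>" "i \<zero>\<^bsub>B\<^esub> = \<zero>\<^bsub>P\<^esub>"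
        using mod_hom_zero[OF rm(3) rB E(1)] mod_hom_zero[OF rm(3) rC E(2)] mod_hom_zero[OF rB rm(3) ij(1)] by simp_all
      show "carrier B = {\<zero>\<^bsub>B\<^esub>} \<or> carrier C = {\<zero>\<^bsub>C\<^esub>}"
      proof (rule ccontr)
        assume "\<not> ?thesis"
        then obtain x y where x: "x \<in> carrier B" "x \<noteq> \<zero>\<^bsub>B\<^esub>" and y: "y \<in> carrier C" "y \<noteq> \<zero>\<^bsub>C\<^esub>"
          using B.M.zero_closed C.M.zero_closed by blast
        have "i x \<noteq> \<zero>\<^bsub>P\<^esub>" using ij(3)[OF x(1)] x(2) z(1) by auto
        moreover have "j y \<noteq> \<zero>\<^bsub>P\<^esub>" using ij(4)[OF y(1)] y(2) z(2) by auto
        ultimately have "i ` carrier B \<noteq> {\<zero>\<^bsub>P\<^esub>}" "j ` carrier C \<noteq> {\<zero>\<^bsub>P\<^esub>}" using x(1) y(1) by blast+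
        from cover_uniform[OF T sub(1) this(1) sub(2) this(2)]
        obtain w where w: "w \<in> i ` carrier B" "w \<in> j ` carrier C" "w \<noteq> \<zero>\<^bsub>P\<^esub>" by blast
        then obtain x' y' where xy: "x' \<in> carrier B" "w = i x'" "y' \<in> carrier C" "w = j y'" by blast
        have "x' = \<zero>\<^bsub>B\<^esub>" using ij(3)[OF xy(1)] ij(5)[OF xy(3)] xy(2,4) by simp
        then show False using w(3) xy(2) z(3) by simp
      qed
    qed (use UM False in auto)
    from extends_if_indecomposable[OF this incl _ P(1) Q g]
    show ?thesis by simp
  qed
qed

text \<open>Induction on the colength of \<open>U\<close>, with covers in the part that cyclic
  modules have in Baer's criterion. A simple quotient \<open>T\<close> of \<open>N\<close> modulo
  \<open>U\<close> gives a map \<open>h0\<close> from the cover of \<open>T\<close> to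
  \<open>N\<close>; on the preimage of \<open>U\<close> the map \<open>g\<close> extends to the
  whole cover, and the result glues with \<open>g\<close> on the sum of \<open>U\<close> and the
  image of \<open>h0\<close>.\<close>

lemma projective_injective:
  assumes Q: "projective A Q" and N: "N \<in> Mods" and "submodule U A N" "g \<in> mod_hom A (N\<lparr>carrier := U\<rparr>) Q"
  shows "\<exists>h\<in>mod_hom A N Q. \<forall>x\<in>U. h x = g x"
  using assms(3,4)
proof (induction "len A N - len A (N\<lparr>carrier := U\<rparr>)" arbitrary: U g rule: less_induct)
  case less
  note U = less.prems(1) and g = less.prems(2)
  note QM = projective_Mods[OF Q]
  note rN = right_module_Mods[OF N] and rQ = right_module_Mods[OF QM]
  interpret N: right_module A N by (rule rN)
  interpret Q: right_module A Q by (rule rQ)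
  have Us: "U \<subseteq> carrier N" using U by (simp add: N.submodule_iff)
  let ?U = "N\<lparr>carrier := U\<rparr>"
  have UM: "?U \<in> Mods" by (rule restrict_Mods[OF N U])
  note rU = right_module_Mods[OF UM]
  interpret U: right_module A ?U by (rule rU)
  have incl: "(\<lambda>x. x) \<in> mod_hom A ?U N" using Us by (auto simp: mod_hom_iff)
  show ?case
  proof (cases "U = carrier N")
    case True
    then have "g \<in> mod_hom A N Q" using g by (simp add: mod_hom_iff)
    then show ?thesis by (intro bexI[of _ g]) auto
  next
    case False
    obtain C c where C: "C \<in> Mods" "c \<in> mod_hom A N C" "c ` carrier N = carrier C" "a_kernel N C c = U"
      by (rule quotient_Mods[OF N U])
    note rC = right_module_Mods[OF C(1)]
    have "carrier C \<noteq> {\<zero>\<^bsub>C\<^esub>}"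
    proof
      assume "carrier C = {\<zero>\<^bsub>C\<^esub>}"
      then have "a_kernel N C c = carrier N" using mod_hom_closed[OF C(2)] by (auto simp: a_kernel_def')
      then show False using False C(4) by simp
    qed
    then obtain T t where T: "simple T" "t \<in> mod_hom A C T" "t ` carrier C = carrier T"
      by (rule simple_quotient_exists[OF C(1)])
    note TM = simpleD(1)[OF T(1)]
    note rT = right_module_Mods[OF TM]
    let ?\<pi> = "\<lambda>x. t (c x)"
    have \<pi>: "?\<pi> \<in> mod_hom A N T" by (rule mod_hom_comp[OF C(2) T(2)])
    have \<pi>surj: "?\<pi> ` carrier N = carrier T" using C(3) T(3) by (metis image_image)
    have \<pi>U: "?\<pi> x = \<zero>\<^bsub>T\<^esub>" if "x \<in> U" for x
    proof -
      have "c x = \<zero>\<^bsub>C\<^esub>" using that unfolding C(4)[symmetric] by (simp add: a_kernel_def')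
      then show ?thesis using mod_hom_zero[OF rC rT T(2)] by simp
    qed
    obtain P p where cov: "projective_cover A P p T" by (rule projective_cover_exists[OF TM])
    note P = coverD[OF cov]
    note rP = right_module_Mods[OF P(2)]
    interpret P: right_module A P by (rule rP)
    from projective_lift[OF P(1) N TM \<pi> P(3) \<pi>surj]
    obtain h0 where h0: "h0 \<in> mod_hom A P N" "\<forall>x\<in>carrier P. ?\<pi> (h0 x) = p x" by (rule bexE)
    let ?k = "{x \<in> carrier P. h0 x \<in> U}"
    have k: "submodule ?k A P" by (rule submodule_vimage[OF rP rN h0(1) U])
    have "(\<lambda>x. g (h0 x)) \<in> mod_hom A (P\<lparr>carrier := ?k\<rparr>) Q"
      using mod_hom_closed[OF g] mod_hom_add[OF g] mod_hom_act[OF g] mod_hom_add[OF h0(1)] mod_hom_act[OF h0(1)]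
      by (simp add: mod_hom_iff)
    from extends_from_cover_submodule[OF T(1) cov k Q this]
    obtain g2 where g2: "g2 \<in> mod_hom A P Q" "\<forall>x\<in>?k. g2 x = g (h0 x)" by (rule bexE)
    \<comment> \<open>The external sum of \<open>U\<close> and \<open>P\<close> maps onto the
      enlarged submodule by \<open>?s\<close>. The map \<open>?f\<close> descends along it because
      \<open>g\<close> and \<open>g2\<close> are compatible on the overlap.\<close>
    obtain D \<alpha> \<beta> where D: "D \<in> Mods" "is_dsum A D ?U P \<alpha> \<beta>" by (rule dsum_Mods[OF UM P(2)])
    note rD = right_module_Mods[OF D(1)] and E = is_dsumE[OF D(2)]
    interpret D: right_module A D by (rule rD)
    have \<alpha>N: "\<alpha> \<in> mod_hom A D N" by (rule mod_hom_comp[OF E(1) incl])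
    have \<alpha>U: "\<alpha> x \<in> U" if "x \<in> carrier D" for x using mod_hom_closed[OF E(1) that] by simp
    let ?s = "\<lambda>x. \<alpha> x \<oplus>\<^bsub>N\<^esub> h0 (\<beta> x)" and ?f = "\<lambda>x. g (\<alpha> x) \<oplus>\<^bsub>Q\<^esub> g2 (\<beta> x)"
    have s: "?s \<in> mod_hom A D N" by (rule mod_hom_plus[OF rN \<alpha>N mod_hom_comp[OF E(2) h0(1)]])
    have f: "?f \<in> mod_hom A D Q" by (rule mod_hom_plus[OF rQ mod_hom_comp[OF E(1) g] mod_hom_comp[OF E(2) g2(1)]])
    let ?V = "?s ` carrier D"
    have V: "submodule ?V A N" by (rule submodule_image[OF rD rN s D.submodule_carrier])
    have VM: "N\<lparr>carrier := ?V\<rparr> \<in> Mods" by (rule restrict_Mods[OF N V])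
    have sV: "?s \<in> mod_hom A D (N\<lparr>carrier := ?V\<rparr>)" using s by (simp add: mod_hom_iff)
    have ss: "ses A (D\<lparr>carrier := a_kernel D (N\<lparr>carrier := ?V\<rparr>) ?s\<rparr>) (\<lambda>x. x) D ?s (N\<lparr>carrier := ?V\<rparr>)"
      by (rule ses_kernel[OF D(1) VM sV]) simp
    have z: "?f x = \<zero>\<^bsub>Q\<^esub>" if "x \<in> carrier (D\<lparr>carrier := a_kernel D (N\<lparr>carrier := ?V\<rparr>) ?s\<rparr>)" for x
    proof -
      have x: "x \<in> carrier D" "?s x = \<zero>\<^bsub>N\<^esub>" using that by (auto simp: a_kernel_def')
      have c: "\<alpha> x \<in> carrier N" "\<beta> x \<in> carrier P" "h0 (\<beta> x) \<in> carrier N"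
        by (rule mod_hom_closed[OF \<alpha>N x(1)], rule mod_hom_closed[OF E(2) x(1)],
          rule mod_hom_closed[OF mod_hom_comp[OF E(2) h0(1)] x(1)])
      have eq: "\<alpha> x = \<ominus>\<^bsub>N\<^esub> h0 (\<beta> x)" using x(2) c by (metis N.M.minus_equality)
      then have eq': "h0 (\<beta> x) = \<ominus>\<^bsub>N\<^esub> \<alpha> x" using c by simp
      then have hU: "h0 (\<beta> x) \<in> U" using N.submodule_minus[OF U \<alpha>U[OF x(1)]] by simp
      then have "g2 (\<beta> x) = g (h0 (\<beta> x))" using g2(2) c(2) by blast
      moreover have "g (\<alpha> x) \<oplus>\<^bsub>Q\<^esub> g (h0 (\<beta> x)) = g (\<alpha> x \<oplus>\<^bsub>N\<^esub> h0 (\<beta> x))"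
        using mod_hom_add[OF g, of "\<alpha> x" "h0 (\<beta> x)"] \<alpha>U[OF x(1)] hU by simp
      ultimately show ?thesis using x(2) mod_hom_zero[OF rU rQ g] by simp
    qed
    obtain g' where g': "g' \<in> mod_hom A (N\<lparr>carrier := ?V\<rparr>) Q" "\<And>x. x \<in> carrier D \<Longrightarrow> g' (?s x) = ?f x"
    proof (rule ses_colift[OF ss rQ f])
      fix g' assume "g' \<in> mod_hom A (N\<lparr>carrier := ?V\<rparr>) Q" "\<And>x. x \<in> carrier D \<Longrightarrow> g' (?s x) = ?f x"
      from that[OF this] show thesis .
    qed (rule z)
    have lift: "x \<in> ?V \<and> g' x = g x" if x: "x \<in> U" for x
    proof -
      have "x \<in> carrier ?U" using x by simp
      from E(4)[OF this P.M.zero_closed] obtain d where d: "d \<in> carrier D" "\<alpha> d = x" "\<beta> d = \<zero>\<^bsub>P\<^esub>" by blast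
      have xN: "x \<in> carrier N" "g x \<in> carrier Q" using x Us mod_hom_closed[OF g] by auto
      have sd: "?s d = x" using d xN mod_hom_zero[OF rP rN h0(1)] by simp
      have fd: "?f d = g x" using d xN mod_hom_zero[OF rP rQ g2(1)] by simp
      show ?thesis
      proof
        from imageI[OF d(1), of ?s] show "x \<in> ?V" unfolding sd .
        from g'(2)[OF d(1)] show "g' x = g x" unfolding sd fd .
      qed
    qed
    \<comment> \<open>The enlargement is strict: an element of the cover over a nonzero element of
      \<open>T\<close> is sent outside \<open>U\<close>, since \<open>U\<close> dies in
      \<open>T\<close>.\<close>
    obtain y where y: "y \<in> carrier T" "y \<noteq> \<zero>\<^bsub>T\<^esub>" by (rule simple_nonzero[OF T(1)])
    then have "y \<in> p ` carrier P" using P(4) by simp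
    then obtain w where w: "w \<in> carrier P" "p w = y" by auto
    have hw: "h0 w \<in> carrier N" by (rule mod_hom_closed[OF h0(1) w(1)])
    have "\<zero>\<^bsub>N\<^esub> \<in> carrier ?U" using U by (simp add: N.submodule_iff)
    from E(4)[OF this w(1)] obtain d where d: "d \<in> carrier D" "\<alpha> d = \<zero>\<^bsub>N\<^esub>" "\<beta> d = w" by blast
    have "?s d = h0 w" using d hw by simp
    then have "h0 w \<in> ?V" using imageI[OF d(1), of ?s] by simp
    moreover have "h0 w \<notin> U" using \<pi>U[of "h0 w"] bspec[OF h0(2) w(1)] w(2) y(2) by auto
    ultimately have ne: "U \<noteq> ?V" by blast
    have UV: "U \<subseteq> ?V" using lift by blast
    have "submodule U A (N\<lparr>carrier := ?V\<rparr>)" using U UV by (simp add: N.submodule_restrict[OF V])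
    from len_restrict_less[OF right_module_Mods[OF VM] finite_length_Mods[OF VM] this]
    have "len A ?U < len A (N\<lparr>carrier := ?V\<rparr>)" using ne by simp
    moreover have "len A (N\<lparr>carrier := ?V\<rparr>) \<le> len A N"
      by (rule len_restrict_le[OF rN finite_length_Mods[OF N] V])
    ultimately have "len A N - len A (N\<lparr>carrier := ?V\<rparr>) < len A N - len A ?U" by linarith
    from less.hyps[OF this V g'(1)] obtain h where h: "h \<in> mod_hom A N Q" "\<forall>x\<in>?V. h x = g' x" by (rule bexE)
    have "h x = g x" if "x \<in> U" for x
      using bspec[OF h(2) conjunct1[OF lift[OF that]]] conjunct2[OF lift[OF that]] by (rule trans)
    then show ?thesis by (intro bexI[OF _ h(1)] ballI)
  qed
qed

lemma projective_extension:
  assumes Q: "projective A Q" and N: "N \<in> Mods" and M: "M \<in> Mods" and j: "j \<in> mod_hom A M N" "inj_on j (carrier M)"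
    and g: "g \<in> mod_hom A M Q"
  shows "\<exists>h\<in>mod_hom A N Q. \<forall>x\<in>carrier M. h (j x) = g x"
proof -
  note rm = right_module_Mods[OF M] right_module_Mods[OF N]
  interpret MM: right_module A M by (rule rm)
  let ?J = "N\<lparr>carrier := j ` carrier M\<rparr>"
  have J: "submodule (j ` carrier M) A N" by (rule submodule_image[OF rm j(1) MM.submodule_carrier])
  have jJ: "j \<in> mod_hom A M ?J" using j(1) by (simp add: mod_hom_iff)
  have bij: "bij_betw j (carrier M) (carrier ?J)" using j(2) by (simp add: bij_betw_def)
  from projective_injective[OF Q N J mod_hom_comp[OF mod_hom_inv[OF rm(1) jJ bij] g]]
  obtain h where h: "h \<in> mod_hom A N Q" "\<forall>x\<in>j ` carrier M. h x = g (inv_into (carrier M) j x)" by (rule bexE)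
  have "h (j x) = g x" if "x \<in> carrier M" for x using h(2) that inv_into_f_f[OF j(2) that] by simp
  then show ?thesis by (intro bexI[OF _ h(1)] ballI)
qed

text \<open>Choose a map to a projective with kernel of least length. A simple submodule of a
  nonzero kernel embeds into a cover by \<open>socle_correspondence\<close>, this embedding extends
  to \<open>M\<close> by injectivity of the cover, and adding it as a second component shrinks the
  kernel.\<close>

lemma embeds_in_projective:
  assumes M: "M \<in> Mods"
  obtains E i q C where "projective A E" "ses A M i E q C"
proof -
  note rM = right_module_Mods[OF M]
  interpret N: right_module A M by (rule rM)
  let ?S = "\<lambda>k. \<exists>E f. projective A E \<and> f \<in> mod_hom A M E \<and> len A (M\<lparr>carrier := a_kernel M E f\<rparr>) = k"
  obtain Z where Z: "Z \<in> Mods" "projective A Z" by (rule zero_module_exists)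
  have "\<exists>k. ?S k" using Z(2) mod_hom_zero_map[OF rM right_module_Mods[OF Z(1)]] by blast
  then obtain k where k: "?S k" "\<And>k'. ?S k' \<Longrightarrow> k \<le> k'" using LeastI_ex[of ?S] Least_le[of ?S] by blast
  then obtain E f where E: "projective A E" and f: "f \<in> mod_hom A M E" and len: "len A (M\<lparr>carrier := a_kernel M E f\<rparr>) = k"
    by blast
  note EM = projective_Mods[OF E]
  note rE = right_module_Mods[OF EM]
  let ?k = "a_kernel M E f"
  have ks: "submodule ?k A M" by (rule submodule_kernel[OF rM rE f])
  have kM: "M\<lparr>carrier := ?k\<rparr> \<in> Mods" by (rule restrict_Mods[OF M ks])
  have "?k = {\<zero>\<^bsub>M\<^esub>}"
  proof (rule ccontr)
    assume "?k \<noteq> {\<zero>\<^bsub>M\<^esub>}"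
    then have "carrier (M\<lparr>carrier := ?k\<rparr>) \<noteq> {\<zero>\<^bsub>M\<lparr>carrier := ?k\<rparr>\<^esub>}" by simp
    then obtain W where W: "submodule W A (M\<lparr>carrier := ?k\<rparr>)" "simple ((M\<lparr>carrier := ?k\<rparr>)\<lparr>carrier := W\<rparr>)"
      by (rule simple_submodule_exists[OF kM])
    then have WM: "submodule W A M" "W \<subseteq> ?k" and sW: "simple (M\<lparr>carrier := W\<rparr>)"
      by (simp_all add: N.submodule_restrict[OF ks])
    obtain \<sigma> where \<sigma>: "\<And>S. simple S \<Longrightarrow> \<exists>T P p e. simple T \<and> projective_cover A P p T \<and> simple (\<sigma> (iso_class T)) \<and>
      e \<in> mod_hom A (\<sigma> (iso_class T)) P \<and> inj_on e (carrier (\<sigma> (iso_class T))) \<and>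
      mod_isomorphic A S (\<sigma> (iso_class T))" by (rule socle_correspondence) blast
    obtain T P p e where T: "projective_cover A P p T" "e \<in> mod_hom A (\<sigma> (iso_class T)) P"
      "inj_on e (carrier (\<sigma> (iso_class T)))" "mod_isomorphic A (M\<lparr>carrier := W\<rparr>) (\<sigma> (iso_class T))"
      using \<sigma>[OF sW] by (elim exE conjE)
    note P = coverD[OF T(1)]
    note rP = right_module_Mods[OF P(2)]
    obtain l where l: "l \<in> mod_hom A (M\<lparr>carrier := W\<rparr>) (\<sigma> (iso_class T))"
      "bij_betw l (carrier (M\<lparr>carrier := W\<rparr>)) (carrier (\<sigma> (iso_class T)))"
      using T(4) unfolding mod_isomorphic_def by (rule bexE)
    from projective_injective[OF P(1) M WM(1) mod_hom_comp[OF l(1) T(2)]]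
    obtain b where b: "b \<in> mod_hom A M P" "\<forall>x\<in>W. b x = e (l x)" by (rule bexE)
    have "inj_on (e \<circ> l) W" using l(2) T(3) by (intro comp_inj_on) (auto simp: bij_betw_def)
    then have binj: "inj_on b W" using b(2) by (simp add: inj_on_def)
    obtain D u v where D: "D \<in> Mods" "is_dsum A D E P u v" by (rule dsum_Mods[OF EM P(2)])
    note rD = right_module_Mods[OF D(1)]
    obtain h where h: "h \<in> mod_hom A M D" "\<And>x. x \<in> carrier M \<Longrightarrow> u (h x) = f x" "\<And>x. x \<in> carrier M \<Longrightarrow> v (h x) = b x"
      by (rule is_dsum_pair[OF rD D(2) f b(1)]) blast
    let ?k' = "a_kernel M D h"
    have k': "submodule ?k' A M" by (rule submodule_kernel[OF rM rD h(1)])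
    have z: "u \<zero>\<^bsub>D\<^esub> = \<zero>\<^bsub>E\<^esub>" "v \<zero>\<^bsub>D\<^esub> = \<zero>\<^bsub>P\<^esub>"
      by (rule mod_hom_zero[OF rD rE is_dsumE(1)[OF D(2)]], rule mod_hom_zero[OF rD rP is_dsumE(2)[OF D(2)]])
    have k'_mem: "f x = \<zero>\<^bsub>E\<^esub> \<and> b x = \<zero>\<^bsub>P\<^esub>" if x: "x \<in> carrier M" "h x = \<zero>\<^bsub>D\<^esub>" for x
      using h(2,3)[OF x(1)] x(2) z by simp
    have sub: "?k' \<subseteq> ?k" using k'_mem by (auto simp: a_kernel_def')
    obtain x where x: "x \<in> W" "x \<noteq> \<zero>\<^bsub>M\<^esub>" using simple_nonzero[OF sW] by auto
    have WMs: "W \<subseteq> carrier M" "\<zero>\<^bsub>M\<^esub> \<in> W" using WM(1) by (auto simp: N.submodule_iff)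
    have "b x \<noteq> \<zero>\<^bsub>P\<^esub>"
    proof
      assume "b x = \<zero>\<^bsub>P\<^esub>"
      then have "b x = b \<zero>\<^bsub>M\<^esub>" using mod_hom_zero[OF rM rP b(1)] by simp
      then show False using inj_onD[OF binj _ x(1) WMs(2)] x(2) by blast
    qed
    then have "x \<notin> ?k'" using k'_mem by (auto simp: a_kernel_def')
    then have "?k' \<noteq> ?k" using x(1) WM(2) by blast
    moreover have "submodule ?k' A (M\<lparr>carrier := ?k\<rparr>)" using k' sub by (simp add: N.submodule_restrict[OF ks])
    ultimately have "len A (M\<lparr>carrier := ?k'\<rparr>) < k"
      using len_restrict_less[OF right_module_Mods[OF kM] finite_length_Mods[OF kM], of ?k'] len by simp
    moreover have "?S (len A (M\<lparr>carrier := ?k'\<rparr>))" using projective_dsum[OF E P(1) D] h(1) by blast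
    ultimately show False using k(2) by fastforce
  qed
  then have "inj_on f (carrier M)" unfolding mod_hom_inj_iff[OF rM rE f] by (auto simp: a_kernel_def')
  then obtain C q where "ses A M f E q C" by (rule ses_cokernel[OF M EM f])
  with E show thesis by (rule that)
qed

section \<open>Cosyzygies and the injectivity of the syzygy map\<close>

lemma projective_mono_splits:
  assumes E: "projective A E" and N: "N \<in> Mods" and j: "j \<in> mod_hom A E N" "inj_on j (carrier E)"
  shows "\<exists>r\<in>mod_hom A N E. \<forall>x\<in>carrier E. r (j x) = x"
  by (rule projective_extension[OF E N projective_Mods[OF E] j mod_hom_id])

text \<open>The dual of Schanuel's lemma.\<close>

lemma cls_cosyzygy_unique:
  assumes s: "ses A M i E q C" "projective A E" and s': "ses A M i' E' q' C'" "projective A E'"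
  shows "cls C = cls C'"
proof -
  interpret G: comm_group "K0 A" by (rule comm_group_K0)
  note sD = sesD[OF s(1)] and sD' = sesD[OF s'(1)]
  obtain S u v where S: "S \<in> Mods" "is_dsum A S E E' u v" by (rule dsum_Mods[OF sD(2) sD'(2)])
  obtain k where k: "k \<in> mod_hom A M S" "\<And>x. x \<in> carrier M \<Longrightarrow> u (k x) = i x" "\<And>x. x \<in> carrier M \<Longrightarrow> v (k x) = i' x"
    by (rule is_dsum_pair[OF right_module_Mods[OF S(1)] S(2) sD(4) sD'(4)]) blast
  have "inj_on k (carrier M)" using sD(6) k(2) by (auto simp: inj_on_def) metis
  then obtain D w where D: "ses A M k S w D" by (rule ses_cokernel[OF sD(1) S(1) k(1)])
  have "\<exists>r t. is_dsum A D E C' r t"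
    by (rule pushout_split[OF s(1) s'(1) S D k(2,3) projective_mono_splits[OF s(2)]])
  then obtain r t where 1: "is_dsum A D E C' r t" by blast
  have "\<exists>r t. is_dsum A D E' C r t"
    by (rule pushout_split[OF s'(1) s(1) S(1) is_dsum_swap[OF S(2)] D k(3,2) projective_mono_splits[OF s'(2)]])
  then obtain r' t' where 2: "is_dsum A D E' C r' t'" by blast
  note DM = sesD(3)[OF D]
  show ?thesis
    using cls_dsum[OF sD(2) sD'(3) DM 1] cls_dsum[OF sD'(2) sD(3) DM 2] sD(3) sD'(3)
    by (simp add: cls_projective[OF s(2)] cls_projective[OF s'(2)])
qed

text \<open>The class of a cokernel of an embedding into a projective is well defined by
  \<open>cls_cosyzygy_unique\<close> and induces \<sigma> on \<open>K0 A\<close>. It undoes \<Omega>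
  because \<open>M\<close> is itself such a cokernel for its syzygy.\<close>

lemma Omega_left_inverse:
  obtains \<sigma> where "\<And>x. x \<in> carrier (K0 A) \<Longrightarrow> \<sigma> (\<Omega> x) = x" "\<sigma> \<in> hom (K0 A) (K0 A)"
proof -
  interpret G: comm_group "K0 A" by (rule comm_group_K0)
  let ?R = "\<lambda>M C. \<exists>E i q. projective A E \<and> ses A M i E q C"
  have "\<forall>M\<in>Mods. \<exists>C. ?R M C"
  proof
    fix M assume M: "M \<in> Mods"
    obtain E i q C where "projective A E" "ses A M i E q C" by (rule embeds_in_projective[OF M])
    then show "\<exists>C. ?R M C" by blast
  qed
  then obtain co where co: "\<forall>M\<in>Mods. ?R M (co M)" by (rule bchoice[THEN exE])
  have coE: "\<exists>E i q. projective A E \<and> ses A M i E q (co M)" if "M \<in> Mods" for M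
    using co that by (rule bspec)
  have coM: "co M \<in> Mods" if "M \<in> Mods" for M using coE[OF that] sesD(3) by blast
  have uniq: "cls (co M) = cls C" if s: "ses A M i E q C" "projective A E" for M i E q C
  proof -
    obtain E' i' q' where "projective A E'" "ses A M i' E' q' (co M)" using coE[OF sesD(1)[OF s(1)]] by blast
    from cls_cosyzygy_unique[OF this(2,1) s] show ?thesis .
  qed
  obtain \<sigma> where \<sigma>: "\<sigma> \<in> hom (K0 A) (K0 A)" "\<And>M. M \<in> Mods \<Longrightarrow> \<sigma> (cls M) = cls (co M)"
  proof (rule K0_universal[OF comm_group_K0, of "\<lambda>M. cls (co M)"])
    show "cls (co M) \<in> carrier (K0 A)" if "M \<in> Mods" for M using coM[OF that] by simp
  next
    fix D U V p q assume D: "D \<in> Mods" and U: "U \<in> Mods" and V: "V \<in> Mods" and d: "is_dsum A D U V p q"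
    obtain E i a where s: "projective A E" "ses A U i E a (co U)" using coE[OF U] by blast
    obtain E' i' a' where s': "projective A E'" "ses A V i' E' a' (co V)" using coE[OF V] by blast
    obtain N c c' where N: "N \<in> Mods" "is_dsum A N (co U) (co V) c c'" by (rule dsum_Mods[OF coM[OF U] coM[OF V]])
    obtain F b b' where F: "F \<in> Mods" "is_dsum A F E E' b b'"
      by (rule dsum_Mods[OF projective_Mods[OF s(1)] projective_Mods[OF s'(1)]])
    obtain j t where t: "ses A D j F t N" by (rule dsum_ses[OF s(2) s'(2) N F D d])
    show "cls (co D) = cls (co U) \<otimes>\<^bsub>K0 A\<^esub> cls (co V)"
      using uniq[OF t projective_dsum[OF s(1) s'(1) F]] cls_dsum[OF coM[OF U] coM[OF V] N] by simp
  next
    fix P assume P: "projective A P"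
    note PM = projective_Mods[OF P]
    obtain E i q where s: "projective A E" "ses A P i E q (co P)" using coE[OF PM] by blast
    note sD = sesD[OF s(2)]
    from projective_mono_splits[OF P sD(2,4,6)]
    obtain r where r: "r \<in> mod_hom A E P" "\<forall>x\<in>carrier P. r (i x) = x" by (rule bexE)
    have "is_dsum A E P (co P) r q" by (rule ses_retraction[OF s(2) r(1)]) (use r(2) in blast)
    from cls_dsum[OF PM coM[OF PM] sD(2) this]
    show "cls (co P) = \<one>\<^bsub>K0 A\<^esub>" using coM[OF PM] by (simp add: cls_projective[OF s(1)] cls_projective[OF P])
  qed (use that in blast)
  have "\<sigma> (\<Omega> x) = x" if x: "x \<in> carrier (K0 A)" for x
  proof (rule hom_K0_eqI[OF group_K0 _ _ _ x, of "\<lambda>x. \<sigma> (\<Omega> x)" "\<lambda>x. x"])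
    show "(\<lambda>x. \<sigma> (\<Omega> x)) \<in> hom (K0 A) (K0 A)"
      using hom_compose[OF Omega_bar_props(1) \<sigma>(1)] by (simp add: comp_def)
    show "(\<lambda>x. x) \<in> hom (K0 A) (K0 A)" by (simp add: hom_def)
    fix M assume M: "M \<in> Mods"
    obtain P i p where s: "projective A P" "ses A (syzygy A M) i P p M" by (rule syzygy_ses[OF M])
    show "\<sigma> (\<Omega> (cls M)) = cls M"
      using Omega_bar_props(2)[OF M] \<sigma>(2)[OF syzygy_Mods[OF M]] uniq[OF s(2,1)] by simp
  qed
  then show thesis using \<sigma>(1) by (rule that)
qed

lemma phi_eq_0:
  assumes M: "M \<in> Mods" shows "phi A M = 0"
proof -
  obtain \<sigma> where \<sigma>: "\<And>x. x \<in> carrier (K0 A) \<Longrightarrow> \<sigma> (\<Omega> x) = x" "\<sigma> \<in> hom (K0 A) (K0 A)"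
    by (rule Omega_left_inverse) blast
  have "kernel_stable M 0" unfolding kernel_stable_def
  proof (intro allI impI ballI)
    fix j x assume x: "x \<in> add_subgroup A M" "(\<Omega> ^^ Suc j) x = \<one>\<^bsub>K0 A\<^esub>"
    have c: "(\<Omega> ^^ j) x \<in> carrier (K0 A)"
      by (rule group_hom.hom_closed[OF Omega_funpow_hom add_subgroup_carrier[OF M x(1)]])
    have "(\<Omega> ^^ j) x = \<sigma> \<one>\<^bsub>K0 A\<^esub>" using \<sigma>(1)[OF c] x(2) by simp
    then show "(\<Omega> ^^ j) x = \<one>\<^bsub>K0 A\<^esub>" using hom_one[OF \<sigma>(2) group_K0 group_K0] by simp
  qed
  then have "phi A M \<le> 0" by (simp only: phi_le_iff[OF M])
  then show ?thesis by simp
qed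

end

lemma phi_one_attained:
  assumes "phi_dim A > 0"
  shows "\<exists>M\<in>Mods. phi A M = 1"
proof (rule ccontr)
  assume "\<not> ?thesis"
  then have "phi A M = 0" if "M \<in> Mods" for M using phi_eq_0 that by blast
  then have "phi_dim A \<le> 0" unfolding phi_dim_def by (intro SUP_least) (simp add: zero_enat_def)
  then show False using assms by simp
qed

end

theorem theorem4p3:
  fixes K :: "('k, 'z) ring_scheme" and A :: "('k, 'a, 'y) module_scheme"
  assumes "fd_algebra K A"
    and "phi_dim A > 0"
  shows "(\<exists>M \<in> fg_modules A. phi A M = 1) \<and>
    (phi_dim A < \<infinity> \<longrightarrow> (\<exists>N \<in> fg_modules A. enat (phi A N) = phi_dim A - 1))"
proof -
  interpret fd_algebra K A by (rule assms(1))
  show ?thesis using phi_one_attained phi_pred_attained assms(2) by blast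
qed

end
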